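(* Let $n\ge3$ and $\rho>0$. Let $g:[0,\infty)\to(0,\infty)$ be a non-decreasing convex $C^3$ function satisfying $(1+s)g'(s)-g(s)\ge0$ for all $s\ge0$. Then there exists $\varepsilon>0$ such that if $\Omega\subset\mathbb{H}^{n+1}$ is a domain with boundary $M=\{(\rho(1+u(x)),x):x\in\mathbb{S}^n\}$, $u$ smooth with $\|u\|_{C^1(\mathbb{S}^n)}<\varepsilon$, $\int_\Omega\phi'\,dv=\int_{\bar B_\rho}\phi'\,dv$ and $\operatorname{bar}(\Omega)=O$, then, writing $V=\frac{(n+1)\int_\Omega\phi'dv}{\omega_n}$, $$\int_M g(\Phi)H^+d\mu\ \ge\ n\omega_n\, g\!\left(\left(1+V^{\frac{2}{n+1}}\right)^{1/2}-1\right)\left(V^{\frac{2(n-1)}{n+1}}+V^{\frac{2n}{n+1}}\right)^{1/2}.$$ Equality holds if and only if $\Omega$ is a geodesic ball centered at the origin.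
   Context: $\mathbb{H}^{n+1}$ is written in geodesic polar coordinates about a fixed origin $O$ as $[0,\infty)\times\mathbb{S}^n$ with metric $dr^2+\phi(r)^2g_{\mathbb{S}^n}$, $\phi(r)=\sinh r$, so $\phi'(r)=\cosh r$; $\phi'$ is regarded as a function on $\mathbb{H}^{n+1}$ and $dv$ is the volume measure. $\Phi(r)=\int_0^r\phi(s)ds=\cosh r-1$; on $M$, $g(\Phi)$ means $g(\Phi(r))$ at the point. $\bar B_\rho$ is the geodesic ball of radius $\rho$ centered at $O$. The parametrization means $u:\mathbb{S}^n\to(-1,\infty)$ and $M$ consists of the points at distance $\rho(1+u(x))$ from $O$ in direction $x$. $H$ is the mean curvature (sum of principal curvatures w.r.t. outward normal), $H^+=\max\{H,0\}$, $d\mu$ the induced area measure, $\omega_n$ the area of $\mathbb{S}^n$. $\operatorname{bar}(\Omega)$ is the minimizer $p$ of $p\mapsto\int_\Omega d(y,p)^2dv(y)$, $d$ the hyperbolic distance. *)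

theory Defs
  imports "HOL-Analysis.Analysis"
begin

text \<open>Model: H^{n+1} is represented in geodesic normal coordinates about the origin O,
  i.e. by R^{n+1} = real^'n with CARD('n) = n+1: the point at distance r from O in
  direction x (unit vector) is r *R x.  The hyperbolic geometry is computed through the
  isometric embedding into the hyperboloid model in Minkowski space real x real^'n.\<close>

definition sinhc :: "real \<Rightarrow> real" where
  "sinhc r = (if r = 0 then 1 else sinh r / r)"

definition lor :: "real \<times> (real^'n) \<Rightarrow> real \<times> (real^'n) \<Rightarrow> real" where
  "lor p q = - (fst p * fst q) + snd p \<bullet> snd q"

text \<open>Normal coordinates to hyperboloid: r x \<mapsto> (cosh r, sinh r x).\<close>
definition hemb :: "real^'n \<Rightarrow> real \<times> (real^'n)" where
  "hemb y = (cosh (norm y), sinhc (norm y) *\<^sub>R y)"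

definition hdist :: "real^'n \<Rightarrow> real^'n \<Rightarrow> real" where
  "hdist y p = arcosh (- lor (hemb y) (hemb p))"

definition hvol :: "(real^'n) measure" where
  "hvol = density lborel (\<lambda>y. ennreal (sinhc (norm y) ^ (CARD('n) - 1)))"

text \<open>Standard (n-dimensional) surface measure on the unit sphere S^n of real^'n,
  obtained from Lebesgue measure on the unit ball via the cone construction
  sigma(A) = (n+1) * Leb {t x | 0 < t \<le> 1, x \<in> A}.\<close>
definition sphere_measure :: "(real^'n) measure" where
  "sphere_measure = density
     (distr (restrict_space lborel (ball 0 1 - {0})) (restrict_space borel (sphere 0 1))
        (\<lambda>y. y /\<^sub>R norm y))
     (\<lambda>_. ennreal (real CARD('n)))"

definition omega :: "'n::finite itself \<Rightarrow> real" where
  "omega _ = measure (sphere_measure :: (real^'n) measure) (sphere 0 1)"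

fun Ck_on :: "nat \<Rightarrow> ('a::euclidean_space \<Rightarrow> real) \<Rightarrow> 'a set \<Rightarrow> bool" where
  "Ck_on 0 f S = continuous_on S f"
| "Ck_on (Suc k) f S = (f differentiable_on S \<and>
      (\<forall>v. Ck_on k (\<lambda>y. frechet_derivative f (at y) v) S))"

definition smooth_on :: "('a::euclidean_space \<Rightarrow> real) \<Rightarrow> 'a set \<Rightarrow> bool" where
  "smooth_on f S = (\<forall>k. Ck_on k f S)"

text \<open>Degree-0 homogeneous extension of a function on S^n to real^'n - {0}.
  Smoothness of u on S^n means smoothness of this extension on real^'n - {0};
  its derivative at x \<in> S^n is the spherical gradient of u.\<close>
definition hom_ext :: "(real^'n \<Rightarrow> 'b) \<Rightarrow> real^'n \<Rightarrow> 'b" where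
  "hom_ext u y = u (y /\<^sub>R norm y)"

definition smooth_sphere :: "(real^'n \<Rightarrow> real) \<Rightarrow> bool" where
  "smooth_sphere u = smooth_on (hom_ext u) (UNIV - {0})"

definition C1_norm_sphere :: "(real^'n \<Rightarrow> real) \<Rightarrow> real" where
  "C1_norm_sphere u = (SUP x\<in>sphere 0 1. \<bar>u x\<bar>)
      + (SUP x\<in>sphere 0 1. onorm (frechet_derivative (hom_ext u) (at x)))"

definition radf :: "real \<Rightarrow> (real^'n \<Rightarrow> real) \<Rightarrow> real^'n \<Rightarrow> real" where
  "radf \<rho> u x = \<rho> * (1 + u x)"

definition Omega :: "real \<Rightarrow> (real^'n \<Rightarrow> real) \<Rightarrow> (real^'n) set" where
  "Omega \<rho> u = {y. y = 0 \<or> norm y < radf \<rho> u (y /\<^sub>R norm y)}"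

definition surfF :: "real \<Rightarrow> (real^'n \<Rightarrow> real) \<Rightarrow> real^'n \<Rightarrow> real \<times> (real^'n)" where
  "surfF \<rho> u = hom_ext (\<lambda>x. hemb (radf \<rho> u x *\<^sub>R x))"

definition dF :: "real \<Rightarrow> (real^'n \<Rightarrow> real) \<Rightarrow> real^'n \<Rightarrow> real^'n \<Rightarrow> real \<times> (real^'n)" where
  "dF \<rho> u x = frechet_derivative (surfF \<rho> u) (at x)"

text \<open>Outward unit normal of M at the point over x (tangent to the hyperboloid,
  orthogonal to M, positive pairing with the radial direction d/dr).\<close>
definition outer_normal :: "real \<Rightarrow> (real^'n \<Rightarrow> real) \<Rightarrow> real^'n \<Rightarrow> real \<times> (real^'n)" where
  "outer_normal \<rho> u x = (THE N. lor N (surfF \<rho> u x) = 0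
      \<and> (\<forall>v. lor N (dF \<rho> u x v) = 0) \<and> lor N N = 1
      \<and> lor N (sinh (radf \<rho> u x), cosh (radf \<rho> u x) *\<^sub>R x) > 0)"

definition dN :: "real \<Rightarrow> (real^'n \<Rightarrow> real) \<Rightarrow> real^'n \<Rightarrow> real^'n \<Rightarrow> real \<times> (real^'n)" where
  "dN \<rho> u x = frechet_derivative (hom_ext (outer_normal \<rho> u)) (at x)"

definition tproj :: "real^'n \<Rightarrow> real^'n \<Rightarrow> real^'n" where
  "tproj x v = v - (v \<bullet> x) *\<^sub>R x"

text \<open>First fundamental form of M on T_x S^n (extended by the identity on span x),
  and second fundamental form (extended by 0), in the standard orthonormal basis.\<close>
definition fform1 :: "real \<Rightarrow> (real^'n \<Rightarrow> real) \<Rightarrow> real^'n \<Rightarrow> real^'n^'n" where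
  "fform1 \<rho> u x = (\<chi> i j. lor (dF \<rho> u x (tproj x (axis i 1))) (dF \<rho> u x (tproj x (axis j 1)))
                          + (axis i 1 \<bullet> x) * (axis j 1 \<bullet> x))"

definition fform2 :: "real \<Rightarrow> (real^'n \<Rightarrow> real) \<Rightarrow> real^'n \<Rightarrow> real^'n^'n" where
  "fform2 \<rho> u x = (\<chi> i j. lor (dN \<rho> u x (tproj x (axis i 1))) (dF \<rho> u x (tproj x (axis j 1))))"

text \<open>Mean curvature (trace of the shape operator w.r.t. the outward normal) and
  area element (so that d mu = area_elem d sigma) of M at the point over x \<in> S^n.\<close>
definition mean_curv :: "real \<Rightarrow> (real^'n \<Rightarrow> real) \<Rightarrow> real^'n \<Rightarrow> real" where
  "mean_curv \<rho> u x = trace (matrix_inv (fform1 \<rho> u x) ** fform2 \<rho> u x)"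

definition area_elem :: "real \<Rightarrow> (real^'n \<Rightarrow> real) \<Rightarrow> real^'n \<Rightarrow> real" where
  "area_elem \<rho> u x = sqrt (det (fform1 \<rho> u x))"

end

theory Submission
  imports Defs
begin

text \<open>
  Write the boundary as the radial graph of $r$, put $\phi = \sinh$, and let $p = \nabla r / \phi(r)$, which is the
  spherical gradient of $h = \int_\rho^r ds/\phi(s)$. With $v = \sqrt{1 + |p|^2}$ one has
  $H = \phi^{-1}\,(n\phi'/v - \mathrm{div}(p/v))$ and $d\mu = \phi^n v\,d\sigma$. Since $u$ is only $C^1$-small, the
  second derivatives in $H$ have to be removed exactly: for every function $f$ with $0 \le f \le v$ we have
  $H^+ v \ge H f$, and for $f = 1 + p\cdot P - c|P|^2$ with a fixed smooth field $P$ the integral of $g(\Phi) H f \phi^n$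
  reduces, by the divergence theorem on the sphere and the symmetry of the Hessian of $h$, to an integral of first
  order in $h$.

  The choice $f = 1$ loses too much of the Dirichlet energy on spherical harmonics of degree at most two, so
  $P$ is the gradient of the projection of $h$ to polynomials of degree two: this restores the full coefficient
  there, while on the complement the eigenvalue $3(n+2)$ compensates for the loss (here $n \ge 3$ enters). The
  volume constraint makes the mean of $h$ quadratically small, convexity and $(1+s)g' \ge g$ bound the
  zeroth order term of the second variation from below, and $g' > 0$ leaves a positive multiple of $\int |p|^2$,
  which also controls the modes of degree one.
\<close>

subsection \<open>Polar coordinates\<close>

text \<open>The form of f comes from convexity of v in p: the tangent plane at p = P is (1 + p.P) /
  sqrt (1 + |P|^2), that is 1 + p.P - |P|^2 / 2 up to fourth order. Any c slightly above 1/2 absorbs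
  the fourth-order part and gives f <= v for small p and P.

  The choice P = p would be optimal to second order, but its divergence brings back second
  derivatives of h, on which there is no smallness. A projection onto a fixed finite-dimensional
  space has all its derivatives bounded by sup |h|.

  Degree two is forced by numbers. Put k = g' phi^2 / (g phi') at rho and divide by g phi^(n-1)
  phi'. The zeroth order term costs n(n-1) per unit of the integral of h^2. The coefficient of the
  Dirichlet energy is (n-2)/2 + k where P = 0 and n - 1 + k/2 where P = p. Apart from k, degree one
  with P = p gives n(n-1), exactly balanced, so k is the only gain there. Degree two with P = 0
  would give (n+1)(n-2) = n(n-1) - 2, just too little. Degree three with P = 0 gives 3(n+2)(n-2)/2,
  which is at least n(n-1) from n = 3 on.\<close>

lemma space_sphere_measure [simp]: "space sphere_measure = sphere (0::real^'n) 1"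
  by (simp add: sphere_measure_def space_restrict_space)

lemma sets_sphere_measure [measurable_cong]:
  "sets sphere_measure = sets (restrict_space borel (sphere (0::real^'n) 1))"
  by (simp add: sphere_measure_def)

lemma direction_measurable:
  assumes "A \<in> sets borel"
  shows "(\<lambda>y::real^'n. y /\<^sub>R norm y) \<in> measurable (restrict_space lborel (A - {0})) (restrict_space borel (sphere 0 1))"
  by (rule measurable_restrict_space3) (auto intro!: borel_measurable_scaleR borel_measurable_inverse)

lemma sphere_sets_iff: "B \<in> sets sphere_measure \<longleftrightarrow> B \<subseteq> sphere 0 1 \<and> B \<in> sets borel"
  unfolding sets_sphere_measure by (subst sets_restrict_space_iff) (auto simp: closed_sphere borel_closed)

lemma cone_sets:
  assumes "B \<in> sets sphere_measure"
  shows "{y::real^'n. y \<noteq> 0 \<and> y /\<^sub>R norm y \<in> B} \<in> sets borel"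
proof -
  have [measurable]: "B \<in> sets borel" using assms by (simp add: sphere_sets_iff)
  show ?thesis by measurable
qed

lemma emeasure_sphere_measure:
  assumes "B \<in> sets sphere_measure"
  shows "emeasure sphere_measure B
    = ennreal (real CARD('n)) * emeasure lborel {y::real^'n. y \<noteq> 0 \<and> norm y < 1 \<and> y /\<^sub>R norm y \<in> B}"
proof -
  let ?D = "distr (restrict_space lborel (ball 0 1 - {0})) (restrict_space borel (sphere 0 1)) (\<lambda>y::real^'n. y /\<^sub>R norm y)"
  have B: "B \<in> sets (restrict_space borel (sphere 0 1))" using assms by (simp add: sets_sphere_measure)
  have "emeasure sphere_measure B = (\<integral>\<^sup>+x. ennreal (real CARD('n)) * indicator B x \<partial>?D)"
    unfolding sphere_measure_def using B by (subst emeasure_density) auto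
  also have "\<dots> = ennreal (real CARD('n)) * emeasure ?D B"
    using B by (subst nn_integral_cmult_indicator) auto
  also have "emeasure ?D B = emeasure (restrict_space lborel (ball 0 1 - {0})) ((\<lambda>y. y /\<^sub>R norm y) -` B \<inter> (ball 0 1 - {0}))"
    using B by (subst emeasure_distr[OF direction_measurable]) (auto simp: space_restrict_space)
  also have "\<dots> = emeasure lborel ((\<lambda>y. y /\<^sub>R norm y) -` B \<inter> (ball 0 1 - {0}))"
    by (subst emeasure_restrict_space) auto
  also have "(\<lambda>y. y /\<^sub>R norm y) -` B \<inter> (ball 0 1 - {0}) = {y::real^'n. y \<noteq> 0 \<and> norm y < 1 \<and> y /\<^sub>R norm y \<in> B}"
    by auto
  finally show ?thesis .
qed

text \<open>The cone of height \<open>a\<close> over \<open>B\<close> is the image of the unit cone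
  under multiplication by \<open>a\<close>, which scales Lebesgue measure by
  \<open>a ^ CARD('n)\<close>.\<close>

lemma emeasure_cone:
  assumes B: "B \<in> sets sphere_measure" and a: "a > 0"
  shows "ennreal (real CARD('n)) * emeasure lborel {y::real^'n. y \<noteq> 0 \<and> norm y < a \<and> y /\<^sub>R norm y \<in> B}
     = ennreal (a ^ CARD('n)) * emeasure sphere_measure B"
proof -
  have [measurable]: "B \<in> sets borel" using B by (simp add: sphere_sets_iff)
  let ?T = "\<lambda>a. {y::real^'n. y \<noteq> 0 \<and> norm y < a \<and> y /\<^sub>R norm y \<in> B}"
  have [measurable]: "?T a \<in> sets borel" for a by measurable
  have dirn: "(a *\<^sub>R y) /\<^sub>R norm (a *\<^sub>R y) = y /\<^sub>R norm y" for y :: "real^'n"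
    using a by simp
  have eq: "(*\<^sub>R) a -` ?T a = ?T 1"
    unfolding vimage_def mem_Collect_eq dirn using a by (intro Collect_cong) simp
  have "emeasure lborel (?T a) = emeasure (density (distr lborel borel (\<lambda>x::real^'n. 0 + a *\<^sub>R x)) (\<lambda>_. ennreal (\<bar>a\<bar> ^ DIM(real^'n)))) (?T a)"
    using a by (subst lborel_affine[of a "0::real^'n"]) auto
  also have "\<dots> = ennreal (a ^ CARD('n)) * emeasure (distr lborel borel (\<lambda>x::real^'n. a *\<^sub>R x)) (?T a)"
    using a by (subst emeasure_density) (auto simp: nn_integral_cmult_indicator)
  also have "emeasure (distr lborel borel (\<lambda>x::real^'n. a *\<^sub>R x)) (?T a) = emeasure lborel ((*\<^sub>R) a -` ?T a \<inter> space lborel)"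
    by (rule emeasure_distr) auto
  also have "(*\<^sub>R) a -` ?T a \<inter> space lborel = ?T 1"
    by (simp only: eq space_lborel space_borel Int_UNIV_right)
  finally show ?thesis
    using emeasure_sphere_measure[OF B] by (simp add: mult_ac)
qed

section \<open>Lebesgue measure as a product of a radial and a spherical measure\<close>

definition radial_measure :: "nat \<Rightarrow> real measure" where
  "radial_measure k = density lborel (\<lambda>r. ennreal (r ^ k) * indicator {0<..} r)"

lemma sets_radial_measure [simp, measurable_cong]: "sets (radial_measure k) = sets borel"
  by (simp add: radial_measure_def)

lemma space_radial_measure [simp]: "space (radial_measure k) = UNIV"
  by (simp add: radial_measure_def)

lemma sigma_finite_radial_measure: "sigma_finite_measure (radial_measure k)"
  unfolding radial_measure_def
  by (subst sigma_finite_measure.sigma_finite_iff_density_finite[OF lborel.sigma_finite_measure_axioms]) (auto intro!: AE_I2 simp: ennreal_mult_eq_top_iff indicator_def)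

lemma finite_sphere_measure: "finite_measure (sphere_measure :: (real^'n) measure)"
proof (rule finite_measureI)
  have "emeasure lborel {y::real^'n. y \<noteq> 0 \<and> norm y < 1 \<and> y /\<^sub>R norm y \<in> sphere 0 1} \<le> emeasure lborel (ball (0::real^'n) 1)"
    by (rule emeasure_mono) auto
  also have "\<dots> < \<infinity>" using emeasure_bounded_finite[OF bounded_ball] by blast
  finally have "emeasure lborel {y::real^'n. y \<noteq> 0 \<and> norm y < 1 \<and> y /\<^sub>R norm y \<in> sphere 0 1} \<noteq> \<infinity>" by simp
  then show "emeasure sphere_measure (space (sphere_measure :: (real^'n) measure)) \<noteq> \<infinity>"
    using emeasure_sphere_measure[of "sphere (0::real^'n) 1"]
    by (auto simp: sphere_sets_iff borel_closed closed_sphere ennreal_mult_eq_top_iff)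
qed

interpretation SM: finite_measure "sphere_measure :: (real^'n::finite) measure"
  by (rule finite_sphere_measure)

lemma emeasure_radial_measure:
  assumes "a > 0"
  shows "emeasure (radial_measure k) {..<a} = ennreal (a ^ Suc k / Suc k)"
proof -
  have "emeasure (radial_measure k) {..<a} = (\<integral>\<^sup>+r. ennreal (r ^ k) * indicator {0<..} r * indicator {..<a} r \<partial>lborel)"
    unfolding radial_measure_def by (subst emeasure_density) auto
  also have "\<dots> = (\<integral>\<^sup>+r. ennreal (r ^ k) * indicator {0..a} r \<partial>lborel)"
    using AE_lborel_singleton[of 0] AE_lborel_singleton[of a]
    by (intro nn_integral_cong_AE) (auto elim!: eventually_elim2 split: split_indicator)
  also have "\<dots> = ennreal (a ^ Suc k / Suc k - 0 ^ Suc k / Suc k)"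
  proof (rule nn_integral_FTC_Icc)
    fix r :: real
    show "((\<lambda>x. x ^ Suc k / real (Suc k)) has_real_derivative r ^ k) (at r)"
      by (rule derivative_eq_intros refl | simp)+
  qed (use assms in auto)
  finally show ?thesis by simp
qed

lemma polar_coordinates_measurable:
  "(\<lambda>y::real^'n. (norm y, y /\<^sub>R norm y)) \<in> measurable (restrict_space lborel (UNIV - {0})) (borel \<Otimes>\<^sub>M sphere_measure)"
proof -
  have "(\<lambda>y::real^'n. y /\<^sub>R norm y) \<in> measurable (restrict_space lborel (UNIV - {0})) sphere_measure"
    using direction_measurable[of UNIV] by (simp add: measurable_cong_sets[OF refl sets_sphere_measure])
  moreover have "(\<lambda>y::real^'n. norm y) \<in> measurable (restrict_space lborel (UNIV - {0})) borel"
    by (rule measurable_restrict_space1) simp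
  ultimately show ?thesis by (intro measurable_Pair) (simp_all add: o_def)
qed

lemma polar_pullback_measurable:
  assumes [measurable]: "f \<in> borel_measurable borel"
  shows "(\<lambda>p. f (fst p *\<^sub>R snd p)) \<in> borel_measurable (borel \<Otimes>\<^sub>M (sphere_measure :: (real^'n) measure))"
proof -
  have "(\<lambda>x. x) \<in> borel_measurable (sphere_measure :: (real^'n) measure)"
    unfolding measurable_cong_sets[OF sets_sphere_measure refl] by (rule measurable_restrict_space1) simp
  from measurable_compose[OF measurable_snd this]
  have [measurable]: "snd \<in> measurable (borel \<Otimes>\<^sub>M (sphere_measure :: (real^'n) measure)) borel" .
  show ?thesis by measurable
qed

text \<open>It suffices to compare rectangles \<open>A\<close> times \<open>B\<close>. For fixed
  \<open>B\<close> both sides are measures in \<open>A\<close>; they agree on half-lines by the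
  scaling of cones, and half-lines form an intersection-stable generator of the Borel sets.\<close>

lemma polar_measure:
  "radial_measure (CARD('n) - 1) \<Otimes>\<^sub>M sphere_measure
    = distr (restrict_space lborel (UNIV - {0})) (borel \<Otimes>\<^sub>M sphere_measure) (\<lambda>y::real^'n. (norm y, y /\<^sub>R norm y))"
proof -
  let ?k = "CARD('n) - 1"
  let ?R = "restrict_space lborel (UNIV - {0::real^'n})"
  note pm = polar_coordinates_measurable[where 'n='n]
  show ?thesis
  proof (rule pair_measure_eqI)
    show "sigma_finite_measure (radial_measure ?k)" by (rule sigma_finite_radial_measure)
    show "sigma_finite_measure (sphere_measure :: (real^'n) measure)" ..
    show "sets (radial_measure ?k \<Otimes>\<^sub>M sphere_measure) = sets (distr ?R (borel \<Otimes>\<^sub>M sphere_measure) (\<lambda>y::real^'n. (norm y, y /\<^sub>R norm y)))"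
      by (simp cong: sets_pair_measure_cong)
  next
    fix A :: "real set" and B :: "(real^'n) set"
    assume A: "A \<in> sets (radial_measure ?k)" and B: "B \<in> sets sphere_measure"
    then have A': "A \<in> sets borel" by simp
    have [measurable]: "B \<in> sets borel" using B by (simp add: sphere_sets_iff)
    let ?C = "{y::real^'n. y \<noteq> 0 \<and> y /\<^sub>R norm y \<in> B}"
    have C: "?C \<in> sets borel" using cone_sets[OF B] .
    define s where "s = emeasure sphere_measure B"
    have sfin: "s \<noteq> \<infinity>" unfolding s_def using SM.emeasure_finite by simp
    \<comment> \<open>\<open>\<nu>1\<close> and \<open>\<nu>2\<close> are the two sides of the
      identity, with \<open>B\<close> fixed, as measures of the radial set.\<close>
    define \<nu>1 where "\<nu>1 = distr (restrict_space lborel ?C) borel norm"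
    define \<nu>2 where "\<nu>2 = density (radial_measure ?k) (\<lambda>_. s)"
    have e1: "emeasure \<nu>1 X = emeasure lborel {y::real^'n. norm y \<in> X \<and> y \<in> ?C}" if "X \<in> sets borel" for X
    proof -
      have "emeasure \<nu>1 X = emeasure (restrict_space lborel ?C) (norm -` X \<inter> space (restrict_space lborel ?C))"
        unfolding \<nu>1_def using that by (intro emeasure_distr measurable_restrict_space1) auto
      also have "\<dots> = emeasure lborel (norm -` X \<inter> space (restrict_space lborel ?C))"
        using C by (intro emeasure_restrict_space) (auto simp: space_restrict_space)
      finally show ?thesis by (simp add: space_restrict_space vimage_def Int_def conj_commute)
    qed
    have e2: "emeasure \<nu>2 X = s * emeasure (radial_measure ?k) X" if "X \<in> sets borel" for X
      unfolding \<nu>2_def using that by (subst emeasure_density) (auto simp: nn_integral_cmult_indicator)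
    have lt: "emeasure \<nu>1 {..<a} = emeasure \<nu>2 {..<a} \<and> emeasure \<nu>1 {..<a} \<noteq> \<infinity>" for a
    proof (cases "a > 0")
      case False
      have "{y::real^'n. norm y \<in> {..<a} \<and> y \<in> ?C} = {}"
      proof -
        have "\<not> norm y < a" for y :: "real^'n" using False norm_ge_zero[of y] by linarith
        then show ?thesis by auto
      qed
      then have 1: "emeasure \<nu>1 {..<a} = 0" by (subst e1) (auto simp del: Collect_empty_eq)
      have "emeasure (radial_measure ?k) {..<a} = (\<integral>\<^sup>+r. ennreal (r ^ ?k) * indicator {0<..} r * indicator {..<a} r \<partial>lborel)"
        unfolding radial_measure_def by (subst emeasure_density) auto
      also have "\<dots> = (\<integral>\<^sup>+r. 0 \<partial>(lborel::real measure))"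
        using False by (intro nn_integral_cong) (auto split: split_indicator)
      finally show ?thesis using 1 by (simp add: e2)
    next
      case True
      have S: "{y::real^'n. norm y \<in> {..<a} \<and> y \<in> ?C} = {y. y \<noteq> 0 \<and> norm y < a \<and> y /\<^sub>R norm y \<in> B}" by auto
      have c: "ennreal (real CARD('n)) * emeasure \<nu>1 {..<a} = ennreal (a ^ CARD('n)) * s"
        unfolding e1[OF lessThan_borel] S s_def by (rule emeasure_cone[OF B True])
      have c2: "ennreal (real CARD('n)) * emeasure \<nu>2 {..<a} = ennreal (a ^ CARD('n)) * s"
      proof -
        have "ennreal (real CARD('n)) * emeasure \<nu>2 {..<a} = s * (ennreal (real CARD('n)) * ennreal (a ^ CARD('n) / CARD('n)))"
          using emeasure_radial_measure[OF True, of ?k] by (simp add: e2 mult_ac)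
        also have "ennreal (real CARD('n)) * ennreal (a ^ CARD('n) / CARD('n)) = ennreal (a ^ CARD('n))"
          using True by (subst ennreal_mult[symmetric]) auto
        finally show ?thesis by (simp add: mult_ac)
      qed
      have fin: "ennreal (a ^ CARD('n)) * s \<noteq> \<infinity>" using sfin by (simp add: ennreal_mult_eq_top_iff)
      have "emeasure \<nu>1 {..<a} = emeasure \<nu>2 {..<a}"
        using c c2 ennreal_mult_cancel_left[of "ennreal (real CARD('n))" "emeasure \<nu>1 {..<a}" "emeasure \<nu>2 {..<a}"]
        by simp
      moreover have "emeasure \<nu>1 {..<a} \<noteq> \<infinity>"
      proof
        assume "emeasure \<nu>1 {..<a} = \<infinity>"
        then have "ennreal (real CARD('n)) * emeasure \<nu>1 {..<a} = \<infinity>" by (simp add: ennreal_mult_eq_top_iff)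
        with c fin show False by simp
      qed
      ultimately show ?thesis by simp
    qed
    have "\<nu>1 = \<nu>2"
    proof (rule measure_eqI_generator_eq[where E = "range lessThan" and \<Omega> = UNIV and A = "\<lambda>i::nat. {..<real i}"])
      show "Int_stable (range (lessThan :: real \<Rightarrow> _))"
      proof -
        have "{..<a} \<inter> {..<b} = {..<min a b}" for a b :: real by auto
        then show ?thesis unfolding Int_stable_def by (metis (no_types, lifting) imageE rangeI)
      qed
      show "sets \<nu>1 = sigma_sets UNIV (range lessThan)" "sets \<nu>2 = sigma_sets UNIV (range lessThan)"
        unfolding \<nu>1_def \<nu>2_def by (simp_all add: borel_Iio)
      show "(\<Union>i::nat. {..<real i}) = UNIV" using reals_Archimedean2 by auto
      show "emeasure \<nu>1 {..<real i} \<noteq> \<infinity>" for i :: nat using lt by blast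
      show "emeasure \<nu>1 X = emeasure \<nu>2 X" if "X \<in> range lessThan" for X using lt that by blast
    qed auto
    then have "s * emeasure (radial_measure ?k) A = emeasure \<nu>1 A" using e2[OF A'] by simp
    also have "\<dots> = emeasure lborel {y::real^'n. norm y \<in> A \<and> y \<in> ?C}" by (rule e1[OF A'])
    also have "\<dots> = emeasure ?R ((\<lambda>y::real^'n. (norm y, y /\<^sub>R norm y)) -` (A \<times> B) \<inter> space ?R)"
      by (subst emeasure_restrict_space) (auto simp: space_restrict_space intro!: arg_cong[where f="emeasure lborel"])
    also have "\<dots> = emeasure (distr ?R (borel \<Otimes>\<^sub>M sphere_measure) (\<lambda>y::real^'n. (norm y, y /\<^sub>R norm y))) (A \<times> B)"
      using A' B by (subst emeasure_distr[OF pm]) auto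
    finally show "emeasure (radial_measure ?k) A * emeasure sphere_measure B
       = emeasure (distr ?R (borel \<Otimes>\<^sub>M sphere_measure) (\<lambda>y::real^'n. (norm y, y /\<^sub>R norm y))) (A \<times> B)"
      by (simp add: s_def mult_ac)
  qed
qed

text \<open>The nonnegative version asks for no integrability of \<open>f\<close>; the volume of
  star-shaped domains is computed with it.\<close>

lemma polar_nn_integral:
  fixes f :: "real^'n \<Rightarrow> ennreal"
  assumes [measurable]: "f \<in> borel_measurable borel"
  shows "(\<integral>\<^sup>+y. f y \<partial>lborel)
    = (\<integral>\<^sup>+x. (\<integral>\<^sup>+r. ennreal (r ^ (CARD('n) - 1)) * indicator {0<..} r * f (r *\<^sub>R x) \<partial>lborel) \<partial>sphere_measure)"
proof -
  let ?k = "CARD('n) - 1"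
  let ?R = "restrict_space lborel (UNIV - {0::real^'n})"
  interpret R: sigma_finite_measure "radial_measure ?k" by (rule sigma_finite_radial_measure)
  interpret P: pair_sigma_finite "radial_measure ?k" "sphere_measure :: (real^'n) measure" ..
  note pm = polar_coordinates_measurable[where 'n='n]
  note fm = polar_pullback_measurable[OF assms]
  have "(\<integral>\<^sup>+y. f y \<partial>lborel) = (\<integral>\<^sup>+y. f y * indicator (UNIV - {0}) y \<partial>lborel)"
    using AE_lborel_singleton[of "0::real^'n"] by (intro nn_integral_cong_AE) (auto elim!: eventually_mono)
  also have "\<dots> = (\<integral>\<^sup>+y. f y \<partial>?R)"
    by (subst nn_integral_restrict_space) auto
  also have "\<dots> = (\<integral>\<^sup>+y. f (norm y *\<^sub>R (y /\<^sub>R norm y)) \<partial>?R)"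
    by (intro nn_integral_cong) (auto simp: space_restrict_space)
  also have "\<dots> = (\<integral>\<^sup>+p. f (fst p *\<^sub>R snd p) \<partial>distr ?R (borel \<Otimes>\<^sub>M sphere_measure) (\<lambda>y. (norm y, y /\<^sub>R norm y)))"
    using fm by (subst nn_integral_distr[OF pm]) auto
  also have "\<dots> = (\<integral>\<^sup>+p. f (fst p *\<^sub>R snd p) \<partial>(radial_measure ?k \<Otimes>\<^sub>M sphere_measure))"
    by (simp only: polar_measure)
  also have "\<dots> = (\<integral>\<^sup>+x. (\<integral>\<^sup>+r. f (r *\<^sub>R x) \<partial>radial_measure ?k) \<partial>sphere_measure)"
    using fm by (subst P.nn_integral_snd[symmetric]) (auto cong: measurable_cong_sets sets_pair_measure_cong)
  also have "\<dots> = (\<integral>\<^sup>+x. (\<integral>\<^sup>+r. ennreal (r ^ ?k) * indicator {0<..} r * f (r *\<^sub>R x) \<partial>lborel) \<partial>sphere_measure)"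
    unfolding radial_measure_def by (intro nn_integral_cong nn_integral_density) auto
  finally show ?thesis .
qed

section \<open>Integrals of continuous functions over the sphere\<close>

lemma measurable_sphere_measure:
  fixes f :: "real^'n \<Rightarrow> real"
  assumes "continuous_on (sphere 0 1) f"
  shows "f \<in> borel_measurable sphere_measure"
  unfolding measurable_cong_sets[OF sets_sphere_measure refl]
  using assms by (rule borel_measurable_continuous_on_restrict)

lemma integrable_sphere_measure:
  fixes f :: "real^'n \<Rightarrow> real"
  assumes "continuous_on (sphere 0 1) f"
  shows "integrable sphere_measure f"
proof -
  have "compact (f ` sphere 0 1)" using assms by (intro compact_continuous_image) auto
  then obtain B where "\<forall>x\<in>sphere 0 1. norm (f x) \<le> B"
    using compact_imp_bounded[of "f ` sphere 0 1"] unfolding bounded_iff by auto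
  then show ?thesis
    by (intro SM.integrable_const_bound[of _ B] AE_I2 measurable_sphere_measure assms) auto
qed

text \<open>The cone over a relatively open set is open and contains the midpoint of the segment
  from the origin to \<open>x\<close>, hence a ball of positive volume.\<close>

lemma emeasure_sphere_measure_open_pos:
  fixes x :: "real^'n"
  assumes "x \<in> sphere 0 1" "open U" "x \<in> U"
  shows "emeasure sphere_measure (U \<inter> sphere 0 1) > 0"
proof -
  let ?B = "U \<inter> sphere (0::real^'n) 1"
  have B: "?B \<in> sets sphere_measure" using assms by (auto simp: sphere_sets_iff)
  define C where "C = {y::real^'n. y \<noteq> 0 \<and> norm y < 1 \<and> y /\<^sub>R norm y \<in> ?B}"
  have C: "C = (\<lambda>y. y /\<^sub>R norm y) -` U \<inter> (ball 0 1 - {0})" by (auto simp: C_def)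
  have "open C" unfolding C using assms(2)
    by (subst Int_commute, intro continuous_open_preimage) (auto intro!: continuous_intros)
  moreover have "(1/2) *\<^sub>R x \<in> C" using assms by (auto simp: C_def)
  ultimately obtain e where e: "e > 0" "ball ((1/2) *\<^sub>R x) e \<subseteq> C" by (meson openE)
  have "0 < emeasure lborel (ball ((1/2) *\<^sub>R x) e)"
    using e by (simp add: emeasure_ball unit_ball_vol_pos)
  also have "\<dots> \<le> emeasure lborel C" using e \<open>open C\<close> by (intro emeasure_mono) auto
  finally have "emeasure lborel C > 0" .
  then show ?thesis using emeasure_sphere_measure[OF B]
    unfolding C_def[symmetric] by (simp add: ennreal_zero_less_mult_iff)
qed

lemma omega_pos: "omega TYPE('n::finite) > 0"
proof -
  obtain x :: "real^'n" where x: "x \<in> sphere 0 1"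
    using vector_choose_size[of 1] by (metis mem_sphere_0 zero_le_one)
  have "emeasure (sphere_measure :: (real^'n) measure) (UNIV \<inter> sphere 0 1) > 0"
    using x by (rule emeasure_sphere_measure_open_pos) auto
  then have "ennreal (omega TYPE('n)) > 0"
    unfolding omega_def by (simp add: SM.emeasure_eq_measure)
  then show ?thesis by simp
qed

lemma lint_const_sphere: "(LINT x|(sphere_measure :: (real^'n::finite) measure). c) = (c::real) * omega TYPE('n)"
  by (simp add: omega_def)

text \<open>If \<open>f x\<close> were positive, \<open>f\<close> would be positive on a relatively
  open set, which has positive measure. The equality case of the inequality rests on this.\<close>

lemma sphere_integral_zero_imp:
  fixes f :: "real^'n \<Rightarrow> real"
  assumes f: "continuous_on (sphere 0 1) f" "\<And>x. x \<in> sphere 0 1 \<Longrightarrow> f x \<ge> 0"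
    and z: "(LINT x|sphere_measure. f x) = 0" and x: "x \<in> sphere 0 1"
  shows "f x = 0"
proof (rule ccontr)
  assume "f x \<noteq> 0"
  then have pos: "f x > 0" using f(2)[OF x] by auto
  obtain U where U: "open U" "U \<inter> sphere 0 1 = f -` {0<..} \<inter> sphere 0 1"
    using f(1)[unfolded continuous_on_open_invariant, rule_format, OF open_greaterThan[of 0]] by blast
  have "x \<in> f -` {0<..} \<inter> sphere 0 1" using x pos by simp
  then have "x \<in> U" unfolding U(2)[symmetric] by (rule IntD1)
  then have pos2: "emeasure sphere_measure (U \<inter> sphere 0 1) > 0"
    using U x emeasure_sphere_measure_open_pos by blast
  have "AE x in sphere_measure. f x = 0"
    using z integrable_sphere_measure[OF f(1)] f(2)
    by (subst (asm) integral_nonneg_eq_0_iff_AE) auto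
  then have ae: "AE x in sphere_measure. x \<notin> U \<inter> sphere 0 1"
    by eventually_elim (use U in auto)
  have st: "U \<inter> sphere 0 1 \<in> sets sphere_measure" unfolding sphere_sets_iff using U(1)
    by (intro conjI sets.Int borel_open borel_closed) auto
  have eq: "{x \<in> space sphere_measure. \<not> x \<notin> U \<inter> sphere 0 1} = U \<inter> sphere (0::real^'n) 1" by auto
  have "emeasure sphere_measure (U \<inter> sphere 0 1) = 0"
    by (rule AE_iff_measurable[THEN iffD1, OF st eq ae])
  with pos2 show False by simp
qed

text \<open>The signed version serves the integration by parts, whose integrand changes
  sign.\<close>

lemma polar_integral:
  fixes f :: "real^'n \<Rightarrow> real"
  assumes f: "integrable lborel f"
  shows "(LINT y|lborel. f y) = (LINT x|sphere_measure. (LINT r|radial_measure (CARD('n) - 1). f (r *\<^sub>R x)))"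
proof -
  let ?k = "CARD('n) - 1"
  have fb[measurable]: "f \<in> borel_measurable borel" using f by auto
  let ?R = "restrict_space lborel (UNIV - {0::real^'n})"
  interpret R: sigma_finite_measure "radial_measure ?k" by (rule sigma_finite_radial_measure)
  interpret P: pair_sigma_finite "radial_measure ?k" "sphere_measure :: (real^'n) measure" ..
  note pm = polar_coordinates_measurable[where 'n='n]
  note fm = polar_pullback_measurable[OF fb]
  have Rf: "integrable ?R f"
    using integrable_mult_indicator[OF _ f, of "UNIV - {0}"] by (subst integrable_restrict_space) auto
  have "(LINT y|lborel. f y) = (LINT y|lborel. indicator (UNIV - {0}) y *\<^sub>R f y)"
    using AE_lborel_singleton[of "0::real^'n"] by (intro integral_cong_AE) (auto elim!: eventually_mono)
  also have "\<dots> = (LINT y|?R. f y)"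
    by (subst integral_restrict_space) auto
  also have "\<dots> = (LINT y|?R. f (norm y *\<^sub>R (y /\<^sub>R norm y)))"
    by (intro Bochner_Integration.integral_cong) (auto simp: space_restrict_space)
  also have "\<dots> = (LINT p|distr ?R (borel \<Otimes>\<^sub>M sphere_measure) (\<lambda>y. (norm y, y /\<^sub>R norm y)). f (fst p *\<^sub>R snd p))"
    using fm by (subst integral_distr[OF pm]) auto
  also have "\<dots> = (LINT p|(radial_measure ?k \<Otimes>\<^sub>M sphere_measure). f (fst p *\<^sub>R snd p))"
    by (simp only: polar_measure)
  also have "\<dots> = (LINT x|sphere_measure. (LINT r|radial_measure ?k. f (r *\<^sub>R x)))"
  proof -
    have "integrable ?R (\<lambda>y. f (norm y *\<^sub>R (y /\<^sub>R norm y)))"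
      by (rule Bochner_Integration.integrable_cong[THEN iffD1, OF refl _ Rf]) (auto simp: space_restrict_space)
    then have "integrable (distr ?R (borel \<Otimes>\<^sub>M sphere_measure) (\<lambda>y. (norm y, y /\<^sub>R norm y))) (\<lambda>p. f (fst p *\<^sub>R snd p))"
      using fm by (subst integrable_distr_eq[OF pm]) auto
    then have "integrable (radial_measure ?k \<Otimes>\<^sub>M sphere_measure) (\<lambda>(r,x). f (r *\<^sub>R x))"
      by (simp only: polar_measure split_def)
    from P.integral_snd[OF this] show ?thesis by (simp add: split_def)
  qed
  finally show ?thesis .
qed

subsection \<open>Divergence theorem on the sphere\<close>

text \<open>Functions and fields on the sphere are differentiated through their 0-homogeneous
  extensions, so that gradients are automatically tangential.\<close>

definition sgrad :: "(real^'n \<Rightarrow> real) \<Rightarrow> (real^'n \<Rightarrow> real^'n) \<Rightarrow> bool" where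
  "sgrad u \<Gamma> \<longleftrightarrow> continuous_on (sphere 0 1) \<Gamma> \<and>
     (\<forall>x\<in>sphere 0 1. (hom_ext u has_derivative (\<lambda>v. \<Gamma> x \<bullet> v)) (at x))"

lemma hom_ext_scale: "t > 0 \<Longrightarrow> hom_ext u (t *\<^sub>R y) = hom_ext u y"
proof -
  assume "t > 0"
  then have "(t *\<^sub>R y) /\<^sub>R norm (t *\<^sub>R y) = y /\<^sub>R norm y" by simp
  then show ?thesis by (simp only: hom_ext_def)
qed

lemma hom_ext_sphere [simp]: "norm x = 1 \<Longrightarrow> hom_ext u x = u x"
  by (simp add: hom_ext_def)

text \<open>The derivative of a function homogeneous of degree 0 is homogeneous of degree -1, whence
  the factor \<open>1 / norm y\<close>.\<close>

lemma sgrad_at: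
  assumes "sgrad u \<Gamma>" "y \<noteq> 0"
  shows "(hom_ext u has_derivative (\<lambda>v. (\<Gamma> (y /\<^sub>R norm y) \<bullet> v) / norm y)) (at y)"
proof -
  let ?t = "inverse (norm y)"
  have t: "?t > 0" using assms by simp
  have d: "(hom_ext u has_derivative (\<lambda>v. \<Gamma> (y /\<^sub>R norm y) \<bullet> v)) (at (?t *\<^sub>R y))"
    using assms by (auto simp: sgrad_def)
  have "((\<lambda>z. hom_ext u (?t *\<^sub>R z)) has_derivative (\<lambda>v. \<Gamma> (y /\<^sub>R norm y) \<bullet> (?t *\<^sub>R v))) (at y)"
    by (rule has_derivative_compose[where f="\<lambda>z. ?t *\<^sub>R z" and g="hom_ext u", OF _ d]) (auto intro!: derivative_eq_intros)
  then show ?thesis using hom_ext_scale[OF t, of u] by (simp add: divide_inverse mult.commute)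
qed

text \<open>The extension is constant along the ray through \<open>x\<close>.\<close>

lemma hom_ext_radial_derivative:
  fixes u :: "real^'n \<Rightarrow> 'b::real_normed_vector"
  assumes "(hom_ext u has_derivative D) (at x)" "x \<noteq> 0"
  shows "D x = 0"
proof -
  have d: "(hom_ext u has_derivative D) (at ((1::real) *\<^sub>R x))" using assms by simp
  have 1: "((\<lambda>t. hom_ext u (t *\<^sub>R x)) has_derivative (\<lambda>t. D (t *\<^sub>R x))) (at (1::real))"
    by (rule has_derivative_compose[where f="\<lambda>t::real. t *\<^sub>R x" and g="hom_ext u", OF _ d]) (auto intro!: derivative_eq_intros)
  have ev: "eventually (\<lambda>t::real. t > 0) (at 1)"
    using eventually_at_in_open'[of "{0<..}" "1::real"] by (auto elim: eventually_mono)
  have 2: "((\<lambda>t. hom_ext u (t *\<^sub>R x)) has_derivative (\<lambda>t. 0)) (at (1::real))"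
  proof (rule has_derivative_transform_eventually)
    show "((\<lambda>t. hom_ext u x) has_derivative (\<lambda>t. 0)) (at (1::real))" by simp
    show "eventually (\<lambda>t::real. hom_ext u x = hom_ext u (t *\<^sub>R x)) (at 1)"
      using ev by eventually_elim (simp add: hom_ext_scale)
  qed auto
  have "(\<lambda>t. D (t *\<^sub>R x)) = (\<lambda>t::real. 0)"
    by (rule has_derivative_unique[OF 1 2])
  from fun_cong[OF this, of 1] show ?thesis by simp
qed

lemma sgrad_tangent:
  assumes "sgrad u \<Gamma>" "x \<in> sphere 0 1"
  shows "\<Gamma> x \<bullet> x = 0"
proof -
  have "x \<noteq> 0" using assms by auto
  then show ?thesis using assms hom_ext_radial_derivative[of u "\<lambda>v. \<Gamma> x \<bullet> v" x] by (auto simp: sgrad_def)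
qed

lemma continuous_on_sphere_hom_ext:
  fixes u :: "real^'n \<Rightarrow> 'b::real_normed_vector"
  assumes "\<And>x. x \<in> sphere 0 1 \<Longrightarrow> (hom_ext u has_derivative D x) (at x)"
  shows "continuous_on (sphere 0 1) u"
proof -
  have "continuous_on (sphere 0 1) (hom_ext u)"
    using assms has_derivative_continuous by (intro continuous_at_imp_continuous_on ballI) blast
  then show ?thesis
    by (rule continuous_on_cong[THEN iffD1, rotated -1]) auto
qed

lemma sgrad_continuous:
  assumes "sgrad u \<Gamma>" shows "continuous_on (sphere 0 1) u"
  using assms unfolding sgrad_def by (intro continuous_on_sphere_hom_ext) blast

section \<open>Integration by parts in space and on the sphere\<close>

lemma pos_part_sq_derivative: "((\<lambda>t::real. (max 0 t)\<^sup>2) has_real_derivative 2 * max 0 t) (at t)"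
proof -
  consider "t > 0" | "t < 0" | "t = 0" by linarith
  then show ?thesis
  proof cases
    case 1
    have "((\<lambda>t::real. t\<^sup>2) has_real_derivative 2 * max 0 t) (at t)"
      using 1 by (auto intro!: derivative_eq_intros)
    then show ?thesis
      by (rule DERIV_cong_ev[THEN iffD1, OF refl _ refl, rotated])
         (use 1 eventually_nhds_in_open[of "{0<..}" t] in \<open>auto elim!: eventually_mono\<close>)
  next
    case 2
    have "((\<lambda>t::real. 0) has_real_derivative 2 * max 0 t) (at t)"
      using 2 by (auto intro!: derivative_eq_intros)
    then show ?thesis
      by (rule DERIV_cong_ev[THEN iffD1, OF refl _ refl, rotated])
         (use 2 eventually_nhds_in_open[of "{..<0}" t] in \<open>auto elim!: eventually_mono\<close>)
  next
    case 3
    have "((\<lambda>h. ((max 0 (0 + h))\<^sup>2 - (max 0 0)\<^sup>2) / h) \<longlongrightarrow> 0) (at (0::real))"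
    proof (rule tendsto_rabs_zero_cancel, rule tendsto_sandwich[where f="\<lambda>_. 0" and h="\<lambda>h. \<bar>h\<bar>"])
      show "\<forall>\<^sub>F h in at (0::real). \<bar>((max 0 (0 + h))\<^sup>2 - (max 0 0)\<^sup>2) / h\<bar> \<le> \<bar>h\<bar>"
        by (rule always_eventually) (auto simp: max_def power2_eq_square)
      show "((\<lambda>h. \<bar>h\<bar>) \<longlongrightarrow> 0) (at (0::real))" by (auto intro!: tendsto_eq_intros)
    qed auto
    then show ?thesis using 3 by (simp add: DERIV_def)
  qed
qed

text \<open>By translation invariance every difference quotient of \<open>f\<close> has integral
  zero. The mean value theorem bounds the quotients by \<open>C\<close> on a fixed ball, so
  dominated convergence transfers the value zero to \<open>D\<close>.\<close>

lemma integral_directional_derivative_zero: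
  fixes f :: "'a::euclidean_space \<Rightarrow> real"
  assumes d: "\<And>y. ((\<lambda>t. f (y + t *\<^sub>R e)) has_real_derivative D y) (at 0)"
    and cf: "continuous_on UNIV f"
    and bd: "\<And>y. \<bar>D y\<bar> \<le> C" and supp: "\<And>y. norm y > b \<Longrightarrow> f y = 0"
    and Dm: "D \<in> borel_measurable borel"
  shows "(LINT y|lborel. D y) = 0" "integrable lborel D"
proof -
  let ?s = "\<lambda>i y. (f (y + (1 / real (Suc i)) *\<^sub>R e) - f y) / (1 / real (Suc i))"
  \<comment> \<open>The step sizes are at most 1, so every quotient vanishes outside the support of
    \<open>f\<close> enlarged by \<open>norm e\<close>.\<close>
  let ?w = "\<lambda>y. indicator (cball 0 (b + norm e)) y * C"
  have fm: "f \<in> borel_measurable borel" using cf by (rule borel_measurable_continuous_onI)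
  have d': "((\<lambda>t. f (y + t *\<^sub>R e)) has_real_derivative D (y + t *\<^sub>R e)) (at t)" for y t
  proof -
    have "((\<lambda>s. f ((y + t *\<^sub>R e) + s *\<^sub>R e)) has_real_derivative D (y + t *\<^sub>R e)) (at (t - t))"
      using d[of "y + t *\<^sub>R e"] by simp
    then show ?thesis using DERIV_shift[of "\<lambda>s. f ((y + t *\<^sub>R e) + s *\<^sub>R e)" "D (y + t *\<^sub>R e)" t "-t"]
      by (simp add: algebra_simps)
  qed
  have C0: "C \<ge> 0" using bd[of 0] abs_ge_zero order_trans by blast
  have lip: "\<bar>?s i y\<bar> \<le> ?w y" for i y
  proof -
    define t where "t = 1 / real (Suc i)"
    have t: "0 < t" "t \<le> 1" by (auto simp: t_def)
    obtain z where z: "f (y + t *\<^sub>R e) - f (y + 0 *\<^sub>R e) = (t - 0) * D (y + z *\<^sub>R e)"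
      using MVT2[of 0 t "\<lambda>t. f (y + t *\<^sub>R e)" "\<lambda>t. D (y + t *\<^sub>R e)"] d' t by blast
    then have "?s i y = D (y + z *\<^sub>R e)" using t unfolding t_def[symmetric] by (simp only: scaleR_zero_left add_0_right diff_zero) simp
    then have 1: "\<bar>?s i y\<bar> \<le> C" using bd by simp
    show ?thesis
    proof (cases "norm y \<le> b + norm e")
      case True then show ?thesis using 1 by simp
    next
      case False
      have "norm (t *\<^sub>R e) \<le> norm e" using t by (simp add: mult_left_le_one_le)
      moreover have "norm y \<le> norm (y + t *\<^sub>R e) + norm (t *\<^sub>R e)"
        using norm_triangle_ineq4[of "y + t *\<^sub>R e" "t *\<^sub>R e"] by simp
      ultimately have "norm (y + t *\<^sub>R e) > b" using False by linarith
      moreover have "norm y > b" using False norm_ge_zero[of e] by linarith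
      ultimately show ?thesis using supp C0 unfolding t_def[symmetric] by (simp split: split_indicator)
    qed
  qed
  have lim: "(\<lambda>i. ?s i y) \<longlonglongrightarrow> D y" for y
  proof -
    have "((\<lambda>h. (f (y + h *\<^sub>R e) - f y) / h) \<longlongrightarrow> D y) (at 0)"
      using d[of y] by (simp add: DERIV_def)
    moreover have "filterlim (\<lambda>i. 1 / real (Suc i)) (at 0) sequentially"
    proof -
      have "(\<lambda>i. 1 / real (Suc i)) \<longlonglongrightarrow> 0" by (rule LIMSEQ_Suc[OF lim_1_over_n])
      then show ?thesis unfolding filterlim_at by (intro conjI always_eventually allI) simp_all
    qed
    ultimately show ?thesis by (rule filterlim_compose)
  qed
  have wi: "integrable lborel ?w" by (auto intro!: integrable_mult_left integrable_real_indicator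
        simp: emeasure_bounded_finite[OF bounded_cball, simplified])
  have sm: "?s i \<in> borel_measurable lborel" for i
  proof -
    have "(\<lambda>y. f (y + (1 / real (Suc i)) *\<^sub>R e)) \<in> borel_measurable borel"
      by (rule measurable_compose[OF _ fm]) measurable
    then show ?thesis using fm by simp
  qed
  have DM: "D \<in> borel_measurable lborel" using Dm by simp
  have L: "(\<lambda>i. LINT y|lborel. ?s i y) \<longlonglongrightarrow> (LINT y|lborel. D y)"
    by (rule integral_dominated_convergence[where s="?s" and w="?w", OF DM sm wi AE_I2[OF lim] AE_I2]) (simp only: real_norm_def lip)
  show "integrable lborel D"
    by (rule integrable_dominated_convergence[where s="?s" and w="?w", OF DM sm wi AE_I2[OF lim] AE_I2]) (simp only: real_norm_def lip)
  have fi: "integrable lborel f"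
  proof -
    have "integrable lborel (\<lambda>y. indicator (cball 0 b) y *\<^sub>R f y)"
      by (rule borel_integrable_compact) (auto intro: continuous_on_subset[OF cf])
    moreover have "(\<lambda>y. indicator (cball 0 b) y *\<^sub>R f y) = f"
    proof
      fix y show "indicator (cball 0 b) y *\<^sub>R f y = f y"
        using supp[of y] by (cases "norm y \<le> b") auto
    qed
    ultimately show ?thesis by simp
  qed
  have tr: "integrable lborel (\<lambda>y. f (y + c))" "(LINT y|lborel. f (y + c)) = (LINT y|lborel. f y)" for c
  proof -
    have "integrable (distr lborel borel ((+) c)) f" using fi by (simp add: lborel_distr_plus)
    then show "integrable lborel (\<lambda>y. f (y + c))"
      using fm by (subst (asm) integrable_distr_eq) (auto simp: add.commute)
    have "(LINT y|lborel. f y) = (LINT y|distr lborel borel ((+) c). f y)" by (simp add: lborel_distr_plus)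
    also have "\<dots> = (LINT y|lborel. f (c + y))" using fm by (subst integral_distr) auto
    finally show "(LINT y|lborel. f (y + c)) = (LINT y|lborel. f y)" by (simp add: add.commute)
  qed
  have "(LINT y|lborel. ?s i y) = 0" for i
    using tr fi by simp
  with L show "(LINT y|lborel. D y) = 0" by (simp add: LIMSEQ_const_iff)
qed


text \<open>A C^1 cutoff supported in the shell between radii 1 and 2. It stays away from the
  origin, where 0-homogeneous extensions are singular, and squaring the positive part is enough to
  make it differentiable.\<close>

definition bump :: "real \<Rightarrow> real" where "bump r = (max 0 ((r - 1) * (2 - r)))\<^sup>2"
definition bump' :: "real \<Rightarrow> real" where "bump' r = 2 * max 0 ((r - 1) * (2 - r)) * (3 - 2 * r)"

lemma bump_derivative: "(bump has_real_derivative bump' r) (at r)"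
proof -
  have "((\<lambda>r. (r - 1) * (2 - r)) has_real_derivative 3 - 2 * r) (at r)"
    by (auto intro!: derivative_eq_intros)
  from DERIV_chain2[OF pos_part_sq_derivative this] show ?thesis
    by (simp add: bump_def[abs_def] bump'_def)
qed

lemma bump_outside:
  assumes "r \<notin> {1<..<2}" shows "bump r = 0" "bump' r = 0"
proof -
  have "(r - 1) * (2 - r) \<le> 0"
    using assms by (cases "r \<le> 1") (auto simp: mult_le_0_iff)
  then show "bump r = 0" "bump' r = 0" by (auto simp: bump_def bump'_def max_def)
qed

lemma bump_pos: "1 < r \<Longrightarrow> r < 2 \<Longrightarrow> bump r > 0"
  by (auto simp: bump_def max_def)

lemma continuous_bump [continuous_intros]:
  "continuous_on A f \<Longrightarrow> continuous_on A (\<lambda>x. bump (f x))"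
  "continuous_on A f \<Longrightarrow> continuous_on A (\<lambda>x. bump' (f x))"
  unfolding bump_def bump'_def by (auto intro!: continuous_intros)

text \<open>The first identity integrates the derivative of \<open>r ^ k * bump r\<close> over the
  shell, at whose ends the cutoff vanishes. With \<open>k = CARD('n) - 1\<close> it is the origin of
  the dimensional factor in the divergence theorem.\<close>

lemma bump_moments:
  "(LINT r|radial_measure k. bump' r) = - real k * (LINT r|radial_measure k. bump r / r)"
  "(LINT r|radial_measure k. bump r / r) > 0"
  "integrable (radial_measure k) (\<lambda>r. bump r / r)" "integrable (radial_measure k) bump'"
proof -
  have rd: "radial_measure k = density lborel (\<lambda>r. ennreal (r ^ k * indicator {0<..} r))"
    unfolding radial_measure_def by (intro density_cong) (auto split: split_indicator)
  have m1: "(\<lambda>r. bump r / r) \<in> borel_measurable lborel" "bump' \<in> borel_measurable lborel"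
  proof -
    have "bump \<in> borel_measurable borel" "bump' \<in> borel_measurable borel"
      by (auto intro!: borel_measurable_continuous_onI continuous_bump(1)[of UNIV "\<lambda>x. x"] continuous_bump(2)[of UNIV "\<lambda>x. x"] continuous_on_id)
    then show "(\<lambda>r. bump r / r) \<in> borel_measurable lborel" "bump' \<in> borel_measurable lborel" by simp_all
  qed
  have c1: "continuous_on {1..2} (\<lambda>r. r ^ k * (bump r / r))" by (auto intro!: continuous_intros)
  have c2: "continuous_on {1..2} (\<lambda>r. r ^ k * bump' r)" by (auto intro!: continuous_intros)
  have i1: "integrable lborel (\<lambda>r. indicator {1..2} r *\<^sub>R (r ^ k * (bump r / r)))"
    by (rule borel_integrable_compact[OF _ c1]) simp
  have i2: "integrable lborel (\<lambda>r. indicator {1..2} r *\<^sub>R (r ^ k * bump' r))"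
    by (rule borel_integrable_compact[OF _ c2]) simp
  have e1: "(r ^ k * indicator {0<..} r) *\<^sub>R (bump r / r) = indicator {1..2} r *\<^sub>R (r ^ k * (bump r / r))" for r
    using bump_outside[of r] by (auto split: split_indicator)
  have e2: "(r ^ k * indicator {0<..} r) *\<^sub>R bump' r = indicator {1..2} r *\<^sub>R (r ^ k * bump' r)" for r
    using bump_outside[of r] by (auto split: split_indicator)
  have nn: "AE r in lborel. 0 \<le> r ^ k * indicator {0<..} (r::real)"
    by (auto split: split_indicator)
  show I1: "integrable (radial_measure k) (\<lambda>r. bump r / r)"
    unfolding rd using i1 m1 nn by (subst integrable_density) (auto simp: e1 simp del: real_scaleR_def)
  show I2: "integrable (radial_measure k) bump'"
    unfolding rd using i2 m1 nn by (subst integrable_density) (auto simp: e2 simp del: real_scaleR_def)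
  have L1: "(LINT r|radial_measure k. bump r / r) = (LINT r|lborel. indicator {1..2} r *\<^sub>R (r ^ k * (bump r / r)))"
    unfolding rd using m1 nn by (subst integral_density) (auto simp: e1 simp del: real_scaleR_def)
  have L2: "(LINT r|radial_measure k. bump' r) = (LINT r|lborel. indicator {1..2} r *\<^sub>R (r ^ k * bump' r))"
    unfolding rd using m1 nn by (subst integral_density) (auto simp: e2 simp del: real_scaleR_def)
  have "(LINT r|lborel. (real k * (r ^ k * (bump r / r)) + r ^ k * bump' r) * indicator {1..2} r) = 2 ^ k * bump 2 - 1 ^ k * bump 1"
  proof (rule integral_FTC_Icc_real)
    fix r :: real assume r: "1 \<le> r" "r \<le> 2"
    have "((\<lambda>r. r ^ k) has_real_derivative real k * r ^ k / r) (at r)"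
      using r DERIV_pow[of k r UNIV] by (cases k) (auto simp: mult.assoc)
    from DERIV_mult[OF this bump_derivative]
    show "((\<lambda>r. r ^ k * bump r) has_real_derivative real k * (r ^ k * (bump r / r)) + r ^ k * bump' r) (at r)"
      by (simp add: mult_ac)
  next
    fix r :: real assume "1 \<le> r" "r \<le> 2"
    then have "continuous_on {1/2<..} (\<lambda>r. real k * (r ^ k * (bump r / r)) + r ^ k * bump' r)"
      by (auto intro!: continuous_intros)
    then show "isCont (\<lambda>r. real k * (r ^ k * (bump r / r)) + r ^ k * bump' r) r"
      using \<open>1 \<le> r\<close> by (subst (asm) continuous_on_eq_continuous_at) auto
  qed simp
  also have "\<dots> = 0" using bump_outside[of 1] bump_outside[of 2] by simp
  also have "(LINT r|lborel. (real k * (r ^ k * (bump r / r)) + r ^ k * bump' r) * indicator {1..2} r)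
    = real k * (LINT r|lborel. indicator {1..2} r *\<^sub>R (r ^ k * (bump r / r)))
      + (LINT r|lborel. indicator {1..2} r *\<^sub>R (r ^ k * bump' r))"
  proof -
    have "(LINT r|lborel. (real k * (r ^ k * (bump r / r)) + r ^ k * bump' r) * indicator {1..2} r)
      = (LINT r|lborel. real k * (indicator {1..2} r *\<^sub>R (r ^ k * (bump r / r))) + indicator {1..2} r *\<^sub>R (r ^ k * bump' r))"
      by (intro Bochner_Integration.integral_cong) (auto simp: algebra_simps)
    also have "\<dots> = (LINT r|lborel. real k * (indicator {1..2} r *\<^sub>R (r ^ k * (bump r / r)))) + (LINT r|lborel. indicator {1..2} r *\<^sub>R (r ^ k * bump' r))"
      by (rule Bochner_Integration.integral_add[OF integrable_mult_right[OF i1] i2])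
    finally show ?thesis by (simp only: Bochner_Integration.integral_mult_right_zero)
  qed
  finally show "(LINT r|radial_measure k. bump' r) = - real k * (LINT r|radial_measure k. bump r / r)"
    unfolding L1 L2 by linarith
  show "(LINT r|radial_measure k. bump r / r) > 0"
  proof (rule ccontr)
    assume neg: "\<not> ?thesis"
    have nnf: "indicator {1..2} r *\<^sub>R (r ^ k * (bump r / r)) \<ge> 0" for r
      by (auto split: split_indicator simp: bump_def)
    have "(LINT r|lborel. indicator {1..2} r *\<^sub>R (r ^ k * (bump r / r))) \<ge> 0"
      by (rule Bochner_Integration.integral_nonneg) (rule nnf)
    then have "(LINT r|lborel. indicator {1..2} r *\<^sub>R (r ^ k * (bump r / r))) = 0"
      using neg unfolding L1 by linarith
    then have "AE r in lborel. indicator {1..2} r *\<^sub>R (r ^ k * (bump r / r)) = 0"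
      using i1 nnf by (subst (asm) integral_nonneg_eq_0_iff_AE) auto
    then have "AE r in lborel. r \<notin> {1<..<2::real}"
    proof eventually_elim
      case (elim r)
      show ?case
      proof
        assume "r \<in> {1<..<2}"
        with elim bump_pos[of r] show False by auto
      qed
    qed
    then have "emeasure lborel {1<..<2::real} = 0"
      by (subst (asm) AE_iff_measurable[of "{1<..<2}"]) auto
    then show False by simp
  qed
qed

text \<open>The function \<open>bump (norm y) * hom_ext u y\<close> has compact support, so its
  derivative along \<open>e\<close> integrates to zero. In polar coordinates the radial integrals
  factor out as multiples of one positive moment, and dividing by it leaves an identity on the
  sphere.\<close>

lemma spherical_integration_by_parts:
  fixes u :: "real^'n \<Rightarrow> real"
  assumes u: "sgrad u \<Gamma>"
  shows "(LINT x|sphere_measure. \<Gamma> x \<bullet> e) = (real CARD('n) - 1) * (LINT x|sphere_measure. (x \<bullet> e) * u x)"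
proof -
  let ?k = "CARD('n) - 1"
  define f where "f y = bump (norm y) * hom_ext u y" for y
  define D where "D y = bump' (norm y) * ((y \<bullet> e) / norm y) * u (y /\<^sub>R norm y)
      + bump (norm y) * ((\<Gamma> (y /\<^sub>R norm y) \<bullet> e) / norm y)" for y
  have cu: "continuous_on (sphere 0 1) u" by (rule sgrad_continuous[OF u])
  have cG: "continuous_on (sphere 0 1) \<Gamma>" using u by (simp add: sgrad_def)
  have cdir: "continuous_on (UNIV - {0}) (\<lambda>y::real^'n. y /\<^sub>R norm y)" by (auto intro!: continuous_intros)
  have cu': "continuous_on (UNIV - {0}) (\<lambda>y. u (y /\<^sub>R norm y))"
    by (rule continuous_on_compose2[OF cu cdir]) (auto simp: field_simps split: if_splits)
  have cG': "continuous_on (UNIV - {0}) (\<lambda>y. \<Gamma> (y /\<^sub>R norm y))"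
    by (rule continuous_on_compose2[OF cG cdir]) (auto simp: field_simps split: if_splits)
  have cf0: "continuous_on (UNIV - {0}) f" unfolding f_def hom_ext_def
    using cu' by (auto intro!: continuous_intros)
  have cD0: "continuous_on (UNIV - {0}) D" unfolding D_def
    using cu' cG' by (auto intro!: continuous_intros)
  have cball0: "continuous_on (ball 0 1) f" "continuous_on (ball 0 1) D"
  proof -
    have z: "f y = 0" "D y = 0" if "y \<in> ball 0 1" for y
      using that bump_outside[of "norm y"] by (simp_all add: f_def D_def)
    show "continuous_on (ball 0 1) f"
      by (rule continuous_on_eq[OF continuous_on_const[of _ 0]]) (simp add: z)
    show "continuous_on (ball 0 1) D"
      by (rule continuous_on_eq[OF continuous_on_const[of _ 0]]) (simp add: z)
  qed
  have un: "(UNIV - {0}) \<union> ball (0::real^'n) 1 = UNIV" by auto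
  have cf: "continuous_on UNIV f"
    using continuous_on_open_Un[OF _ _ cf0 cball0(1)] un by (simp add: open_Diff)
  have cD: "continuous_on UNIV D"
    using continuous_on_open_Un[OF _ _ cD0 cball0(2)] un by (simp add: open_Diff)
  have supp: "f y = 0" "D y = 0" if "norm y > 2" for y
    using that bump_outside[of "norm y"] by (auto simp: f_def D_def)
  obtain C where C: "\<forall>y\<in>cball 0 2. \<bar>D y\<bar> \<le> C"
  proof -
    have "compact (D ` cball 0 2)"
      by (intro compact_continuous_image continuous_on_subset[OF cD]) auto
    then show ?thesis using that compact_imp_bounded[of "D ` cball 0 2"] unfolding bounded_iff by auto
  qed
  have C0: "0 \<le> C" using C[rule_format, of 0] abs_ge_zero[of "D 0"] by force
  have bd: "\<bar>D y\<bar> \<le> C" for y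
    using C supp(2)[of y] C0 by (cases "norm y \<le> 2") auto
  \<comment> \<open>At the origin \<open>hom_ext u\<close> has no derivative, but there the cutoff
    vanishes in a whole neighbourhood.\<close>
  have d: "((\<lambda>t. f (y + t *\<^sub>R e)) has_real_derivative D y) (at 0)" for y
  proof (cases "y = 0")
    case True
    have D0: "D 0 = 0" using bump_outside[of 0] by (simp add: D_def)
    have ev: "eventually (\<lambda>t::real. norm (t *\<^sub>R e) < 1) (nhds 0)"
    proof -
      have "isCont (\<lambda>t::real. norm (t *\<^sub>R e)) 0" by (intro continuous_intros)
      then have "((\<lambda>t::real. norm (t *\<^sub>R e)) \<longlongrightarrow> norm (0 *\<^sub>R e)) (nhds 0)"
        by (simp add: isCont_def tendsto_nhds_iff)
      then show ?thesis by (rule order_tendstoD(2)) simp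
    qed
    have "((\<lambda>t::real. 0::real) has_real_derivative 0) (at 0)" by simp
    then have "((\<lambda>t. f (0 + t *\<^sub>R e)) has_real_derivative 0) (at 0)"
    proof (rule DERIV_cong_ev[THEN iffD1, OF refl _ refl, rotated])
      show "eventually (\<lambda>t. 0 = f (0 + t *\<^sub>R e)) (nhds 0)"
        using ev by eventually_elim (use bump_outside in \<open>auto simp: f_def\<close>)
    qed
    then show ?thesis using True D0 by simp
  next
    case False
    have dn: "(norm has_derivative (\<lambda>h. h \<bullet> sgn y)) (at y)"
      using has_derivative_norm[OF False] by simp
    have db: "(bump has_derivative (\<lambda>h. bump' (norm y) * h)) (at (norm y))"
      using bump_derivative by (simp add: has_field_derivative_def)
    have "(f has_derivative (\<lambda>h. bump (norm y) * ((\<Gamma> (y /\<^sub>R norm y) \<bullet> h) / norm y)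
        + bump' (norm y) * (h \<bullet> sgn y) * hom_ext u y)) (at y)"
      unfolding f_def by (rule has_derivative_mult[OF has_derivative_compose[OF dn db] sgrad_at[OF u False]])
    then have F: "(f has_derivative (\<lambda>h. bump (norm y) * ((\<Gamma> (y /\<^sub>R norm y) \<bullet> h) / norm y)
        + bump' (norm y) * (h \<bullet> sgn y) * hom_ext u y)) (at (y + (0::real) *\<^sub>R e))" by simp
    have "((\<lambda>t::real. y + t *\<^sub>R e) has_derivative (\<lambda>t. t *\<^sub>R e)) (at 0)"
      by (auto intro!: derivative_eq_intros)
    from has_derivative_compose[OF this F] show ?thesis
      unfolding has_field_derivative_def
      by (rule has_derivative_eq_rhs)
        (simp add: fun_eq_iff D_def hom_ext_def sgn_div_norm inner_commute algebra_simps divide_inverse)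
  qed
  have Dm: "D \<in> borel_measurable borel" using cD by (rule borel_measurable_continuous_onI)
  note I = integral_directional_derivative_zero[OF d cf bd supp(1) Dm]
  define A where "A = (LINT r|radial_measure ?k. bump r / r)"
  have A: "A > 0" unfolding A_def by (rule bump_moments(2))
  have "0 = (LINT x|sphere_measure. (LINT r|radial_measure ?k. D (r *\<^sub>R x)))"
    using polar_integral[OF I(2)] I(1) by simp
  also have "\<dots> = (LINT x|sphere_measure. (\<Gamma> x \<bullet> e) * A - (real CARD('n) - 1) * A * ((x \<bullet> e) * u x))"
  proof (rule Bochner_Integration.integral_cong[OF refl])
    fix x :: "real^'n" assume "x \<in> space sphere_measure"
    then have x: "norm x = 1" by simp
    have e: "D (r *\<^sub>R x) = ((x \<bullet> e) * u x) * bump' r + (\<Gamma> x \<bullet> e) * (bump r / r)" if "r > 0" for r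
      using x that by (simp add: D_def)
    have "AE r in radial_measure ?k. r > 0"
      unfolding radial_measure_def by (subst AE_density) (auto split: split_indicator)
    then have "AE r in radial_measure ?k. D (r *\<^sub>R x) = ((x \<bullet> e) * u x) * bump' r + (\<Gamma> x \<bullet> e) * (bump r / r)"
      by eventually_elim (rule e)
    moreover have "(\<lambda>r. D (r *\<^sub>R x)) \<in> borel_measurable (radial_measure ?k)"
      by (rule measurable_compose[OF _ Dm]) simp
    moreover have "(\<lambda>r. ((x \<bullet> e) * u x) * bump' r + (\<Gamma> x \<bullet> e) * (bump r / r)) \<in> borel_measurable (radial_measure ?k)"
      by (intro borel_measurable_add borel_measurable_times borel_measurable_const
          borel_measurable_integrable[OF bump_moments(3)] borel_measurable_integrable[OF bump_moments(4)])
    ultimately have "(LINT r|radial_measure ?k. D (r *\<^sub>R x))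
       = (LINT r|radial_measure ?k. ((x \<bullet> e) * u x) * bump' r + (\<Gamma> x \<bullet> e) * (bump r / r))"
      by (intro integral_cong_AE)
    also have "\<dots> = ((x \<bullet> e) * u x) * (LINT r|radial_measure ?k. bump' r) + (\<Gamma> x \<bullet> e) * A"
      unfolding A_def
      by (subst Bochner_Integration.integral_add[OF integrable_mult_right[OF bump_moments(4)] integrable_mult_right[OF bump_moments(3)]])
        (simp only: Bochner_Integration.integral_mult_right_zero)
    also have "\<dots> = (\<Gamma> x \<bullet> e) * A - (real CARD('n) - 1) * A * ((x \<bullet> e) * u x)"
      unfolding bump_moments(1)[of ?k] A_def by (simp add: of_nat_diff Suc_leI algebra_simps)
    finally show "(LINT r|radial_measure ?k. D (r *\<^sub>R x)) = (\<Gamma> x \<bullet> e) * A - (real CARD('n) - 1) * A * ((x \<bullet> e) * u x)" .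
  qed
  also have "\<dots> = (LINT x|sphere_measure. \<Gamma> x \<bullet> e) * A - (real CARD('n) - 1) * A * (LINT x|sphere_measure. (x \<bullet> e) * u x)"
  proof -
    have "integrable sphere_measure (\<lambda>x. \<Gamma> x \<bullet> e)" "integrable sphere_measure (\<lambda>x. (x \<bullet> e) * u x)"
      using cu cG by (auto intro!: integrable_sphere_measure continuous_intros)
    then show ?thesis by simp
  qed
  finally have "A * ((LINT x|sphere_measure. \<Gamma> x \<bullet> e) - (real CARD('n) - 1) * (LINT x|sphere_measure. (x \<bullet> e) * u x)) = 0"
    by (simp add: algebra_simps)
  then show ?thesis using A by simp
qed

text \<open>The trace of \<open>L\<close>. When \<open>L\<close> is the derivative of the
  0-homogeneous extension of a tangent field, the radial direction contributes nothing and this is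
  the divergence on the sphere.\<close>

definition div_at :: "(real^'n \<Rightarrow> real^'n) \<Rightarrow> real" where
  "div_at L = (\<Sum>i\<in>UNIV. L (axis i 1) $ i)"

lemma linear_axis_sum:
  fixes L :: "real^'n \<Rightarrow> 'b::real_vector"
  assumes "linear L"
  shows "L z = (\<Sum>j\<in>UNIV. z $ j *\<^sub>R L (axis j 1))"
proof -
  have "L z = L (\<Sum>j\<in>UNIV. z $ j *\<^sub>R axis j 1)" by (simp add: basis_expansion scalar_mult_eq_scaleR[symmetric])
  then show ?thesis using assms by (simp add: linear_sum linear_cmul o_def)
qed

text \<open>Each component of \<open>V\<close> is integrated by parts along its own coordinate axis,
  and the results are summed. For tangent fields the right-hand side vanishes.\<close>

lemma divergence_theorem_sphere:
  fixes V :: "real^'n \<Rightarrow> real^'n"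
  assumes d: "\<And>x. x \<in> sphere 0 1 \<Longrightarrow> (hom_ext V has_derivative DV x) (at x)"
    and c: "\<And>v. continuous_on (sphere 0 1) (\<lambda>x. DV x v)"
  shows "(LINT x|sphere_measure. div_at (DV x)) = (real CARD('n) - 1) * (LINT x|sphere_measure. V x \<bullet> x)"
proof -
  have cV: "continuous_on (sphere 0 1) V" using d by (rule continuous_on_sphere_hom_ext)
  define \<Gamma> where "\<Gamma> i x = (\<chi> j. DV x (axis j 1) $ i)" for i x
  have sg: "sgrad (\<lambda>x. V x $ i) (\<Gamma> i)" for i
    unfolding sgrad_def
  proof (intro conjI ballI)
    show "continuous_on (sphere 0 1) (\<Gamma> i)"
      unfolding \<Gamma>_def using c by (auto intro!: continuous_intros)
    fix x :: "real^'n" assume x: "x \<in> sphere 0 1"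
    have "((\<lambda>y. hom_ext V y $ i) has_derivative (\<lambda>v. DV x v $ i)) (at x)"
      by (rule bounded_linear.has_derivative[OF bounded_linear_vec_nth d[OF x]])
    moreover have "DV x v $ i = \<Gamma> i x \<bullet> v" for v
    proof -
      have lin: "linear (DV x)" using d[OF x] has_derivative_linear by blast
      show ?thesis unfolding linear_axis_sum[OF lin, of v] by (simp add: \<Gamma>_def inner_vec_def mult.commute)
    qed
    ultimately show "(hom_ext (\<lambda>x. V x $ i) has_derivative (\<lambda>v. \<Gamma> i x \<bullet> v)) (at x)"
      by (simp add: hom_ext_def[abs_def])
  qed
  have e: "\<Gamma> i x \<bullet> axis i 1 = DV x (axis i 1) $ i" for i x by (simp add: \<Gamma>_def inner_axis)
  have int: "integrable sphere_measure (\<lambda>x. DV x (axis i 1) $ i)" for i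
    using c by (auto intro!: integrable_sphere_measure continuous_intros)
  have int2: "integrable sphere_measure (\<lambda>x. x $ i * V x $ i)" for i
    using cV by (auto intro!: integrable_sphere_measure continuous_intros)
  have "(LINT x|sphere_measure. div_at (DV x)) = (\<Sum>i\<in>UNIV. LINT x|sphere_measure. DV x (axis i 1) $ i)"
    unfolding div_at_def using int by simp
  also have "\<dots> = (\<Sum>i\<in>UNIV. (real CARD('n) - 1) * (LINT x|sphere_measure. (x \<bullet> axis i 1) * V x $ i))"
    using spherical_integration_by_parts[OF sg] by (simp flip: e)
  also have "\<dots> = (real CARD('n) - 1) * (LINT x|sphere_measure. V x \<bullet> x)"
  proof -
    have ax: "x \<bullet> axis i 1 = x $ i" for x :: "real^'n" and i by (simp add: inner_axis)
    have "(LINT x|sphere_measure. V x \<bullet> x) = (\<Sum>i\<in>UNIV. LINT x|sphere_measure. x $ i * V x $ i)"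
      using int2 by (simp add: inner_vec_def mult.commute)
    then show ?thesis by (simp add: ax sum_distrib_left)
  qed
  finally show ?thesis .
qed

subsection \<open>Spherical polynomials and the Poincare inequality\<close>

definition svec :: "(real^'n \<Rightarrow> real^'n) \<Rightarrow> (real^'n \<Rightarrow> real^'n \<Rightarrow> real^'n) \<Rightarrow> bool" where
  "svec V DV \<longleftrightarrow> (\<forall>x\<in>sphere 0 1. (hom_ext V has_derivative DV x) (at x))
      \<and> (\<forall>v. continuous_on (sphere 0 1) (\<lambda>x. DV x v))"

lemma svec_continuous: "svec V DV \<Longrightarrow> continuous_on (sphere 0 1) V"
  unfolding svec_def by (intro continuous_on_sphere_hom_ext) blast

lemma svec_scale: "svec V DV \<Longrightarrow> svec (\<lambda>x. c *\<^sub>R V x) (\<lambda>x v. c *\<^sub>R DV x v)"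
  unfolding svec_def hom_ext_def by (auto intro!: derivative_intros continuous_intros)

lemma svec_add: "svec V DV \<Longrightarrow> svec W DW \<Longrightarrow> svec (\<lambda>x. V x + W x) (\<lambda>x v. DV x v + DW x v)"
  unfolding svec_def hom_ext_def by (auto intro!: derivative_intros continuous_intros)

lemma sgrad_scale: "sgrad u \<Gamma> \<Longrightarrow> sgrad (\<lambda>x. c * u x) (\<lambda>x. c *\<^sub>R \<Gamma> x)"
  unfolding sgrad_def hom_ext_def inner_scaleR_left by (auto intro!: continuous_intros has_derivative_mult_right)

lemma sgrad_add: "sgrad u \<Gamma> \<Longrightarrow> sgrad w \<Delta> \<Longrightarrow> sgrad (\<lambda>x. u x + w x) (\<lambda>x. \<Gamma> x + \<Delta> x)"
  unfolding sgrad_def hom_ext_def inner_add_left by (auto intro!: continuous_intros has_derivative_add)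

lemma has_derivative_direction:
  assumes "norm (x::real^'n) = 1"
  shows "((\<lambda>y. y /\<^sub>R norm y) has_derivative tproj x) (at x)"
proof -
  have x0: "x \<noteq> 0" using assms by auto
  have "((\<lambda>y. y /\<^sub>R norm y) has_derivative
     (\<lambda>v. inverse (norm x) *\<^sub>R v + (- (inverse (norm x) * (v \<bullet> sgn x) * inverse (norm x))) *\<^sub>R x)) (at x)"
    by (rule has_derivative_scaleR[OF Deriv.has_derivative_inverse[OF _ has_derivative_norm[OF x0]] has_derivative_ident])
       (use x0 in auto)
  then show ?thesis
    by (rule has_derivative_eq_rhs) (use assms in \<open>auto simp: fun_eq_iff tproj_def sgn_div_norm\<close>)
qed

lemma has_derivative_hom_ext:
  assumes "(W has_derivative W') (at x)" "norm (x::real^'n) = 1"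
  shows "(hom_ext W has_derivative (\<lambda>v. W' (tproj x v))) (at x)"
proof -
  have "(W has_derivative W') (at (x /\<^sub>R norm x))" using assms by simp
  from has_derivative_compose[OF has_derivative_direction[OF assms(2)] this]
  show ?thesis by (simp add: hom_ext_def[abs_def])
qed

text \<open>\<open>l\<close> is minus the Laplacian of \<open>f\<close> on the sphere, characterized
  weakly against functions that possess a continuous gradient.\<close>

definition green :: "(real^'n \<Rightarrow> real) \<Rightarrow> (real^'n \<Rightarrow> real^'n) \<Rightarrow> (real^'n \<Rightarrow> real) \<Rightarrow> bool" where
  "green f \<Gamma>f l \<longleftrightarrow> sgrad f \<Gamma>f \<and> continuous_on (sphere 0 1) l \<and>
     (\<forall>u \<Gamma>. sgrad u \<Gamma> \<longrightarrow> (LINT x|sphere_measure. \<Gamma> x \<bullet> \<Gamma>f x) = (LINT x|sphere_measure. u x * l x))"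

lemma green_scale: "green f \<Gamma> l \<Longrightarrow> green (\<lambda>x. c * f x) (\<lambda>x. c *\<^sub>R \<Gamma> x) (\<lambda>x. c * l x)"
  unfolding green_def by (auto intro!: sgrad_scale continuous_intros simp: mult.left_commute)

lemma green_add:
  fixes f g :: "real^'n \<Rightarrow> real"
  assumes "green f \<Gamma> l" "green g \<Delta> m"
  shows "green (\<lambda>x. f x + g x) (\<lambda>x. \<Gamma> x + \<Delta> x) (\<lambda>x. l x + m x)"
  unfolding green_def
proof (intro conjI allI impI)
  show "sgrad (\<lambda>x. f x + g x) (\<lambda>x. \<Gamma> x + \<Delta> x)" using assms by (auto simp: green_def intro!: sgrad_add)
  show "continuous_on (sphere 0 1) (\<lambda>x. l x + m x)" using assms by (auto simp: green_def intro!: continuous_intros)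
  fix u :: "real^'n \<Rightarrow> real" and \<Gamma>u assume u: "sgrad u \<Gamma>u"
  have c: "continuous_on (sphere 0 1) \<Gamma>u" "continuous_on (sphere 0 1) u" "continuous_on (sphere 0 1) \<Gamma>"
    "continuous_on (sphere 0 1) \<Delta>" "continuous_on (sphere 0 1) l" "continuous_on (sphere 0 1) m"
    using u assms sgrad_continuous[OF u] by (auto simp: green_def sgrad_def)
  have i: "integrable sphere_measure (\<lambda>x. \<Gamma>u x \<bullet> \<Gamma> x)" "integrable sphere_measure (\<lambda>x. \<Gamma>u x \<bullet> \<Delta> x)"
    "integrable sphere_measure (\<lambda>x. u x * l x)" "integrable sphere_measure (\<lambda>x. u x * m x)"
    using c by (auto intro!: integrable_sphere_measure continuous_intros)
  show "(LINT x|sphere_measure. \<Gamma>u x \<bullet> (\<Gamma> x + \<Delta> x)) = (LINT x|sphere_measure. u x * (l x + m x))"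
    using assms u i by (simp add: inner_add_right distrib_left green_def)
qed

lemma green_zero: "green (\<lambda>x::real^'n. 0) (\<lambda>x. 0) (\<lambda>x. 0)"
proof -
  have "hom_ext (\<lambda>x::real^'n. 0::real) = (\<lambda>y. 0)" by (simp add: hom_ext_def[abs_def])
  then show ?thesis by (simp add: green_def sgrad_def)
qed

lemma green_sum:
  assumes "finite I" "\<And>i. i \<in> I \<Longrightarrow> green (f i) (\<Gamma> i) (l i)"
  shows "green (\<lambda>x. \<Sum>i\<in>I. f i x) (\<lambda>x. \<Sum>i\<in>I. \<Gamma> i x) (\<lambda>x. \<Sum>i\<in>I. l i x)"
  using assms by (induction rule: finite_induct) (auto intro!: green_add simp: green_zero)

text \<open>Polynomials of degree at most \<open>d\<close>, generated by powers of linear forms. By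
  polarization these powers span all polynomials, and on them gradient and Laplacian are
  explicit.\<close>

inductive pd :: "nat \<Rightarrow> (real^'n \<Rightarrow> real) \<Rightarrow> bool" where
  pd_pow: "k \<le> d \<Longrightarrow> pd d (\<lambda>x. c * (a \<bullet> x) ^ k)"
| pd_add: "pd d f \<Longrightarrow> pd d g \<Longrightarrow> pd d (\<lambda>x. f x + g x)"

lemma pd_mono: "pd d f \<Longrightarrow> d \<le> d' \<Longrightarrow> pd d' f"
  by (induction rule: pd.induct) (auto intro: pd.intros)

lemma pd_const: "pd d (\<lambda>x. c)"
  using pd_pow[of 0 d c 0] by simp

lemma pd_scale: "pd d f \<Longrightarrow> pd d (\<lambda>x. c * f x)"
proof (induction rule: pd.induct)
  case (pd_pow k d c' a)
  then show ?case using pd.pd_pow[of k d "c * c'" a] by (simp add: mult.assoc)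
next
  case (pd_add d f g)
  then show ?case using pd.pd_add[OF pd_add.IH] by (simp add: distrib_left)
qed

lemma pd_diff: "pd d f \<Longrightarrow> pd d g \<Longrightarrow> pd d (\<lambda>x. f x - g x)"
  using pd_add[OF _ pd_scale[of d g "-1"], of f] by simp

lemma pd_sum: "finite I \<Longrightarrow> (\<And>i. i \<in> I \<Longrightarrow> pd d (f i)) \<Longrightarrow> pd d (\<lambda>x. \<Sum>i\<in>I. f i x)"
  by (induction rule: finite_induct) (auto intro: pd_add pd_const)

lemma pd_continuous: "pd d f \<Longrightarrow> continuous_on A f"
  by (induction rule: pd.induct) (auto intro!: continuous_intros)

text \<open>With \<open>CARD('n) = n + 1\<close> this is \<open>k * (k + n - 1)\<close>, the
  eigenvalue of minus the Laplacian on spherical harmonics of degree \<open>k\<close>.\<close>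

definition lam :: "'n::finite itself \<Rightarrow> nat \<Rightarrow> real" where
  "lam _ k = real k * (real k + real CARD('n) - 2)"

lemma div_at_rank_one: "div_at (\<lambda>v. (b \<bullet> v) *\<^sub>R w) = b \<bullet> w"
  by (simp add: div_at_def inner_vec_def[of b w] inner_axis)

lemma div_at_tproj: "norm x = 1 \<Longrightarrow> div_at (tproj (x::real^'n)) = real CARD('n) - 1"
proof -
  assume x: "norm x = 1"
  have "div_at (tproj x) = (\<Sum>i\<in>UNIV. 1 - x $ i * x $ i)"
    by (simp add: div_at_def tproj_def inner_axis inner_axis')
  also have "\<dots> = real CARD('n) - x \<bullet> x" by (simp add: sum_subtractf inner_vec_def)
  finally show ?thesis using x by (simp add: dot_square_norm)
qed

lemma div_at_add: "div_at (\<lambda>v. L v + M v) = div_at L + div_at M"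
  by (simp add: div_at_def sum.distrib)
lemma div_at_diff: "div_at (\<lambda>v. L v - M v) = div_at L - div_at M"
  by (simp add: div_at_def sum_subtractf)
lemma div_at_scale: "div_at (\<lambda>v. c *\<^sub>R L v) = c * div_at L"
  by (simp add: div_at_def sum_distrib_left)

text \<open>On the sphere, minus the Laplacian of a homogeneous polynomial of degree
  \<open>k\<close> is \<open>lam k\<close> times the polynomial minus its Euclidean Laplacian. The
  weak form follows from the divergence theorem for \<open>u\<close> times the tangential
  gradient.\<close>

lemma green_power:
  fixes a :: "real^'n" and c :: real and k :: nat
  defines "\<Gamma>f \<equiv> (\<lambda>x. (c * real k * (a \<bullet> x) ^ (k - 1)) *\<^sub>R tproj x a)"
  shows "green (\<lambda>x. c * (a \<bullet> x) ^ k) \<Gamma>f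
     (\<lambda>x. lam TYPE('n) k * (c * (a \<bullet> x) ^ k) - c * real k * real (k - 1) * (a \<bullet> a) * (a \<bullet> x) ^ (k - 2))"
   and "\<exists>D. svec \<Gamma>f D"
proof -
  let ?t = "\<lambda>x. tproj x a"
  define D where "D x v = (c * real k * real (k - 1) * (a \<bullet> x) ^ (k - 2) * (?t x \<bullet> v)) *\<^sub>R ?t x
     - (c * real k * (a \<bullet> x) ^ (k - 1)) *\<^sub>R ((?t x \<bullet> v) *\<^sub>R x + (a \<bullet> x) *\<^sub>R tproj x v)" for x v
  have tsym: "a \<bullet> tproj x v = ?t x \<bullet> v" for x v
    by (simp add: tproj_def inner_diff_left inner_diff_right inner_commute)
  have ct: "continuous_on A ?t" for A unfolding tproj_def by (intro continuous_intros)
  have ct2: "continuous_on A (\<lambda>x. tproj x v)" for A and v :: "real^'n" unfolding tproj_def by (intro continuous_intros)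
  have sf: "sgrad (\<lambda>x. c * (a \<bullet> x) ^ k) \<Gamma>f"
    unfolding sgrad_def
  proof (intro conjI ballI)
    show "continuous_on (sphere 0 1) \<Gamma>f" unfolding \<Gamma>f_def by (intro continuous_intros ct)
    fix x :: "real^'n" assume "x \<in> sphere 0 1"
    then have x: "norm x = 1" by simp
    have "((\<lambda>x. c * (a \<bullet> x) ^ k) has_derivative (\<lambda>v. c * (real k * (a \<bullet> v) * (a \<bullet> x) ^ (k - 1)))) (at x)"
      by (auto intro!: derivative_eq_intros)
    from has_derivative_hom_ext[OF this x] show "(hom_ext (\<lambda>x. c * (a \<bullet> x) ^ k) has_derivative (\<bullet>) (\<Gamma>f x)) (at x)"
      by (rule has_derivative_eq_rhs) (simp add: fun_eq_iff \<Gamma>f_def tsym mult_ac)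
  qed
  have sv: "svec \<Gamma>f D"
    unfolding svec_def
  proof (intro conjI ballI allI)
    show "continuous_on (sphere 0 1) (\<lambda>x. D x v)" for v
      unfolding D_def by (intro continuous_intros ct ct2)
    fix x :: "real^'n" assume "x \<in> sphere 0 1"
    then have x: "norm x = 1" by simp
    have t1: "tproj x v \<bullet> a = ?t x \<bullet> v" for v using tsym[of x v] by (simp add: inner_commute)
    have "(\<Gamma>f has_derivative (\<lambda>v. (c * real k * (a \<bullet> x) ^ (k - 1)) *\<^sub>R (- ((a \<bullet> v) *\<^sub>R x + (a \<bullet> x) *\<^sub>R v))
        + (c * real k * (real (k - 1) * (a \<bullet> v) * (a \<bullet> x) ^ (k - 1 - 1))) *\<^sub>R ?t x)) (at x)"
      unfolding \<Gamma>f_def tproj_def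
      by (auto intro!: derivative_eq_intros simp: fun_eq_iff algebra_simps)
    from has_derivative_hom_ext[OF this x] show "(hom_ext \<Gamma>f has_derivative D x) (at x)"
      by (rule has_derivative_eq_rhs) (simp add: fun_eq_iff D_def tsym algebra_simps numeral_2_eq_2)
  qed
  then show "\<exists>D. svec \<Gamma>f D" by blast
  let ?l = "\<lambda>x. lam TYPE('n) k * (c * (a \<bullet> x) ^ k) - c * real k * real (k - 1) * (a \<bullet> a) * (a \<bullet> x) ^ (k - 2)"
  have divD: "div_at (D x) = - ?l x" if x: "norm x = 1" for x
  proof -
    have tx: "?t x \<bullet> x = 0" using x by (simp add: tproj_def inner_diff_left dot_square_norm)
    have tt: "?t x \<bullet> ?t x = a \<bullet> a - (a \<bullet> x)\<^sup>2"
    proof -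
      have "x \<bullet> x = 1" using x by (simp add: dot_square_norm)
      then show ?thesis by (simp add: tproj_def inner_diff_left inner_diff_right inner_commute power2_eq_square)
    qed
    have "D x = (\<lambda>v. (c * real k * real (k - 1) * (a \<bullet> x) ^ (k - 2)) *\<^sub>R ((?t x \<bullet> v) *\<^sub>R ?t x)
     - (c * real k * (a \<bullet> x) ^ (k - 1)) *\<^sub>R ((?t x \<bullet> v) *\<^sub>R x + (a \<bullet> x) *\<^sub>R tproj x v))"
      by (simp add: fun_eq_iff D_def)
    then have "div_at (D x) = (c * real k * real (k - 1) * (a \<bullet> x) ^ (k - 2)) * (a \<bullet> a - (a \<bullet> x)\<^sup>2)
        - (c * real k * (a \<bullet> x) ^ (k - 1)) * ((a \<bullet> x) * (real CARD('n) - 1))"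
      by (simp only: div_at_diff div_at_scale div_at_add div_at_rank_one div_at_tproj[OF x] tx tt add_0_left)
    also have "\<dots> = - ?l x"
    proof -
      \<comment> \<open>The subtractions \<open>k - 1\<close> and \<open>k - 2\<close> are
        truncated; for small \<open>k\<close> the coefficients in front of the affected powers are
        zero.\<close>
      consider "k = 0" | "k = 1" | m where "k = Suc (Suc m)" by (metis One_nat_def not0_implies_Suc)
      then show ?thesis
        by cases (auto simp: lam_def algebra_simps power2_eq_square)
    qed
    finally show ?thesis .
  qed
  show "green (\<lambda>x. c * (a \<bullet> x) ^ k) \<Gamma>f ?l"
    unfolding green_def
  proof (intro conjI allI impI sf)
    show cl: "continuous_on (sphere 0 1) ?l" by (intro continuous_intros)
    fix u :: "real^'n \<Rightarrow> real" and \<Gamma> assume u: "sgrad u \<Gamma>"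
    have cu: "continuous_on (sphere 0 1) u" "continuous_on (sphere 0 1) \<Gamma>"
      using sgrad_continuous[OF u] u by (auto simp: sgrad_def)
    have cg: "continuous_on (sphere 0 1) \<Gamma>f" by (rule svec_continuous[OF sv])
    \<comment> \<open>The derivative of the tangent field \<open>u x *\<^sub>R \<Gamma>f x\<close>,
      whose divergence integrates to zero.\<close>
    define DV where "DV x v = u x *\<^sub>R D x v + (\<Gamma> x \<bullet> v) *\<^sub>R \<Gamma>f x" for x v
    have "(LINT x|sphere_measure. div_at (DV x)) = (real CARD('n) - 1) * (LINT x|sphere_measure. (u x *\<^sub>R \<Gamma>f x) \<bullet> x)"
    proof (rule divergence_theorem_sphere)
      show "continuous_on (sphere 0 1) (\<lambda>x. DV x v)" for v
        unfolding DV_def using sv cu cg by (auto intro!: continuous_intros simp: svec_def)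
      fix x :: "real^'n" assume x: "x \<in> sphere 0 1"
      then have nx: "norm x = 1" by simp
      have "((\<lambda>y. hom_ext u y *\<^sub>R hom_ext \<Gamma>f y) has_derivative (\<lambda>v. hom_ext u x *\<^sub>R D x v + (\<Gamma> x \<bullet> v) *\<^sub>R hom_ext \<Gamma>f x)) (at x)"
        using u sv x by (intro has_derivative_scaleR) (auto simp: sgrad_def svec_def)
      then show "(hom_ext (\<lambda>x. u x *\<^sub>R \<Gamma>f x) has_derivative DV x) (at x)"
        using nx by (simp add: hom_ext_def[abs_def] DV_def[abs_def])
    qed
    also have "(LINT x|sphere_measure. (u x *\<^sub>R \<Gamma>f x) \<bullet> x) = (LINT x|(sphere_measure :: (real^'n) measure). 0)"
      using sgrad_tangent[OF sf] by (intro Bochner_Integration.integral_cong) auto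
    also have "(LINT x|sphere_measure. div_at (DV x)) = (LINT x|sphere_measure. \<Gamma> x \<bullet> \<Gamma>f x - u x * ?l x)"
      by (intro Bochner_Integration.integral_cong refl)
         (simp add: DV_def[abs_def] div_at_add div_at_scale div_at_rank_one divD algebra_simps)
    also have "\<dots> = (LINT x|sphere_measure. \<Gamma> x \<bullet> \<Gamma>f x) - (LINT x|sphere_measure. u x * ?l x)"
      using cu cg cl by (intro Bochner_Integration.integral_diff integrable_sphere_measure continuous_intros)
    finally show "(LINT x|sphere_measure. \<Gamma> x \<bullet> \<Gamma>f x) = (LINT x|sphere_measure. u x * ?l x)" by simp
  qed
qed

text \<open>Minus the Laplacian, reduced by \<open>lam d\<close>, lowers the degree: on powers of
  exponent \<open>d\<close> the leading parts cancel, and smaller exponents are of lower degree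
  already. For \<open>d = 0\<close> the truncated bound \<open>d - 1\<close> would still admit
  constants, so the vanishing of \<open>g\<close> is recorded separately.\<close>

lemma pd_laplacian:
  fixes f :: "real^'n \<Rightarrow> real"
  assumes "pd d f"
  shows "\<exists>\<Gamma> D g. green f \<Gamma> (\<lambda>x. lam TYPE('n) d * f x + g x) \<and> svec \<Gamma> D
     \<and> pd (d - 1) g \<and> (d = 0 \<longrightarrow> g = (\<lambda>x. 0))"
  using assms
proof (induction rule: pd.induct)
  case (pd_pow k d c a)
  let ?f = "\<lambda>x. c * (a \<bullet> x) ^ k"
  let ?h = "\<lambda>x. (- c * real k * real (k - 1) * (a \<bullet> a)) * (a \<bullet> x) ^ (k - 2)"
  let ?g = "\<lambda>x. (lam TYPE('n) k - lam TYPE('n) d) * (c * (a \<bullet> x) ^ k) + ?h x"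
  obtain D where D: "svec (\<lambda>x. (c * real k * (a \<bullet> x) ^ (k - 1)) *\<^sub>R tproj x a) D"
    using green_power(2) by blast
  have gr: "green ?f (\<lambda>x. (c * real k * (a \<bullet> x) ^ (k - 1)) *\<^sub>R tproj x a) (\<lambda>x. lam TYPE('n) d * ?f x + ?g x)"
    using green_power(1)[of c a k] by (simp add: algebra_simps)
  have "pd (d - 1) ?h"
    using pd_pow by (intro pd.pd_pow) auto
  moreover have "pd (d - 1) (\<lambda>x. (lam TYPE('n) k - lam TYPE('n) d) * (c * (a \<bullet> x) ^ k))"
  proof (cases "k = d")
    case True then show ?thesis using pd_const[of "d - 1" 0] by simp
  next
    case False then show ?thesis using pd_pow by (intro pd_scale pd.pd_pow) auto
  qed
  ultimately have "pd (d - 1) ?g" by (intro pd.pd_add)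
  moreover have "d = 0 \<longrightarrow> ?g = (\<lambda>x. 0)" using pd_pow by auto
  ultimately show ?case using gr D
    by (intro exI[of _ "\<lambda>x. (c * real k * (a \<bullet> x) ^ (k - 1)) *\<^sub>R tproj x a"] exI[of _ D] exI[of _ "?g"] conjI)
next
  case (pd_add d f g)
  obtain \<Gamma> D p where 1: "green f \<Gamma> (\<lambda>x. lam TYPE('n) d * f x + p x)" "svec \<Gamma> D" "pd (d - 1) p" "d = 0 \<longrightarrow> p = (\<lambda>x. 0)"
    using pd_add.IH(1) by (elim exE conjE) (rule that)
  obtain \<Delta> E q where 2: "green g \<Delta> (\<lambda>x. lam TYPE('n) d * g x + q x)" "svec \<Delta> E" "pd (d - 1) q" "d = 0 \<longrightarrow> q = (\<lambda>x. 0)"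
    using pd_add.IH(2) by (elim exE conjE) (rule that)
  have "green (\<lambda>x. f x + g x) (\<lambda>x. \<Gamma> x + \<Delta> x) (\<lambda>x. lam TYPE('n) d * (f x + g x) + (p x + q x))"
    using green_add[OF 1(1) 2(1)] by (simp add: algebra_simps)
  moreover have "svec (\<lambda>x. \<Gamma> x + \<Delta> x) (\<lambda>x v. D x v + E x v)" by (rule svec_add[OF 1(2) 2(2)])
  moreover have "pd (d - 1) (\<lambda>x. p x + q x)" by (rule pd.pd_add[OF 1(3) 2(3)])
  moreover have "d = 0 \<longrightarrow> (\<lambda>x. p x + q x) = (\<lambda>x. 0)" using 1(4) 2(4) by auto
  ultimately show ?case
    by (intro exI[of _ "\<lambda>x. \<Gamma> x + \<Delta> x"] exI[of _ "\<lambda>x v. D x v + E x v"] exI[of _ "\<lambda>x. p x + q x"] conjI)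
qed

lemma lam_strict_mono:
  assumes "CARD('n::finite) \<ge> 2" "j < k"
  shows "lam TYPE('n) j < lam TYPE('n) k"
proof -
  have "real j * (real j + real CARD('n) - 2) \<le> real j * (real k + real CARD('n) - 2)"
    using assms by (intro mult_left_mono) auto
  also have "\<dots> < real k * (real k + real CARD('n) - 2)"
    using assms by (intro mult_strict_right_mono) auto
  finally show ?thesis by (simp add: lam_def)
qed

text \<open>Induction on the degree. The lower-degree remainder \<open>g\<close> of
  \<open>pd_laplacian\<close> splits into eigenfunctions; dividing each by the gap of eigenvalues
  gives the lower components of \<open>f\<close>, and what is left of \<open>f\<close> is an
  eigenfunction for the top eigenvalue.\<close>

lemma pd_eigen_decomposition:
  fixes f :: "real^'n \<Rightarrow> real"
  assumes N: "CARD('n) \<ge> 2" and "pd d f"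
  shows "\<exists>F \<Gamma>. (\<forall>x. f x = (\<Sum>k\<le>d. F k x)) \<and>
     (\<forall>k\<le>d. pd k (F k) \<and> green (F k) (\<Gamma> k) (\<lambda>x. lam TYPE('n) k * F k x))"
  using assms(2)
proof (induction d arbitrary: f)
  case 0
  then obtain \<Gamma> where "green f \<Gamma> (\<lambda>x. lam TYPE('n) 0 * f x)" using pd_laplacian[of 0 f] by fastforce
  then show ?case using 0 by (intro exI[of _ "\<lambda>_. f"] exI[of _ "\<lambda>_. \<Gamma>"]) auto
next
  case (Suc d)
  let ?L = "lam TYPE('n)"
  obtain \<Gamma> g where g: "green f \<Gamma> (\<lambda>x. ?L (Suc d) * f x + g x)" "pd d g"
    using pd_laplacian[OF Suc.prems] by auto
  obtain F \<Delta> where F: "\<And>x. g x = (\<Sum>k\<le>d. F k x)"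
    "\<And>k. k \<le> d \<Longrightarrow> pd k (F k)" "\<And>k. k \<le> d \<Longrightarrow> green (F k) (\<Delta> k) (\<lambda>x. ?L k * F k x)"
    using Suc.IH[OF g(2)] by blast
  \<comment> \<open>Applying minus the Laplacian, reduced by \<open>?L (Suc d)\<close>, to
    \<open>c k * F k x\<close> returns \<open>F k x\<close>. Strict monotonicity of the eigenvalues
    keeps the denominator away from zero.\<close>
  define c where "c k = 1 / (?L k - ?L (Suc d))" for k
  have c: "c k * (?L k - ?L (Suc d)) = 1" if "k \<le> d" for k
    using lam_strict_mono[OF N, of k "Suc d"] that by (simp add: c_def)
  define H where "H k x = (if k \<le> d then c k * F k x else f x - (\<Sum>k\<le>d. c k * F k x))" for k x
  define \<Theta> where "\<Theta> k x = (if k \<le> d then c k *\<^sub>R \<Delta> k x else \<Gamma> x + (-1) *\<^sub>R (\<Sum>k\<le>d. c k *\<^sub>R \<Delta> k x))" for k x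
  have "f x = (\<Sum>k\<le>Suc d. H k x)" for x by (simp add: H_def)
  moreover have "pd k (H k) \<and> green (H k) (\<Theta> k) (\<lambda>x. ?L k * H k x)" if "k \<le> Suc d" for k
  proof (cases "k \<le> d")
    case True
    then have "H k = (\<lambda>x. c k * F k x)" "\<Theta> k = (\<lambda>x. c k *\<^sub>R \<Delta> k x)" by (auto simp: H_def \<Theta>_def)
    then show ?thesis using F(2,3)[OF True] pd_scale[of k "F k" "c k"] green_scale[of "F k" "\<Delta> k" "\<lambda>x. ?L k * F k x" "c k"]
      by (simp add: mult_ac)
  next
    case False
    then have k: "k = Suc d" using that by simp
    have H: "H k = (\<lambda>x. f x - (\<Sum>k\<le>d. c k * F k x))" "\<Theta> k = (\<lambda>x. \<Gamma> x + (-1) *\<^sub>R (\<Sum>k\<le>d. c k *\<^sub>R \<Delta> k x))"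
      using False by (auto simp: H_def \<Theta>_def)
    have "pd (Suc d) (\<lambda>x. \<Sum>k\<le>d. c k * F k x)"
      using F(2) by (intro pd_sum pd_scale) (auto intro: pd_mono[OF F(2)])
    then have "pd k (H k)" unfolding H(1) unfolding k by (intro pd_diff Suc.prems)
    moreover have "green (H k) (\<Theta> k) (\<lambda>x. (?L (Suc d) * f x + g x) + (-1) * (\<Sum>k\<le>d. c k * (?L k * F k x)))"
    proof -
      have "green (\<lambda>x. f x + (-1) * (\<Sum>k\<le>d. c k * F k x)) (\<Theta> k)
        (\<lambda>x. (?L (Suc d) * f x + g x) + (-1) * (\<Sum>k\<le>d. c k * (?L k * F k x)))"
        unfolding H by (intro green_add g(1) green_scale green_sum) (auto intro: F(3))
      then show ?thesis unfolding H by simp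
    qed
    moreover have "(?L (Suc d) * f x + g x) + (-1) * (\<Sum>k\<le>d. c k * (?L k * F k x)) = ?L k * H k x" for x
    proof -
      have "(\<Sum>k\<le>d. c k * (?L k * F k x)) = (\<Sum>k\<le>d. F k x + ?L (Suc d) * (c k * F k x))"
      proof (rule sum.cong[OF refl])
        fix k assume "k \<in> {..d}"
        then have "c k * ?L k = 1 + c k * ?L (Suc d)" using c[of k] by (simp add: algebra_simps)
        then have "c k * ?L k * F k x = (1 + c k * ?L (Suc d)) * F k x" by simp
        then show "c k * (?L k * F k x) = F k x + ?L (Suc d) * (c k * F k x)" by (simp add: algebra_simps)
      qed
      also have "\<dots> = g x + ?L (Suc d) * (\<Sum>k\<le>d. c k * F k x)"
        by (simp add: sum.distrib F(1) sum_distrib_left)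
      finally show ?thesis unfolding H(1) unfolding k by (simp add: algebra_simps)
    qed
    ultimately show ?thesis by simp
  qed
  ultimately show ?case by blast
qed


section \<open>Uniform approximation by polynomials on the sphere\<close>

inductive exp_span :: "(real^'n \<Rightarrow> real) \<Rightarrow> bool" where
  exp_span_exp: "exp_span (\<lambda>x. c * exp (a \<bullet> x))"
| exp_span_add: "exp_span f \<Longrightarrow> exp_span g \<Longrightarrow> exp_span (\<lambda>x. f x + g x)"

lemma exp_span_mult_exp: "exp_span f \<Longrightarrow> exp_span (\<lambda>x. f x * (c * exp (a \<bullet> x)))"
proof (induction rule: exp_span.induct)
  case (exp_span_exp c' a')
  have "exp_span (\<lambda>x. (c' * c) * exp ((a' + a) \<bullet> x))" by (rule exp_span.exp_span_exp)
  then show ?case by (simp add: inner_add_left exp_add mult_ac)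
next
  case (exp_span_add f g)
  from exp_span.exp_span_add[OF exp_span_add.IH] show ?case by (simp add: distrib_right)
qed

text \<open>Products of exponentials of linear forms are again of that kind, so the span is visibly
  an algebra. For sums of powers of linear forms the same closure would need polarization; this is
  why Stone-Weierstrass is applied to exponentials, which are then replaced by Taylor
  polynomials.\<close>

lemma exp_span_mult: "exp_span g \<Longrightarrow> exp_span f \<Longrightarrow> exp_span (\<lambda>x. f x * g x)"
proof (induction rule: exp_span.induct)
  case (exp_span_exp c a) then show ?case by (rule exp_span_mult_exp)
next
  case (exp_span_add g h)
  from exp_span.exp_span_add[OF exp_span_add.IH(1)[OF exp_span_add.prems] exp_span_add.IH(2)[OF exp_span_add.prems]]
  show ?case by (simp add: distrib_left)
qed

lemma exp_uniform_approx:
  assumes "\<eta> > (0::real)" "r \<ge> 0"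
  shows "\<exists>m. \<forall>t. \<bar>t\<bar> \<le> r \<longrightarrow> \<bar>exp t - (\<Sum>i<m. t ^ i / fact i)\<bar> < \<eta>"
proof -
  have "uniform_limit {-r..r} (\<lambda>n x. \<Sum>i<n. x ^ i / fact i) (\<lambda>x. suminf (\<lambda>i. x ^ i / fact i)) sequentially"
  proof (rule Weierstrass_m_test)
    show "norm (x ^ i / fact i) \<le> r ^ i / fact i" if "x \<in> {-r..r}" for i x
      using that by (auto simp: power_abs intro!: divide_right_mono power_mono)
    show "summable (\<lambda>i. r ^ i / fact i)" using summable_exp[of r] by (simp add: divide_inverse mult.commute)
  qed
  from uniform_limitD[OF this assms(1)] obtain m where
    m: "\<forall>x\<in>{-r..r}. dist (\<Sum>i<m. x ^ i / fact i) (suminf (\<lambda>i. x ^ i / fact i)) < \<eta>"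
    by (auto simp: eventually_sequentially)
  have "suminf (\<lambda>i. x ^ i / fact i) = exp x" for x :: real by (simp add: exp_def divide_inverse mult.commute)
  then show ?thesis using m by (intro exI[of _ m]) (auto simp: dist_real_def abs_minus_commute abs_le_iff)
qed

lemma exp_span_approx_pd:
  assumes "exp_span f" "\<eta> > 0"
  shows "\<exists>d p. pd d p \<and> (\<forall>x\<in>sphere 0 1. \<bar>f x - p x\<bar> < \<eta>)"
  using assms
proof (induction arbitrary: \<eta> rule: exp_span.induct)
  case (exp_span_exp c a)
  have "\<eta> / (\<bar>c\<bar> + 1) > 0" using exp_span_exp by simp
  from exp_uniform_approx[OF this norm_ge_zero[of a]] obtain m where
    m: "\<And>t. \<bar>t\<bar> \<le> norm a \<Longrightarrow> \<bar>exp t - (\<Sum>i<m. t ^ i / fact i)\<bar> < \<eta> / (\<bar>c\<bar> + 1)" by blast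
  have "pd m (\<lambda>x. \<Sum>i<m. (c / fact i) * (a \<bullet> x) ^ i)"
    by (intro pd_sum pd_pow) auto
  moreover have "\<bar>c * exp (a \<bullet> x) - (\<Sum>i<m. (c / fact i) * (a \<bullet> x) ^ i)\<bar> < \<eta>" if "x \<in> sphere 0 1" for x
  proof -
    have "\<bar>a \<bullet> x\<bar> \<le> norm a" using Cauchy_Schwarz_ineq2[of a x] that by simp
    from m[OF this] have 1: "\<bar>exp (a \<bullet> x) - (\<Sum>i<m. (a \<bullet> x) ^ i / fact i)\<bar> < \<eta> / (\<bar>c\<bar> + 1)" .
    have "\<bar>c * exp (a \<bullet> x) - (\<Sum>i<m. (c / fact i) * (a \<bullet> x) ^ i)\<bar> = \<bar>c\<bar> * \<bar>exp (a \<bullet> x) - (\<Sum>i<m. (a \<bullet> x) ^ i / fact i)\<bar>"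
      by (simp add: abs_mult[symmetric] right_diff_distrib sum_distrib_left)
    also have "\<dots> \<le> (\<bar>c\<bar> + 1) * \<bar>exp (a \<bullet> x) - (\<Sum>i<m. (a \<bullet> x) ^ i / fact i)\<bar>"
      by (intro mult_right_mono) auto
    also have "\<dots> < (\<bar>c\<bar> + 1) * (\<eta> / (\<bar>c\<bar> + 1))" using 1 by (intro mult_strict_left_mono) auto
    also have "\<dots> = \<eta>" by simp
    finally show ?thesis .
  qed
  ultimately show ?case by blast
next
  case (exp_span_add f g)
  obtain d p where 1: "pd d p" "\<And>x. x \<in> sphere 0 1 \<Longrightarrow> \<bar>f x - p x\<bar> < \<eta> / 2"
    using exp_span_add.IH(1)[of "\<eta> / 2"] exp_span_add.prems by auto
  obtain e q where 2: "pd e q" "\<And>x. x \<in> sphere 0 1 \<Longrightarrow> \<bar>g x - q x\<bar> < \<eta> / 2"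
    using exp_span_add.IH(2)[of "\<eta> / 2"] exp_span_add.prems by auto
  have "pd (max d e) (\<lambda>x. p x + q x)"
    by (intro pd_add pd_mono[OF 1(1)] pd_mono[OF 2(1)]) auto
  moreover have "\<bar>(f x + g x) - (p x + q x)\<bar> < \<eta>" if "x \<in> sphere 0 1" for x
    using 1(2)[OF that] 2(2)[OF that] by linarith
  ultimately show ?case by blast
qed

lemma pd_dense:
  fixes u :: "real^'n \<Rightarrow> real"
  assumes "continuous_on (sphere 0 1) u" "\<eta> > 0"
  shows "\<exists>d p. pd d p \<and> (\<forall>x\<in>sphere 0 1. \<bar>u x - p x\<bar> < \<eta>)"
proof -
  have "\<exists>g. exp_span g \<and> (\<forall>x\<in>sphere 0 1. \<bar>u x - g x\<bar> < \<eta> / 2)"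
  proof (rule Stone_Weierstrass_HOL)
    show "exp_span (\<lambda>x::real^'n. c)" for c using exp_span_exp[of c 0] by simp
    show "continuous_on (sphere 0 1) f" if "exp_span f" for f :: "real^'n \<Rightarrow> real"
      using that by (induction rule: exp_span.induct) (auto intro!: continuous_intros)
    fix x y :: "real^'n" assume xy: "x \<in> sphere 0 1 \<and> y \<in> sphere 0 1 \<and> x \<noteq> y"
    \<comment> \<open>The linear form with coefficient vector \<open>x - y\<close> takes values at
      \<open>x\<close> and \<open>y\<close> that differ by the squared distance.\<close>
    have "(x - y) \<bullet> (x - y) \<noteq> 0" using xy by simp
    then have "1 * exp ((x - y) \<bullet> x) \<noteq> 1 * exp ((x - y) \<bullet> y)" by (simp add: inner_diff_right)
    then show "\<exists>f. exp_span f \<and> f x \<noteq> f y"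
      by (intro exI[of _ "\<lambda>z. 1 * exp ((x - y) \<bullet> z)"] conjI exp_span_exp)
  qed (use assms in \<open>auto intro: exp_span.intros exp_span_mult\<close>)
  then obtain g where g: "exp_span g" "\<And>x. x \<in> sphere 0 1 \<Longrightarrow> \<bar>u x - g x\<bar> < \<eta> / 2" by blast
  obtain d p where p: "pd d p" "\<And>x. x \<in> sphere 0 1 \<Longrightarrow> \<bar>g x - p x\<bar> < \<eta> / 2"
    using exp_span_approx_pd[OF g(1), of "\<eta> / 2"] assms by auto
  have "\<bar>u x - p x\<bar> < \<eta>" if "x \<in> sphere 0 1" for x
    using g(2)[OF that] p(2)[OF that] by linarith
  then show ?thesis using p by blast
qed

text \<open>A duality argument replaces the expansion of \<open>u\<close> in harmonics. If
  \<open>h\<close> is the part of degree at least \<open>d0\<close> of a polynomial near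
  \<open>u\<close>, and \<open>w\<close> solves minus Laplacian of \<open>w\<close> equal to
  \<open>h\<close>, then expanding the square of
  \<open>\<Gamma> x - ?L d0 *\<^sub>R \<Gamma>w x\<close> involves only the integrals of
  \<open>u * h\<close> and \<open>w * h\<close>. Hence uniform closeness to \<open>u\<close> is
  enough and no approximation of its gradient is required.\<close>

lemma poincare_sphere:
  fixes u :: "real^'n \<Rightarrow> real"
  assumes N: "CARD('n) \<ge> 2" and u: "sgrad u \<Gamma>" and d0: "d0 \<ge> 1"
    and orth: "\<And>f. pd (d0 - 1) f \<Longrightarrow> (LINT x|sphere_measure. u x * f x) = 0"
  shows "lam TYPE('n) d0 * (LINT x|sphere_measure. (u x)\<^sup>2) \<le> (LINT x|sphere_measure. \<Gamma> x \<bullet> \<Gamma> x)"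
proof -
  let ?L = "lam TYPE('n)" and ?I = "\<lambda>f. LINT x|(sphere_measure :: (real^'n) measure). f x"
  let ?S = "sphere (0::real^'n) 1"
  have cu: "continuous_on ?S u" and cG: "continuous_on ?S \<Gamma>"
    using sgrad_continuous[OF u] u by (auto simp: sgrad_def)
  note ci = integrable_sphere_measure continuous_intros
  have Lpos: "?L k > 0" if "k \<ge> 1" for k using lam_strict_mono[OF N, of 0 k] that by (simp add: lam_def)
  have key: "?L d0 * (?I (\<lambda>x. (u x)\<^sup>2) - \<eta>\<^sup>2 * omega TYPE('n)) \<le> ?I (\<lambda>x. \<Gamma> x \<bullet> \<Gamma> x)" if eta: "\<eta> > 0" for \<eta>
  proof -
    obtain d' p where p': "pd d' p" and pu: "\<And>x. x \<in> ?S \<Longrightarrow> \<bar>u x - p x\<bar> < \<eta>"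
      using pd_dense[OF cu eta] by blast
    \<comment> \<open>The maximum with \<open>d0\<close> lets the components below \<open>d0\<close>
      and those from \<open>d0\<close> to \<open>d\<close> together exhaust the
      decomposition.\<close>
    define d where "d = max d' d0"
    have p: "pd d p" using pd_mono[OF p'] by (simp add: d_def)
    have dd: "d0 \<le> d" by (simp add: d_def)
    obtain F \<Delta> where F: "\<And>x. p x = (\<Sum>k\<le>d. F k x)" "\<And>k. k \<le> d \<Longrightarrow> pd k (F k)"
      and gF: "\<And>k. k \<le> d \<Longrightarrow> green (F k) (\<Delta> k) (\<lambda>x. ?L k * F k x)"
      using pd_eigen_decomposition[OF N p] by blast
    have cF: "continuous_on ?S (F k)" if "k \<le> d" for k using F(2)[OF that] by (rule pd_continuous)
    have cD: "continuous_on ?S (\<Delta> k)" if "k \<le> d" for k using gF[OF that] by (simp add: green_def sgrad_def)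
    \<comment> \<open>Green's identity applied both ways round gives the same integral with two
      different eigenvalues.\<close>
    have ort: "?I (\<lambda>x. F j x * F k x) = 0" if "j \<le> d" "k \<le> d" "j \<noteq> k" for j k
    proof -
      have "?I (\<lambda>x. \<Delta> j x \<bullet> \<Delta> k x) = ?I (\<lambda>x. F j x * (?L k * F k x))"
        using gF[OF that(1)] gF[OF that(2)] by (simp add: green_def)
      moreover have "?I (\<lambda>x. \<Delta> k x \<bullet> \<Delta> j x) = ?I (\<lambda>x. F k x * (?L j * F j x))"
        using gF[OF that(1)] gF[OF that(2)] by (simp add: green_def)
      ultimately have "?I (\<lambda>x. F j x * (?L k * F k x)) = ?I (\<lambda>x. F k x * (?L j * F j x))"
        by (simp add: inner_commute)
      moreover have "?I (\<lambda>x. F j x * (?L k * F k x)) = ?L k * ?I (\<lambda>x. F j x * F k x)"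
        by (subst Bochner_Integration.integral_mult_right_zero[symmetric]) (simp add: mult_ac)
      moreover have "?I (\<lambda>x. F k x * (?L j * F j x)) = ?L j * ?I (\<lambda>x. F j x * F k x)"
        by (subst Bochner_Integration.integral_mult_right_zero[symmetric]) (simp add: mult_ac)
      ultimately have "(?L k - ?L j) * ?I (\<lambda>x. F j x * F k x) = 0" by (simp add: algebra_simps)
      moreover have "?L k \<noteq> ?L j" using lam_strict_mono[OF N, of j k] lam_strict_mono[OF N, of k j] that(3)
        by (metis less_irrefl nat_neq_iff)
      ultimately show ?thesis by simp
    qed
    \<comment> \<open>\<open>h\<close> and \<open>lo\<close> are the high and low degree parts of
      \<open>p\<close>, and \<open>w\<close> inverts minus the Laplacian on
      \<open>h\<close>.\<close>
    define h where "h x = (\<Sum>k\<in>{d0..d}. F k x)" for x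
    define lo where "lo x = (\<Sum>k<d0. F k x)" for x
    define w where "w x = (\<Sum>k\<in>{d0..d}. (1 / ?L k) * F k x)" for x
    define \<Gamma>w where "\<Gamma>w x = (\<Sum>k\<in>{d0..d}. (1 / ?L k) *\<^sub>R \<Delta> k x)" for x
    have gw: "green w \<Gamma>w h"
    proof -
      have "green w \<Gamma>w (\<lambda>x. \<Sum>k\<in>{d0..d}. (1 / ?L k) * (?L k * F k x))"
        unfolding w_def \<Gamma>w_def by (intro green_sum green_scale gF) auto
      moreover have "(\<Sum>k\<in>{d0..d}. (1 / ?L k) * (?L k * F k x)) = h x" for x
        unfolding h_def
      proof (intro sum.cong refl)
        fix k assume "k \<in> {d0..d}"
        then have "?L k > 0" using Lpos d0 by auto
        then show "(1 / ?L k) * (?L k * F k x) = F k x" by simp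
      qed
      ultimately show ?thesis by simp
    qed
    have ph: "p x = lo x + h x" for x
    proof -
      have "{..d} = {..<d0} \<union> {d0..d}" using dd by auto
      then show ?thesis unfolding F(1) lo_def h_def by (simp add: sum.union_disjoint disjoint_iff)
    qed
    have clo: "continuous_on ?S lo" unfolding lo_def using dd by (intro continuous_intros cF) auto
    have ch: "continuous_on ?S h" unfolding h_def by (intro continuous_intros cF) auto
    have cw: "continuous_on ?S w" unfolding w_def by (intro continuous_intros cF) auto
    have cGw: "continuous_on ?S \<Gamma>w" unfolding \<Gamma>w_def by (intro continuous_intros cD) auto
    have ulo: "?I (\<lambda>x. u x * lo x) = 0"
    proof (rule orth)
      show "pd (d0 - 1) lo" unfolding lo_def
        using dd by (intro pd_sum) (auto intro!: pd_mono[OF F(2)])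
    qed
    have hlo: "?I (\<lambda>x. h x * lo x) = 0"
    proof -
      have "?I (\<lambda>x. h x * lo x) = ?I (\<lambda>x. \<Sum>k\<in>{d0..d}. \<Sum>j<d0. F k x * F j x)"
        by (simp add: h_def lo_def sum_product)
      also have "\<dots> = (\<Sum>k\<in>{d0..d}. \<Sum>j<d0. ?I (\<lambda>x. F k x * F j x))"
        using dd by (subst Bochner_Integration.integral_sum, (intro ci cF; auto), intro sum.cong refl
           Bochner_Integration.integral_sum, intro ci cF) auto
      also have "\<dots> = 0" using dd by (intro sum.neutral ballI) (auto intro!: ort)
      finally show ?thesis .
    qed
    \<comment> \<open>By orthogonality both sides are sums over single degrees, and on each of them
      the inverse eigenvalue is at most \<open>1 / ?L d0\<close>.\<close>
    have dom: "?I (\<lambda>x. w x * h x) \<le> (1 / ?L d0) * ?I (\<lambda>x. (h x)\<^sup>2)"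
    proof -
      have diag: "?I (\<lambda>x. (\<Sum>k\<in>{d0..d}. c k * F k x) * h x) = (\<Sum>k\<in>{d0..d}. c k * ?I (\<lambda>x. (F k x)\<^sup>2))" for c
      proof -
        have "?I (\<lambda>x. (\<Sum>k\<in>{d0..d}. c k * F k x) * h x) = ?I (\<lambda>x. \<Sum>k\<in>{d0..d}. \<Sum>j\<in>{d0..d}. c k * (F k x * F j x))"
          by (simp add: h_def sum_product mult.assoc)
        also have "\<dots> = (\<Sum>k\<in>{d0..d}. \<Sum>j\<in>{d0..d}. c k * ?I (\<lambda>x. F k x * F j x))"
        proof -
          have i: "integrable sphere_measure (\<lambda>x. c k * (F k x * F j x))" if "k \<in> {d0..d}" "j \<in> {d0..d}" for k j
            using that by (intro ci cF) auto
          show ?thesis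
            by (subst Bochner_Integration.integral_sum, rule Bochner_Integration.integrable_sum, rule i, assumption, assumption,
              intro sum.cong refl, subst Bochner_Integration.integral_sum, rule i, assumption, assumption, simp)
        qed
        also have "\<dots> = (\<Sum>k\<in>{d0..d}. c k * ?I (\<lambda>x. (F k x)\<^sup>2))"
        proof (intro sum.cong refl)
          fix k assume k: "k \<in> {d0..d}"
          have "(\<Sum>j\<in>{d0..d}. c k * ?I (\<lambda>x. F k x * F j x)) = (\<Sum>j\<in>{d0..d}. if j = k then c k * ?I (\<lambda>x. F k x * F k x) else 0)"
            using k by (intro sum.cong refl) (auto simp: ort)
          also have "\<dots> = c k * ?I (\<lambda>x. F k x * F k x)" using k by simp
          finally show "(\<Sum>j\<in>{d0..d}. c k * ?I (\<lambda>x. F k x * F j x)) = c k * ?I (\<lambda>x. (F k x)\<^sup>2)"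
            by (simp add: power2_eq_square)
        qed
        finally show ?thesis .
      qed
      have "?I (\<lambda>x. w x * h x) = (\<Sum>k\<in>{d0..d}. (1 / ?L k) * ?I (\<lambda>x. (F k x)\<^sup>2))"
        unfolding w_def by (rule diag)
      also have "\<dots> \<le> (\<Sum>k\<in>{d0..d}. (1 / ?L d0) * ?I (\<lambda>x. (F k x)\<^sup>2))"
      proof (intro sum_mono mult_right_mono)
        fix k assume k: "k \<in> {d0..d}"
        have "?L d0 \<le> ?L k" using k lam_strict_mono[OF N, of d0 k] by (cases "k = d0") auto
        then show "1 / ?L k \<le> 1 / ?L d0" using Lpos[OF d0] by (intro divide_left_mono mult_pos_pos) auto
      qed (simp add: Bochner_Integration.integral_nonneg)
      also have "\<dots> = ?I (\<lambda>x. (\<Sum>k\<in>{d0..d}. (1 / ?L d0) * F k x) * h x)" by (rule diag[symmetric])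
      also have "\<dots> = (1 / ?L d0) * ?I (\<lambda>x. (h x)\<^sup>2)"
        by (subst Bochner_Integration.integral_mult_right_zero[symmetric])
          (simp add: h_def sum_divide_distrib[symmetric] power2_eq_square)
      finally show ?thesis .
    qed
    have 1: "?I (\<lambda>x. \<Gamma> x \<bullet> \<Gamma>w x) = ?I (\<lambda>x. u x * h x)" using gw u by (simp add: green_def)
    have 2: "?I (\<lambda>x. \<Gamma>w x \<bullet> \<Gamma>w x) = ?I (\<lambda>x. w x * h x)" using gw by (simp add: green_def)
    have "0 \<le> ?I (\<lambda>x. (\<Gamma> x - ?L d0 *\<^sub>R \<Gamma>w x) \<bullet> (\<Gamma> x - ?L d0 *\<^sub>R \<Gamma>w x))"
      by (simp add: Bochner_Integration.integral_nonneg)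
    also have "\<dots> = ?I (\<lambda>x. \<Gamma> x \<bullet> \<Gamma> x - 2 * ?L d0 * (\<Gamma> x \<bullet> \<Gamma>w x) + (?L d0)\<^sup>2 * (\<Gamma>w x \<bullet> \<Gamma>w x))"
      by (intro Bochner_Integration.integral_cong refl)
        (simp add: inner_diff_left inner_diff_right inner_commute power2_eq_square algebra_simps)
    also have "\<dots> = ?I (\<lambda>x. \<Gamma> x \<bullet> \<Gamma> x) - 2 * ?L d0 * ?I (\<lambda>x. \<Gamma> x \<bullet> \<Gamma>w x) + (?L d0)\<^sup>2 * ?I (\<lambda>x. \<Gamma>w x \<bullet> \<Gamma>w x)"
    proof -
      have i: "integrable sphere_measure (\<lambda>x. \<Gamma> x \<bullet> \<Gamma> x)" "integrable sphere_measure (\<lambda>x. \<Gamma> x \<bullet> \<Gamma>w x)"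
        "integrable sphere_measure (\<lambda>x. \<Gamma>w x \<bullet> \<Gamma>w x)" using cG cGw by (auto intro!: ci)
      show ?thesis
        by (subst Bochner_Integration.integral_add[OF Bochner_Integration.integrable_diff[OF i(1) integrable_mult_right[OF i(2)]] integrable_mult_right[OF i(3)]],
           subst Bochner_Integration.integral_diff[OF i(1) integrable_mult_right[OF i(2)]]) simp
    qed
    also have "\<dots> \<le> ?I (\<lambda>x. \<Gamma> x \<bullet> \<Gamma> x) - 2 * ?L d0 * ?I (\<lambda>x. u x * h x) + ?L d0 * ?I (\<lambda>x. (h x)\<^sup>2)"
    proof -
      have "(?L d0)\<^sup>2 * ?I (\<lambda>x. w x * h x) \<le> (?L d0)\<^sup>2 * ((1 / ?L d0) * ?I (\<lambda>x. (h x)\<^sup>2))"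
        by (intro mult_left_mono dom) auto
      also have "\<dots> = ?L d0 * ?I (\<lambda>x. (h x)\<^sup>2)" using Lpos[OF d0] by (simp add: power2_eq_square)
      finally show ?thesis unfolding 1 2 by simp
    qed
    finally have A: "?L d0 * (2 * ?I (\<lambda>x. u x * h x) - ?I (\<lambda>x. (h x)\<^sup>2)) \<le> ?I (\<lambda>x. \<Gamma> x \<bullet> \<Gamma> x)"
      by (simp add: algebra_simps)
    have "?I (\<lambda>x. (u x)\<^sup>2) - \<eta>\<^sup>2 * omega TYPE('n) \<le> 2 * ?I (\<lambda>x. u x * h x) - ?I (\<lambda>x. (h x)\<^sup>2)"
    proof -
      have i: "integrable sphere_measure (\<lambda>x. (u x)\<^sup>2)" "integrable sphere_measure (\<lambda>x. u x * h x)"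
        "integrable sphere_measure (\<lambda>x. (h x)\<^sup>2)" "integrable sphere_measure (\<lambda>x. u x * lo x)"
        "integrable sphere_measure (\<lambda>x. h x * lo x)" "integrable sphere_measure (\<lambda>x. (lo x)\<^sup>2)"
        using cu ch clo by (auto intro!: ci)
      have pd2: "(u x - p x)\<^sup>2 = (u x)\<^sup>2 - 2 * (u x * h x) + (h x)\<^sup>2 - 2 * (u x * lo x) + 2 * (h x * lo x) + (lo x)\<^sup>2" for x
        unfolding ph by (simp add: power2_eq_square algebra_simps)
      have "?I (\<lambda>x. (u x - p x)\<^sup>2) = ?I (\<lambda>x. (u x)\<^sup>2) - 2 * ?I (\<lambda>x. u x * h x) + ?I (\<lambda>x. (h x)\<^sup>2)
          - 2 * ?I (\<lambda>x. u x * lo x) + 2 * ?I (\<lambda>x. h x * lo x) + ?I (\<lambda>x. (lo x)\<^sup>2)"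
        unfolding pd2 using i by simp
      then have e: "?I (\<lambda>x. (u x - p x)\<^sup>2) = ?I (\<lambda>x. (u x)\<^sup>2) - 2 * ?I (\<lambda>x. u x * h x) + ?I (\<lambda>x. (h x)\<^sup>2) + ?I (\<lambda>x. (lo x)\<^sup>2)"
        using ulo hlo by simp
      have "?I (\<lambda>x. (u x - p x)\<^sup>2) \<le> ?I (\<lambda>x. \<eta>\<^sup>2)"
      proof (rule integral_mono)
        show "integrable sphere_measure (\<lambda>x. (u x - p x)\<^sup>2)" using cu pd_continuous[OF p] by (intro ci)
        show "integrable (sphere_measure :: (real^'n) measure) (\<lambda>x. \<eta>\<^sup>2)" by (intro ci)
        fix x assume "x \<in> space (sphere_measure :: (real^'n) measure)"
        then have "\<bar>u x - p x\<bar> \<le> \<eta>" using pu[of x] by auto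
        then show "(u x - p x)\<^sup>2 \<le> \<eta>\<^sup>2" using eta by (simp add: abs_le_square_iff[symmetric])
      qed
      also have "\<dots> = \<eta>\<^sup>2 * omega TYPE('n)" by (rule lint_const_sphere)
      finally have "?I (\<lambda>x. (u x - p x)\<^sup>2) \<le> \<eta>\<^sup>2 * omega TYPE('n)" .
      moreover have "?I (\<lambda>x. (lo x)\<^sup>2) \<ge> 0" by (simp add: Bochner_Integration.integral_nonneg)
      ultimately show ?thesis using e by linarith
    qed
    then have "?L d0 * (?I (\<lambda>x. (u x)\<^sup>2) - \<eta>\<^sup>2 * omega TYPE('n)) \<le> ?L d0 * (2 * ?I (\<lambda>x. u x * h x) - ?I (\<lambda>x. (h x)\<^sup>2))"
      using Lpos[OF d0] by (intro mult_left_mono) auto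
    with A show ?thesis by linarith
  qed
  have lim: "((\<lambda>\<eta>. ?L d0 * (?I (\<lambda>x. (u x)\<^sup>2) - \<eta>\<^sup>2 * omega TYPE('n))) \<longlongrightarrow> ?L d0 * (?I (\<lambda>x. (u x)\<^sup>2) - 0\<^sup>2 * omega TYPE('n))) (at_right 0)"
    by (intro tendsto_intros)
  have "?L d0 * (?I (\<lambda>x. (u x)\<^sup>2) - 0\<^sup>2 * omega TYPE('n)) \<le> ?I (\<lambda>x. \<Gamma> x \<bullet> \<Gamma> x)"
    by (rule tendsto_upperbound[OF lim]) (auto simp: eventually_at_filter key intro!: always_eventually)
  then show ?thesis by simp
qed


section \<open>Orthogonal projection onto polynomials of degree two\<close>

lemma pd2_orthogonality_test:
  "\<exists>B. finite B \<and> (\<forall>b\<in>B. pd 2 b) \<and> (\<forall>u :: real^'n \<Rightarrow> real. continuous_on (sphere 0 1) u \<longrightarrow>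
     (\<forall>b\<in>B. (LINT x|sphere_measure. u x * b x) = 0) \<longrightarrow> (\<forall>f. pd 2 f \<longrightarrow> (LINT x|sphere_measure. u x * f x) = 0))"
proof -
  \<comment> \<open>The monomials of degree at most two span \<open>pd 2\<close>, so orthogonality
    needs to be tested on finitely many functions only.\<close>
  define B where "B = {\<lambda>x::real^'n. 1} \<union> range (\<lambda>i x. x $ i) \<union> (\<lambda>(i, j) x. x $ i * x $ j) ` (UNIV :: ('n \<times> 'n) set)"
  have "finite B" by (auto simp: B_def)
  moreover have "pd 2 b" if bB: "b \<in> B" for b
  proof -
    consider "b = (\<lambda>x. 1)" | i where "b = (\<lambda>x. x $ i)" | i j where "b = (\<lambda>x. x $ i * x $ j)"
      using bB by (auto simp: B_def)
    then show ?thesis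
    proof cases
      case 1 then show ?thesis using pd_const[of 2 1] by simp
    next
      case (2 i)
      have "pd 2 (\<lambda>x. 1 * (axis i 1 \<bullet> x) ^ 1)" by (rule pd_pow) simp
      then show ?thesis by (simp add: 2 inner_axis')
    next
      case (3 i j)
      \<comment> \<open>Polarization: a product of two coordinates is a difference of squares of
        linear forms.\<close>
      have "pd 2 (\<lambda>x. (1/4) * ((axis i 1 + axis j 1) \<bullet> x)\<^sup>2 + (-1/4) * ((axis i 1 - axis j 1) \<bullet> x)\<^sup>2)"
        by (intro pd_add pd_pow) simp_all
      moreover have "(1/4) * ((axis i 1 + axis j 1) \<bullet> x)\<^sup>2 + (-1/4) * ((axis i 1 - axis j 1) \<bullet> x)\<^sup>2 = x $ i * x $ j" for x :: "real^'n"
        by (simp add: inner_axis' inner_add_left inner_diff_left power2_eq_square field_simps)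
      ultimately show ?thesis by (simp add: 3)
    qed
  qed
  moreover have "(LINT x|sphere_measure. u x * f x) = 0"
    if cu: "continuous_on (sphere 0 1) u" and ort: "\<forall>b\<in>B. (LINT x|sphere_measure. u x * b x) = 0" and f: "pd 2 f"
    for u f :: "real^'n \<Rightarrow> real"
    using f
  proof (induction "2::nat" f rule: pd.induct)
    case (pd_pow k c a)
    have o0: "(LINT x|sphere_measure. u x) = 0" using ort[rule_format, of "\<lambda>x. 1"] by (simp add: B_def)
    have o1: "(LINT x|sphere_measure. u x * x $ i) = 0" for i
      using ort[rule_format, of "\<lambda>x. x $ i"] by (simp add: B_def)
    have o2: "(LINT x|sphere_measure. u x * (x $ i * x $ j)) = 0" for i j
    proof -
      have "(\<lambda>x::real^'n. x $ i * x $ j) \<in> B" unfolding B_def by (auto intro!: image_eqI[of _ _ "(i, j)"])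
      from ort[rule_format, OF this] show ?thesis .
    qed
    have i1: "integrable sphere_measure (\<lambda>x. u x * x $ i)" for i
      using cu by (auto intro!: integrable_sphere_measure continuous_intros)
    have i2: "integrable sphere_measure (\<lambda>x. u x * (x $ i * x $ j))" for i j
      using cu by (auto intro!: integrable_sphere_measure continuous_intros)
    consider "k = 0" | "k = 1" | "k = 2" using pd_pow by linarith
    then show ?case
    proof cases
      case 1 then show ?thesis using o0 by simp
    next
      case 2
      have "(LINT x|sphere_measure. u x * (c * (a \<bullet> x) ^ k)) = (LINT x|sphere_measure. (\<Sum>i\<in>UNIV. (c * a $ i) * (u x * x $ i)))"
        by (intro Bochner_Integration.integral_cong refl) (simp add: 2 inner_vec_def sum_distrib_left mult_ac)
      also have "\<dots> = (\<Sum>i\<in>UNIV. (c * a $ i) * (LINT x|sphere_measure. u x * x $ i))"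
        by (subst Bochner_Integration.integral_sum, rule integrable_mult_right, rule i1) (simp only: Bochner_Integration.integral_mult_right_zero)
      finally show ?thesis by (simp add: o1)
    next
      case 3
      have "(LINT x|sphere_measure. u x * (c * (a \<bullet> x) ^ k)) = (LINT x|sphere_measure. (\<Sum>p\<in>UNIV. (c * a $ fst p * a $ snd p) * (u x * (x $ fst p * x $ snd p))))"
        by (intro Bochner_Integration.integral_cong refl)
          (simp add: 3 inner_vec_def power2_eq_square sum_product sum.cartesian_product sum_distrib_left mult_ac split_def)
      also have "\<dots> = (\<Sum>p\<in>UNIV. (c * a $ fst p * a $ snd p) * (LINT x|sphere_measure. u x * (x $ fst p * x $ snd p)))"
        by (subst Bochner_Integration.integral_sum, rule integrable_mult_right, rule i2) (simp only: Bochner_Integration.integral_mult_right_zero)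
      finally show ?thesis by (simp add: o2)
    qed
  next
    case (pd_add f g)
    have "integrable sphere_measure (\<lambda>x. u x * f x)" "integrable sphere_measure (\<lambda>x. u x * g x)"
      using cu pd_continuous[OF pd_add.hyps(1)] pd_continuous[OF pd_add.hyps(3)]
      by (auto intro!: integrable_sphere_measure continuous_intros)
    then show ?case using pd_add.hyps by (simp add: distrib_left)
  qed
  ultimately show ?thesis by (intro exI[of _ B]) blast
qed

text \<open>Gram-Schmidt. The last clause says by duality that \<open>B\<close> lies in the span of
  \<open>E\<close> on the sphere, which avoids a vector space structure on functions.\<close>

lemma pd_orthonormal_family:
  fixes B :: "(real^'n \<Rightarrow> real) set"
  assumes "finite B" "\<forall>b\<in>B. pd d b"
  shows "\<exists>E. finite E \<and> (\<forall>e\<in>E. pd d e) \<and>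
     (\<forall>e\<in>E. \<forall>e'\<in>E. (LINT x|sphere_measure. e x * e' x) = (if e = e' then 1 else 0)) \<and>
     (\<forall>u. continuous_on (sphere 0 1) u \<longrightarrow> (\<forall>e\<in>E. (LINT x|sphere_measure. u x * e x) = 0) \<longrightarrow>
        (\<forall>b\<in>B. (LINT x|sphere_measure. u x * b x) = 0))"
  using assms
proof (induction rule: finite_induct)
  case empty
  then show ?case by (intro exI[of _ "{}"]) auto
next
  case (insert b B)
  let ?I = "\<lambda>f. LINT x|(sphere_measure :: (real^'n) measure). f x"
  let ?S = "sphere (0::real^'n) 1"
  obtain E where E: "finite E" "\<forall>e\<in>E. pd d e"
     "\<forall>e\<in>E. \<forall>e'\<in>E. ?I (\<lambda>x. e x * e' x) = (if e = e' then 1 else 0)"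
     "\<forall>u. continuous_on ?S u \<longrightarrow> (\<forall>e\<in>E. ?I (\<lambda>x. u x * e x) = 0) \<longrightarrow> (\<forall>b\<in>B. ?I (\<lambda>x. u x * b x) = 0)"
  proof -
    have "\<forall>b\<in>B. pd d b" using insert.prems by simp
    from insert.IH[OF this] show ?thesis by (elim exE conjE) (rule that)
  qed
  have b: "pd d b" using insert.prems by simp
  define c where "c e = ?I (\<lambda>x. b x * e x)" for e
  define r where "r x = b x - (\<Sum>e\<in>E. c e * e x)" for x
  have r: "pd d r" unfolding r_def by (intro pd_diff b pd_sum pd_scale E(1)) (use E(2) in auto)
  have cE: "continuous_on ?S e" if "e \<in> E" for e using E(2) that pd_continuous by blast
  have cb: "continuous_on ?S b" and cr: "continuous_on ?S r" using b r pd_continuous by auto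
  have exp: "?I (\<lambda>x. u x * b x) = ?I (\<lambda>x. u x * r x) + (\<Sum>e\<in>E. c e * ?I (\<lambda>x. u x * e x))" if cu: "continuous_on ?S u" for u
  proof -
    have i: "integrable sphere_measure (\<lambda>x. c e * (u x * e x))" if "e \<in> E" for e
      using cu cE[OF that] by (auto intro!: integrable_sphere_measure continuous_intros)
    have ir: "integrable sphere_measure (\<lambda>x. u x * r x)"
      using cu cr by (auto intro!: integrable_sphere_measure continuous_intros)
    have "?I (\<lambda>x. u x * b x) = ?I (\<lambda>x. u x * r x + (\<Sum>e\<in>E. c e * (u x * e x)))"
      by (intro Bochner_Integration.integral_cong refl) (simp add: r_def algebra_simps sum_distrib_left)
    also have "\<dots> = ?I (\<lambda>x. u x * r x) + ?I (\<lambda>x. \<Sum>e\<in>E. c e * (u x * e x))"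
      by (intro Bochner_Integration.integral_add ir Bochner_Integration.integrable_sum i)
    also have "?I (\<lambda>x. \<Sum>e\<in>E. c e * (u x * e x)) = (\<Sum>e\<in>E. c e * ?I (\<lambda>x. u x * e x))"
      by (subst Bochner_Integration.integral_sum, erule i) (simp only: Bochner_Integration.integral_mult_right_zero)
    finally show ?thesis .
  qed
  have re: "?I (\<lambda>x. e x * r x) = 0" if e: "e \<in> E" for e
  proof -
    have "(\<Sum>e'\<in>E. c e' * ?I (\<lambda>x. e x * e' x)) = (\<Sum>e'\<in>E. if e' = e then c e else 0)"
      using E(3) e by (intro sum.cong) auto
    then have "(\<Sum>e'\<in>E. c e' * ?I (\<lambda>x. e x * e' x)) = c e" using E(1) e by simp
    moreover have "?I (\<lambda>x. e x * b x) = c e" by (simp add: c_def mult.commute)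
    ultimately show ?thesis using exp[OF cE[OF e]] by simp
  qed
  show ?case
  proof (cases "?I (\<lambda>x. (r x)\<^sup>2) = 0")
    \<comment> \<open>Distinct polynomials may coincide on the sphere, as the constant 1 and the sum
      of squared coordinates do. Then the residual has norm zero there and \<open>b\<close> adds
      nothing to the family.\<close>
    case True
    have r0: "r x = 0" if "x \<in> ?S" for x
      using sphere_integral_zero_imp[OF _ _ True that] cr by (auto intro!: continuous_intros)
    have "?I (\<lambda>x. u x * r x) = 0" for u
    proof -
      have "?I (\<lambda>x. u x * r x) = ?I (\<lambda>x. 0)" by (intro Bochner_Integration.integral_cong refl) (use r0 in auto)
      then show ?thesis by simp
    qed
    then have "?I (\<lambda>x. u x * b x) = 0" if "continuous_on ?S u" "\<forall>e\<in>E. ?I (\<lambda>x. u x * e x) = 0" for u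
      using exp[OF that(1)] that(2) by simp
    then show ?thesis using E by (intro exI[of _ E]) auto
  next
    case False
    define N where "N = ?I (\<lambda>x. (r x)\<^sup>2)"
    have N: "N > 0" using False Bochner_Integration.integral_nonneg[of sphere_measure "\<lambda>x. (r x)\<^sup>2"]
      by (simp add: N_def less_le)
    define e0 where "e0 x = (1 / sqrt N) * r x" for x
    have p0: "pd d e0" unfolding e0_def by (rule pd_scale[OF r])
    have ce0: "?I (\<lambda>x. u x * e0 x) = (1 / sqrt N) * ?I (\<lambda>x. u x * r x)" for u
      by (subst Bochner_Integration.integral_mult_right_zero[symmetric]) (simp add: e0_def mult_ac)
    have n0: "?I (\<lambda>x. e0 x * e0 x) = 1"
    proof -
      have "?I (\<lambda>x. e0 x * e0 x) = (1 / sqrt N) * ?I (\<lambda>x. (1 / sqrt N) * (r x)\<^sup>2)"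
        unfolding ce0 by (simp add: e0_def power2_eq_square mult_ac)
      also have "\<dots> = (1 / sqrt N) * ((1 / sqrt N) * N)"
        unfolding N_def by (simp only: Bochner_Integration.integral_mult_right_zero)
      also have "\<dots> = 1" using N by (simp add: divide_simps)
      finally show ?thesis .
    qed
    have oe: "?I (\<lambda>x. e x * e0 x) = 0" "?I (\<lambda>x. e0 x * e x) = 0" if "e \<in> E" for e
    proof -
      show "?I (\<lambda>x. e x * e0 x) = 0" using ce0[of e] re[OF that] by simp
      then show "?I (\<lambda>x. e0 x * e x) = 0" by (simp add: mult.commute)
    qed
    have nin: "e0 \<notin> E" using n0 oe(1)[of e0] by auto
    have A4: "\<forall>b'\<in>insert b B. ?I (\<lambda>x. u x * b' x) = 0"
      if cu: "continuous_on ?S u" and h: "\<forall>e\<in>insert e0 E. ?I (\<lambda>x. u x * e x) = 0" for u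
    proof -
      have "?I (\<lambda>x. u x * r x) = 0" using h ce0[of u] N by simp
      then have "?I (\<lambda>x. u x * b x) = 0" using exp[OF cu] h by simp
      then show ?thesis using E(4) cu h by auto
    qed
    have A3: "\<forall>e\<in>insert e0 E. \<forall>e'\<in>insert e0 E. ?I (\<lambda>x. e x * e' x) = (if e = e' then 1 else 0)"
      using E(3) n0 oe nin by auto
    have "finite (insert e0 E)" "\<forall>e\<in>insert e0 E. pd d e" using E(1,2) p0 by auto
    then show ?thesis using A3
      by (intro exI[of _ "insert e0 E"] conjI allI impI) (assumption | rule A4)+
  qed
qed

lemma svec_bounded:
  assumes "svec V DV"
  shows "\<exists>C\<ge>0. \<forall>x\<in>sphere 0 1. norm (V x) \<le> C \<and> \<bar>div_at (DV x)\<bar> \<le> C \<and> (\<forall>v. norm (DV x v) \<le> C * norm v)"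
proof -
  let ?S = "sphere (0::real^'a) 1"
  have bd: "\<exists>C\<ge>0. \<forall>x\<in>?S. norm (W x) \<le> C" if "continuous_on ?S W" for W :: "real^'a \<Rightarrow> real^'a"
  proof -
    have "compact (W ` ?S)" by (intro compact_continuous_image that) auto
    then obtain C where "\<forall>x\<in>?S. norm (W x) \<le> C"
      using compact_imp_bounded[of "W ` ?S"] unfolding bounded_iff by auto
    then show ?thesis by (intro exI[of _ "max C 0"]) (auto simp: le_max_iff_disj)
  qed
  obtain C0 where C0: "C0 \<ge> 0" "\<forall>x\<in>?S. norm (V x) \<le> C0" using bd[OF svec_continuous[OF assms]] by blast
  have "\<forall>i. \<exists>C\<ge>0. \<forall>x\<in>?S. norm (DV x (axis i 1)) \<le> C"
    using bd assms by (auto simp: svec_def)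
  then obtain C where C: "\<And>i. C i \<ge> 0" "\<And>i x. x \<in> ?S \<Longrightarrow> norm (DV x (axis i 1)) \<le> C i" by metis
  define K where "K = C0 + (\<Sum>i\<in>UNIV. C i)"
  have S0: "(\<Sum>i\<in>UNIV. C i) \<ge> 0" using C(1) by (simp add: sum_nonneg)
  have "norm (V x) \<le> K \<and> \<bar>div_at (DV x)\<bar> \<le> K \<and> (\<forall>v. norm (DV x v) \<le> K * norm v)" if x: "x \<in> ?S" for x
  proof (intro conjI allI)
    show "norm (V x) \<le> K" using C0 x S0 by (auto simp: K_def intro: add_increasing2)
    have "\<bar>div_at (DV x)\<bar> \<le> (\<Sum>i\<in>UNIV. \<bar>DV x (axis i 1) $ i\<bar>)" unfolding div_at_def by (rule sum_abs)
    also have "\<dots> \<le> (\<Sum>i\<in>UNIV. C i)"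
      by (intro sum_mono) (metis C(2)[OF x] component_le_norm_cart order_trans)
    also have "\<dots> \<le> K" using C0 by (simp add: K_def)
    finally show "\<bar>div_at (DV x)\<bar> \<le> K" .
    fix v
    have lin: "linear (DV x)" using assms x has_derivative_linear unfolding svec_def by blast
    have "DV x v = (\<Sum>j\<in>UNIV. v $ j *\<^sub>R DV x (axis j 1))" by (rule linear_axis_sum[OF lin])
    also have "norm \<dots> \<le> (\<Sum>j\<in>UNIV. norm (v $ j *\<^sub>R DV x (axis j 1)))" by (rule norm_sum)
    also have "\<dots> \<le> (\<Sum>j\<in>UNIV. norm v * C j)"
      unfolding norm_scaleR real_norm_def
      by (intro sum_mono mult_mono component_le_norm_cart C(2)[OF x]) auto
    also have "\<dots> = (\<Sum>j\<in>UNIV. C j) * norm v" by (simp add: sum_distrib_left mult.commute)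
    also have "\<dots> \<le> K * norm v" using C0 by (intro mult_right_mono) (auto simp: K_def)
    finally show "norm (DV x v) \<le> K * norm v" .
  qed
  moreover have "K \<ge> 0" using C0 S0 by (simp add: K_def)
  ultimately show ?thesis by blast
qed

text \<open>In a finite-dimensional space the sup norm of \<open>u\<close> controls the coefficients
  of its projection and therefore all derivatives of the projection. This makes the divergence of
  the test field small although \<open>u\<close> itself is small in C^1 only.\<close>

lemma quadratic_projection:
  "\<exists>C\<ge>0. \<forall>(u :: real^'n \<Rightarrow> real) M. continuous_on (sphere 0 1) u \<and> (\<forall>x\<in>sphere 0 1. \<bar>u x\<bar> \<le> M) \<longrightarrow>
     (\<exists>w \<Gamma>w D l. pd 2 w \<and> green w \<Gamma>w l \<and> pd 2 l \<and> svec \<Gamma>w D \<and>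
       (\<forall>f. pd 2 f \<longrightarrow> (LINT x|sphere_measure. (u x - w x) * f x) = 0) \<and>
       (\<forall>x\<in>sphere 0 1. norm (\<Gamma>w x) \<le> C * M \<and> \<bar>div_at (D x)\<bar> \<le> C * M \<and> (\<forall>v. norm (D x v) \<le> C * M * norm v)))"
proof -
  let ?I = "\<lambda>f. LINT x|(sphere_measure :: (real^'n) measure). f x"
  let ?S = "sphere (0::real^'n) 1"
  obtain B where B: "finite B" "\<forall>b\<in>B. pd 2 b"
    "\<And>u :: real^'n \<Rightarrow> real. continuous_on ?S u \<Longrightarrow> (\<forall>b\<in>B. ?I (\<lambda>x. u x * b x) = 0) \<Longrightarrow> (\<forall>f. pd 2 f \<longrightarrow> ?I (\<lambda>x. u x * f x) = 0)"
    using pd2_orthogonality_test by blast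
  obtain E where E: "finite E" "\<forall>e\<in>E. pd 2 e"
     "\<forall>e\<in>E. \<forall>e'\<in>E. ?I (\<lambda>x. e x * e' x) = (if e = e' then 1 else 0)"
     "\<forall>u. continuous_on ?S u \<longrightarrow> (\<forall>e\<in>E. ?I (\<lambda>x. u x * e x) = 0) \<longrightarrow> (\<forall>b\<in>B. ?I (\<lambda>x. u x * b x) = 0)"
    using pd_orthonormal_family[OF B(1,2)] by blast
  have "\<exists>G D l. green e G l \<and> svec G D \<and> pd 2 l" if "e \<in> E" for e
  proof -
    have p2: "pd 2 e" using E(2) that by blast
    from pd_laplacian[OF p2]
    obtain G D g where "green e G (\<lambda>x. lam TYPE('n) 2 * e x + g x)" "svec G D" "pd (2 - 1) g"
      by (elim exE conjE) (rule that)
    moreover have "pd 2 (\<lambda>x. lam TYPE('n) 2 * e x + g x)"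
      using E(2) that by (intro pd_add pd_scale pd_mono[OF \<open>pd (2 - 1) g\<close>]) auto
    ultimately show ?thesis by blast
  qed
  then obtain G D l where G: "\<And>e. e \<in> E \<Longrightarrow> green e (G e) (l e)" "\<And>e. e \<in> E \<Longrightarrow> svec (G e) (D e)"
     "\<And>e. e \<in> E \<Longrightarrow> pd 2 (l e)" by metis
  have "\<exists>C\<ge>0. \<forall>x\<in>?S. norm (G e x) \<le> C \<and> \<bar>div_at (D e x)\<bar> \<le> C \<and> (\<forall>v. norm (D e x v) \<le> C * norm v)" if "e \<in> E" for e
    using svec_bounded[OF G(2)[OF that]] .
  then obtain C where C: "\<And>e. e \<in> E \<Longrightarrow> C e \<ge> 0"
    "\<And>e x. e \<in> E \<Longrightarrow> x \<in> ?S \<Longrightarrow> norm (G e x) \<le> C e"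
    "\<And>e x. e \<in> E \<Longrightarrow> x \<in> ?S \<Longrightarrow> \<bar>div_at (D e x)\<bar> \<le> C e"
    "\<And>e x v. e \<in> E \<Longrightarrow> x \<in> ?S \<Longrightarrow> norm (D e x v) \<le> C e * norm v" by metis
  have cE: "continuous_on ?S e" if "e \<in> E" for e using E(2) that pd_continuous by blast
  define J where "J e = ?I (\<lambda>x. \<bar>e x\<bar>)" for e :: "real^'n \<Rightarrow> real"
  have J0: "J e \<ge> 0" for e unfolding J_def by (rule Bochner_Integration.integral_nonneg) simp
  \<comment> \<open>Each coefficient is at most \<open>M\<close> times the L^1 norm
    \<open>J e\<close> of the basis element, and \<open>C e\<close> bounds the gradient of that
    element together with its derivative.\<close>
  define K where "K = (\<Sum>e\<in>E. J e * C e)"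
  have K0: "K \<ge> 0" unfolding K_def using J0 C(1) by (auto intro!: sum_nonneg)
  have main: "\<exists>w \<Gamma>w D l. pd 2 w \<and> green w \<Gamma>w l \<and> pd 2 l \<and> svec \<Gamma>w D \<and>
       (\<forall>f. pd 2 f \<longrightarrow> ?I (\<lambda>x. (u x - w x) * f x) = 0) \<and>
       (\<forall>x\<in>?S. norm (\<Gamma>w x) \<le> K * M \<and> \<bar>div_at (D x)\<bar> \<le> K * M \<and> (\<forall>v. norm (D x v) \<le> K * M * norm v))"
    if cu: "continuous_on ?S u" and uM: "\<forall>x\<in>?S. \<bar>u x\<bar> \<le> M" for u M
  proof -
    define c where "c e = ?I (\<lambda>x. u x * e x)" for e
    have cb: "\<bar>c e\<bar> \<le> M * J e" if "e \<in> E" for e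
    proof -
      have "\<bar>c e\<bar> \<le> ?I (\<lambda>x. \<bar>u x * e x\<bar>)" unfolding c_def by (rule integral_abs_bound)
      also have "\<dots> \<le> ?I (\<lambda>x. M * \<bar>e x\<bar>)"
      proof (rule integral_mono)
        show "integrable sphere_measure (\<lambda>x. \<bar>u x * e x\<bar>)" "integrable sphere_measure (\<lambda>x. M * \<bar>e x\<bar>)"
          using cu cE[OF that] by (auto intro!: integrable_sphere_measure continuous_intros)
        fix x assume "x \<in> space (sphere_measure :: (real^'n) measure)"
        then show "\<bar>u x * e x\<bar> \<le> M * \<bar>e x\<bar>" using uM by (auto simp: abs_mult intro!: mult_right_mono)
      qed
      also have "\<dots> = M * J e" by (simp add: J_def)
      finally show ?thesis .
    qed
    define w where "w x = (\<Sum>e\<in>E. c e * e x)" for x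
    define \<Gamma>w where "\<Gamma>w x = (\<Sum>e\<in>E. c e *\<^sub>R G e x)" for x
    define Dw where "Dw x v = (\<Sum>e\<in>E. c e *\<^sub>R D e x v)" for x v
    define lw where "lw x = (\<Sum>e\<in>E. c e * l e x)" for x
    have 1: "pd 2 w" unfolding w_def using E by (intro pd_sum pd_scale) auto
    have 2: "green w \<Gamma>w lw" unfolding w_def \<Gamma>w_def lw_def using E by (intro green_sum green_scale G) auto
    have 3: "pd 2 lw" unfolding lw_def using E by (intro pd_sum pd_scale G) auto
    have 4: "svec \<Gamma>w Dw" unfolding \<Gamma>w_def Dw_def
      using E(1) G(2)
    proof (induction rule: finite_induct)
      case empty
      have "hom_ext (\<lambda>x::real^'n. 0::real^'n) = (\<lambda>y. 0)" by (simp add: hom_ext_def[abs_def])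
      then show ?case by (simp add: svec_def)
    next
      case (insert e F)
      then show ?case by (auto intro!: svec_add svec_scale)
    qed
    have 5: "?I (\<lambda>x. (u x - w x) * f x) = 0" if "pd 2 f" for f
    proof -
      have cw: "continuous_on ?S (\<lambda>x. u x - w x)" using cu pd_continuous[OF 1] by (intro continuous_intros)
      have "?I (\<lambda>x. (u x - w x) * e x) = 0" if e: "e \<in> E" for e
      proof -
        have i: "integrable sphere_measure (\<lambda>x. c e' * (e' x * e x))" if "e' \<in> E" for e'
          using cE[OF that] cE[OF e] by (auto intro!: integrable_sphere_measure continuous_intros)
        have i2: "integrable sphere_measure (\<lambda>x. u x * e x)"
          using cE[OF e] cu by (auto intro!: integrable_sphere_measure continuous_intros)
        have "?I (\<lambda>x. (u x - w x) * e x) = ?I (\<lambda>x. u x * e x - (\<Sum>e'\<in>E. c e' * (e' x * e x)))"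
          by (intro Bochner_Integration.integral_cong refl) (simp add: w_def left_diff_distrib sum_distrib_right mult.assoc)
        also have "\<dots> = ?I (\<lambda>x. u x * e x) - ?I (\<lambda>x. \<Sum>e'\<in>E. c e' * (e' x * e x))"
          by (intro Bochner_Integration.integral_diff i2 Bochner_Integration.integrable_sum i)
        also have "?I (\<lambda>x. \<Sum>e'\<in>E. c e' * (e' x * e x)) = (\<Sum>e'\<in>E. c e' * ?I (\<lambda>x. e' x * e x))"
          by (subst Bochner_Integration.integral_sum, erule i) (simp only: Bochner_Integration.integral_mult_right_zero)
        also have "\<dots> = (\<Sum>e'\<in>E. if e' = e then c e else 0)"
          using E(3) e by (intro sum.cong) auto
        also have "\<dots> = c e" using E(1) e by simp
        finally show ?thesis by (simp add: c_def)
      qed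
      then have "\<forall>b\<in>B. ?I (\<lambda>x. (u x - w x) * b x) = 0" using E(4) cw by auto
      then show ?thesis using B(3)[OF cw] that by blast
    qed
    have cs: "(\<Sum>e\<in>E. \<bar>c e\<bar> * C e) \<le> K * M"
    proof -
      have "(\<Sum>e\<in>E. \<bar>c e\<bar> * C e) \<le> (\<Sum>e\<in>E. (M * J e) * C e)"
        by (intro sum_mono mult_right_mono cb C(1))
      also have "\<dots> = K * M" unfolding K_def sum_distrib_right by (intro sum.cong refl) simp
      finally show ?thesis .
    qed
    have 6: "norm (\<Gamma>w x) \<le> K * M" "\<bar>div_at (Dw x)\<bar> \<le> K * M" "norm (Dw x v) \<le> K * M * norm v" if x: "x \<in> ?S" for x v
    proof -
      have "norm (\<Gamma>w x) \<le> (\<Sum>e\<in>E. norm (c e *\<^sub>R G e x))" unfolding \<Gamma>w_def by (rule norm_sum)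
      also have "\<dots> \<le> (\<Sum>e\<in>E. \<bar>c e\<bar> * C e)"
        unfolding norm_scaleR by (intro sum_mono mult_left_mono C(2) x) auto
      finally show "norm (\<Gamma>w x) \<le> K * M" using cs by simp
      have "div_at (Dw x) = (\<Sum>e\<in>E. c e * div_at (D e x))"
        unfolding Dw_def div_at_def by (simp add: sum_distrib_left) (rule sum.swap)
      also have "\<bar>\<dots>\<bar> \<le> (\<Sum>e\<in>E. \<bar>c e * div_at (D e x)\<bar>)" by (rule sum_abs)
      also have "\<dots> \<le> (\<Sum>e\<in>E. \<bar>c e\<bar> * C e)"
        unfolding abs_mult by (intro sum_mono mult_left_mono C(3) x) auto
      finally show "\<bar>div_at (Dw x)\<bar> \<le> K * M" using cs by simp
      have "norm (Dw x v) \<le> (\<Sum>e\<in>E. norm (c e *\<^sub>R D e x v))" unfolding Dw_def by (rule norm_sum)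
      also have "\<dots> \<le> (\<Sum>e\<in>E. \<bar>c e\<bar> * (C e * norm v))"
        unfolding norm_scaleR by (intro sum_mono mult_left_mono C(4) x) auto
      also have "\<dots> = (\<Sum>e\<in>E. \<bar>c e\<bar> * C e) * norm v" by (simp add: sum_distrib_right mult.assoc)
      also have "\<dots> \<le> K * M * norm v" using cs by (intro mult_right_mono) auto
      finally show "norm (Dw x v) \<le> K * M * norm v" .
    qed
    show ?thesis
      using 1 2 3 4 5 6 by (intro exI[of _ w] exI[of _ \<Gamma>w] exI[of _ Dw] exI[of _ lw]) blast
  qed
  show ?thesis
    using K0 main by (intro exI[of _ K] conjI allI impI) (simp_all only:, blast)
qed

subsection \<open>Curvature of radial graphs\<close>

text \<open>\<open>\<alpha>\<close> times the identity plus two rank-one terms. The first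
  fundamental form and its inverse both have this shape, with the position \<open>x\<close> and the
  gradient \<open>p\<close> as the two vectors.\<close>

definition rk :: "real \<Rightarrow> real \<Rightarrow> real^'n \<Rightarrow> real \<Rightarrow> real^'n \<Rightarrow> real^'n^'n" where
  "rk \<alpha> \<beta> a \<gamma> b = (\<chi> i j. (if i = j then \<alpha> else 0) + \<beta> * (a $ i * a $ j) + \<gamma> * (b $ i * b $ j))"

lemma vec_eqI: "(\<And>i. a $ i = b $ i) \<Longrightarrow> a = b" by (simp add: vec_eq_iff)

lemma rk_vector: "rk \<alpha> \<beta> a \<gamma> b *v z = \<alpha> *\<^sub>R z + (\<beta> * (a \<bullet> z)) *\<^sub>R a + (\<gamma> * (b \<bullet> z)) *\<^sub>R b"
proof (rule vec_eqI)
  fix i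
  have "(rk \<alpha> \<beta> a \<gamma> b *v z) $ i
     = (\<Sum>j\<in>UNIV. (if i = j then \<alpha> * z $ j else 0) + \<beta> * a $ i * (a $ j * z $ j) + \<gamma> * b $ i * (b $ j * z $ j))"
    unfolding rk_def matrix_vector_mult_def by (auto intro!: sum.cong simp: algebra_simps)
  also have "\<dots> = \<alpha> * z $ i + \<beta> * a $ i * (a \<bullet> z) + \<gamma> * b $ i * (b \<bullet> z)"
    by (simp add: sum.distrib sum_distrib_left[symmetric] inner_vec_def)
  finally show "(rk \<alpha> \<beta> a \<gamma> b *v z) $ i = (\<alpha> *\<^sub>R z + (\<beta> * (a \<bullet> z)) *\<^sub>R a + (\<gamma> * (b \<bullet> z)) *\<^sub>R b) $ i"
    by (simp add: algebra_simps)
qed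

text \<open>A rotation that takes a coordinate axis to \<open>a\<close> turns the matrix into a
  diagonal one.\<close>

lemma det_rank_one_unit:
  fixes a :: "real^'n"
  assumes "norm a = 1"
  shows "det (rk 1 c a 0 0) = 1 + c"
proof -
  obtain A k where A: "orthogonal_matrix A" "A *v axis k 1 = a"
    using orthogonal_matrix_exists_basis[OF assms] by metis
  let ?D = "rk 1 c (axis k 1) 0 0 :: real^'n^'n"
  have tA: "transpose A *v (A *v z) = z" "A *v (transpose A *v z) = z" for z
    using A(1) by (simp_all add: orthogonal_matrix_def matrix_vector_mul_assoc del: transpose_matrix_vector)
  have "rk 1 c a 0 0 = A ** (?D ** transpose A)"
    unfolding matrix_eq
  proof
    fix z
    have "axis k 1 \<bullet> (transpose A *v z) = a \<bullet> z"
      using A(2) by (metis dot_lmul_matrix vector_transpose_matrix transpose_transpose inner_commute)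
    then have "(A ** (?D ** transpose A)) *v z = A *v (transpose A *v z + (c * (a \<bullet> z)) *\<^sub>R axis k 1)"
      by (simp add: matrix_vector_mul_assoc[symmetric] rk_vector del: transpose_matrix_vector)
    also have "\<dots> = z + (c * (a \<bullet> z)) *\<^sub>R a"
      by (simp add: matrix_vector_right_distrib tA matrix_vector_mult_scaleR A(2) del: transpose_matrix_vector)
    finally show "rk 1 c a 0 0 *v z = (A ** (?D ** transpose A)) *v z" by (simp add: rk_vector)
  qed
  then have "det (rk 1 c a 0 0) = det ?D * (det A * det (transpose A))" by (simp add: det_mul)
  also have "det A * det (transpose A) = 1"
    using A(1) unfolding orthogonal_matrix_def by (metis det_I det_mul)
  also have "det ?D = (\<Prod>i\<in>UNIV. ?D $ i $ i)"
    by (rule det_diagonal) (auto simp: rk_def axis_def)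
  also have "\<dots> = (\<Prod>i\<in>UNIV. if i = k then 1 + c else 1)"
    by (intro prod.cong) (auto simp: rk_def axis_def)
  also have "\<dots> = 1 + c" by simp
  finally show ?thesis by simp
qed

lemma det_rank_one: "det (rk 1 c (a::real^'n) 0 0) = 1 + c * (a \<bullet> a)"
proof (cases "a = 0")
  case True
  have "rk 1 c a 0 0 = mat 1" by (simp add: True rk_def mat_def)
  then show ?thesis using True by simp
next
  case False
  have "rk 1 c a 0 0 = rk 1 (c * (a \<bullet> a)) (a /\<^sub>R norm a) 0 0"
    unfolding matrix_eq rk_vector using False by (simp add: dot_square_norm power2_eq_square field_simps)
  then show ?thesis using det_rank_one_unit[of "a /\<^sub>R norm a" "c * (a \<bullet> a)"] False by simp
qed

lemma det_scaled: "det (c *\<^sub>R (A::real^'n^'n)) = c ^ CARD('n) * det A"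
proof -
  have "c *\<^sub>R A = matrix ((*\<^sub>R) c) ** A"
    unfolding matrix_eq by (simp add: matrix_vector_mul_assoc[symmetric] matrix_works linear_scaleR scaleR_matrix_vector_assoc)
  then show ?thesis by (simp add: det_mul)
qed

text \<open>Since \<open>p\<close> is orthogonal to \<open>x\<close>, the matrix is
  \<open>s\<^sup>2\<close> times a product of two rank-one perturbations of the identity. The
  coefficient \<open>\<beta>\<close> is the one that restores the value 1 in the direction
  \<open>x\<close>.\<close>

lemma det_first_form:
  fixes x p :: "real^'n"
  assumes x: "norm x = 1" and px: "p \<bullet> x = 0" and s: "s > 0"
  shows "det (rk (s\<^sup>2) (1 - s\<^sup>2) x (s\<^sup>2) p) = (s ^ (CARD('n) - 1))\<^sup>2 * (1 + p \<bullet> p)"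
proof -
  have xp: "x \<bullet> p = 0" using px by (simp add: inner_commute)
  define \<beta> where "\<beta> = (1 - s\<^sup>2) / s\<^sup>2"
  have \<beta>: "s\<^sup>2 * \<beta> = 1 - s\<^sup>2" using s by (simp add: \<beta>_def)
  have "rk (s\<^sup>2) (1 - s\<^sup>2) x (s\<^sup>2) p = s\<^sup>2 *\<^sub>R (rk 1 1 p 0 0 ** rk 1 \<beta> x 0 0)"
    unfolding matrix_eq
    by (simp add: scaleR_matrix_vector_assoc[symmetric] matrix_vector_mul_assoc[symmetric] rk_vector
        inner_add_right scaleR_add_right px xp mult.assoc[symmetric] \<beta>)
  then have "det (rk (s\<^sup>2) (1 - s\<^sup>2) x (s\<^sup>2) p) = (s\<^sup>2) ^ CARD('n) * ((1 + p \<bullet> p) * (1 + (1 - s\<^sup>2) / s\<^sup>2))"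
    using x by (simp add: det_scaled det_mul det_rank_one dot_square_norm \<beta>_def)
  also have "1 + (1 - s\<^sup>2) / s\<^sup>2 = 1 / s\<^sup>2" using s by (simp add: field_simps)
  also have "(s\<^sup>2) ^ CARD('n) = (s ^ (CARD('n) - 1))\<^sup>2 * s\<^sup>2"
    using zero_less_card_finite[where 'a='n] by (cases "CARD('n)") (auto simp: power_mult_distrib power_commutes power2_eq_square)
  finally show ?thesis using s by simp
qed

lemma matrix_inv_eqI:
  fixes A B :: "real^'n^'n"
  assumes "A ** B = mat 1" "B ** A = mat 1"
  shows "matrix_inv A = B"
proof -
  have "A ** matrix_inv A = mat 1 \<and> matrix_inv A ** A = mat 1"
    unfolding matrix_inv_def by (rule someI[of _ B]) (use assms in auto)
  then show ?thesis by (metis assms(1) matrix_mul_assoc matrix_mul_lid matrix_mul_rid)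
qed

text \<open>The matrix acts as 1 on \<open>x\<close>, as
  \<open>s\<^sup>2 * (1 + p \<bullet> p)\<close> on \<open>p\<close> and as \<open>s\<^sup>2\<close>
  on the common orthogonal complement; the coefficient of \<open>p\<close> in the inverse is the
  Sherman-Morrison correction.\<close>

lemma inverse_first_form:
  fixes x p :: "real^'n"
  assumes x: "norm x = 1" and px: "p \<bullet> x = 0" and s: "s > 0"
  shows "matrix_inv (rk (s\<^sup>2) (1 - s\<^sup>2) x (s\<^sup>2) p)
     = rk (1 / s\<^sup>2) (1 - 1 / s\<^sup>2) x (- (1 / s\<^sup>2) / (1 + p \<bullet> p)) p"
proof -
  have xp: "x \<bullet> p = 0" using px by (simp add: inner_commute)
  have xx: "x \<bullet> x = 1" using x by (simp add: dot_square_norm)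
  have q: "1 + p \<bullet> p > 0" using inner_ge_zero[of p] by linarith
  define m where "m = - (1 / s\<^sup>2) / (1 + p \<bullet> p)"
  have m: "s\<^sup>2 * m + 1 + s\<^sup>2 * m * (p \<bullet> p) = 0"
  proof -
    have "m * (1 + p \<bullet> p) = - (1 / s\<^sup>2)" using q by (simp add: m_def)
    then have "s\<^sup>2 * (m * (1 + p \<bullet> p)) = -1" using s by simp
    then show ?thesis by (simp add: algebra_simps)
  qed
  have A: "(s\<^sup>2 * m + 1 + s\<^sup>2 * m * (p \<bullet> p)) * t = 0" for t by (simp only: m mult_zero_left)
  show ?thesis
  proof (rule matrix_inv_eqI)
    have "rk (s\<^sup>2) (1 - s\<^sup>2) x (s\<^sup>2) p *v (rk (1 / s\<^sup>2) (1 - 1 / s\<^sup>2) x m p *v z) = z" for z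
    proof -
      have "rk (s\<^sup>2) (1 - s\<^sup>2) x (s\<^sup>2) p *v (rk (1 / s\<^sup>2) (1 - 1 / s\<^sup>2) x m p *v z)
        = z + ((s\<^sup>2 * m + 1 + s\<^sup>2 * m * (p \<bullet> p)) * (p \<bullet> z)) *\<^sub>R p"
        using s by (simp add: rk_vector inner_add_right xp px xx algebra_simps)
      then show ?thesis by (simp only: A scaleR_zero_left add_0_right)
    qed
    then show "rk (s\<^sup>2) (1 - s\<^sup>2) x (s\<^sup>2) p ** rk (1 / s\<^sup>2) (1 - 1 / s\<^sup>2) x (- (1 / s\<^sup>2) / (1 + p \<bullet> p)) p = mat 1"
      unfolding matrix_eq m_def by (simp add: matrix_vector_mul_assoc[symmetric])
    have "rk (1 / s\<^sup>2) (1 - 1 / s\<^sup>2) x m p *v (rk (s\<^sup>2) (1 - s\<^sup>2) x (s\<^sup>2) p *v z) = z" for z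
    proof -
      have "rk (1 / s\<^sup>2) (1 - 1 / s\<^sup>2) x m p *v (rk (s\<^sup>2) (1 - s\<^sup>2) x (s\<^sup>2) p *v z)
        = z + ((s\<^sup>2 * m + 1 + s\<^sup>2 * m * (p \<bullet> p)) * (p \<bullet> z)) *\<^sub>R p"
        using s by (simp add: rk_vector inner_add_right xp px xx algebra_simps)
      then show ?thesis by (simp only: A scaleR_zero_left add_0_right)
    qed
    then show "rk (1 / s\<^sup>2) (1 - 1 / s\<^sup>2) x (- (1 / s\<^sup>2) / (1 + p \<bullet> p)) p ** rk (s\<^sup>2) (1 - s\<^sup>2) x (s\<^sup>2) p = mat 1"
      unfolding matrix_eq m_def by (simp add: matrix_vector_mul_assoc[symmetric])
  qed
qed

lemma trace_rk_mult:
  fixes F :: "real^'n^'n"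
  shows "trace (rk \<alpha> \<beta> a \<gamma> b ** F) = \<alpha> * trace F + \<beta> * (\<Sum>i\<in>UNIV. \<Sum>j\<in>UNIV. a $ i * a $ j * F $ j $ i)
     + \<gamma> * (\<Sum>i\<in>UNIV. \<Sum>j\<in>UNIV. b $ i * b $ j * F $ j $ i)"
proof -
  have "trace (rk \<alpha> \<beta> a \<gamma> b ** F) = (\<Sum>i\<in>UNIV. \<Sum>j\<in>UNIV. (if i = j then \<alpha> * F $ j $ i else 0)
     + \<beta> * (a $ i * a $ j * F $ j $ i) + \<gamma> * (b $ i * b $ j * F $ j $ i))"
    unfolding trace_def matrix_matrix_mult_def rk_def by (auto intro!: sum.cong simp: algebra_simps)
  also have "\<dots> = (\<Sum>i\<in>UNIV. \<alpha> * F $ i $ i) + \<beta> * (\<Sum>i\<in>UNIV. \<Sum>j\<in>UNIV. a $ i * a $ j * F $ j $ i)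
     + \<gamma> * (\<Sum>i\<in>UNIV. \<Sum>j\<in>UNIV. b $ i * b $ j * F $ j $ i)"
    by (simp add: sum.distrib sum_distrib_left)
  finally show ?thesis by (simp add: trace_def sum_distrib_left)
qed

lemma sum_form_axis:
  fixes L M :: "real^'n \<Rightarrow> 'a::real_inner" and z :: "real^'n"
  assumes "linear L" "linear M"
  shows "(\<Sum>i\<in>UNIV. \<Sum>j\<in>UNIV. z $ i * z $ j * (L (axis j 1) \<bullet> M (axis i 1))) = L z \<bullet> M z"
proof -
  show ?thesis unfolding linear_axis_sum[OF assms(1), of z] linear_axis_sum[OF assms(2), of z]
    by (simp add: inner_sum_left inner_sum_right sum_distrib_left mult_ac)
qed

section \<open>Normal, fundamental forms and mean curvature of a radial graph\<close>

locale radial_graph =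
  fixes r :: "real^'n \<Rightarrow> real" and p :: "real^'n \<Rightarrow> real^'n" and Dp :: "real^'n \<Rightarrow> real^'n \<Rightarrow> real^'n"
  assumes r_pos: "norm x = 1 \<Longrightarrow> r x > 0"
    and r_grad: "sgrad r (\<lambda>x. sinh (r x) *\<^sub>R p x)"
    and p_deriv: "svec p Dp"
begin

lemma p_tangent: "norm x = 1 \<Longrightarrow> p x \<bullet> x = 0"
  using sgrad_tangent[OF r_grad, of x] r_pos[of x] by simp

lemma r_has_derivative: "norm x = 1 \<Longrightarrow> (hom_ext r has_derivative (\<lambda>v. sinh (r x) * (p x \<bullet> v))) (at x)"
  using r_grad by (simp add: sgrad_def)

lemma cosh_r_has_derivative:
  "norm x = 1 \<Longrightarrow> ((\<lambda>y. cosh (hom_ext r y)) has_derivative (\<lambda>v. sinh (r x) * (sinh (r x) * (p x \<bullet> v)))) (at x)"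
proof -
  assume x: "norm x = 1"
  have "(cosh has_derivative (\<lambda>h. sinh (r x) * h)) (at (hom_ext r x))"
    using x by (auto intro!: derivative_eq_intros simp: has_field_derivative_def[symmetric])
  from has_derivative_compose[OF r_has_derivative[OF x] this] show ?thesis .
qed

lemma sinh_r_has_derivative:
  "norm x = 1 \<Longrightarrow> ((\<lambda>y. sinh (hom_ext r y)) has_derivative (\<lambda>v. cosh (r x) * (sinh (r x) * (p x \<bullet> v)))) (at x)"
proof -
  assume x: "norm x = 1"
  have "(sinh has_derivative (\<lambda>h. cosh (r x) * h)) (at (hom_ext r x))"
    using x by (auto intro!: derivative_eq_intros simp: has_field_derivative_def[symmetric])
  from has_derivative_compose[OF r_has_derivative[OF x] this] show ?thesis .
qed

lemma p_has_derivative: "norm x = 1 \<Longrightarrow> (hom_ext p has_derivative Dp x) (at x)"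
  using p_deriv by (simp add: svec_def)

lemma Dp_linear: "norm x = 1 \<Longrightarrow> linear (Dp x)"
  using p_has_derivative has_derivative_linear by blast

lemma Dp_radial: "norm x = 1 \<Longrightarrow> Dp x x = 0"
  using hom_ext_radial_derivative[OF p_has_derivative] by force

text \<open>Differentiation of the tangency relation \<open>p x \<bullet> x = 0\<close>.\<close>

lemma Dp_inner: assumes x: "norm x = 1" shows "Dp x v \<bullet> x = - (p x \<bullet> v)"
proof -
  have "((\<lambda>y. hom_ext p y \<bullet> (y /\<^sub>R norm y)) has_derivative
      (\<lambda>v. hom_ext p x \<bullet> tproj x v + Dp x v \<bullet> (x /\<^sub>R norm x))) (at x)"
    by (rule has_derivative_inner[OF p_has_derivative[OF x] has_derivative_direction[OF x]])
  moreover have "((\<lambda>y. hom_ext p y \<bullet> (y /\<^sub>R norm y)) has_derivative (\<lambda>v. 0)) (at x)"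
  proof (rule has_derivative_transform_within_open)
    show "((\<lambda>y. 0) has_derivative (\<lambda>v. 0)) (at x)" by simp
    show "open (UNIV - {0::real^'n})" by auto
    show "x \<in> UNIV - {0}" using x by auto
    show "0 = hom_ext p y \<bullet> (y /\<^sub>R norm y)" if "y \<in> UNIV - {0}" for y
      using p_tangent[of "y /\<^sub>R norm y"] that by (simp add: hom_ext_def)
  qed
  ultimately have "(\<lambda>v. hom_ext p x \<bullet> tproj x v + Dp x v \<bullet> (x /\<^sub>R norm x)) = (\<lambda>v. 0)"
    by (rule has_derivative_unique)
  from fun_cong[OF this, of v] show ?thesis
    using x p_tangent[OF x] by (simp add: tproj_def inner_diff_right)
qed

text \<open>The reciprocal of the area factor v, and also the radial component of the unit
  normal.\<close>

definition W where "W x = 1 / sqrt (1 + p x \<bullet> p x)"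

lemma W_pos: "W x > 0" and W_sq: "(W x)\<^sup>2 * (1 + p x \<bullet> p x) = 1"
proof -
  have "1 + p x \<bullet> p x > 0" using inner_ge_zero[of "p x"] by linarith
  then show "W x > 0" "(W x)\<^sup>2 * (1 + p x \<bullet> p x) = 1" by (auto simp: W_def power_divide)
qed

lemma area_factor_pos: "1 + p x \<bullet> p x > 0"
  using inner_ge_zero[of "p x"] by linarith

lemma area_factor_has_derivative:
  assumes x: "norm x = 1"
  shows "((\<lambda>y. sqrt (1 + hom_ext p y \<bullet> hom_ext p y)) has_derivative (\<lambda>v. (p x \<bullet> Dp x v + Dp x v \<bullet> p x) * (W x / 2))) (at x)"
proof -
  have "((\<lambda>y. 1 + hom_ext p y \<bullet> hom_ext p y) has_derivative (\<lambda>v. 0 + (hom_ext p x \<bullet> Dp x v + Dp x v \<bullet> hom_ext p x))) (at x)"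
    by (intro has_derivative_add has_derivative_const has_derivative_inner p_has_derivative[OF x])
  then have d1: "((\<lambda>y. 1 + hom_ext p y \<bullet> hom_ext p y) has_derivative (\<lambda>v. p x \<bullet> Dp x v + Dp x v \<bullet> p x)) (at x)"
    using x by simp
  have "(sqrt has_derivative (\<lambda>h. h * (W x / 2))) (at (1 + hom_ext p x \<bullet> hom_ext p x))"
    using DERIV_real_sqrt[OF area_factor_pos[of x]] x unfolding has_field_derivative_def W_def divide_inverse mult_1
    by (simp add: fun_eq_iff) (erule has_derivative_eq_rhs, simp add: fun_eq_iff)
  from has_derivative_compose[OF d1 this] show ?thesis .
qed

lemma W_inverse: "W x = inverse (sqrt (1 + p x \<bullet> p x))"
  by (simp add: W_def divide_inverse)

lemma area_factor_inverse_has_derivative: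
  assumes x: "norm x = 1"
  shows "((\<lambda>y. inverse (sqrt (1 + hom_ext p y \<bullet> hom_ext p y))) has_derivative
    (\<lambda>v. - (W x * ((p x \<bullet> Dp x v + Dp x v \<bullet> p x) * (W x / 2)) * W x))) (at x)"
proof -
  have "sqrt (1 + hom_ext p x \<bullet> hom_ext p x) \<noteq> 0" using area_factor_pos[of x] x by simp
  from Deriv.has_derivative_inverse[OF this area_factor_has_derivative[OF x]]
  show ?thesis by (simp only: hom_ext_sphere[OF x] W_inverse)
qed

text \<open>The radial unit vector of the hyperboloid minus \<open>p\<close>; its Minkowski square
  is \<open>1 + p x \<bullet> p x\<close>, so \<open>W\<close> normalizes it.\<close>

definition N0 where "N0 x = (sinh (r x), cosh (r x) *\<^sub>R x - p x)"

lemma dF_formula: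
  assumes x: "norm x = 1" and rr: "\<forall>x. norm x = 1 \<longrightarrow> radf \<rho> u x = r x"
  shows "dF \<rho> u x v = (sinh (r x) * (sinh (r x) * (p x \<bullet> v)),
     (cosh (r x) * (sinh (r x) * (p x \<bullet> v))) *\<^sub>R x + sinh (r x) *\<^sub>R tproj x v)"
    and "surfF \<rho> u x = (cosh (r x), sinh (r x) *\<^sub>R x)"
proof -
  have F: "surfF \<rho> u y = (cosh (hom_ext r y), sinh (hom_ext r y) *\<^sub>R (y /\<^sub>R norm y))" if "y \<noteq> 0" for y
  proof -
    have n: "norm (y /\<^sub>R norm y) = 1" using that by simp
    define z where "z = y /\<^sub>R norm y"
    have "r z > 0" using r_pos n by (simp add: z_def)
    then have "hemb (r z *\<^sub>R z) = (cosh (r z), sinh (r z) *\<^sub>R z)"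
      using n by (simp add: hemb_def sinhc_def z_def[symmetric])
    then show ?thesis using rr[rule_format, OF n] by (simp add: surfF_def hom_ext_def z_def)
  qed
  show "surfF \<rho> u x = (cosh (r x), sinh (r x) *\<^sub>R x)" using F[of x] x by (cases "x = 0") auto
  have x0: "x \<noteq> 0" using x by auto
  note dc = cosh_r_has_derivative[OF x] and ds = sinh_r_has_derivative[OF x]
  have "((\<lambda>y. (cosh (hom_ext r y), sinh (hom_ext r y) *\<^sub>R (y /\<^sub>R norm y))) has_derivative
     (\<lambda>v. (sinh (r x) * (sinh (r x) * (p x \<bullet> v)),
       sinh (hom_ext r x) *\<^sub>R tproj x v + (cosh (r x) * (sinh (r x) * (p x \<bullet> v))) *\<^sub>R (x /\<^sub>R norm x)))) (at x)"
    by (intro has_derivative_Pair dc has_derivative_scaleR[OF ds has_derivative_direction[OF x]])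
  then have "(surfF \<rho> u has_derivative
     (\<lambda>v. (sinh (r x) * (sinh (r x) * (p x \<bullet> v)),
       sinh (hom_ext r x) *\<^sub>R tproj x v + (cosh (r x) * (sinh (r x) * (p x \<bullet> v))) *\<^sub>R (x /\<^sub>R norm x)))) (at x)"
    by (rule has_derivative_transform_within_open[where s="UNIV - {0}"]) (use x0 F in auto)
  from frechet_derivative_at[OF this, symmetric] show "dF \<rho> u x v = (sinh (r x) * (sinh (r x) * (p x \<bullet> v)),
     (cosh (r x) * (sinh (r x) * (p x \<bullet> v))) *\<^sub>R x + sinh (r x) *\<^sub>R tproj x v)"
    using x by (simp add: dF_def add.commute)
qed

text \<open>Because the normal is given by a definite description, uniqueness has to be shown as
  well: tangency to the hyperboloid and orthogonality to the surface fix the direction, the norm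
  fixes the length and the radial pairing fixes the sign.\<close>

lemma outer_normal_formula:
  assumes x: "norm x = 1" and rr: "\<forall>x. norm x = 1 \<longrightarrow> radf \<rho> u x = r x"
  shows "outer_normal \<rho> u x = W x *\<^sub>R N0 x"
  unfolding outer_normal_def
proof (rule the_equality)
  have xx: "x \<bullet> x = 1" using x by (simp add: dot_square_norm)
  have px: "p x \<bullet> x = 0" "x \<bullet> p x = 0" using p_tangent[OF x] by (auto simp: inner_commute)
  have cs: "(cosh (r x))\<^sup>2 = 1 + (sinh (r x))\<^sup>2" by (simp add: cosh_square_eq)
  have sp: "sinh (r x) > 0" using r_pos[OF x] by simp
  have tp: "tproj x v \<bullet> x = 0" "x \<bullet> tproj x v = 0" "p x \<bullet> tproj x v = p x \<bullet> v" for v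
    using xx px by (auto simp: tproj_def inner_diff_left inner_diff_right inner_commute)
  note dFf = dF_formula[OF x rr]
  show "lor (W x *\<^sub>R N0 x) (surfF \<rho> u x) = 0 \<and> (\<forall>v. lor (W x *\<^sub>R N0 x) (dF \<rho> u x v) = 0) \<and>
     lor (W x *\<^sub>R N0 x) (W x *\<^sub>R N0 x) = 1 \<and> 0 < lor (W x *\<^sub>R N0 x) (sinh (radf \<rho> u x), cosh (radf \<rho> u x) *\<^sub>R x)"
  proof (intro conjI allI)
    show "lor (W x *\<^sub>R N0 x) (surfF \<rho> u x) = 0"
      unfolding dFf by (simp add: lor_def N0_def inner_diff_left px xx)
    show "lor (W x *\<^sub>R N0 x) (dF \<rho> u x v) = 0" for v
    proof -
      have "lor (W x *\<^sub>R N0 x) (dF \<rho> u x v) = W x * sinh (r x) * (p x \<bullet> v) * ((cosh (r x))\<^sup>2 - (sinh (r x))\<^sup>2 - 1)"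
        unfolding dFf by (simp add: lor_def N0_def inner_diff_left inner_add_right px xx tp power2_eq_square algebra_simps)
      then show ?thesis by (simp add: cs)
    qed
    have "lor (W x *\<^sub>R N0 x) (W x *\<^sub>R N0 x) = (W x)\<^sup>2 * ((cosh (r x))\<^sup>2 - (sinh (r x))\<^sup>2 + p x \<bullet> p x)"
      by (simp add: lor_def N0_def inner_diff_left inner_diff_right px xx power2_eq_square algebra_simps)
    then show "lor (W x *\<^sub>R N0 x) (W x *\<^sub>R N0 x) = 1" using W_sq[of x] by (simp add: cs)
    have "lor (W x *\<^sub>R N0 x) (sinh (radf \<rho> u x), cosh (radf \<rho> u x) *\<^sub>R x) = W x * ((cosh (r x))\<^sup>2 - (sinh (r x))\<^sup>2)"
      by (simp add: rr[rule_format, OF x] lor_def N0_def inner_diff_left inner_diff_right px xx power2_eq_square algebra_simps)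
    then show "0 < lor (W x *\<^sub>R N0 x) (sinh (radf \<rho> u x), cosh (radf \<rho> u x) *\<^sub>R x)" using W_pos by (simp add: cs)
  qed
  fix M :: "real \<times> (real^'n)"
  assume M: "lor M (surfF \<rho> u x) = 0 \<and> (\<forall>v. lor M (dF \<rho> u x v) = 0) \<and>
     lor M M = 1 \<and> 0 < lor M (sinh (radf \<rho> u x), cosh (radf \<rho> u x) *\<^sub>R x)"
  \<comment> \<open>The spatial part of \<open>M\<close> splits into the part \<open>b\<close> along
    \<open>x\<close> and the part \<open>c\<close> orthogonal to it; \<open>k\<close> below is the
    component of \<open>M\<close> in the radial direction of the hyperboloid.\<close>
  define b where "b = snd M \<bullet> x"
  define c where "c = snd M - b *\<^sub>R x"
  define k where "k = b * cosh (r x) - fst M * sinh (r x)"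
  have cx: "c \<bullet> x = 0" "x \<bullet> c = 0" using xx by (auto simp: c_def b_def inner_diff_left inner_diff_right inner_commute)
  have sM: "snd M = b *\<^sub>R x + c" by (simp add: c_def)
  have M1: "fst M * cosh (r x) = b * sinh (r x)" using M by (simp add: dFf lor_def b_def mult.commute)
  have M4: "k > 0" using M by (simp add: rr[rule_format, OF x] lor_def b_def k_def mult.commute)
  have fM: "fst M = k * sinh (r x)"
  proof -
    have "k * sinh (r x) = cosh (r x) * (b * sinh (r x)) - fst M * (sinh (r x))\<^sup>2" by (simp add: k_def power2_eq_square algebra_simps)
    also have "\<dots> = fst M * ((cosh (r x))\<^sup>2 - (sinh (r x))\<^sup>2)" by (simp add: M1[symmetric] power2_eq_square algebra_simps)
    finally show ?thesis by (simp add: cs)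
  qed
  have bM: "b = k * cosh (r x)"
  proof -
    have "k * cosh (r x) = b * (cosh (r x))\<^sup>2 - (fst M * cosh (r x)) * sinh (r x)" by (simp add: k_def power2_eq_square algebra_simps)
    also have "\<dots> = b * ((cosh (r x))\<^sup>2 - (sinh (r x))\<^sup>2)" by (simp add: M1 power2_eq_square algebra_simps)
    finally show ?thesis by (simp add: cs)
  qed
  have cM: "c = - k *\<^sub>R p x"
  proof -
    \<comment> \<open>Testing orthogonality on the vector that should vanish itself: the pairing is
      its squared norm times \<open>sinh (r x)\<close>.\<close>
    let ?d = "c + k *\<^sub>R p x"
    have dx: "?d \<bullet> x = 0" by (simp add: inner_add_left cx px)
    then have td: "tproj x ?d = ?d" by (simp add: tproj_def)
    have "0 = lor M (dF \<rho> u x ?d)" using M by simp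
    also have "\<dots> = sinh (r x) * ((p x \<bullet> ?d) * k * ((cosh (r x))\<^sup>2 - (sinh (r x))\<^sup>2) + c \<bullet> ?d)"
      unfolding dFf lor_def td fst_conv snd_conv sM fM
      by (simp add: bM inner_add_left inner_add_right px cx xx power2_eq_square algebra_simps)
    also have "\<dots> = sinh (r x) * (?d \<bullet> ?d)" by (simp add: cs inner_add_left inner_add_right inner_commute algebra_simps)
    finally have "?d \<bullet> ?d = 0" using sp by simp
    then have "?d = 0" by simp
    then show ?thesis by (simp add: add_eq_0_iff2)
  qed
  have MN: "M = k *\<^sub>R N0 x"
    by (rule prod_eqI) (simp_all add: N0_def fM sM bM cM algebra_simps)
  have "1 = lor M M" using M by simp
  also have "\<dots> = k\<^sup>2 * ((cosh (r x))\<^sup>2 - (sinh (r x))\<^sup>2 + p x \<bullet> p x)"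
    unfolding MN by (simp add: lor_def N0_def inner_diff_left inner_diff_right px xx power2_eq_square algebra_simps)
  finally have "k\<^sup>2 * (1 + p x \<bullet> p x) = 1" by (simp add: cs)
  then have "k\<^sup>2 * (1 + p x \<bullet> p x) = (W x)\<^sup>2 * (1 + p x \<bullet> p x)" using W_sq by simp
  moreover have "1 + p x \<bullet> p x \<noteq> 0" using inner_ge_zero[of "p x"] by linarith
  ultimately have "k\<^sup>2 = (W x)\<^sup>2" by simp
  then have "k = W x" using M4 W_pos[of x] by (simp add: power2_eq_iff_nonneg)
  then show "M = W x *\<^sub>R N0 x" using MN by simp
qed

text \<open>The derivative of the normalizing factor multiplies \<open>N0\<close>, which is
  orthogonal to the image of \<open>dF\<close>; so only the derivative of \<open>N0\<close>
  survives.\<close>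

lemma lor_dN_dF:
  assumes x: "norm x = 1" and rr: "\<forall>x. norm x = 1 \<longrightarrow> radf \<rho> u x = r x"
    and vx: "v \<bullet> x = 0" and wx: "w \<bullet> x = 0"
  shows "lor (dN \<rho> u x v) (dF \<rho> u x w)
    = W x * sinh (r x) * (cosh (r x) * (v \<bullet> w + (p x \<bullet> v) * (p x \<bullet> w)) - Dp x v \<bullet> w)"
proof -
  have x0: "x \<noteq> 0" using x by auto
  have xx: "x \<bullet> x = 1" using x by (simp add: dot_square_norm)
  have px: "p x \<bullet> x = 0" "x \<bullet> p x = 0" using p_tangent[OF x] by (auto simp: inner_commute)
  have cs: "(cosh (r x))\<^sup>2 = 1 + (sinh (r x))\<^sup>2" by (simp add: cosh_square_eq)
  have tp: "tproj x v = v" "tproj x w = w" using vx wx by (auto simp: tproj_def)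
  have xw: "x \<bullet> w = 0" "x \<bullet> v = 0" using vx wx by (auto simp: inner_commute)
  define dr where "dr v = sinh (r x) * (p x \<bullet> v)" for v
  note dc = cosh_r_has_derivative[OF x, folded dr_def] and ds = sinh_r_has_derivative[OF x, folded dr_def]
  define dN0 where "dN0 v = (cosh (r x) * dr v, (cosh (r x) *\<^sub>R tproj x v + (sinh (r x) * dr v) *\<^sub>R x) - Dp x v)" for v
  have D0: "((\<lambda>y. (sinh (hom_ext r y), cosh (hom_ext r y) *\<^sub>R (y /\<^sub>R norm y) - hom_ext p y)) has_derivative dN0) (at x)"
  proof -
    have "((\<lambda>y. (sinh (hom_ext r y), cosh (hom_ext r y) *\<^sub>R (y /\<^sub>R norm y) - hom_ext p y)) has_derivative
       (\<lambda>v. (cosh (r x) * dr v, (cosh (hom_ext r x) *\<^sub>R tproj x v + (sinh (r x) * dr v) *\<^sub>R (x /\<^sub>R norm x)) - Dp x v))) (at x)"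
      by (intro has_derivative_Pair ds has_derivative_diff p_has_derivative[OF x] has_derivative_scaleR[OF dc has_derivative_direction[OF x]])
    then show ?thesis by (rule has_derivative_eq_rhs) (simp add: fun_eq_iff dN0_def x)
  qed
  define Wd where "Wd v = - (W x * ((p x \<bullet> Dp x v + Dp x v \<bullet> p x) * (W x / 2)) * W x)" for v
  have D1: "((\<lambda>y. inverse (sqrt (1 + hom_ext p y \<bullet> hom_ext p y))) has_derivative Wd) (at x)"
    using area_factor_inverse_has_derivative[OF x] by (simp add: Wd_def[abs_def])
  have D2: "((\<lambda>y. inverse (sqrt (1 + hom_ext p y \<bullet> hom_ext p y)) *\<^sub>R (sinh (hom_ext r y), cosh (hom_ext r y) *\<^sub>R (y /\<^sub>R norm y) - hom_ext p y))
     has_derivative (\<lambda>v. W x *\<^sub>R dN0 v + Wd v *\<^sub>R N0 x)) (at x)"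
    using has_derivative_scaleR[OF D1 D0] x by (simp add: W_def N0_def divide_inverse)
  have "(hom_ext (outer_normal \<rho> u) has_derivative (\<lambda>v. W x *\<^sub>R dN0 v + Wd v *\<^sub>R N0 x)) (at x)"
  proof (rule has_derivative_transform_within_open[OF D2])
    show "open (UNIV - {0::real^'n})" by auto
    show "x \<in> UNIV - {0}" using x0 by auto
    fix y :: "real^'n" assume "y \<in> UNIV - {0}"
    then have "norm (y /\<^sub>R norm y) = 1" by simp
    from outer_normal_formula[OF this rr]
    show "inverse (sqrt (1 + hom_ext p y \<bullet> hom_ext p y)) *\<^sub>R (sinh (hom_ext r y), cosh (hom_ext r y) *\<^sub>R (y /\<^sub>R norm y) - hom_ext p y) = hom_ext (outer_normal \<rho> u) y"
      by (simp add: hom_ext_def W_def N0_def divide_inverse)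
  qed
  from frechet_derivative_at[OF this, symmetric] have dNx: "dN \<rho> u x v = W x *\<^sub>R dN0 v + Wd v *\<^sub>R N0 x"
    by (simp add: dN_def)
  note dFf = dF_formula[OF x rr]
  have zero: "lor (N0 x) (dF \<rho> u x w) = 0"
  proof -
    have "lor (N0 x) (dF \<rho> u x w) = sinh (r x) * (p x \<bullet> w) * ((cosh (r x))\<^sup>2 - (sinh (r x))\<^sup>2 - 1)"
      unfolding dFf by (simp add: lor_def N0_def inner_diff_left inner_add_right px xx xw tp power2_eq_square algebra_simps)
    then show ?thesis by (simp add: cs)
  qed
  have "lor (dN \<rho> u x v) (dF \<rho> u x w) = W x * lor (dN0 v) (dF \<rho> u x w) + Wd v * lor (N0 x) (dF \<rho> u x w)"
    unfolding dNx by (simp add: lor_def inner_add_left algebra_simps)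
  also have "\<dots> = W x * lor (dN0 v) (dF \<rho> u x w)" by (simp add: zero)
  also have "lor (dN0 v) (dF \<rho> u x w) = sinh (r x) * (cosh (r x) * (v \<bullet> w + (p x \<bullet> v) * (p x \<bullet> w)) - Dp x v \<bullet> w)"
    unfolding dFf dN0_def dr_def lor_def tp
    by (simp add: inner_add_left inner_add_right inner_diff_left px xx xw vx wx Dp_inner[OF x] power2_eq_square algebra_simps)
  finally show ?thesis by simp
qed

lemma fform1_formula:
  assumes x: "norm x = 1" and rr: "\<forall>x. norm x = 1 \<longrightarrow> radf \<rho> u x = r x"
  shows "fform1 \<rho> u x = rk ((sinh (r x))\<^sup>2) (1 - (sinh (r x))\<^sup>2) x ((sinh (r x))\<^sup>2) (p x)"
proof -
  have xx: "x \<bullet> x = 1" using x by (simp add: dot_square_norm)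
  have px: "p x \<bullet> x = 0" "x \<bullet> p x = 0" using p_tangent[OF x] by (auto simp: inner_commute)
  have cs: "(cosh (r x))\<^sup>2 = 1 + (sinh (r x))\<^sup>2" by (simp add: cosh_square_eq)
  have tx: "tproj x v \<bullet> x = 0" "x \<bullet> tproj x v = 0" "p x \<bullet> tproj x v = p x \<bullet> v" for v
    using xx px by (auto simp: tproj_def inner_diff_left inner_diff_right inner_commute)
  have tt: "tproj x (tproj x v) = tproj x v" for v using tx(1)[of v] by (simp add: tproj_def)
  have tab: "tproj x a \<bullet> tproj x b = a \<bullet> b - (a \<bullet> x) * (b \<bullet> x)" for a b
    using xx by (simp add: tproj_def inner_diff_left inner_diff_right inner_commute algebra_simps)
  have ta: "tproj x (axis i 1) \<bullet> tproj x (axis j 1) = (if i = j then 1 else 0) - x $ i * x $ j" for i j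
  proof -
    have a: "axis i (1::real) \<bullet> axis j 1 = (if i = j then 1 else 0)" by (simp add: inner_axis_axis)
    have b: "axis k (1::real) \<bullet> x = x $ k" for k by (simp add: inner_axis')
    show ?thesis by (simp only: tab a b)
  qed
  have "lor (dF \<rho> u x (tproj x (axis i 1))) (dF \<rho> u x (tproj x (axis j 1)))
     = (sinh (r x))\<^sup>2 * ((if i = j then 1 else 0) - x $ i * x $ j + p x $ i * p x $ j)" for i j
  proof -
    have "lor (dF \<rho> u x (tproj x (axis i 1))) (dF \<rho> u x (tproj x (axis j 1)))
      = (sinh (r x))\<^sup>2 * ((p x $ i * p x $ j) * ((cosh (r x))\<^sup>2 - (sinh (r x))\<^sup>2) + tproj x (axis i 1) \<bullet> tproj x (axis j 1))"
      unfolding dF_formula[OF x rr] lor_def tt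
      by (simp add: inner_add_left inner_add_right tx xx inner_axis power2_eq_square algebra_simps)
    then show ?thesis by (simp add: cs ta algebra_simps)
  qed
  then show ?thesis
    by (simp add: fform1_def rk_def vec_eq_iff inner_axis' algebra_simps)
qed

lemma area_elem_formula:
  assumes x: "norm x = 1" and rr: "\<forall>x. norm x = 1 \<longrightarrow> radf \<rho> u x = r x"
  shows "area_elem \<rho> u x = sinh (r x) ^ (CARD('n) - 1) * sqrt (1 + p x \<bullet> p x)"
proof -
  have sp: "sinh (r x) > 0" using r_pos[OF x] by simp
  show ?thesis unfolding area_elem_def fform1_formula[OF x rr] det_first_form[OF x p_tangent[OF x] sp]
    using sp by (simp add: real_sqrt_mult)
qed

text \<open>The bracket multiplied by \<open>W\<close> is n cosh / v minus the divergence of p / v,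
  with the derivative of 1 / v written out; \<open>CARD('n) - 1\<close> is n. The added direction
  \<open>x\<close> does not disturb the trace, since the second form annihilates it.\<close>

lemma mean_curv_formula:
  assumes x: "norm x = 1" and rr: "\<forall>x. norm x = 1 \<longrightarrow> radf \<rho> u x = r x"
  shows "mean_curv \<rho> u x = W x / sinh (r x) *
     ((real CARD('n) - 1) * cosh (r x) - div_at (Dp x) + (W x)\<^sup>2 * (Dp x (p x) \<bullet> p x))"
proof -
  have sp: "sinh (r x) > 0" using r_pos[OF x] by simp
  have xx: "x \<bullet> x = 1" using x by (simp add: dot_square_norm)
  have px: "p x \<bullet> x = 0" "x \<bullet> p x = 0" using p_tangent[OF x] by (auto simp: inner_commute)
  let ?F = "fform2 \<rho> u x" and ?t = "tproj x" and ?s = "sinh (r x)" and ?c = "cosh (r x)" and ?q = "p x \<bullet> p x"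
  have tx: "?t v \<bullet> x = 0" for v using xx by (auto simp: tproj_def inner_diff_left)
  have lt: "linear ?t"
    unfolding linear_iff tproj_def by (simp add: inner_add_left algebra_simps)
  have lD: "linear (\<lambda>v. Dp x (?t v))" using linear_compose[OF lt Dp_linear[OF x]] by (simp add: o_def)
  have lp: "linear (\<lambda>v. p x \<bullet> ?t v)" using lt by (simp add: linear_iff inner_add_right)
  have tp: "?t (p x) = p x" "?t x = 0" using px xx by (auto simp: tproj_def)
  have Fij: "?F $ i $ j = W x * ?s * (?c * (?t (axis i 1) \<bullet> ?t (axis j 1) + (p x \<bullet> ?t (axis i 1)) \<bullet> (p x \<bullet> ?t (axis j 1)))
      - Dp x (?t (axis i 1)) \<bullet> ?t (axis j 1))" for i j
    unfolding fform2_def using lor_dN_dF[OF x rr tx tx] by simp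
  have quad: "(\<Sum>i\<in>UNIV. \<Sum>j\<in>UNIV. z $ i * z $ j * ?F $ j $ i) = W x * ?s * (?c * (?t z \<bullet> ?t z + (p x \<bullet> ?t z)\<^sup>2) - Dp x (?t z) \<bullet> ?t z)" for z
  proof -
    have "(\<Sum>i\<in>UNIV. \<Sum>j\<in>UNIV. z $ i * z $ j * ?F $ j $ i) = W x * ?s * (?c *
       ((\<Sum>i\<in>UNIV. \<Sum>j\<in>UNIV. z $ i * z $ j * (?t (axis j 1) \<bullet> ?t (axis i 1)))
      + (\<Sum>i\<in>UNIV. \<Sum>j\<in>UNIV. z $ i * z $ j * ((p x \<bullet> ?t (axis j 1)) \<bullet> (p x \<bullet> ?t (axis i 1)))))
      - (\<Sum>i\<in>UNIV. \<Sum>j\<in>UNIV. z $ i * z $ j * (Dp x (?t (axis j 1)) \<bullet> ?t (axis i 1))))"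
      unfolding Fij by (simp add: sum_distrib_left sum.distrib[symmetric] sum_subtractf[symmetric] algebra_simps)
    then show ?thesis
      unfolding sum_form_axis[OF lt lt] sum_form_axis[OF lp lp] sum_form_axis[OF lD lt] by (simp add: power2_eq_square)
  qed
  have tr: "trace ?F = W x * ?s * (?c * (real CARD('n) - 1 + ?q) - div_at (Dp x))"
  proof -
    have t1: "(\<Sum>i\<in>UNIV. ?t (axis i 1) \<bullet> ?t (axis i 1)) = real CARD('n) - 1"
    proof -
      have "?t (axis i 1) \<bullet> ?t (axis i 1) = ?t (axis i 1) $ i" for i
      proof -
        have "?t (axis i 1) \<bullet> ?t (axis i 1) = ?t (axis i 1) \<bullet> axis i 1"
          using tx[of "axis i 1"] unfolding tproj_def[of x "axis i 1"] by (subst inner_diff_right) simp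
        then show ?thesis by (simp add: inner_axis)
      qed
      then show ?thesis using div_at_tproj[OF x] by (simp add: div_at_def)
    qed
    have t2: "(\<Sum>i\<in>UNIV. (p x \<bullet> ?t (axis i 1)) \<bullet> (p x \<bullet> ?t (axis i 1))) = ?q"
    proof -
      have "p x \<bullet> ?t (axis i 1) = p x $ i" for i by (simp add: tproj_def inner_diff_right px inner_axis)
      then show ?thesis by (simp add: inner_vec_def)
    qed
    have t3: "(\<Sum>i\<in>UNIV. Dp x (?t (axis i 1)) \<bullet> ?t (axis i 1)) = div_at (Dp x)"
    proof -
      have a: "Dp x (?t v) = Dp x v" for v
        using Dp_linear[OF x] Dp_radial[OF x] by (simp add: tproj_def linear_diff linear_cmul)
      have "Dp x (?t (axis i 1)) \<bullet> ?t (axis i 1) = Dp x (axis i 1) $ i + x $ i * p x $ i" for i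
        unfolding a by (simp add: tproj_def inner_diff_right inner_axis inner_axis' Dp_inner[OF x])
      then have "(\<Sum>i\<in>UNIV. Dp x (?t (axis i 1)) \<bullet> ?t (axis i 1)) = div_at (Dp x) + x \<bullet> p x"
        by (simp add: sum.distrib div_at_def inner_vec_def)
      then show ?thesis by (simp add: px)
    qed
    have "trace ?F = W x * ?s * (?c * ((\<Sum>i\<in>UNIV. ?t (axis i 1) \<bullet> ?t (axis i 1)) + (\<Sum>i\<in>UNIV. (p x \<bullet> ?t (axis i 1)) \<bullet> (p x \<bullet> ?t (axis i 1))))
       - (\<Sum>i\<in>UNIV. Dp x (?t (axis i 1)) \<bullet> ?t (axis i 1)))"
      unfolding trace_def Fij by (simp add: sum_distrib_left sum.distrib[symmetric] sum_subtractf[symmetric] algebra_simps)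
    then show ?thesis unfolding t1 t2 t3 .
  qed
  \<comment> \<open>The contribution of the direction \<open>x\<close> vanishes because its
    tangential projection is zero.\<close>
  have qx: "W x * ?s * (?c * (?t x \<bullet> ?t x + (p x \<bullet> ?t x)\<^sup>2) - Dp x (?t x) \<bullet> ?t x) = 0"
    unfolding tp using Dp_linear[OF x] by (simp add: linear_0)
  have W2: "1 / (1 + ?q) = (W x)\<^sup>2"
  proof -
    have "1 + ?q > 0" using inner_ge_zero[of "p x"] by linarith
    then show ?thesis using W_sq[of x] by (simp add: field_simps)
  qed
  have "mean_curv \<rho> u x = trace (rk (1 / ?s\<^sup>2) (1 - 1 / ?s\<^sup>2) x (- (1 / ?s\<^sup>2) / (1 + ?q)) (p x) ** ?F)"
    unfolding mean_curv_def fform1_formula[OF x rr] inverse_first_form[OF x px(1) sp] ..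
  also have "\<dots> = (1 / ?s\<^sup>2) * (W x * ?s * (?c * (real CARD('n) - 1 + ?q) - div_at (Dp x)))
     - (1 / ?s\<^sup>2) * (1 / (1 + ?q)) * (W x * ?s * (?c * (?q + ?q\<^sup>2) - Dp x (p x) \<bullet> p x))"
    unfolding trace_rk_mult quad tr qx unfolding tp by simp
  also have "\<dots> = (1 / ?s\<^sup>2) * (W x * ?s) * ((?c * (real CARD('n) - 1 + ?q) - div_at (Dp x)) -
      (?c * ((W x)\<^sup>2 * (1 + ?q)) * ?q - (W x)\<^sup>2 * (Dp x (p x) \<bullet> p x)))"
    unfolding W2 by (simp add: algebra_simps power2_eq_square)
  also have "\<dots> = W x / ?s * ((real CARD('n) - 1) * ?c - div_at (Dp x) + (W x)\<^sup>2 * (Dp x (p x) \<bullet> p x))"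
    unfolding W_sq using sp by (simp add: power2_eq_square algebra_simps)
  finally show ?thesis .
qed

end

subsection \<open>Regularity and volume\<close>

text \<open>The classical argument with the second difference over a small parallelogram: the mean
  value theorem along either side identifies it with one of the two mixed derivatives. Only
  differentiability of the gradient at the single point \<open>x\<close> enters.\<close>

lemma symmetric_second_derivative:
  fixes f :: "'a::euclidean_space \<Rightarrow> real"
  assumes "open S" "x \<in> S"
    and f: "\<And>y. y \<in> S \<Longrightarrow> (f has_derivative (\<lambda>v. D y \<bullet> v)) (at y)"
    and D: "(D has_derivative H) (at x)"
  shows "H v \<bullet> w = H w \<bullet> v"
proof -
  have lin: "linear H" using D has_derivative_linear by blast
  obtain \<delta>0 where \<delta>0: "\<delta>0 > 0" "ball x \<delta>0 \<subseteq> S" using assms(1,2) by (meson openE)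
  define m where "m = norm v + norm w + 1"
  have m: "m > 0" "norm v \<le> m" "norm w \<le> m" "norm v + norm w < m"
    using norm_ge_zero[of v] norm_ge_zero[of w] unfolding m_def by linarith+
  have key: "\<bar>H w \<bullet> v - H v \<bullet> w\<bar> \<le> \<eta> * (6 * m * m)" if eta: "\<eta> > 0" for \<eta>
  proof -
    obtain \<delta>1 where \<delta>1: "\<delta>1 > 0" "\<And>y. norm (y - x) < \<delta>1 \<Longrightarrow> norm (D y - D x - H (y - x)) \<le> \<eta> * norm (y - x)"
      using D eta unfolding has_derivative_at_alt by blast
    define t where "t = min \<delta>0 \<delta>1 / (2 * m)"
    have t: "t > 0" using \<delta>0 \<delta>1 m by (simp add: t_def)
    have tm: "t * m < \<delta>0" "t * m < \<delta>1"
      using m \<delta>0 \<delta>1 by (auto simp: t_def min_def field_simps)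
    have near: "norm (a *\<^sub>R v + b *\<^sub>R w) \<le> t * m" if "0 \<le> a" "a \<le> t" "0 \<le> b" "b \<le> t" for a b
    proof -
      have "norm (a *\<^sub>R v + b *\<^sub>R w) \<le> a * norm v + b * norm w"
        using norm_triangle_ineq[of "a *\<^sub>R v" "b *\<^sub>R w"] that by simp
      also have "\<dots> \<le> t * norm v + t * norm w" using that by (intro add_mono mult_right_mono) auto
      also have "\<dots> \<le> t * m" using t m by (simp add: distrib_left[symmetric])
      finally show ?thesis .
    qed
    have Dn: "norm (D (x + d) - D x - H d) \<le> \<eta> * (t * m)" if "norm d \<le> t * m" for d
    proof -
      have "norm (D (x + d) - D x - H d) \<le> \<eta> * norm d" using \<delta>1(2)[of "x + d"] that tm by simp
      also have "\<dots> \<le> \<eta> * (t * m)" using that eta by (intro mult_left_mono) auto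
      finally show ?thesis .
    qed
    \<comment> \<open>This expression is symmetric in \<open>v\<close> and \<open>w\<close>, so
      \<open>one\<close> applies to it in both orders.\<close>
    define \<Delta> where "\<Delta> = f (x + t *\<^sub>R v + t *\<^sub>R w) - f (x + t *\<^sub>R v) - f (x + t *\<^sub>R w) + f x"
    have one: "\<bar>\<Delta> - t * t * (H b \<bullet> a)\<bar> \<le> t * (3 * \<eta> * (t * m) * m)"
      if ab: "(a = v \<and> b = w) \<or> (a = w \<and> b = v)" for a b
    proof -
      have nr: "norm (s *\<^sub>R a + s' *\<^sub>R b) \<le> t * m" if "0 \<le> s" "s \<le> t" "0 \<le> s'" "s' \<le> t" for s s'
        using ab near[of s s'] near[of s' s] that by (auto simp: add.commute)
      have mem: "x + (s *\<^sub>R a + s' *\<^sub>R b) \<in> S" if "0 \<le> s" "s \<le> t" "0 \<le> s'" "s' \<le> t" for s s'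
      proof -
        have "x + (s *\<^sub>R a + s' *\<^sub>R b) \<in> ball x \<delta>0" proof -
          have dd: "dist x (x + d) = norm d" for d by (simp add: dist_norm)
          show ?thesis unfolding mem_ball dd using nr[OF that] tm by linarith
        qed
        then show ?thesis using \<delta>0(2) by blast
      qed
      have \<Delta>: "\<Delta> = (f (x + (t *\<^sub>R a + t *\<^sub>R b)) - f (x + (t *\<^sub>R a + 0 *\<^sub>R b))) - (f (x + (0 *\<^sub>R a + t *\<^sub>R b)) - f (x + (0 *\<^sub>R a + 0 *\<^sub>R b)))"
        using ab by (auto simp: \<Delta>_def algebra_simps)
      have der: "((\<lambda>s. f (x + (s *\<^sub>R a + s' *\<^sub>R b))) has_real_derivative D (x + (s *\<^sub>R a + s' *\<^sub>R b)) \<bullet> a) (at s)"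
        if "0 \<le> s" "s \<le> t" "0 \<le> s'" "s' \<le> t" for s s'
      proof -
        have "((\<lambda>s. x + (s *\<^sub>R a + s' *\<^sub>R b)) has_derivative (\<lambda>h. h *\<^sub>R a)) (at s)"
          by (auto intro!: derivative_eq_intros)
        from has_derivative_compose[OF this f[OF mem[OF that]]] show ?thesis
          unfolding has_field_derivative_def by (rule has_derivative_eq_rhs) (simp add: fun_eq_iff mult.commute)
      qed
      have "\<exists>s. s > 0 \<and> s < t \<and> \<Delta> = (t - 0) * (D (x + (s *\<^sub>R a + t *\<^sub>R b)) \<bullet> a - D (x + (s *\<^sub>R a + 0 *\<^sub>R b)) \<bullet> a)"
        unfolding \<Delta>
      proof (rule MVT2[where f="\<lambda>s. f (x + (s *\<^sub>R a + t *\<^sub>R b)) - f (x + (s *\<^sub>R a + 0 *\<^sub>R b))", OF t])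
        fix s :: real assume s: "0 \<le> s" "s \<le> t"
        show "((\<lambda>s. f (x + (s *\<^sub>R a + t *\<^sub>R b)) - f (x + (s *\<^sub>R a + 0 *\<^sub>R b))) has_real_derivative
          D (x + (s *\<^sub>R a + t *\<^sub>R b)) \<bullet> a - D (x + (s *\<^sub>R a + 0 *\<^sub>R b)) \<bullet> a) (at s)"
          using s t by (intro DERIV_diff der) auto
      qed
      then obtain s where s: "0 < s" "s < t" "\<Delta> = t * ((D (x + (s *\<^sub>R a + t *\<^sub>R b)) - D (x + (s *\<^sub>R a + 0 *\<^sub>R b))) \<bullet> a)"
        by (auto simp: inner_diff_left)
      let ?e1 = "D (x + (s *\<^sub>R a + t *\<^sub>R b)) - D x - H (s *\<^sub>R a + t *\<^sub>R b)"
      let ?e2 = "D (x + (s *\<^sub>R a + 0 *\<^sub>R b)) - D x - H (s *\<^sub>R a + 0 *\<^sub>R b)"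
      have "D (x + (s *\<^sub>R a + t *\<^sub>R b)) - D (x + (s *\<^sub>R a + 0 *\<^sub>R b)) = t *\<^sub>R H b + (?e1 - ?e2)"
        using lin by (simp add: linear_add linear_cmul)
      then have "\<Delta> - t * t * (H b \<bullet> a) = t * ((?e1 - ?e2) \<bullet> a)"
        unfolding s(3) by (simp only: inner_add_left) (simp add: algebra_simps)
      also have "\<bar>\<dots>\<bar> \<le> t * (norm (?e1 - ?e2) * norm a)"
        using t Cauchy_Schwarz_ineq2[of "?e1 - ?e2" a] by (simp only: abs_mult) simp
      also have "\<dots> \<le> t * ((\<eta> * (t * m) + \<eta> * (t * m)) * m)"
      proof (intro mult_left_mono mult_mono)
        show "norm (?e1 - ?e2) \<le> \<eta> * (t * m) + \<eta> * (t * m)"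
        proof -
          have "norm ?e1 \<le> \<eta> * (t * m)" by (rule Dn, rule nr) (use s t in auto)
          moreover have "norm ?e2 \<le> \<eta> * (t * m)" by (rule Dn, rule nr) (use s t in auto)
          ultimately show ?thesis using norm_triangle_ineq4[of ?e1 ?e2] by linarith
        qed
        show "norm a \<le> m" using ab m by auto
      qed (use t eta m in auto)
      also have "\<dots> \<le> t * (3 * \<eta> * (t * m) * m)"
        using t eta m by (intro mult_left_mono mult_right_mono) (auto simp: algebra_simps)
      finally show ?thesis .
    qed
    have "\<bar>t * t * (H w \<bullet> v) - t * t * (H v \<bullet> w)\<bar> \<le> 2 * (t * (3 * \<eta> * (t * m) * m))"
      using one[of v w] one[of w v] by simp
    also have "t * t * (H w \<bullet> v) - t * t * (H v \<bullet> w) = (t * t) * (H w \<bullet> v - H v \<bullet> w)" by (simp add: algebra_simps)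
    also have "\<bar>\<dots>\<bar> = (t * t) * \<bar>H w \<bullet> v - H v \<bullet> w\<bar>" using t by (simp add: abs_mult)
    also have "2 * (t * (3 * \<eta> * (t * m) * m)) = (t * t) * (\<eta> * (6 * m * m))" by (simp add: algebra_simps)
    finally show ?thesis using t by (simp add: mult_le_cancel_left_pos)
  qed
  have "\<bar>H w \<bullet> v - H v \<bullet> w\<bar> \<le> 0"
  proof (rule field_le_epsilon)
    fix e :: real assume e: "e > 0"
    have "6 * m * m > 0" using m by simp
    then show "\<bar>H w \<bullet> v - H v \<bullet> w\<bar> \<le> 0 + e" using key[of "e / (6 * m * m)"] e m(1) by simp
  qed
  then show ?thesis by simp
qed

text \<open>\<open>D\<close> is the derivative of the 0-homogeneous extension of the gradient
  restricted to the sphere, hence the Hessian precomposed with the tangential projection. Symmetry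
  is therefore claimed for tangent vectors only.\<close>

lemma smooth_sphere_gradient:
  fixes u :: "real^'n \<Rightarrow> real"
  assumes "smooth_sphere u"
  shows "\<exists>\<Gamma> D. sgrad u \<Gamma> \<and> svec \<Gamma> D \<and>
     (\<forall>x v w. norm x = 1 \<longrightarrow> v \<bullet> x = 0 \<longrightarrow> w \<bullet> x = 0 \<longrightarrow> D x v \<bullet> w = D x w \<bullet> v)"
proof -
  let ?U = "hom_ext u" and ?S = "UNIV - {0::real^'n}"
  have oS: "open ?S" by auto
  have sm: "Ck_on k ?U ?S" for k using assms by (simp add: smooth_sphere_def smooth_on_def)
  define fd where "fd i y = frechet_derivative ?U (at y) (axis i 1)" for i y
  have fd: "Ck_on k (fd i) ?S" for k i using sm[of "Suc k"] by (simp add: fd_def[abs_def])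
  define \<Gamma> where "\<Gamma> y = (\<chi> i. fd i y)" for y
  define H where "H y v = (\<chi> i. frechet_derivative (fd i) (at y) v)" for y v
  have U: "(?U has_derivative (\<lambda>v. \<Gamma> y \<bullet> v)) (at y)" if "y \<in> ?S" for y
  proof -
    have "?U differentiable_on ?S" using sm[of 1] by simp
    then have d: "(?U has_derivative frechet_derivative ?U (at y)) (at y)"
      using that oS by (metis differentiable_on_eq_differentiable_at frechet_derivative_works)
    then have lin: "linear (frechet_derivative ?U (at y))" using has_derivative_linear by blast
    have "frechet_derivative ?U (at y) v = \<Gamma> y \<bullet> v" for v
    proof -
      show ?thesis unfolding linear_axis_sum[OF lin, of v] by (simp add: \<Gamma>_def fd_def inner_vec_def mult.commute)
    qed
    then have "frechet_derivative ?U (at y) = (\<lambda>v. \<Gamma> y \<bullet> v)" by auto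
    then show ?thesis using d by simp
  qed
  have G: "(\<Gamma> has_derivative H y) (at y)" if "y \<in> ?S" for y
  proof -
    have "(fd i has_derivative frechet_derivative (fd i) (at y)) (at y)" for i
    proof -
      have "fd i differentiable_on ?S" using fd[of 1 i] by simp
      then show ?thesis using that oS by (metis differentiable_on_eq_differentiable_at frechet_derivative_works)
    qed
    then show ?thesis unfolding \<Gamma>_def H_def
      by (subst has_derivative_componentwise_within)
         (auto simp: Basis_vec_def inner_axis)
  qed
  have cH: "continuous_on ?S (\<lambda>y. H y v)" for v
  proof -
    have "continuous_on ?S (\<lambda>y. frechet_derivative (fd i) (at y) v)" for i using fd[of 1 i] by simp
    then show ?thesis unfolding H_def by (intro continuous_intros)
  qed
  have sub: "sphere 0 1 \<subseteq> ?S" by auto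
  have cHS: "continuous_on (sphere 0 1) (\<lambda>y. H y v)" for v by (rule continuous_on_subset[OF cH sub])
  have linH: "linear (H y)" if "y \<in> ?S" for y using G[OF that] has_derivative_linear by blast
  have "sgrad u \<Gamma>"
    unfolding sgrad_def
  proof (intro conjI ballI)
    show "continuous_on (sphere 0 1) \<Gamma>"
      using G sub by (intro continuous_at_imp_continuous_on ballI) (blast intro: has_derivative_continuous)
    show "(?U has_derivative (\<lambda>v. \<Gamma> x \<bullet> v)) (at x)" if "x \<in> sphere 0 1" for x
    proof -
      have "x \<in> ?S" using that by auto
      then show ?thesis by (rule U)
    qed
  qed
  moreover have "svec \<Gamma> (\<lambda>x v. H x (tproj x v))"
    unfolding svec_def
  proof (intro conjI ballI allI)
    show "(hom_ext \<Gamma> has_derivative (\<lambda>v. H x (tproj x v))) (at x)" if "x \<in> sphere 0 1" for x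
      using that by (intro has_derivative_hom_ext G) auto
    fix v
    have "H x (tproj x v) = H x v - (v \<bullet> x) *\<^sub>R (\<Sum>j\<in>UNIV. x $ j *\<^sub>R H x (axis j 1))" if "x \<in> sphere 0 1" for x
    proof -
      have "x \<in> ?S" using that by auto
      then have l: "linear (H x)" by (rule linH)
      show ?thesis using l unfolding linear_axis_sum[OF l, of x, symmetric] by (simp add: tproj_def linear_diff linear_cmul)
    qed
    moreover have "continuous_on (sphere 0 1) (\<lambda>x. H x v - (v \<bullet> x) *\<^sub>R (\<Sum>j\<in>UNIV. x $ j *\<^sub>R H x (axis j 1)))"
      using cHS by (intro continuous_intros) auto
    ultimately show "continuous_on (sphere 0 1) (\<lambda>x. H x (tproj x v))"
      using continuous_on_eq by fastforce
  qed
  moreover have "H x (tproj x v) \<bullet> w = H x (tproj x w) \<bullet> v" if "norm x = 1" "v \<bullet> x = 0" "w \<bullet> x = 0" for x v w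
  proof -
    have x: "x \<in> ?S" using that(1) by auto
    have "H x v \<bullet> w = H x w \<bullet> v" by (rule symmetric_second_derivative[OF oS x U G[OF x]])
    then show ?thesis using that by (simp add: tproj_def)
  qed
  ultimately show ?thesis by blast
qed

text \<open>The operator norm of a linear form equals the norm of its gradient vector, and both
  suprema are nonnegative, so each of them is at most their sum.\<close>

lemma C1_norm_sphere_bound:
  fixes u :: "real^'n \<Rightarrow> real"
  assumes u: "sgrad u \<Gamma>" and e: "C1_norm_sphere u < \<epsilon>" and x: "x \<in> sphere 0 1"
  shows "\<bar>u x\<bar> < \<epsilon>" "norm (\<Gamma> x) < \<epsilon>"
proof -
  let ?S = "sphere (0::real^'n) 1"
  have cu: "continuous_on ?S u" and cG: "continuous_on ?S \<Gamma>"
    using sgrad_continuous[OF u] u by (auto simp: sgrad_def)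
  have bdd: "bdd_above (h ` ?S)" if "continuous_on ?S h" for h :: "real^'n \<Rightarrow> real"
    by (intro bounded_imp_bdd_above compact_imp_bounded compact_continuous_image that compact_sphere)
  have fr: "frechet_derivative (hom_ext u) (at y) = (\<lambda>v. \<Gamma> y \<bullet> v)" if "y \<in> ?S" for y
    using u that frechet_derivative_at[symmetric] unfolding sgrad_def by blast
  have on: "onorm (\<lambda>v. \<Gamma> y \<bullet> v) = norm (\<Gamma> y)" for y
  proof (rule antisym)
    show "onorm (\<lambda>v. \<Gamma> y \<bullet> v) \<le> norm (\<Gamma> y)"
      by (rule onorm_bound) (auto simp: Cauchy_Schwarz_ineq2)
    show "norm (\<Gamma> y) \<le> onorm (\<lambda>v. \<Gamma> y \<bullet> v)"
    proof (cases "\<Gamma> y = 0")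
      case True then show ?thesis by (simp add: onorm_zero)
    next
      case False
      have "norm (\<Gamma> y \<bullet> \<Gamma> y) \<le> onorm (\<lambda>v. \<Gamma> y \<bullet> v) * norm (\<Gamma> y)"
        by (rule onorm) (rule bounded_linear_inner_right)
      then have "norm (\<Gamma> y) * norm (\<Gamma> y) \<le> onorm (\<lambda>v. \<Gamma> y \<bullet> v) * norm (\<Gamma> y)"
        by (simp add: dot_square_norm power2_eq_square)
      then show ?thesis using False by simp
    qed
  qed
  have eq: "C1_norm_sphere u = (SUP x\<in>?S. \<bar>u x\<bar>) + (SUP x\<in>?S. norm (\<Gamma> x))"
  proof -
    have "(SUP x\<in>?S. onorm (frechet_derivative (hom_ext u) (at x))) = (SUP x\<in>?S. norm (\<Gamma> x))"
      by (rule SUP_cong[OF refl]) (simp only: fr on)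
    then show ?thesis by (simp only: C1_norm_sphere_def)
  qed
  have 1: "\<bar>u x\<bar> \<le> (SUP x\<in>?S. \<bar>u x\<bar>)" using cu x by (intro cSUP_upper bdd continuous_intros)
  have 2: "norm (\<Gamma> x) \<le> (SUP x\<in>?S. norm (\<Gamma> x))" using cG x by (intro cSUP_upper bdd continuous_intros)
  show "\<bar>u x\<bar> < \<epsilon>" "norm (\<Gamma> x) < \<epsilon>"
    using 1 2 e eq abs_ge_zero[of "u x"] norm_ge_zero[of "\<Gamma> x"] by linarith+
qed

text \<open>The weight \<open>cosh\<close> makes the radial integrand the exact derivative of
  \<open>sinh r ^ CARD('n) / CARD('n)\<close>. Nothing is prescribed at radius \<open>R x\<close>
  itself, so one statement serves the open domain and the closed ball.\<close>

lemma weighted_volume_star: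
  fixes R :: "real^'n \<Rightarrow> real"
  assumes R: "continuous_on (sphere 0 1) R" "\<And>x. norm x = 1 \<Longrightarrow> R x > 0"
    and A: "A \<in> sets borel"
      "\<And>x t. norm x = 1 \<Longrightarrow> 0 < t \<Longrightarrow> t < R x \<Longrightarrow> t *\<^sub>R x \<in> A"
      "\<And>x t. norm x = 1 \<Longrightarrow> R x < t \<Longrightarrow> t *\<^sub>R x \<notin> A"
  shows "(LINT y:A|hvol. cosh (norm y)) = (LINT x|sphere_measure. sinh (R x) ^ CARD('n)) / real CARD('n)"
proof -
  let ?k = "CARD('n) - 1" and ?N = "CARD('n)"
  have N: "Suc ?k = ?N" by simp
  have [measurable]: "sinhc \<in> borel_measurable borel"
  proof -
    have "(\<lambda>r::real. sinh r / r) \<in> borel_measurable borel"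
      by (intro borel_measurable_divide borel_measurable_continuous_onI continuous_intros)
    then show ?thesis unfolding sinhc_def[abs_def] by measurable
  qed
  have sp: "sinhc r \<ge> 0" for r
    by (cases "r > 0") (auto simp: sinhc_def divide_nonneg_pos divide_nonpos_neg)
  have chm: "(\<lambda>y::real^'n. cosh (norm y)) \<in> borel_measurable borel"
    by (intro borel_measurable_continuous_onI continuous_intros)
  have fm: "(\<lambda>y. sinhc (norm y) ^ ?k * (indicator A y * cosh (norm y))) \<in> borel_measurable borel"
    using chm A(1) by measurable
  have "(LINT y:A|hvol. cosh (norm y)) = (LINT y|lborel. sinhc (norm y) ^ ?k * (indicator A y * cosh (norm y)))"
    unfolding set_lebesgue_integral_def hvol_def using sp A(1) chm by (subst integral_density) auto
  also have "\<dots> = enn2real (\<integral>\<^sup>+y. ennreal (sinhc (norm y) ^ ?k * (indicator A y * cosh (norm y))) \<partial>lborel)"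
    using fm sp by (intro integral_eq_nn_integral) auto
  also have "(\<integral>\<^sup>+y. ennreal (sinhc (norm y) ^ ?k * (indicator A y * cosh (norm y))) \<partial>lborel)
    = (\<integral>\<^sup>+x. (\<integral>\<^sup>+r. ennreal (r ^ ?k) * indicator {0<..} r *
         ennreal (sinhc (norm (r *\<^sub>R x)) ^ ?k * (indicator A (r *\<^sub>R x) * cosh (norm (r *\<^sub>R x)))) \<partial>lborel) \<partial>sphere_measure)"
    using fm by (intro polar_nn_integral) simp
  also have "\<dots> = (\<integral>\<^sup>+x. ennreal (sinh (R x) ^ ?N / real ?N) \<partial>sphere_measure)"
  proof (rule nn_integral_cong)
    fix x assume "x \<in> space (sphere_measure :: (real^'n) measure)"
    then have x: "norm x = 1" by simp
    have "(\<integral>\<^sup>+r. ennreal (r ^ ?k) * indicator {0<..} r *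
         ennreal (sinhc (norm (r *\<^sub>R x)) ^ ?k * (indicator A (r *\<^sub>R x) * cosh (norm (r *\<^sub>R x)))) \<partial>lborel)
       = (\<integral>\<^sup>+r. ennreal (sinh r ^ ?k * cosh r) * indicator {0..R x} r \<partial>lborel)"
    proof (rule nn_integral_cong_AE)
      show "AE r in lborel. ennreal (r ^ ?k) * indicator {0<..} r *
         ennreal (sinhc (norm (r *\<^sub>R x)) ^ ?k * (indicator A (r *\<^sub>R x) * cosh (norm (r *\<^sub>R x))))
        = ennreal (sinh r ^ ?k * cosh r) * indicator {0..R x} r"
        using AE_lborel_singleton[of 0] AE_lborel_singleton[of "R x"]
      proof eventually_elim
        case (elim r)
        consider "r < 0" | "0 < r \<and> r < R x" | "R x < r" using elim by linarith
        then show ?case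
        proof cases
          case 2
          have "ennreal (r ^ ?k) * ennreal (sinhc r ^ ?k * cosh r) = ennreal (sinh r ^ ?k * cosh r)"
            using 2 sp[of r] by (subst ennreal_mult[symmetric]) (auto simp: sinhc_def power_divide)
          then show ?thesis using 2 A(2)[OF x, of r] x by simp
        qed (use A(3)[OF x, of r] R(2)[OF x] in auto)
      qed
    qed
    also have "\<dots> = ennreal (sinh (R x) ^ ?N / real ?N - sinh 0 ^ ?N / real ?N)"
    proof -
      have m: "(\<lambda>r::real. sinh r ^ ?k * cosh r) \<in> borel_measurable borel"
        by (intro borel_measurable_continuous_onI continuous_intros)
      have nn: "0 \<le> sinh r ^ ?k * cosh r" if "0 \<le> r" for r :: real using that by simp
      have "((\<lambda>r. sinh r ^ Suc ?k / real (Suc ?k)) has_real_derivative sinh r ^ ?k * cosh r) (at r)" for r :: real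
        by (rule derivative_eq_intros refl | simp)+
      then have d: "((\<lambda>r. sinh r ^ ?N / real ?N) has_real_derivative sinh r ^ ?k * cosh r) (at r)" for r :: real
        by (simp only: N)
      show ?thesis
        by (rule nn_integral_FTC_Icc[OF m d nn]) (use R(2)[OF x] in auto)
    qed
    finally show "(\<integral>\<^sup>+r. ennreal (r ^ ?k) * indicator {0<..} r *
         ennreal (sinhc (norm (r *\<^sub>R x)) ^ ?k * (indicator A (r *\<^sub>R x) * cosh (norm (r *\<^sub>R x)))) \<partial>lborel)
      = ennreal (sinh (R x) ^ ?N / real ?N)" by (simp only: sinh_0 zero_power[OF zero_less_card_finite] div_0 diff_zero)
  qed
  also have "\<dots> = ennreal (LINT x|sphere_measure. sinh (R x) ^ ?N / real ?N)"
  proof (rule nn_integral_eq_integral)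
    show "integrable sphere_measure (\<lambda>x. sinh (R x) ^ ?N / real ?N)"
      using R(1) by (intro integrable_sphere_measure continuous_intros) auto
    show "AE x in sphere_measure. 0 \<le> sinh (R x) ^ ?N / real ?N"
      by (rule AE_I2) (use R(2) in \<open>auto simp: less_imp_le\<close>)
  qed
  also have "enn2real \<dots> = (LINT x|sphere_measure. sinh (R x) ^ ?N / real ?N)"
  proof (rule enn2real_ennreal, rule Bochner_Integration.integral_nonneg)
    fix x assume "x \<in> space (sphere_measure :: (real^'n) measure)"
    then have "R x > 0" using R(2) by simp
    then show "0 \<le> sinh (R x) ^ ?N / real ?N" by simp
  qed
  also have "\<dots> = (LINT x|sphere_measure. sinh (R x) ^ ?N) / real ?N" by simp
  finally show ?thesis .
qed

subsection \<open>Removing second derivatives from the curvature integral\<close>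

lemma div_at_linear_form:
  assumes "linear l"
  shows "div_at (\<lambda>v. l v *\<^sub>R w) = l w"
  unfolding linear_axis_sum[OF assms, of w] by (simp add: div_at_def mult.commute)

lemma svec_apply_continuous:
  assumes V: "svec V DV" and w: "continuous_on (sphere 0 1) w"
  shows "continuous_on (sphere 0 1) (\<lambda>x. DV x (w x))"
proof -
  have "continuous_on (sphere 0 1) (\<lambda>x. \<Sum>j\<in>UNIV. w x $ j *\<^sub>R DV x (axis j 1))"
    using V w by (intro continuous_intros) (auto simp: svec_def)
  moreover have "(\<Sum>j\<in>UNIV. w x $ j *\<^sub>R DV x (axis j 1)) = DV x (w x)" if "x \<in> sphere 0 1" for x
  proof -
    have lin: "linear (DV x)" using V that has_derivative_linear unfolding svec_def by blast
    show ?thesis by (rule linear_axis_sum[OF lin, symmetric])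
  qed
  ultimately show ?thesis by (rule continuous_on_eq)
qed

lemma svec_div_continuous: "svec V DV \<Longrightarrow> continuous_on (sphere 0 1) (\<lambda>x. div_at (DV x))"
  unfolding svec_def div_at_def by (intro continuous_intros) auto

context radial_graph
begin

definition test_weight :: "real \<Rightarrow> (real^'n \<Rightarrow> real^'n) \<Rightarrow> real^'n \<Rightarrow> real" where
  "test_weight c P x = 1 + p x \<bullet> P x - c * (P x \<bullet> P x)"

text \<open>What remains of the curvature integrand after integration by parts. It contains
  \<open>p\<close>, \<open>P\<close> and the derivative of \<open>P\<close>, but no derivative of
  \<open>p\<close>.\<close>

definition lower_integrand where
  "lower_integrand K Kr c P DP x =
     (real CARD('n) - 1) * (K (r x) * cosh (r x)) * (test_weight c P x * W x)
     + Kr (r x) * sinh (r x) * (test_weight c P x * W x) * (p x \<bullet> p x)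
     + K (r x) * W x * (p x \<bullet> DP x (p x) - 2 * c * (P x \<bullet> DP x (p x)))
     - (sqrt (1 + p x \<bullet> p x) - 1) * (Kr (r x) * sinh (r x) * (p x \<bullet> P x) + K (r x) * div_at (DP x))"

lemma r_continuous: "continuous_on (sphere 0 1) r"
  by (rule sgrad_continuous[OF r_grad])

lemma p_continuous: "continuous_on (sphere 0 1) p"
  by (rule svec_continuous[OF p_deriv])

lemma W_continuous: "continuous_on (sphere 0 1) W"
  unfolding W_def
proof (intro continuous_intros p_continuous ballI)
  fix x show "sqrt (1 + p x \<bullet> p x) \<noteq> 0" using inner_ge_zero[of "p x"] by (simp add: add_nonneg_eq_0_iff)
qed

lemma compose_r_continuous:
  fixes F :: "real \<Rightarrow> real"
  assumes "continuous_on {0<..} F"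
  shows "continuous_on (sphere 0 1) (\<lambda>x. F (r x))"
  by (rule continuous_on_compose2[OF assms r_continuous]) (auto intro: r_pos)

text \<open>A flux along \<open>p\<close> removes the divergence of \<open>p\<close> and the
  derivative of \<open>W\<close>, but differentiating the test weight leaves a term pairing
  \<open>Dp x (p x)\<close> with \<open>P x\<close>. A second flux along \<open>P\<close> produces
  \<open>Dp x (P x)\<close> paired with \<open>p x\<close>, and symmetry of the Hessian makes the
  two cancel.\<close>

lemma curvature_flux_divergence:
  fixes K Kr :: "real \<Rightarrow> real" and P :: "real^'n \<Rightarrow> real^'n"
  assumes K: "\<And>t. t > 0 \<Longrightarrow> (K has_real_derivative Kr t) (at t)" "continuous_on {0<..} Kr"
    and sym: "\<And>x v w. norm x = 1 \<Longrightarrow> v \<bullet> x = 0 \<Longrightarrow> w \<bullet> x = 0 \<Longrightarrow> Dp x v \<bullet> w = Dp x w \<bullet> v"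
    and P: "svec P DP" "\<And>x. norm x = 1 \<Longrightarrow> P x \<bullet> x = 0"
  shows "(LINT x|sphere_measure. K (r x) * test_weight c P x * W x *
       ((real CARD('n) - 1) * cosh (r x) - div_at (Dp x) + (W x)\<^sup>2 * (Dp x (p x) \<bullet> p x)))
     = (LINT x|sphere_measure. lower_integrand K Kr c P DP x)"
    and "continuous_on (sphere 0 1) (lower_integrand K Kr c P DP)"
proof -
  let ?S = "sphere (0::real^'n) 1"
  let ?f = "test_weight c P"
  define v where "v x = sqrt (1 + p x \<bullet> p x)" for x
  note q1 = area_factor_pos
  have vpos: "v x > 0" for x using q1 by (simp add: v_def)
  have Wv: "W x = inverse (v x)" for x by (simp add: W_inverse v_def)
  have K_cont: "continuous_on {0<..} K"
    using K(1) by (intro continuous_at_imp_continuous_on ballI) (auto intro: DERIV_isCont)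
  have cP: "continuous_on ?S P" by (rule svec_continuous[OF P(1)])
  have cv: "continuous_on ?S v" unfolding v_def by (intro continuous_intros p_continuous)
  have cf: "continuous_on ?S ?f" unfolding test_weight_def by (intro continuous_intros p_continuous cP)
  have cK: "continuous_on ?S (\<lambda>x. K (r x))" by (rule compose_r_continuous[OF K_cont])
  have cKr: "continuous_on ?S (\<lambda>x. Kr (r x))" by (rule compose_r_continuous[OF K(2)])
  have cDp: "continuous_on ?S (\<lambda>x. Dp x v)" for v using p_deriv by (simp add: svec_def)
  have cDP: "continuous_on ?S (\<lambda>x. DP x v)" for v using P(1) by (simp add: svec_def)
  note cont = continuous_intros p_continuous r_continuous W_continuous cP cv cf cK cKr cDp cDP
    svec_apply_continuous[OF p_deriv p_continuous] svec_apply_continuous[OF P(1) p_continuous]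
    svec_div_continuous[OF p_deriv] svec_div_continuous[OF P(1)]
  show cl: "continuous_on ?S (lower_integrand K Kr c P DP)"
    unfolding lower_integrand_def[abs_def] v_def[symmetric] by (intro cont)
  define dK where "dK x w = Kr (r x) * (sinh (r x) * (p x \<bullet> w))" for x w
  define dv where "dv x w = (p x \<bullet> Dp x w + Dp x w \<bullet> p x) * (W x / 2)" for x w
  define dW where "dW x w = - (W x * dv x w * W x)" for x w
  define df where "df x w = (p x \<bullet> DP x w + Dp x w \<bullet> P x) - c * (P x \<bullet> DP x w + DP x w \<bullet> P x)" for x w
  define \<alpha> where "\<alpha> x = - (K (r x) * (?f x * W x))" for x
  define d\<alpha> where "d\<alpha> x w = - (K (r x) * (?f x * dW x w + df x w * W x) + dK x w * (?f x * W x))" for x w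
  \<comment> \<open>The derivative of \<open>v\<close> along \<open>P\<close> is the term needed for
    the cancellation. Subtracting the constant 1 leaves that derivative unchanged and makes the
    coefficient of the divergence of \<open>P\<close> quadratically small.\<close>
  define \<beta> where "\<beta> x = K (r x) * (v x - 1)" for x
  define d\<beta> where "d\<beta> x w = K (r x) * dv x w + dK x w * (v x - 1)" for x w
  define Y where "Y x = \<alpha> x *\<^sub>R p x + \<beta> x *\<^sub>R P x" for x
  define DY where "DY x w = (\<alpha> x *\<^sub>R Dp x w + d\<alpha> x w *\<^sub>R p x) + (\<beta> x *\<^sub>R DP x w + d\<beta> x w *\<^sub>R P x)" for x w
  have "(LINT x|sphere_measure. div_at (DY x)) = (real CARD('n) - 1) * (LINT x|sphere_measure. Y x \<bullet> x)"
  proof (rule divergence_theorem_sphere)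
    show "continuous_on ?S (\<lambda>x. DY x w)" for w
      unfolding DY_def \<alpha>_def d\<alpha>_def \<beta>_def d\<beta>_def dK_def dv_def dW_def df_def by (intro cont) auto
    fix x assume "x \<in> ?S"
    then have x: "norm x = 1" by simp
    have hx: "hom_ext r x = r x" "hom_ext p x = p x" "hom_ext P x = P x" using x by auto
    have Pd: "(hom_ext P has_derivative DP x) (at x)" using P(1) x by (simp add: svec_def)
    note pd = p_has_derivative[OF x]
    have HK: "((\<lambda>y. K (hom_ext r y)) has_derivative dK x) (at x)"
    proof -
      have "(K has_derivative (\<lambda>h. Kr (r x) * h)) (at (hom_ext r x))"
        using K(1)[OF r_pos[OF x]] hx by (simp add: has_field_derivative_def)
      from has_derivative_compose[OF r_has_derivative[OF x] this] show ?thesis by (simp add: dK_def[abs_def])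
    qed
    have Hv: "((\<lambda>y. sqrt (1 + hom_ext p y \<bullet> hom_ext p y)) has_derivative dv x) (at x)"
      using area_factor_has_derivative[OF x] by (simp add: dv_def[abs_def])
    have HW: "((\<lambda>y. inverse (sqrt (1 + hom_ext p y \<bullet> hom_ext p y))) has_derivative dW x) (at x)"
      using area_factor_inverse_has_derivative[OF x] by (simp add: dW_def[abs_def] dv_def)
    have Hf: "((\<lambda>y. 1 + hom_ext p y \<bullet> hom_ext P y - c * (hom_ext P y \<bullet> hom_ext P y)) has_derivative df x) (at x)"
    proof -
      have "((\<lambda>y. 1 + hom_ext p y \<bullet> hom_ext P y - c * (hom_ext P y \<bullet> hom_ext P y)) has_derivative
        (\<lambda>v. 0 + (hom_ext p x \<bullet> DP x v + Dp x v \<bullet> hom_ext P x) - c * (hom_ext P x \<bullet> DP x v + DP x v \<bullet> hom_ext P x))) (at x)"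
        by (intro has_derivative_diff has_derivative_add has_derivative_const has_derivative_inner pd Pd has_derivative_mult_right)
      then show ?thesis unfolding hx by (simp add: df_def[abs_def])
    qed
    have A: "((\<lambda>y. - (K (hom_ext r y) * ((1 + hom_ext p y \<bullet> hom_ext P y - c * (hom_ext P y \<bullet> hom_ext P y)) * inverse (sqrt (1 + hom_ext p y \<bullet> hom_ext p y)))))
       has_derivative d\<alpha> x) (at x)"
      using has_derivative_minus[OF has_derivative_mult[OF HK has_derivative_mult[OF Hf HW]]] unfolding hx
      by (simp add: d\<alpha>_def[abs_def] Wv v_def test_weight_def)
    have B: "((\<lambda>y. K (hom_ext r y) * (sqrt (1 + hom_ext p y \<bullet> hom_ext p y) - 1)) has_derivative d\<beta> x) (at x)"
      using has_derivative_mult[OF HK has_derivative_diff[OF Hv has_derivative_const]] unfolding hx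
      by (simp add: d\<beta>_def[abs_def] v_def)
    have "((\<lambda>y. (- (K (hom_ext r y) * ((1 + hom_ext p y \<bullet> hom_ext P y - c * (hom_ext P y \<bullet> hom_ext P y)) * inverse (sqrt (1 + hom_ext p y \<bullet> hom_ext p y))))) *\<^sub>R hom_ext p y
        + (K (hom_ext r y) * (sqrt (1 + hom_ext p y \<bullet> hom_ext p y) - 1)) *\<^sub>R hom_ext P y) has_derivative DY x) (at x)"
      using has_derivative_add[OF has_derivative_scaleR[OF A pd] has_derivative_scaleR[OF B Pd]] unfolding hx
      by (simp add: DY_def[abs_def] \<alpha>_def \<beta>_def Wv v_def test_weight_def)
    then show "(hom_ext Y has_derivative DY x) (at x)"
      by (simp add: hom_ext_def[abs_def] Y_def \<alpha>_def \<beta>_def Wv v_def test_weight_def)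
  qed
  also have "(LINT x|sphere_measure. Y x \<bullet> x) = (LINT x|(sphere_measure :: (real^'n) measure). 0)"
    by (intro Bochner_Integration.integral_cong refl) (simp add: Y_def inner_add_left P(2) p_tangent)
  finally have zero: "(LINT x|sphere_measure. div_at (DY x)) = 0" by simp
  have div: "div_at (DY x) = K (r x) * ?f x * W x *
       ((real CARD('n) - 1) * cosh (r x) - div_at (Dp x) + (W x)\<^sup>2 * (Dp x (p x) \<bullet> p x)) - lower_integrand K Kr c P DP x"
    if x: "norm x = 1" for x
  proof -
    have lD: "linear (Dp x)" by (rule Dp_linear[OF x])
    have lP: "linear (DP x)" using P(1) x has_derivative_linear unfolding svec_def by fastforce
    have ldv: "linear (dv x)" using lD unfolding dv_def linear_iff by (simp add: inner_add_left inner_add_right algebra_simps)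
    have ldK: "linear (dK x)" unfolding dK_def linear_iff by (simp add: inner_add_right algebra_simps)
    have ldf: "linear (df x)" using lD lP unfolding df_def linear_iff by (simp add: inner_add_left inner_add_right algebra_simps)
    have la: "linear (d\<alpha> x)" using ldv ldK ldf unfolding d\<alpha>_def dW_def linear_iff by (simp add: algebra_simps)
    have lb: "linear (d\<beta> x)" using ldv ldK unfolding d\<beta>_def linear_iff by (simp add: algebra_simps)
    have "div_at (DY x) = \<alpha> x * div_at (Dp x) + d\<alpha> x (p x) + (\<beta> x * div_at (DP x) + d\<beta> x (P x))"
      unfolding DY_def[abs_def] by (simp only: div_at_add div_at_scale div_at_linear_form[OF la] div_at_linear_form[OF lb])
    \<comment> \<open>Both vectors are tangent, as the symmetry of the Hessian demands.\<close>
    moreover have "Dp x (P x) \<bullet> p x = Dp x (p x) \<bullet> P x" by (rule sym[OF x P(2)[OF x] p_tangent[OF x]])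
    ultimately show ?thesis
      unfolding lower_integrand_def \<alpha>_def d\<alpha>_def \<beta>_def d\<beta>_def dK_def dW_def df_def dv_def v_def[symmetric]
      by (simp add: inner_commute[of "p x" "Dp x _"] inner_commute[of "DP x _" "P x"] algebra_simps power2_eq_square)
  qed
  have "(LINT x|sphere_measure. K (r x) * ?f x * W x *
       ((real CARD('n) - 1) * cosh (r x) - div_at (Dp x) + (W x)\<^sup>2 * (Dp x (p x) \<bullet> p x)))
     = (LINT x|sphere_measure. div_at (DY x) + lower_integrand K Kr c P DP x)"
    by (intro Bochner_Integration.integral_cong refl) (simp add: div)
  also have "\<dots> = (LINT x|sphere_measure. div_at (DY x)) + (LINT x|sphere_measure. lower_integrand K Kr c P DP x)"
  proof (rule Bochner_Integration.integral_add)
    show "integrable sphere_measure (lower_integrand K Kr c P DP)" by (rule integrable_sphere_measure[OF cl])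
    have "continuous_on ?S (\<lambda>x. K (r x) * ?f x * W x *
       ((real CARD('n) - 1) * cosh (r x) - div_at (Dp x) + (W x)\<^sup>2 * (Dp x (p x) \<bullet> p x)) - lower_integrand K Kr c P DP x)"
      by (intro cont cl)
    then have "continuous_on ?S (\<lambda>x. div_at (DY x))"
      by (rule continuous_on_eq) (simp add: div)
    then show "integrable sphere_measure (\<lambda>x. div_at (DY x))" by (rule integrable_sphere_measure)
  qed
  finally show "(LINT x|sphere_measure. K (r x) * ?f x * W x *
       ((real CARD('n) - 1) * cosh (r x) - div_at (Dp x) + (W x)\<^sup>2 * (Dp x (p x) \<bullet> p x)))
     = (LINT x|sphere_measure. lower_integrand K Kr c P DP x)" using zero by simp
qed

text \<open>The exponent \<open>CARD('n) - 2\<close>, which is n - 1, arises because the area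
  element carries n powers of \<open>sinh\<close> and the mean curvature removes one. The sign cases
  of the curvature use the upper bound on the test weight where it is nonnegative and the lower
  bound where it is negative.\<close>

lemma positive_curvature_lower_bound:
  fixes K Kr :: "real \<Rightarrow> real" and P :: "real^'n \<Rightarrow> real^'n"
  assumes rr: "\<forall>x. norm x = 1 \<longrightarrow> radf \<rho> u x = r x"
    and N: "CARD('n) \<ge> 2"
    and K: "\<And>t. t > 0 \<Longrightarrow> (K has_real_derivative Kr t) (at t)" "continuous_on {0<..} Kr"
    and G: "\<And>t. t > 0 \<Longrightarrow> G t \<ge> 0" "\<And>t. t > 0 \<Longrightarrow> K t = G t * sinh t ^ (CARD('n) - 2)"
    and sym: "\<And>x v w. norm x = 1 \<Longrightarrow> v \<bullet> x = 0 \<Longrightarrow> w \<bullet> x = 0 \<Longrightarrow> Dp x v \<bullet> w = Dp x w \<bullet> v"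
    and P: "svec P DP" "\<And>x. norm x = 1 \<Longrightarrow> P x \<bullet> x = 0"
    and f: "\<And>x. norm x = 1 \<Longrightarrow> 0 \<le> test_weight c P x \<and> test_weight c P x \<le> sqrt (1 + p x \<bullet> p x)"
  shows "(LINT x|sphere_measure. lower_integrand K Kr c P DP x)
     \<le> (LINT x|sphere_measure. G (r x) * max (mean_curv \<rho> u x) 0 * area_elem \<rho> u x)"
proof -
  let ?S = "sphere (0::real^'n) 1"
  define B where "B x = (real CARD('n) - 1) * cosh (r x) - div_at (Dp x) + (W x)\<^sup>2 * (Dp x (p x) \<bullet> p x)" for x
  have K_cont: "continuous_on {0<..} K"
    using K(1) by (intro continuous_at_imp_continuous_on ballI) (auto intro: DERIV_isCont)
  have cK: "continuous_on ?S (\<lambda>x. K (r x))" by (rule compose_r_continuous[OF K_cont])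
  have cP: "continuous_on ?S P" by (rule svec_continuous[OF P(1)])
  have cB: "continuous_on ?S B" unfolding B_def
    by (intro continuous_intros p_continuous r_continuous W_continuous
      svec_apply_continuous[OF p_deriv p_continuous] svec_div_continuous[OF p_deriv])
  have cf: "continuous_on ?S (test_weight c P)" unfolding test_weight_def by (intro continuous_intros p_continuous cP)
  have val: "G (r x) * max (mean_curv \<rho> u x) 0 * area_elem \<rho> u x = K (r x) * max (B x) 0" if x: "norm x = 1" for x
  proof -
    have sp: "sinh (r x) > 0" using r_pos[OF x] by simp
    have q1: "sqrt (1 + p x \<bullet> p x) > 0" using inner_ge_zero[of "p x"] by (simp add: add_pos_nonneg)
    have m: "mean_curv \<rho> u x = W x / sinh (r x) * B x" unfolding B_def by (rule mean_curv_formula[OF x rr])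
    have "max (mean_curv \<rho> u x) 0 = W x / sinh (r x) * max (B x) 0"
      unfolding m using W_pos[of x] sp by (simp add: max_def zero_le_mult_iff zero_le_divide_iff mult_le_0_iff divide_le_0_iff)
    moreover have "sinh (r x) ^ (CARD('n) - 1) = sinh (r x) ^ (CARD('n) - 2) * sinh (r x)"
    proof -
      have "CARD('n) - 1 = Suc (CARD('n) - 2)" using N by simp
      then show ?thesis by (simp only: power_Suc2)
    qed
    ultimately show ?thesis
      unfolding area_elem_formula[OF x rr] G(2)[OF r_pos[OF x]] using sp q1 by (simp add: W_def)
  qed
  have "(LINT x|sphere_measure. lower_integrand K Kr c P DP x) = (LINT x|sphere_measure. K (r x) * test_weight c P x * W x * B x)"
    unfolding B_def
    by (rule curvature_flux_divergence(1)[symmetric]) (fact K(1) | fact K(2) | fact sym | fact P(1) | fact P(2))+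
  also have "\<dots> \<le> (LINT x|sphere_measure. K (r x) * max (B x) 0)"
  proof (rule integral_mono)
    show "integrable sphere_measure (\<lambda>x. K (r x) * test_weight c P x * W x * B x)"
      by (intro integrable_sphere_measure continuous_intros cK cf W_continuous cB)
    show "integrable sphere_measure (\<lambda>x. K (r x) * max (B x) 0)"
      by (intro integrable_sphere_measure continuous_intros cK cB)
    fix x assume "x \<in> space (sphere_measure :: (real^'n) measure)"
    then have x: "norm x = 1" by simp
    have K0: "K (r x) \<ge> 0" using G r_pos[OF x] by simp
    have q1: "sqrt (1 + p x \<bullet> p x) > 0" using inner_ge_zero[of "p x"] by (simp add: add_pos_nonneg)
    have fW: "0 \<le> test_weight c P x * W x" "test_weight c P x * W x \<le> 1"
      using f[OF x] q1 by (auto simp: W_def)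
    have "(test_weight c P x * W x) * B x \<le> max (B x) 0"
    proof (cases "B x \<ge> 0")
      case True then show ?thesis using mult_right_mono[OF fW(2) True] by simp
    next
      case False then show ?thesis using mult_nonneg_nonpos[OF fW(1), of "B x"] by simp
    qed
    from mult_left_mono[OF this K0] show "K (r x) * test_weight c P x * W x * B x \<le> K (r x) * max (B x) 0"
      by (simp add: mult.assoc)
  qed
  also have "\<dots> = (LINT x|sphere_measure. G (r x) * max (mean_curv \<rho> u x) 0 * area_elem \<rho> u x)"
    by (intro Bochner_Integration.integral_cong refl) (simp add: val)
  finally show ?thesis .
qed

end

subsection \<open>Second-order expansion\<close>

lemma sqrt_one_plus_le: "0 \<le> q \<Longrightarrow> sqrt (1 + q) \<le> 1 + q / 2"
proof -
  assume q: "0 \<le> q"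
  have "1 + q \<le> (1 + q / 2)\<^sup>2" by (simp add: power2_eq_square field_simps)
  then show ?thesis using q by (simp add: real_le_lsqrt)
qed

lemma abs_inner_le_half: "\<bar>a \<bullet> b\<bar> \<le> (a \<bullet> a + b \<bullet> b) / 2"
  using inner_ge_zero[of "a + b"] inner_ge_zero[of "a - b"]
  by (simp add: inner_add_left inner_add_right inner_diff_left inner_diff_right inner_commute abs_le_iff)

text \<open>Here \<open>q\<close>, \<open>t\<close>, \<open>s\<close> stand for |p|^2, |P|^2 and
  p.P, the numbers \<open>d1\<close>, \<open>d2\<close>, \<open>d3\<close> for the terms with the
  derivative of \<open>P\<close>, and \<open>A0\<close>, \<open>L0\<close> for values at the
  reference radius. Every error is a small multiple of \<open>q + t\<close>. The leading
  \<open>A\<close> is not frozen at \<open>A0\<close>: its variation with the radius is itself of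
  second order after integration and is treated separately.\<close>

lemma lower_integrand_expansion:
  fixes A L K A0 L0 M c \<delta> \<eta> q s t d1 d2 d3 W v :: real
  assumes c: "c \<ge> 0" and qt: "0 \<le> q" "0 \<le> t" "q + t \<le> \<delta>" "\<delta> \<le> 1"
    and s: "\<bar>s\<bar> \<le> (q + t) / 2" and d: "\<bar>d1\<bar> \<le> \<delta> * q" "\<bar>d2\<bar> \<le> \<delta> * ((q + t) / 2)" "\<bar>d3\<bar> \<le> \<delta>"
    and v: "v = sqrt (1 + q)" "W = 1 / v"
    and A: "0 \<le> A" "A \<le> M" "\<bar>A - A0\<bar> \<le> \<eta>" and L: "0 \<le> L" "L \<le> M" "\<bar>L - L0\<bar> \<le> \<eta>" and K: "0 \<le> K" "K \<le> M"
  shows "A + A0 * (s - c * t - q / 2) + L0 * q - (\<eta> * (c + 3) + M * \<delta> * (4 * c + 6)) * (q + t)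
     \<le> A * ((1 + s - c * t) * W) + L * ((1 + s - c * t) * W) * q + K * W * (d1 - 2 * c * d2) - (v - 1) * (L * s + K * d3)"
proof -
  define X where "X = q + t"
  define e where "e = s - c * t"
  have X: "0 \<le> X" "X \<le> \<delta>" "q \<le> X" "t \<le> X" using qt by (auto simp: X_def)
  have \<delta>: "0 \<le> \<delta>" using X by linarith
  have M: "0 \<le> M" using A by linarith
  have \<eta>: "0 \<le> \<eta>" using A(3) by linarith
  have v1: "1 \<le> v" using qt by (simp add: v)
  have v2: "v \<le> 1 + q / 2" unfolding v by (rule sqrt_one_plus_le[OF qt(1)])
  have W0: "0 < W" "W \<le> 1" using v1 by (auto simp: v(2))
  have W1: "1 - q / 2 \<le> W"
  proof -
    have "(1 - q / 2) * v \<le> 1"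
    proof (cases "1 - q / 2 \<ge> 0")
      case True
      have "(1 - q / 2) * v \<le> (1 - q / 2) * (1 + q / 2)" by (rule mult_left_mono[OF v2 True])
      also have "\<dots> = 1 - (q / 2)\<^sup>2" by (simp add: power2_eq_square algebra_simps)
      finally show ?thesis using zero_le_power2[of "q / 2"] by linarith
    next
      case False
      then have "(1 - q / 2) * v \<le> 0" using v1 by (intro mult_nonpos_nonneg) auto
      then show ?thesis by simp
    qed
    then show ?thesis using v1 by (simp add: v(2) pos_le_divide_eq)
  qed
  have e: "\<bar>e\<bar> \<le> (1 + c) * X"
  proof -
    have "\<bar>e\<bar> \<le> \<bar>s\<bar> + c * t" unfolding e_def using abs_triangle_ineq4[of s "c * t"] c qt by (simp add: abs_mult)
    also have "\<dots> \<le> X + c * X" using s X c qt by (intro add_mono mult_left_mono) (auto simp: X_def)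
    finally show ?thesis by (simp add: algebra_simps)
  qed
  have cX: "0 \<le> (1 + c) * X" using c X by simp
  \<comment> \<open>\<open>W\<close> is at least \<open>1 - q / 2\<close>, and the mixed product of
    \<open>e\<close> with \<open>W - 1\<close> is of fourth order.\<close>
  have fW: "1 + e - q / 2 - (1 + c) * \<delta> * X / 2 \<le> (1 + e) * W"
  proof -
    have "e * (W - 1) \<ge> - (\<bar>e\<bar> * (1 - W))"
    proof -
      have "e * (1 - W) \<le> \<bar>e\<bar> * (1 - W)" using W0(2) by (intro mult_right_mono) auto
      then show ?thesis by (simp add: algebra_simps)
    qed
    moreover have "\<bar>e\<bar> * (1 - W) \<le> ((1 + c) * X) * (\<delta> / 2)"
      using e W0 W1 X cX by (intro mult_mono) auto
    moreover have "(1 + e) * W = W + e + e * (W - 1)" by (simp add: algebra_simps)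
    moreover have "(1 + c) * \<delta> * X / 2 = ((1 + c) * X) * (\<delta> / 2)" by simp
    ultimately show ?thesis using W1 by linarith
  qed
  have T1: "A + A0 * (e - q / 2) - \<eta> * ((2 + c) * X) - M * ((1 + c) * \<delta> * X / 2) \<le> A * ((1 + e) * W)"
  proof -
    have "A * (1 + e - q / 2 - (1 + c) * \<delta> * X / 2) \<le> A * ((1 + e) * W)" by (rule mult_left_mono[OF fW A(1)])
    moreover have "A * ((1 + c) * \<delta> * X / 2) \<le> M * ((1 + c) * \<delta> * X / 2)"
      using c X \<delta> by (intro mult_right_mono A(2)) auto
    moreover have "(A0 - A) * (e - q / 2) \<le> \<eta> * ((2 + c) * X)"
    proof -
      have "(A0 - A) * (e - q / 2) \<le> \<bar>A0 - A\<bar> * \<bar>e - q / 2\<bar>" by (metis abs_ge_self abs_mult)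
      also have "\<dots> \<le> \<eta> * ((2 + c) * X)"
        using A(3) e X qt \<eta> by (intro mult_mono) (auto simp: algebra_simps abs_le_iff)
      finally show ?thesis .
    qed
    moreover have "A * (1 + e - q / 2 - (1 + c) * \<delta> * X / 2) = A + A0 * (e - q / 2) - (A0 - A) * (e - q / 2) - A * ((1 + c) * \<delta> * X / 2)"
      by (simp add: field_simps)
    ultimately show ?thesis by linarith
  qed
  have T2: "L0 * q - \<eta> * X - M * (2 + 2 * c) * \<delta> * X \<le> L * ((1 + e) * W) * q"
  proof -
    have a: "(1 + e) * W \<ge> 1 - (2 + 2 * c) * \<delta>"
    proof -
      have "(1 + c) * X \<le> (1 + c) * \<delta>" using c X by (intro mult_left_mono) auto
      then have "\<bar>e\<bar> \<le> (1 + c) * \<delta>" using e by linarith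
      moreover have "(1 + c) * \<delta> * X / 2 \<le> (1 + c) * \<delta> * 1 / 2"
        using c X \<delta> qt(4) by (intro divide_right_mono mult_left_mono) auto
      moreover have "q / 2 \<le> \<delta> / 2" using X by simp
      moreover have "\<delta> \<le> (1 + c) * \<delta>" using c \<delta> by (simp add: algebra_simps)
      moreover have "(2 + 2 * c) * \<delta> = 2 * ((1 + c) * \<delta>)" by (simp add: algebra_simps)
      ultimately show ?thesis using fW abs_ge_minus_self[of e] by linarith
    qed
    have Lq: "0 \<le> L * q" using L qt by simp
    have "(L * q) * (1 - (2 + 2 * c) * \<delta>) \<le> (L * q) * ((1 + e) * W)" by (rule mult_left_mono[OF a Lq])
    moreover have "(L * q) * ((2 + 2 * c) * \<delta>) \<le> (M * X) * ((2 + 2 * c) * \<delta>)"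
      using L X M qt c \<delta> by (intro mult_right_mono mult_mono) auto
    moreover have "(L0 - L) * q \<le> \<eta> * X"
    proof -
      have "(L0 - L) * q \<le> \<bar>L0 - L\<bar> * q" using qt by (intro mult_right_mono) auto
      also have "\<dots> \<le> \<eta> * X" using L(3) X qt \<eta> by (intro mult_mono) auto
      finally show ?thesis .
    qed
    ultimately show ?thesis by (simp add: algebra_simps)
  qed
  have T3: "- (M * ((1 + c) * \<delta> * X)) \<le> K * W * (d1 - 2 * c * d2)"
  proof -
    have "\<bar>d1 - 2 * c * d2\<bar> \<le> \<bar>d1\<bar> + 2 * c * \<bar>d2\<bar>"
      using abs_triangle_ineq4[of d1 "2 * c * d2"] c by (simp add: abs_mult)
    also have "\<dots> \<le> \<delta> * X + 2 * c * (\<delta> * (X / 2))"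
    proof (intro add_mono mult_left_mono)
      show "\<bar>d1\<bar> \<le> \<delta> * X" using d(1) mult_left_mono[OF X(3) \<delta>] by linarith
      show "\<bar>d2\<bar> \<le> \<delta> * (X / 2)" using d(2) by (simp add: X_def)
    qed (use c in auto)
    finally have dd: "\<bar>d1 - 2 * c * d2\<bar> \<le> (1 + c) * \<delta> * X" by (simp add: algebra_simps)
    have KW: "0 \<le> K * W" "K * W \<le> M" using K W0 mult_mono[of K M W 1] M by auto
    have "\<bar>K * W * (d1 - 2 * c * d2)\<bar> \<le> M * ((1 + c) * \<delta> * X)"
      unfolding abs_mult[of "K * W"] using KW dd M by (intro mult_mono) auto
    then show ?thesis by linarith
  qed
  have T4: "(v - 1) * (L * s + K * d3) \<le> M * \<delta> * X"
  proof -
    have "L * s + K * d3 \<le> M * (\<delta> / 2) + M * \<delta>"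
    proof (rule add_mono)
      have "L * s \<le> L * \<bar>s\<bar>" using L by (intro mult_left_mono) auto
      also have "\<dots> \<le> M * (\<delta> / 2)" using L M s X by (intro mult_mono) (auto simp: X_def)
      finally show "L * s \<le> M * (\<delta> / 2)" .
      have "K * d3 \<le> K * \<bar>d3\<bar>" using K by (intro mult_left_mono) auto
      also have "\<dots> \<le> M * \<delta>" using K M d(3) by (intro mult_mono) auto
      finally show "K * d3 \<le> M * \<delta>" .
    qed
    then have "L * s + K * d3 \<le> 2 * (M * \<delta>)" using mult_nonneg_nonneg[OF M \<delta>] by simp
    then have "(v - 1) * (L * s + K * d3) \<le> (v - 1) * (2 * (M * \<delta>))" using v1 by (intro mult_left_mono) auto
    also have "\<dots> \<le> (X / 2) * (2 * (M * \<delta>))" using v2 X M \<delta> by (intro mult_right_mono) auto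
    finally show ?thesis by (simp add: algebra_simps)
  qed
  have c0: "0 \<le> \<eta> * X" "0 \<le> M * \<delta> * X" "0 \<le> M * \<delta> * X * c" using \<eta> X M \<delta> c by simp_all
  have "A + A0 * (e - q / 2) + L0 * q - (\<eta> * (c + 3) + M * \<delta> * (4 * c + 6)) * X
     \<le> A * ((1 + e) * W) + L * ((1 + e) * W) * q + K * W * (d1 - 2 * c * d2) - (v - 1) * (L * s + K * d3)"
  proof -
    \<comment> \<open>The four estimates contribute \<open>(1 + c) / 2\<close>,
      \<open>2 + 2 * c\<close>, \<open>1 + c\<close> and \<open>1\<close> multiples of
      \<open>M * \<delta> * X\<close>, in total at most \<open>4 * c + 6\<close>; the factor
      \<open>c + 3\<close> of \<open>\<eta>\<close> is \<open>2 + c\<close> from the first and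
      \<open>1\<close> from the second.\<close>
    have "\<eta> * ((2 + c) * X) = 2 * (\<eta> * X) + \<eta> * X * c" "M * ((1 + c) * \<delta> * X / 2) = (M * \<delta> * X + M * \<delta> * X * c) / 2"
      "M * (2 + 2 * c) * \<delta> * X = 2 * (M * \<delta> * X) + 2 * (M * \<delta> * X * c)" "M * ((1 + c) * \<delta> * X) = M * \<delta> * X + M * \<delta> * X * c"
      "(\<eta> * (c + 3) + M * \<delta> * (4 * c + 6)) * X = \<eta> * X * c + 3 * (\<eta> * X) + 4 * (M * \<delta> * X * c) + 6 * (M * \<delta> * X)"
      by (simp_all add: algebra_simps)
    note E = this
    have lin: "a0 + aq + lq - (uc + 3 * u + 4 * mc + 6 * m) \<le> t1 + t2 + t3 - t4"
      if "a0 + aq - (2 * u + uc) - (m + mc) / 2 \<le> t1" "lq - u - (2 * m + 2 * mc) \<le> t2" "- (m + mc) \<le> t3" "t4 \<le> m"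
        "0 \<le> u" "0 \<le> m" "0 \<le> mc" for a0 aq lq u uc m mc t1 t2 t3 t4 :: real
      using that by (simp add: field_simps)
    show ?thesis unfolding E(5)
      by (rule lin[OF T1[unfolded E(1,2)] T2[unfolded E(3)] T3[unfolded E(4)] T4 c0])
  qed
  then show ?thesis by (simp add: e_def X_def algebra_simps)
qed

text \<open>Subtracting the quadratic leaves a function that decreases up to \<open>\<rho>\<close>
  and increases after it, by the expansion of \<open>A'\<close> at that one point.\<close>

lemma second_order_lower_bound:
  fixes A A' :: "real \<Rightarrow> real"
  assumes A: "\<And>t. t > 0 \<Longrightarrow> (A has_real_derivative A' t) (at t)" and \<rho>: "\<rho> > 0"
    and z: "A' \<rho> = 0" and m: "(A' has_real_derivative m) (at \<rho>)" and \<eta>: "\<eta> > 0"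
  shows "\<exists>\<delta>>0. \<forall>t. \<bar>t - \<rho>\<bar> < \<delta> \<longrightarrow> A \<rho> + (m - \<eta>) / 2 * (t - \<rho>)\<^sup>2 \<le> A t"
proof -
  obtain \<delta>0 where \<delta>0: "\<delta>0 > 0" "\<And>t. norm (t - \<rho>) < \<delta>0 \<Longrightarrow> norm (A' t - A' \<rho> - m * (t - \<rho>)) \<le> \<eta> * norm (t - \<rho>)"
    using m \<eta> unfolding has_field_derivative_def has_derivative_at_alt by blast
  define F where "F t = A t - (m - \<eta>) / 2 * (t - \<rho>)\<^sup>2" for t
  have F: "(F has_real_derivative (A' t - (m - \<eta>) * (t - \<rho>))) (at t)" if "t > 0" for t
  proof -
    have "((\<lambda>t. (m - \<eta>) / 2 * (t - \<rho>)\<^sup>2) has_real_derivative (m - \<eta>) * (t - \<rho>)) (at t)"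
      by (auto intro!: derivative_eq_intros)
    from DERIV_diff[OF A[OF that] this] show ?thesis by (simp add: F_def[abs_def])
  qed
  have "A \<rho> + (m - \<eta>) / 2 * (t - \<rho>)\<^sup>2 \<le> A t" if t: "\<bar>t - \<rho>\<bar> < min \<delta>0 \<rho>" for t
  proof -
    have t0: "t > 0" using t by auto
    have b: "\<bar>A' s - m * (s - \<rho>)\<bar> \<le> \<eta> * \<bar>s - \<rho>\<bar>" if "\<bar>s - \<rho>\<bar> < \<delta>0" for s
      using \<delta>0(2)[of s] that z by simp
    have "F \<rho> \<le> F t"
    proof (cases "t \<ge> \<rho>")
      case True
      show ?thesis
      proof (rule DERIV_nonneg_imp_nondecreasing[OF True])
        fix s assume s: "\<rho> \<le> s" "s \<le> t"
        then have "\<bar>A' s - m * (s - \<rho>)\<bar> \<le> \<eta> * (s - \<rho>)" using b[of s] t by simp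
        then have "0 \<le> A' s - (m - \<eta>) * (s - \<rho>)" by (simp add: algebra_simps abs_le_iff)
        then show "\<exists>y. (F has_real_derivative y) (at s) \<and> 0 \<le> y" using F[of s] s \<rho> by auto
      qed
    next
      case False
      then have tr: "t \<le> \<rho>" by simp
      show ?thesis
      proof (rule DERIV_nonpos_imp_nonincreasing[OF tr])
        fix s assume s: "t \<le> s" "s \<le> \<rho>"
        then have "\<bar>A' s - m * (s - \<rho>)\<bar> \<le> \<eta> * (\<rho> - s)" using b[of s] t by simp
        then have "A' s - (m - \<eta>) * (s - \<rho>) \<le> 0" by (simp add: algebra_simps abs_le_iff)
        then show "\<exists>y. (F has_real_derivative y) (at s) \<and> y \<le> 0" using F[of s] s t0 by auto
      qed
    qed
    then show ?thesis by (simp add: F_def)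
  qed
  then show ?thesis using \<delta>0(1) \<rho> by (intro exI[of _ "min \<delta>0 \<rho>"]) auto
qed

text \<open>\<open>\<eta> * H - F\<close> and \<open>\<eta> * H + F\<close> are nondecreasing and
  vanish at \<open>\<rho>\<close>.\<close>

lemma derivative_comparison:
  fixes F H :: "real \<Rightarrow> real"
  assumes F: "\<And>t. \<bar>t - \<rho>\<bar> < \<delta> \<Longrightarrow> (F has_real_derivative F' t) (at t)"
    and H: "\<And>t. \<bar>t - \<rho>\<bar> < \<delta> \<Longrightarrow> (H has_real_derivative H' t) (at t)"
    and b: "\<And>t. \<bar>t - \<rho>\<bar> < \<delta> \<Longrightarrow> \<bar>F' t\<bar> \<le> \<eta> * H' t" and z: "F \<rho> = 0" "H \<rho> = 0" and \<eta>: "\<eta> > 0"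
    and t: "\<bar>t - \<rho>\<bar> < \<delta>"
  shows "\<bar>F t\<bar> \<le> \<eta> * \<bar>H t\<bar>"
proof -
  have d1: "((\<lambda>t. \<eta> * H t - F t) has_real_derivative \<eta> * H' s - F' s) (at s)"
   and d2: "((\<lambda>t. \<eta> * H t + F t) has_real_derivative \<eta> * H' s + F' s) (at s)" if "\<bar>s - \<rho>\<bar> < \<delta>" for s
    using F[OF that] H[OF that] by (auto intro!: derivative_eq_intros)
  have mono: "\<eta> * H a - F a \<le> \<eta> * H c - F c" "\<eta> * H a + F a \<le> \<eta> * H c + F c"
    if "a \<le> c" "\<bar>a - \<rho>\<bar> < \<delta>" "\<bar>c - \<rho>\<bar> < \<delta>" for a c
  proof -
    have in1: "\<bar>s - \<rho>\<bar> < \<delta>" if "a \<le> s" "s \<le> c" for s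
      using that \<open>\<bar>a - \<rho>\<bar> < \<delta>\<close> \<open>\<bar>c - \<rho>\<bar> < \<delta>\<close> by linarith
    show "\<eta> * H a - F a \<le> \<eta> * H c - F c"
    proof (rule DERIV_nonneg_imp_nondecreasing[OF that(1)])
      fix s assume s: "a \<le> s" "s \<le> c"
      then show "\<exists>y. ((\<lambda>t. \<eta> * H t - F t) has_real_derivative y) (at s) \<and> 0 \<le> y"
        using d1[OF in1[OF s]] b[OF in1[OF s]] by (intro exI[of _ "\<eta> * H' s - F' s"]) (auto simp: abs_le_iff)
    qed
    show "\<eta> * H a + F a \<le> \<eta> * H c + F c"
    proof (rule DERIV_nonneg_imp_nondecreasing[OF that(1)])
      fix s assume s: "a \<le> s" "s \<le> c"
      then show "\<exists>y. ((\<lambda>t. \<eta> * H t + F t) has_real_derivative y) (at s) \<and> 0 \<le> y"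
        using d2[OF in1[OF s]] b[OF in1[OF s]] by (intro exI[of _ "\<eta> * H' s + F' s"]) (auto simp: abs_le_iff)
    qed
  qed
  have r: "\<bar>\<rho> - \<rho>\<bar> < \<delta>" using t by auto
  have "\<bar>F t\<bar> \<le> \<bar>\<eta> * H t\<bar>"
  proof (cases "t \<ge> \<rho>")
    case True
    then show ?thesis using mono[of \<rho> t] r t z by auto
  next
    case False
    then show ?thesis using mono[of t \<rho>] r t z by auto
  qed
  then show ?thesis using \<eta> by (simp add: abs_mult)
qed

lemma cosh_gt_1: "t > 0 \<Longrightarrow> cosh (t::real) - 1 > 0"
proof -
  assume t: "t > 0"
  then have s: "sinh t > 0" by simp
  have "cosh t \<noteq> 1"
  proof
    assume "cosh t = 1"
    then have "(sinh t)\<^sup>2 = 0" using cosh_square_eq[of t] by simp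
    then show False using s by simp
  qed
  then show ?thesis by (metis cosh_real_ge_1 less_le diff_gt_0_iff_gt)
qed

text \<open>The function ln (tanh (t / 2)), an antiderivative of \<open>1 / sinh\<close>. Composed
  with r it is the h of the overview up to an additive constant.\<close>

definition logtanh :: "real \<Rightarrow> real" where
  "logtanh t = ln (cosh t - 1) - ln (sinh t)"

lemma logtanh_derivative:
  assumes "t > 0" shows "(logtanh has_real_derivative 1 / sinh t) (at t)"
proof -
  have s: "sinh t > 0" using assms by simp
  have c: "cosh t - 1 > 0" by (rule cosh_gt_1[OF assms])
  have "(logtanh has_real_derivative sinh t / (cosh t - 1) - cosh t / sinh t) (at t)"
    unfolding logtanh_def[abs_def] using s c by (auto intro!: derivative_eq_intros)
  also have "sinh t / (cosh t - 1) - cosh t / sinh t = ((sinh t)\<^sup>2 - (cosh t)\<^sup>2 + cosh t) / ((cosh t - 1) * sinh t)"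
    using s c by (simp add: diff_frac_eq power2_eq_square algebra_simps)
  also have "\<dots> = 1 / sinh t" using s c by (simp add: cosh_square_eq)
  finally show ?thesis .
qed

text \<open>By orthogonality h splits into w and h - w, with gradients P and p - P. The first has
  Poincare constant n once the mean is removed, the second has 3(n + 2). The value of
  \<open>c\<close> gives away half of \<open>k\<close>, so that \<open>k / 2\<close> times the whole
  Dirichlet energy survives. The squared mean is carried along and is made small later by the volume
  constraint.\<close>

lemma sphere_energy_estimate:
  fixes h :: "real^'n \<Rightarrow> real"
  assumes N: "CARD('n) \<ge> 4" and h: "sgrad h p" and k: "k > 0"
    and w: "pd 2 w" "green w P l" "pd 2 l" "\<And>f. pd 2 f \<Longrightarrow> (LINT x|sphere_measure. (h x - w x) * f x) = 0"
    and c: "c = 1 / 2 + k / (2 * (real CARD('n) - 1))"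
  defines "n \<equiv> real CARD('n) - 1"
  shows "k / 2 * (LINT x|sphere_measure. p x \<bullet> p x) - n * (n - 1) * ((LINT x|sphere_measure. h x)\<^sup>2 / omega TYPE('n))
     \<le> n * (LINT x|sphere_measure. p x \<bullet> P x) - n * c * (LINT x|sphere_measure. P x \<bullet> P x)
       + ((n - 2) / 2 + k) * (LINT x|sphere_measure. p x \<bullet> p x) - n * (n - 1) * (LINT x|sphere_measure. (h x)\<^sup>2)"
   and "(LINT x|sphere_measure. P x \<bullet> P x) \<le> (LINT x|sphere_measure. p x \<bullet> p x)"
   and "n * (LINT x|sphere_measure. (h x)\<^sup>2) \<le> (LINT x|sphere_measure. p x \<bullet> p x) + n * ((LINT x|sphere_measure. h x)\<^sup>2 / omega TYPE('n))"
proof -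
  let ?I = "\<lambda>f. LINT x|(sphere_measure :: (real^'n) measure). f x"
  let ?S = "sphere (0::real^'n) 1"
  have n3: "n \<ge> 3" using N by (simp add: n_def)
  have om: "omega TYPE('n) > 0" by (rule omega_pos)
  have N2: "CARD('n) \<ge> 2" using N by simp
  have sw: "sgrad w P" using w(2) by (simp add: green_def)
  have ch: "continuous_on ?S h" "continuous_on ?S p" using sgrad_continuous[OF h] h by (auto simp: sgrad_def)
  have cw: "continuous_on ?S w" "continuous_on ?S P" "continuous_on ?S l"
    using sgrad_continuous[OF sw] sw w(2) by (auto simp: sgrad_def green_def)
  note ci = integrable_sphere_measure continuous_intros
  have poinc1: "n * ?I (\<lambda>x. (f x)\<^sup>2) \<le> ?I (\<lambda>x. F x \<bullet> F x) + n * ((?I f)\<^sup>2 / omega TYPE('n))"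
    if f: "sgrad f F" for f F
  proof -
    have cf: "continuous_on ?S f" by (rule sgrad_continuous[OF f])
    define \<mu> where "\<mu> = ?I f / omega TYPE('n)"
    have sc: "sgrad (\<lambda>x. f x + (- \<mu>)) F"
    proof -
      have "sgrad (\<lambda>x::real^'n. - \<mu>) (\<lambda>x. 0)" by (simp add: sgrad_def hom_ext_def[abs_def])
      from sgrad_add[OF f this] show ?thesis by simp
    qed
    have "lam TYPE('n) 1 * ?I (\<lambda>x. (f x + (- \<mu>))\<^sup>2) \<le> ?I (\<lambda>x. F x \<bullet> F x)"
    proof (rule poincare_sphere[OF N2 sc])
      fix h' :: "real^'n \<Rightarrow> real" assume "pd (1 - 1) h'"
      then have "pd 0 h'" by simp
      then have "\<exists>a. h' = (\<lambda>x. a)"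
        by (induction "0::nat" h' rule: pd.induct) auto
      then obtain a where a: "h' = (\<lambda>x. a)" by blast
      have "integrable sphere_measure f" using cf by (intro ci)
      then have "?I (\<lambda>x. f x + (- \<mu>)) = ?I f - \<mu> * omega TYPE('n)"
        using lint_const_sphere[where 'n='n, of \<mu>] by (simp add: omega_def)
      also have "\<dots> = 0" using om by (simp add: \<mu>_def)
      finally show "?I (\<lambda>x. (f x + (- \<mu>)) * h' x) = 0" unfolding a by simp
    qed simp
    moreover have "lam TYPE('n) 1 = n" by (simp add: lam_def n_def)
    moreover have "?I (\<lambda>x. (f x + (- \<mu>))\<^sup>2) = ?I (\<lambda>x. (f x)\<^sup>2) - (?I f)\<^sup>2 / omega TYPE('n)"
    proof -
      have i: "integrable sphere_measure (\<lambda>x. (f x)\<^sup>2)" "integrable sphere_measure f" using cf by (auto intro!: ci)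
      have e: "(f x + (- \<mu>))\<^sup>2 = (f x)\<^sup>2 - 2 * \<mu> * f x + \<mu>\<^sup>2" for x by (simp add: power2_eq_square algebra_simps)
      have "?I (\<lambda>x. (f x + (- \<mu>))\<^sup>2) = ?I (\<lambda>x. (f x)\<^sup>2) - 2 * \<mu> * ?I f + \<mu>\<^sup>2 * omega TYPE('n)"
        unfolding e using i lint_const_sphere[where 'n='n, of "\<mu>\<^sup>2"] by (simp add: omega_def)
      also have "\<dots> = ?I (\<lambda>x. (f x)\<^sup>2) - (?I f)\<^sup>2 / omega TYPE('n)"
        using om by (simp add: \<mu>_def power2_eq_square field_simps)
      finally show ?thesis .
    qed
    ultimately have "n * (?I (\<lambda>x. (f x)\<^sup>2) - (?I f)\<^sup>2 / omega TYPE('n)) \<le> ?I (\<lambda>x. F x \<bullet> F x)" by (simp only:)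
    then show ?thesis by (simp only: right_diff_distrib)
  qed
  show p1: "n * ?I (\<lambda>x. (h x)\<^sup>2) \<le> ?I (\<lambda>x. p x \<bullet> p x) + n * ((?I h)\<^sup>2 / omega TYPE('n))" by (rule poinc1[OF h])
  have i: "integrable sphere_measure (\<lambda>x. (h x - w x) * l x)" "integrable sphere_measure (\<lambda>x. w x * l x)"
    "integrable sphere_measure (\<lambda>x. p x \<bullet> p x)" "integrable sphere_measure (\<lambda>x. p x \<bullet> P x)"
    "integrable sphere_measure (\<lambda>x. P x \<bullet> P x)" "integrable sphere_measure h" "integrable sphere_measure w"
    "integrable sphere_measure (\<lambda>x. (h x - w x) * w x)" "integrable sphere_measure (\<lambda>x. (w x)\<^sup>2)"
    "integrable sphere_measure (\<lambda>x. (h x - w x)\<^sup>2)" "integrable sphere_measure (\<lambda>x. h x - w x)"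
    using ch cw by (auto intro!: ci)
  have pP: "?I (\<lambda>x. p x \<bullet> P x) = ?I (\<lambda>x. P x \<bullet> P x)"
  proof -
    have "?I (\<lambda>x. p x \<bullet> P x) = ?I (\<lambda>x. h x * l x)" using w(2) h by (simp add: green_def)
    also have "\<dots> = ?I (\<lambda>x. (h x - w x) * l x + w x * l x)" by (simp add: algebra_simps)
    also have "\<dots> = ?I (\<lambda>x. (h x - w x) * l x) + ?I (\<lambda>x. w x * l x)" by (rule Bochner_Integration.integral_add[OF i(1,2)])
    also have "?I (\<lambda>x. w x * l x) = ?I (\<lambda>x. P x \<bullet> P x)" using w(2) sw by (simp add: green_def)
    finally show ?thesis using w(4)[OF w(3)] by simp
  qed
  define b where "b = ?I (\<lambda>x. (p x - P x) \<bullet> (p x - P x))"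
  have b: "b = ?I (\<lambda>x. p x \<bullet> p x) - ?I (\<lambda>x. P x \<bullet> P x)"
  proof -
    have "b = ?I (\<lambda>x. p x \<bullet> p x - 2 * (p x \<bullet> P x) + P x \<bullet> P x)"
      unfolding b_def by (simp add: inner_diff_left inner_diff_right inner_commute algebra_simps)
    also have "\<dots> = ?I (\<lambda>x. p x \<bullet> p x) - 2 * ?I (\<lambda>x. p x \<bullet> P x) + ?I (\<lambda>x. P x \<bullet> P x)" using i by simp
    finally show ?thesis by (simp add: pP)
  qed
  have b0: "b \<ge> 0" unfolding b_def by (simp add: Bochner_Integration.integral_nonneg)
  show P2: "?I (\<lambda>x. P x \<bullet> P x) \<le> ?I (\<lambda>x. p x \<bullet> p x)" using b b0 by linarith
  have hw: "?I (\<lambda>x. (h x)\<^sup>2) = ?I (\<lambda>x. (w x)\<^sup>2) + ?I (\<lambda>x. (h x - w x)\<^sup>2)"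
  proof -
    have e: "(h x)\<^sup>2 = (w x)\<^sup>2 + (h x - w x)\<^sup>2 + 2 * ((h x - w x) * w x)" for x by (simp add: power2_eq_square algebra_simps)
    show ?thesis unfolding e using i w(4)[OF w(1)] by simp
  qed
  have mean: "?I w = ?I h"
  proof -
    have "?I (\<lambda>x. (h x - w x) * 1) = 0" by (rule w(4)[OF pd_const])
    then show ?thesis using i by simp
  qed
  have gz: "3 * (n + 2) * ?I (\<lambda>x. (h x - w x)\<^sup>2) \<le> b"
  proof -
    have sz: "sgrad (\<lambda>x. h x + (-1) * w x) (\<lambda>x. p x + (-1) *\<^sub>R P x)" by (intro sgrad_add h sgrad_scale sw)
    have "lam TYPE('n) 3 * ?I (\<lambda>x. (h x + (-1) * w x)\<^sup>2) \<le> ?I (\<lambda>x. (p x + (-1) *\<^sub>R P x) \<bullet> (p x + (-1) *\<^sub>R P x))"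
      by (rule poincare_sphere[OF N2 sz]) (use w(4) in simp_all)
    moreover have "lam TYPE('n) 3 = 3 * (n + 2)" by (simp add: lam_def n_def)
    ultimately show ?thesis by (simp add: b_def)
  qed
  have gw: "n * ?I (\<lambda>x. (w x)\<^sup>2) \<le> ?I (\<lambda>x. P x \<bullet> P x) + n * ((?I h)\<^sup>2 / omega TYPE('n))"
    using poinc1[OF sw] by (simp add: mean)
  \<comment> \<open>The comparison of constants amounts to n^2 + 2 n - 12 >= 0, which holds from n =
    3 on.\<close>
  have F1: "n * (n - 1) * ?I (\<lambda>x. (h x - w x)\<^sup>2) \<le> (n - 2) / 2 * b"
  proof -
    have "0 \<le> ?I (\<lambda>x. (h x - w x)\<^sup>2)" by (simp add: Bochner_Integration.integral_nonneg)
    moreover have "n * (n - 1) \<le> (n - 2) / 2 * (3 * (n + 2))"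
    proof -
      have "n * 3 \<le> n * n" using n3 by (intro mult_left_mono) auto
      moreover have e: "(n - 2) / 2 * (3 * (n + 2)) = 3 / 2 * (n * n) - 6" "n * (n - 1) = n * n - n"
        by (simp_all add: field_simps)
      ultimately show ?thesis using n3 unfolding e by linarith
    qed
    ultimately have "n * (n - 1) * ?I (\<lambda>x. (h x - w x)\<^sup>2) \<le> (n - 2) / 2 * (3 * (n + 2)) * ?I (\<lambda>x. (h x - w x)\<^sup>2)"
      by (intro mult_right_mono) auto
    also have "\<dots> = (n - 2) / 2 * (3 * (n + 2) * ?I (\<lambda>x. (h x - w x)\<^sup>2))" by simp
    also have "\<dots> \<le> (n - 2) / 2 * b" using gz n3 by (intro mult_left_mono) auto
    finally show ?thesis .
  qed
  \<comment> \<open>Here there is no slack: degree-one harmonics turn this into an equality.\<close>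
  have F2: "n * (n - 1) * ?I (\<lambda>x. (w x)\<^sup>2) \<le> (n - 1) * ?I (\<lambda>x. P x \<bullet> P x) + n * (n - 1) * ((?I h)\<^sup>2 / omega TYPE('n))"
    using mult_left_mono[OF gw, of "n - 1"] n3 by (simp add: algebra_simps)
  have nc: "n * c = n / 2 + k / 2" using n3 by (simp add: c n_def[symmetric] field_simps)
  let ?Q = "?I (\<lambda>x. p x \<bullet> p x)" and ?P = "?I (\<lambda>x. P x \<bullet> P x)"
  have E: "(n - 2) / 2 * b = (n * ?Q - n * ?P) / 2 - ?Q + ?P" "0 \<le> (k * ?Q - k * ?P) / 2" "(n - 1) * ?P = n * ?P - ?P"
    "((n - 2) / 2 + k) * ?Q = n * ?Q / 2 - ?Q + k * ?Q" "n * c * ?P = (n * ?P + k * ?P) / 2"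
    using mult_left_mono[OF P2, of k] k unfolding nc unfolding b by (simp_all add: field_simps)
  have lin: "kQ / 2 - u3 \<le> nP - ncP + e - (u2 + u1)"
    if "u1 \<le> X1" "u2 \<le> X2 + u3" "X1 = (nQ - nP) / 2 - Q + P" "0 \<le> (kQ - kP) / 2" "X2 = nP - P" "e = nQ / 2 - Q + kQ" "ncP = (nP + kP) / 2"
    for u1 u2 u3 X1 X2 nP nQ kP kQ P Q ncP e :: real
    using that by (simp add: field_simps)
  show "k / 2 * ?Q - n * (n - 1) * ((?I h)\<^sup>2 / omega TYPE('n))
     \<le> n * ?I (\<lambda>x. p x \<bullet> P x) - n * c * ?P + ((n - 2) / 2 + k) * ?Q - n * (n - 1) * ?I (\<lambda>x. (h x)\<^sup>2)"
    unfolding pP hw distrib_left[of "n * (n - 1)"] times_divide_eq_left by (rule lin[OF F1 F2 E])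
qed

subsection \<open>Conditions on the weight\<close>

text \<open>A negative value would make \<open>g1\<close> drop to the right of \<open>s\<close>,
  which contradicts the two tangent line inequalities between \<open>s\<close> and a nearby
  point.\<close>

lemma convex_second_derivative_nonneg:
  fixes g g1 g2 :: "real \<Rightarrow> real"
  assumes conv: "convex_on {0..} g"
    and d1: "\<And>s. s > 0 \<Longrightarrow> (g has_real_derivative g1 s) (at s)"
    and d2: "\<And>s. s > 0 \<Longrightarrow> (g1 has_real_derivative g2 s) (at s)"
    and s: "s > 0"
  shows "g2 s \<ge> 0"
proof (rule ccontr)
  assume "\<not> g2 s \<ge> 0"
  then have neg: "g2 s < 0" by simp
  obtain e where e: "e > 0" "\<And>h. 0 < h \<Longrightarrow> h < e \<Longrightarrow> g1 (s + h) < g1 s"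
    using DERIV_neg_dec_right[OF d2[OF s] neg] by blast
  define y where "y = s + e / 2"
  have y: "y > s" "y > 0" "g1 y < g1 s" using e s by (auto simp: y_def)
  have c: "convex_on {0<..} g" by (rule convex_on_subset[OF conv]) auto
  have tangent: "g1 a * (b - a) \<le> g b - g a" if "a > 0" "b > 0" for a b
  proof (rule convex_on_imp_above_tangent[OF c])
    show "connected {(0::real)<..}" by simp
    show "a \<in> interior {0<..}" using that by (simp add: interior_open)
    show "b \<in> {0<..}" using that by simp
    show "(g has_real_derivative g1 a) (at a within {0<..})" using d1[OF that(1)] by (rule has_field_derivative_at_within)
  qed
  have "g1 s * (y - s) \<le> g y - g s" by (rule tangent[OF s y(2)])
  moreover have "g1 y * (s - y) \<le> g s - g y" by (rule tangent[OF y(2) s])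
  ultimately have "(g1 s - g1 y) * (y - s) \<le> 0" by (simp add: algebra_simps)
  then show False using y by (simp add: mult_le_0_iff)
qed

section \<open>Radial profiles of the weight and their expansion at a radius\<close>

locale weight_profile =
  fixes g g1 g2 :: "real \<Rightarrow> real" and j :: nat
  assumes g_pos: "s > 0 \<Longrightarrow> g s > 0"
    and g_deriv: "s > 0 \<Longrightarrow> (g has_real_derivative g1 s) (at s)"
    and g1_deriv: "s > 0 \<Longrightarrow> (g1 has_real_derivative g2 s) (at s)"
    and g2_nonneg: "s > 0 \<Longrightarrow> g2 s \<ge> 0"
    and g_cond: "s > 0 \<Longrightarrow> g s \<le> (1 + s) * g1 s"
begin

text \<open>Throughout, \<open>j\<close> is n - 3, so that n is \<open>j + 3\<close> and the
  exponents n - 1, n and n + 1 are written without subtraction.\<close>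

definition G where "G t = g (cosh t - 1)"
definition K where "K t = G t * sinh t ^ (j + 2)"
definition Kr where "Kr t = g1 (cosh t - 1) * sinh t * sinh t ^ (j + 2) + G t * ((real j + 2) * sinh t ^ (j + 1) * cosh t)"
text \<open>The zeroth order density: \<open>omega * A \<rho>\<close> is the weighted curvature
  integral of the geodesic sphere of radius \<open>\<rho>\<close>. \<open>L\<close> below is the
  coefficient of |p|^2.\<close>

definition A where "A t = (real j + 3) * (K t * cosh t)"
definition L where "L t = Kr t * sinh t"
text \<open>The ratio of \<open>A'\<close> to \<open>n * y'\<close>. Its value at
  \<open>\<rho>\<close>, times n, is the Lagrange multiplier of the volume constraint.\<close>

definition b where "b t = g1 (cosh t - 1) + G t * ((real j + 2) * (cosh t / (sinh t)\<^sup>2) + 1 / cosh t)"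
text \<open>The weighted volume below the graph per unit of solid angle; the volume constraint fixes
  its integral over the sphere.\<close>

definition y where "y t = sinh t ^ (j + 4) / (real j + 4)"

lemma G_pos: "t > 0 \<Longrightarrow> G t > 0"
  unfolding G_def using g_pos[OF cosh_gt_1] .

lemma G_deriv: "t > 0 \<Longrightarrow> (G has_real_derivative g1 (cosh t - 1) * sinh t) (at t)"
  unfolding G_def[abs_def]
  by (rule DERIV_chain2[where f=g and g="\<lambda>t. cosh t - 1", OF g_deriv[OF cosh_gt_1]]) (auto intro!: derivative_eq_intros)

lemma g1_cosh_deriv: "t > 0 \<Longrightarrow> ((\<lambda>t. g1 (cosh t - 1)) has_real_derivative g2 (cosh t - 1) * sinh t) (at t)"
  by (rule DERIV_chain2[where f=g1 and g="\<lambda>t. cosh t - 1", OF g1_deriv[OF cosh_gt_1]]) (auto intro!: derivative_eq_intros)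

lemma g1_bound: "t > 0 \<Longrightarrow> G t \<le> cosh t * g1 (cosh t - 1)"
  using g_cond[OF cosh_gt_1[of t]] by (simp add: G_def)

lemma g1_pos: "t > 0 \<Longrightarrow> g1 (cosh t - 1) > 0"
  using g1_bound[of t] G_pos[of t] cosh_real_pos[of t] by (metis less_le_trans zero_less_mult_pos)

lemma sinh_power_deriv: "((\<lambda>t. sinh t ^ Suc m) has_real_derivative real (Suc m) * sinh t ^ m * cosh t) (at (t::real))"
proof -
  have "(sinh has_real_derivative cosh t) (at t)" by (auto intro!: derivative_eq_intros)
  from DERIV_power_Suc[OF this, of m] show ?thesis by (simp add: mult_ac)
qed

lemma K_deriv: "t > 0 \<Longrightarrow> (K has_real_derivative Kr t) (at t)"
  unfolding K_def[abs_def]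
  using DERIV_mult[OF G_deriv[of t] sinh_power_deriv[of "j + 1" t]]
  by (simp add: Kr_def algebra_simps)

lemma isCont_g1_cosh: "t > 0 \<Longrightarrow> isCont (\<lambda>t. g1 (cosh t - 1)) t"
  using DERIV_isCont[OF g1_cosh_deriv] .

lemma isCont_G: "t > 0 \<Longrightarrow> isCont G t"
  using DERIV_isCont[OF G_deriv] .

lemma isCont_sinh_cosh: "isCont (sinh :: real \<Rightarrow> real) t" "isCont (cosh :: real \<Rightarrow> real) t"
  by (auto intro!: continuous_intros)

lemma Kr_isCont: "t > 0 \<Longrightarrow> isCont Kr t"
  unfolding Kr_def[abs_def] by (intro continuous_intros isCont_g1_cosh isCont_G) auto

lemma Kr_cont: "continuous_on {0<..} Kr"
  by (intro continuous_at_imp_continuous_on ballI Kr_isCont) auto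

lemma K_pos: "t > 0 \<Longrightarrow> K t > 0"
  unfolding K_def using G_pos by simp

lemma L_nonneg: "t > 0 \<Longrightarrow> L t \<ge> 0"
  unfolding L_def Kr_def using g1_pos[of t] G_pos[of t]
  by (intro mult_nonneg_nonneg add_nonneg_nonneg) auto

lemma A_isCont: "t > 0 \<Longrightarrow> isCont A t"
  unfolding A_def[abs_def] by (intro continuous_intros DERIV_isCont[OF K_deriv]) auto

lemma L_isCont: "t > 0 \<Longrightarrow> isCont L t"
  unfolding L_def[abs_def] by (intro continuous_intros Kr_isCont) auto

lemma A_deriv:
  assumes t: "t > 0"
  shows "(A has_real_derivative (real j + 3) * b t * (sinh t ^ (j + 3) * cosh t)) (at t)"
proof -
  have s: "sinh t > 0" and c: "cosh t > 0" using t by auto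
  have "(A has_real_derivative (real j + 3) * (Kr t * cosh t + K t * sinh t)) (at t)"
    unfolding A_def[abs_def]
    by (rule derivative_eq_intros K_deriv[OF t] refl | simp add: algebra_simps)+
  moreover have "Kr t * cosh t + K t * sinh t = b t * (sinh t ^ (j + 3) * cosh t)"
  proof -
    have e: "G t * ((real j + 2) * (cosh t / (sinh t)\<^sup>2) + 1 / cosh t) * (sinh t ^ (j + 3) * cosh t)
      = G t * (real j + 2) * sinh t ^ (j + 1) * (cosh t)\<^sup>2 + G t * sinh t ^ (j + 3)"
      using s c by (simp add: field_simps power2_eq_square eval_nat_numeral)
    show ?thesis unfolding b_def distrib_right e
      by (simp add: Kr_def K_def algebra_simps power2_eq_square eval_nat_numeral)
  qed
  ultimately show ?thesis by (simp add: mult.assoc)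
qed

lemma y_deriv: "(y has_real_derivative sinh t ^ (j + 3) * cosh t) (at t)"
proof -
  have "((\<lambda>t. sinh t ^ Suc (j + 3) / (real j + 4)) has_real_derivative real (Suc (j + 3)) * sinh t ^ (j + 3) * cosh t / (real j + 4)) (at t)"
    by (rule DERIV_cdivide[OF sinh_power_deriv])
  then show ?thesis by (simp add: y_def[abs_def] add.commute)
qed

text \<open>Convexity discards the term with \<open>g2\<close>. The bound
  \<open>G t \<le> cosh t * g1 (cosh t - 1)\<close> pays for two of the three negative terms in the
  derivative, and the third remains. It is exactly what turns into the constant n(n-1) of the energy
  estimate.\<close>

lemma b_deriv_lower:
  assumes t: "t > 0"
  shows "\<exists>m. (b has_real_derivative m) (at t) \<and> m \<ge> - (2 * (real j + 2) * G t / sinh t ^ 3)"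
proof -
  have s: "sinh t > 0" and c: "cosh t > 0" using t by auto
  let ?S = "sinh t" and ?C = "cosh t" and ?J = "real j + 2" and ?g1 = "g1 (cosh t - 1)"
  define m where "m = g2 (cosh t - 1) * ?S + (?g1 * ?S * (?J * (?C / ?S\<^sup>2) + 1 / ?C)
     + (?J * ((?S * ?S\<^sup>2 - ?C * (2 * ?S * ?C)) / (?S\<^sup>2 * ?S\<^sup>2)) - ?S / ?C\<^sup>2) * G t)"
  have dq: "((\<lambda>t. ?J * (cosh t / (sinh t)\<^sup>2) + 1 / cosh t) has_real_derivative
     (?J * ((?S * ?S\<^sup>2 - ?C * (2 * ?S * ?C)) / (?S\<^sup>2 * ?S\<^sup>2)) - ?S / ?C\<^sup>2)) (at t)"
    using s c by (auto intro!: derivative_eq_intros simp: power2_eq_square algebra_simps)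
  have "(b has_real_derivative m) (at t)"
    unfolding b_def[abs_def] m_def
    by (rule DERIV_add[OF g1_cosh_deriv[OF t] DERIV_mult[OF G_deriv[OF t] dq]])
  moreover have "m \<ge> - (2 * ?J * G t / ?S ^ 3)"
  proof -
    have e1: "(?S * ?S\<^sup>2 - ?C * (2 * ?S * ?C)) / (?S\<^sup>2 * ?S\<^sup>2) = - 1 / ?S - 2 / ?S ^ 3"
    proof -
      have "(?S * ?S\<^sup>2 - ?C * (2 * ?S * ?C)) = ?S * (?S\<^sup>2 - 2 * ?C\<^sup>2)" by (simp add: power2_eq_square algebra_simps)
      also have "\<dots> = ?S * (- ?S\<^sup>2 - 2)" by (simp add: cosh_square_eq)
      finally have "(?S * ?S\<^sup>2 - ?C * (2 * ?S * ?C)) / (?S\<^sup>2 * ?S\<^sup>2) = ?S * (- ?S\<^sup>2 - 2) / (?S\<^sup>2 * ?S\<^sup>2)" by simp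
      also have "\<dots> = - 1 / ?S - 2 / ?S ^ 3" using s by (simp add: field_simps power2_eq_square power3_eq_cube)
      finally show ?thesis .
    qed
    have gb: "G t \<le> ?C * ?g1" by (rule g1_bound[OF t])
    have g2: "g2 (cosh t - 1) * ?S \<ge> 0" using g2_nonneg[OF cosh_gt_1[OF t]] s by simp
    have f1: "?g1 * ?S * (?J * (?C / ?S\<^sup>2)) \<ge> ?J * G t / ?S"
    proof -
      have "?J * G t / ?S \<le> ?J * (?C * ?g1) / ?S" using gb s by (intro divide_right_mono mult_left_mono) auto
      moreover have "?g1 * ?S * (?J * (?C / ?S\<^sup>2)) = ?J * (?C * ?g1) / ?S" using s by (simp add: power2_eq_square)
      ultimately show ?thesis by simp
    qed
    have f2: "?g1 * ?S * (1 / ?C) \<ge> ?S / ?C\<^sup>2 * G t"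
    proof -
      have "?S / ?C\<^sup>2 * G t \<le> ?S / ?C\<^sup>2 * (?C * ?g1)" using gb s by (intro mult_left_mono) auto
      then show ?thesis using c by (simp add: power2_eq_square field_simps)
    qed
    have "m = g2 (cosh t - 1) * ?S + (?g1 * ?S * (?J * (?C / ?S\<^sup>2)) - ?J * G t / ?S) + (?g1 * ?S * (1 / ?C) - ?S / ?C\<^sup>2 * G t)
       - 2 * ?J * G t / ?S ^ 3"
      unfolding m_def e1 by (simp add: algebra_simps add_divide_distrib)
    then show ?thesis using g2 f1 f2 by linarith
  qed
  ultimately show ?thesis by blast
qed

text \<open>The last clause expands \<open>A\<close> with its Lagrange multiplier: after subtracting
  \<open>n * b \<rho> * y\<close> the radius \<open>\<rho>\<close> is critical, and the second
  derivative there is bounded through \<open>b_deriv_lower\<close>. The deviation of the radius is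
  measured by \<open>H\<close>, whose gradient is p; since dH = dt / sinh t, the square of
  \<open>t - \<rho>\<close> is close to
  \<open>(sinh \<rho>)\<^sup>2 * (H t)\<^sup>2\<close>.\<close>

lemma local_estimates:
  assumes \<rho>: "\<rho> > 0" and z: "\<zeta> > 0"
  defines "H \<equiv> \<lambda>t. logtanh t - logtanh \<rho>"
  shows "\<exists>\<delta>>0. \<delta> < \<rho> \<and> (\<forall>t. \<bar>t - \<rho>\<bar> < \<delta> \<longrightarrow>
     \<bar>A t - A \<rho>\<bar> \<le> \<zeta> \<and> \<bar>L t - L \<rho>\<bar> \<le> \<zeta> \<and> \<bar>H t\<bar> \<le> \<zeta> \<and>
     \<bar>y t - y \<rho> - sinh \<rho> ^ (j + 4) * cosh \<rho> * H t\<bar> \<le> \<zeta> * \<bar>H t\<bar> \<and>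
     A \<rho> + (real j + 3) * b \<rho> * (y t - y \<rho>) - ((real j + 2) * A \<rho> + \<zeta>) * (H t)\<^sup>2 \<le> A t)"
proof -
  let ?S = "sinh \<rho>" and ?C = "cosh \<rho>" and ?n = "real j + 3"
  have S: "?S > 0" and C: "?C > 0" using \<rho> by auto
  have near: "\<exists>\<delta>>0. \<forall>t. \<bar>t - \<rho>\<bar> < \<delta> \<longrightarrow> \<bar>f t - f \<rho>\<bar> < e" if "isCont f \<rho>" "e > 0" for f :: "real \<Rightarrow> real" and e
    using that unfolding continuous_at_eps_delta by (auto simp: dist_real_def)
  have Hd: "(H has_real_derivative 1 / sinh t) (at t)" if "t > 0" for t
    unfolding H_def using DERIV_diff[OF logtanh_derivative[OF that] DERIV_const] by simp
  have H0: "H \<rho> = 0" by (simp add: H_def)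
  obtain m where m: "(b has_real_derivative m) (at \<rho>)" "m \<ge> - (2 * (real j + 2) * G \<rho> / ?S ^ 3)"
    using b_deriv_lower[OF \<rho>] by blast
  \<comment> \<open>The multiplier makes the derivative of \<open>F\<close> vanish at
    \<open>\<rho>\<close>, because \<open>A'\<close> is \<open>?n * b * y'\<close>.\<close>
  define F where "F t = A t - ?n * b \<rho> * y t" for t
  define F' where "F' t = ?n * (b t - b \<rho>) * (sinh t ^ (j + 3) * cosh t)" for t
  have Fd: "(F has_real_derivative F' t) (at t)" if "t > 0" for t
  proof -
    have "(F has_real_derivative (?n * b t * (sinh t ^ (j + 3) * cosh t) - ?n * b \<rho> * (sinh t ^ (j + 3) * cosh t))) (at t)"
      unfolding F_def[abs_def] by (rule DERIV_diff[OF A_deriv[OF that] DERIV_cmult[OF y_deriv]])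
    then show ?thesis by (simp add: F'_def algebra_simps)
  qed
  define mm where "mm = ?n * m * (?S ^ (j + 3) * ?C)"
  have F'd: "(F' has_real_derivative mm) (at \<rho>)"
  proof -
    have d1: "((\<lambda>t. ?n * (b t - b \<rho>)) has_real_derivative ?n * (m - 0)) (at \<rho>)"
      by (intro DERIV_cmult DERIV_diff m(1) DERIV_const)
    have d2: "((\<lambda>t. sinh t ^ Suc (j + 2) * cosh t) has_real_derivative
      (real (Suc (j + 2)) * sinh \<rho> ^ (j + 2) * cosh \<rho>) * cosh \<rho> + sinh \<rho> * sinh \<rho> ^ Suc (j + 2)) (at \<rho>)"
      by (rule DERIV_mult[OF sinh_power_deriv]) (auto intro!: derivative_eq_intros)
    from DERIV_mult[OF d1 d2] show ?thesis by (simp add: F'_def[abs_def] mm_def eval_nat_numeral)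
  qed
  have mm: "mm \<ge> - 2 * ((real j + 2) * A \<rho> / ?S\<^sup>2)"
  proof -
    have "?n * (- (2 * (real j + 2) * G \<rho> / ?S ^ 3)) * (?S ^ (j + 3) * ?C) \<le> mm"
      unfolding mm_def using m(2) S C by (intro mult_right_mono mult_left_mono) auto
    moreover have "?n * (- (2 * (real j + 2) * G \<rho> / ?S ^ 3)) * (?S ^ (j + 3) * ?C) = - 2 * ((real j + 2) * A \<rho> / ?S\<^sup>2)"
      using S by (simp add: A_def K_def field_simps power2_eq_square eval_nat_numeral)
    ultimately show ?thesis by simp
  qed
  \<comment> \<open>\<open>q \<eta>\<close> is the coefficient of the square of \<open>H\<close>
    when the second derivative and the change of variable each carry an error \<open>\<eta>\<close>.
    Its value at 0 is the exact one, and continuity selects \<open>\<eta>\<close>.\<close>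
  define q where "q \<eta> = ((real j + 2) * A \<rho> / ?S\<^sup>2 + \<eta> / 2) * (?S + \<eta>)\<^sup>2" for \<eta>
  have "isCont q 0" unfolding q_def[abs_def] by (intro continuous_intros) auto
  then obtain e where e: "e > 0" "\<And>x. \<bar>x - 0\<bar> < e \<Longrightarrow> \<bar>q x - q 0\<bar> < \<zeta>"
    unfolding continuous_at_eps_delta using z by (auto simp: dist_real_def)
  define \<eta> where "\<eta> = e / 2"
  have eta: "\<eta> > 0" using e by (simp add: \<eta>_def)
  have qe: "q \<eta> \<le> (real j + 2) * A \<rho> + \<zeta>"
  proof -
    have "q 0 = (real j + 2) * A \<rho>" using S by (simp add: q_def)
    then show ?thesis using e(2)[of \<eta>] e(1) by (simp add: \<eta>_def)
  qed
  obtain \<delta>1 where d1: "\<delta>1 > 0" "\<And>t. \<bar>t - \<rho>\<bar> < \<delta>1 \<Longrightarrow> F \<rho> + (mm - \<eta>) / 2 * (t - \<rho>)\<^sup>2 \<le> F t"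
    using second_order_lower_bound[OF Fd \<rho> _ F'd eta] by (auto simp: F'_def)
  obtain \<delta>2 where d2: "\<delta>2 > 0" "\<And>t. \<bar>t - \<rho>\<bar> < \<delta>2 \<Longrightarrow> \<bar>A t - A \<rho>\<bar> < \<zeta>"
    using near[OF A_isCont[OF \<rho>] z] by blast
  obtain \<delta>3 where d3: "\<delta>3 > 0" "\<And>t. \<bar>t - \<rho>\<bar> < \<delta>3 \<Longrightarrow> \<bar>L t - L \<rho>\<bar> < \<zeta>"
    using near[OF L_isCont[OF \<rho>] z] by blast
  obtain \<delta>4 where d4: "\<delta>4 > 0" "\<And>t. \<bar>t - \<rho>\<bar> < \<delta>4 \<Longrightarrow> \<bar>H t - H \<rho>\<bar> < \<zeta>"
    using near[OF DERIV_isCont[OF Hd[OF \<rho>]] z] by blast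
  obtain \<delta>5 where d5: "\<delta>5 > 0" "\<And>t. \<bar>t - \<rho>\<bar> < \<delta>5 \<Longrightarrow> \<bar>sinh t - sinh \<rho>\<bar> < \<eta>"
    using near[OF isCont_sinh_cosh(1) eta] by blast
  have "isCont (\<lambda>t::real. sinh t ^ (j + 4) * cosh t) \<rho>" by (intro continuous_intros)
  from near[OF this z] obtain \<delta>6 where
    d6: "\<delta>6 > 0" "\<And>t. \<bar>t - \<rho>\<bar> < \<delta>6 \<Longrightarrow> \<bar>sinh t ^ (j + 4) * cosh t - ?S ^ (j + 4) * ?C\<bar> < \<zeta>"
    by blast
  define \<delta> where "\<delta> = min (min (min \<delta>1 \<delta>2) (min \<delta>3 \<delta>4)) (min (min \<delta>5 \<delta>6) (\<rho> / 2))"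
  have dpos: "\<delta> > 0" "\<delta> < \<rho>" using d1 d2 d3 d4 d5 d6 \<rho> by (auto simp: \<delta>_def)
  have dle: "\<bar>t - \<rho>\<bar> < \<delta> \<Longrightarrow> \<bar>t - \<rho>\<bar> < \<delta>1 \<and> \<bar>t - \<rho>\<bar> < \<delta>2 \<and> \<bar>t - \<rho>\<bar> < \<delta>3 \<and> \<bar>t - \<rho>\<bar> < \<delta>4 \<and> \<bar>t - \<rho>\<bar> < \<delta>5 \<and> \<bar>t - \<rho>\<bar> < \<delta>6 \<and> t > 0" for t
    using \<rho> by (auto simp: \<delta>_def abs_if split: if_splits)
  have "\<bar>A t - A \<rho>\<bar> \<le> \<zeta> \<and> \<bar>L t - L \<rho>\<bar> \<le> \<zeta> \<and> \<bar>H t\<bar> \<le> \<zeta> \<and>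
     \<bar>y t - y \<rho> - ?S ^ (j + 4) * ?C * H t\<bar> \<le> \<zeta> * \<bar>H t\<bar> \<and>
     A \<rho> + ?n * b \<rho> * (y t - y \<rho>) - ((real j + 2) * A \<rho> + \<zeta>) * (H t)\<^sup>2 \<le> A t"
    if t: "\<bar>t - \<rho>\<bar> < \<delta>" for t
  proof (intro conjI)
    note tt = dle[OF t]
    show "\<bar>A t - A \<rho>\<bar> \<le> \<zeta>" using d2(2)[of t] tt by simp
    show "\<bar>L t - L \<rho>\<bar> \<le> \<zeta>" using d3(2)[of t] tt by simp
    show "\<bar>H t\<bar> \<le> \<zeta>" using d4(2)[of t] tt H0 by simp
    show "\<bar>y t - y \<rho> - ?S ^ (j + 4) * ?C * H t\<bar> \<le> \<zeta> * \<bar>H t\<bar>"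
    proof (rule derivative_comparison[where F="\<lambda>t. y t - y \<rho> - ?S ^ (j + 4) * ?C * H t" and H=H
          and F'="\<lambda>t. sinh t ^ (j + 3) * cosh t - 0 - ?S ^ (j + 4) * ?C * (1 / sinh t)" and H'="\<lambda>t. 1 / sinh t" and \<rho>=\<rho> and \<delta>=\<delta>])
      fix s assume s: "\<bar>s - \<rho>\<bar> < \<delta>"
      then have s0: "s > 0" using dle by blast
      then have ss: "sinh s > 0" by simp
      show "((\<lambda>t. y t - y \<rho> - ?S ^ (j + 4) * ?C * H t) has_real_derivative sinh s ^ (j + 3) * cosh s - 0 - ?S ^ (j + 4) * ?C * (1 / sinh s)) (at s)"
        by (intro DERIV_diff y_deriv DERIV_const DERIV_cmult Hd s0)
      show "(H has_real_derivative 1 / sinh s) (at s)" by (rule Hd[OF s0])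
      have e: "sinh s ^ (j + 3) * cosh s - 0 - ?S ^ (j + 4) * ?C * (1 / sinh s) = (sinh s ^ (j + 4) * cosh s - ?S ^ (j + 4) * ?C) / sinh s"
        using ss by (simp add: field_simps eval_nat_numeral)
      show "\<bar>sinh s ^ (j + 3) * cosh s - 0 - ?S ^ (j + 4) * ?C * (1 / sinh s)\<bar> \<le> \<zeta> * (1 / sinh s)"
        unfolding e abs_divide using d6(2)[of s] dle[OF s] ss by (simp add: divide_right_mono)
    qed (use H0 z t in auto)
    have tr: "(t - \<rho>)\<^sup>2 \<le> (?S + \<eta>)\<^sup>2 * (H t)\<^sup>2"
    proof -
      have "\<bar>t - \<rho>\<bar> \<le> (?S + \<eta>) * \<bar>H t\<bar>"
      proof (rule derivative_comparison[where F="\<lambda>t. t - \<rho>" and H=H and F'="\<lambda>t. 1" and H'="\<lambda>t. 1 / sinh t" and \<rho>=\<rho> and \<delta>=\<delta>])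
        fix s assume s: "\<bar>s - \<rho>\<bar> < \<delta>"
        then have s0: "s > 0" using dle by blast
        then have ss: "sinh s > 0" by simp
        show "((\<lambda>t. t - \<rho>) has_real_derivative 1) (at s)" by (auto intro!: derivative_eq_intros)
        show "(H has_real_derivative 1 / sinh s) (at s)" by (rule Hd[OF s0])
        have "sinh s \<le> ?S + \<eta>" using d5(2)[of s] dle[OF s] by simp
        then show "\<bar>1\<bar> \<le> (?S + \<eta>) * (1 / sinh s)" using ss by simp
      qed (use H0 add_pos_pos[OF S eta] t in auto)
      then have "\<bar>t - \<rho>\<bar>\<^sup>2 \<le> ((?S + \<eta>) * \<bar>H t\<bar>)\<^sup>2" by (intro power_mono) auto
      then show ?thesis by (simp add: power_mult_distrib)
    qed
    have A0: "A \<rho> > 0" unfolding A_def using K_pos[OF \<rho>] by simp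
    have co: "(real j + 2) * A \<rho> / ?S\<^sup>2 + \<eta> / 2 \<ge> 0" using A0 eta by simp
    have "F \<rho> - q \<eta> * (H t)\<^sup>2 \<le> F t"
    proof -
      have "((real j + 2) * A \<rho> / ?S\<^sup>2 + \<eta> / 2) * (t - \<rho>)\<^sup>2 \<le> ((real j + 2) * A \<rho> / ?S\<^sup>2 + \<eta> / 2) * ((?S + \<eta>)\<^sup>2 * (H t)\<^sup>2)"
        by (rule mult_left_mono[OF tr co])
      moreover have "- ((real j + 2) * A \<rho> / ?S\<^sup>2 + \<eta> / 2) * (t - \<rho>)\<^sup>2 \<le> (mm - \<eta>) / 2 * (t - \<rho>)\<^sup>2"
      proof (rule mult_right_mono)
        have "- (a + \<eta> / 2) \<le> (mm - \<eta>) / 2" if "- 2 * a \<le> mm" for a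
          using that by (simp add: field_simps)
        from this[OF mm] show "- ((real j + 2) * A \<rho> / ?S\<^sup>2 + \<eta> / 2) \<le> (mm - \<eta>) / 2" .
      qed simp
      moreover have "F \<rho> + (mm - \<eta>) / 2 * (t - \<rho>)\<^sup>2 \<le> F t" using d1(2)[of t] tt by blast
      moreover have "f0 - xz \<le> ft" if "xt \<le> xz" "- xt \<le> mt" "f0 + mt \<le> ft" for f0 xz ft xt mt :: real
        using that by simp
      ultimately show ?thesis unfolding q_def mult.assoc minus_mult_left[symmetric] by blast
    qed
    moreover have "q \<eta> * (H t)\<^sup>2 \<le> ((real j + 2) * A \<rho> + \<zeta>) * (H t)\<^sup>2" by (rule mult_right_mono[OF qe]) simp
    ultimately show "A \<rho> + ?n * b \<rho> * (y t - y \<rho>) - ((real j + 2) * A \<rho> + \<zeta>) * (H t)\<^sup>2 \<le> A t"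
      by (simp add: F_def right_diff_distrib)
  qed
  then show ?thesis using dpos by (intro exI[of _ \<delta>]) blast
qed

end

text \<open>If \<open>e\<close> has mean zero and is proportional to \<open>f\<close> up to a small
  relative error, then the mean of \<open>f\<close> is small against its L^2 norm. With
  \<open>e\<close> the volume deviation this makes the mean of h negligible. The Cauchy-Schwarz
  inequality used is the nonnegativity of the variance of |f|.\<close>

lemma integral_square_le:
  fixes f e :: "real^'n \<Rightarrow> real"
  assumes f: "continuous_on (sphere 0 1) f" and e: "continuous_on (sphere 0 1) e"
    and b: "\<And>x. norm x = 1 \<Longrightarrow> \<bar>e x - a * f x\<bar> \<le> \<eta> * \<bar>f x\<bar>"
    and z: "(LINT x|sphere_measure. e x) = 0"
  shows "(a * (LINT x|sphere_measure. f x))\<^sup>2 \<le> \<eta>\<^sup>2 * (omega TYPE('n) * (LINT x|sphere_measure. (f x)\<^sup>2))"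
proof -
  let ?I = "\<lambda>f. LINT x|(sphere_measure :: (real^'n) measure). f x"
  note ci = integrable_sphere_measure continuous_intros
  have om: "omega TYPE('n) > 0" by (rule omega_pos)
  have i: "integrable sphere_measure f" "integrable sphere_measure e" "integrable sphere_measure (\<lambda>x. \<bar>f x\<bar>)"
    "integrable sphere_measure (\<lambda>x. (f x)\<^sup>2)" "integrable sphere_measure (\<lambda>x. \<bar>e x - a * f x\<bar>)"
    using f e by (auto intro!: ci)
  have "\<bar>a * ?I f\<bar> = \<bar>?I (\<lambda>x. e x - a * f x)\<bar>" using i z by simp
  also have "\<dots> \<le> ?I (\<lambda>x. \<bar>e x - a * f x\<bar>)" by (rule integral_abs_bound)
  also have "\<dots> \<le> ?I (\<lambda>x. \<eta> * \<bar>f x\<bar>)"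
    using i b by (intro integral_mono integrable_mult_right) auto
  also have "\<dots> = \<eta> * ?I (\<lambda>x. \<bar>f x\<bar>)" by simp
  finally have "\<bar>a * ?I f\<bar>\<^sup>2 \<le> (\<eta> * ?I (\<lambda>x. \<bar>f x\<bar>))\<^sup>2" by (intro power_mono) auto
  moreover have "(?I (\<lambda>x. \<bar>f x\<bar>))\<^sup>2 \<le> omega TYPE('n) * ?I (\<lambda>x. (f x)\<^sup>2)"
  proof -
    define \<mu> where "\<mu> = ?I (\<lambda>x. \<bar>f x\<bar>) / omega TYPE('n)"
    have "0 \<le> ?I (\<lambda>x. (\<bar>f x\<bar> - \<mu>)\<^sup>2)" by (simp add: Bochner_Integration.integral_nonneg)
    also have "\<dots> = ?I (\<lambda>x. (f x)\<^sup>2 - 2 * \<mu> * \<bar>f x\<bar> + \<mu>\<^sup>2)"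
      by (intro Bochner_Integration.integral_cong refl) (simp add: power2_diff)
    also have "\<dots> = ?I (\<lambda>x. (f x)\<^sup>2) - 2 * \<mu> * ?I (\<lambda>x. \<bar>f x\<bar>) + \<mu>\<^sup>2 * omega TYPE('n)"
      using i lint_const_sphere[where 'n='n, of "\<mu>\<^sup>2"] by (simp add: omega_def)
    also have "\<dots> = ?I (\<lambda>x. (f x)\<^sup>2) - (?I (\<lambda>x. \<bar>f x\<bar>))\<^sup>2 / omega TYPE('n)"
      using om by (simp add: \<mu>_def power2_eq_square field_simps)
    finally show ?thesis using om by (simp add: field_simps)
  qed
  ultimately show ?thesis
    by (simp add: power_mult_distrib) (meson mult_left_mono order_trans zero_le_power2)
qed

text \<open>The Cauchy-Schwarz inequality bounds 1 + p.P by the product of sqrt (1 + |p|^2) and sqrt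
  (1 + |P|^2), and the second root is at most 1 + |P|^2 / 2. The resulting coefficient of |P|^2 is
  sqrt (1 + |p|^2) / 2, which the excess of \<open>c\<close> over 1/2 covers once |p|^2 is at most
  \<open>4 * k\<close>.\<close>

lemma test_weight_bounds:
  fixes p P :: "'a::real_inner"
  assumes k: "k \<ge> 0" and c: "c = 1 / 2 + k" and small: "p \<bullet> p + P \<bullet> P \<le> \<delta>" "\<delta> \<le> 4 * k" "(1 + c) * \<delta> \<le> 1"
  shows "0 \<le> 1 + p \<bullet> P - c * (P \<bullet> P)" "1 + p \<bullet> P - c * (P \<bullet> P) \<le> sqrt (1 + p \<bullet> p)"
proof -
  let ?q = "p \<bullet> p" and ?t = "P \<bullet> P" and ?s = "p \<bullet> P"
  have q: "0 \<le> ?q" "0 \<le> ?t" by auto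
  have cs: "?s\<^sup>2 \<le> ?q * ?t" by (rule Cauchy_Schwarz_ineq)
  have s: "2 * \<bar>?s\<bar> \<le> ?q + ?t" using abs_inner_le_half[of p P] by simp
  have "?t \<le> \<delta>" using small(1) q(1) by linarith
  then have "c * ?t \<le> c * \<delta>" using k c by (intro mult_left_mono) auto
  then show "0 \<le> 1 + ?s - c * ?t" using s small q by (simp add: algebra_simps abs_le_iff)
  have "1 + ?s \<le> sqrt ((1 + ?q) * (1 + ?t))"
  proof (rule real_le_rsqrt)
    have "(1 + ?s)\<^sup>2 = 1 + 2 * ?s + ?s\<^sup>2" by (simp add: power2_eq_square algebra_simps)
    also have "\<dots> \<le> 1 + (?q + ?t) + ?q * ?t" using cs s by linarith
    finally show "(1 + ?s)\<^sup>2 \<le> (1 + ?q) * (1 + ?t)" by (simp add: algebra_simps)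
  qed
  also have "\<dots> = sqrt (1 + ?q) * sqrt (1 + ?t)" by (rule real_sqrt_mult)
  also have "\<dots> \<le> sqrt (1 + ?q) * (1 + ?t / 2)"
    using sqrt_one_plus_le[OF q(2)] q by (intro mult_left_mono) auto
  finally have 1: "1 + ?s \<le> sqrt (1 + ?q) + sqrt (1 + ?q) / 2 * ?t" by (simp add: algebra_simps)
  have "sqrt (1 + ?q) \<le> 1 + ?q / 2" by (rule sqrt_one_plus_le[OF q(1)])
  moreover have "?q \<le> 4 * k" using small q(2) by linarith
  ultimately have "sqrt (1 + ?q) / 2 \<le> c" by (simp add: c)
  then have "sqrt (1 + ?q) / 2 * ?t \<le> c * ?t" using q by (intro mult_right_mono) auto
  then show "1 + ?s - c * ?t \<le> sqrt (1 + ?q)" using 1 by linarith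
qed

section \<open>The local inequality with its equality case\<close>

context weight_profile
begin

text \<open>The errors of the main estimate have to stay below \<open>E * k / 4\<close>, which is
  half of the \<open>E * k / 2\<close> that the energy estimate provides. The remaining bounds serve
  the test weight and the smallness of the mean.\<close>

lemma small_parameters:
  assumes "E > 0" "k > 0" "n > 0" "c > 0" "M > 0" "c1 > (0::real)" "a \<ge> 0"
  shows "\<exists>\<eta> \<delta>. \<eta> > 0 \<and> \<delta> > 0 \<and> \<eta> \<le> 1 \<and> \<delta> \<le> 1 \<and> (\<eta> / c1)\<^sup>2 \<le> 1 / 4 \<and> (1 + c) * \<delta> \<le> 1 \<and> \<delta> \<le> 2 * k / n
    \<and> a * (\<eta> / c1)\<^sup>2 + \<eta> + 2 * (\<eta> * (c + 3) + M * \<delta> * (4 * c + 6)) \<le> E * k / 4"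
proof -
  \<comment> \<open>\<open>X\<close> collects the coefficients of \<open>\<eta>\<close>, the
    quadratic one included because \<open>\<eta>\<^sup>2 \<le> \<eta>\<close>; \<open>Y\<close>
    below collects those of \<open>\<delta>\<close>.\<close>
  define X where "X = a / c1\<^sup>2 + 1 + 2 * (c + 3)"
  have X: "X > 0" using assms by (simp add: X_def add_nonneg_pos)
  define \<eta> where "\<eta> = min 1 (min (c1 / 2) (E * k / 8 / X))"
  have e: "\<eta> > 0" "\<eta> \<le> 1" "\<eta> \<le> c1 / 2" "\<eta> \<le> E * k / 8 / X"
    using assms X by (simp_all add: \<eta>_def min_le_iff_disj)
  define Y where "Y = 2 * M * (4 * c + 6)"
  have Y: "Y > 0" using assms by (simp add: Y_def)
  define \<delta> where "\<delta> = min (min 1 (1 / (1 + c))) (min (2 * k / n) (E * k / 8 / Y))"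
  have d: "\<delta> > 0" "\<delta> \<le> 1" "\<delta> \<le> 1 / (1 + c)" "\<delta> \<le> 2 * k / n" "\<delta> \<le> E * k / 8 / Y"
    using assms Y by (simp_all add: \<delta>_def min_le_iff_disj)
  have "\<eta> * X \<le> E * k / 8" using e(4) X by (simp add: pos_le_divide_eq)
  moreover have "a * (\<eta> / c1)\<^sup>2 \<le> a / c1\<^sup>2 * \<eta>"
  proof -
    have "\<eta>\<^sup>2 \<le> \<eta>" using e by (simp add: power2_eq_square mult_left_le_one_le)
    then have "a / c1\<^sup>2 * \<eta>\<^sup>2 \<le> a / c1\<^sup>2 * \<eta>" using assms by (intro mult_left_mono) auto
    then show ?thesis by (simp add: power_divide)
  qed
  moreover have "\<delta> * Y \<le> E * k / 8" using d(5) Y by (simp add: pos_le_divide_eq)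
  moreover have "\<eta> * X = a / c1\<^sup>2 * \<eta> + \<eta> + 2 * (\<eta> * (c + 3))" by (simp add: X_def algebra_simps)
  moreover have "\<delta> * Y = 2 * (M * \<delta> * (4 * c + 6))" by (simp add: Y_def algebra_simps)
  moreover have "x1 + \<eta> + 2 * (x2 + x3) \<le> e / 4"
    if "xX \<le> e / 8" "x1 \<le> x4" "dY \<le> e / 8" "xX = x4 + \<eta> + 2 * x2" "dY = 2 * x3" for x1 x2 x3 x4 xX dY e :: real
    using that by simp
  ultimately have "a * (\<eta> / c1)\<^sup>2 + \<eta> + 2 * (\<eta> * (c + 3) + M * \<delta> * (4 * c + 6)) \<le> E * k / 4" by blast
  moreover have "(\<eta> / c1)\<^sup>2 \<le> 1 / 4"
  proof -
    have "\<eta> / c1 \<le> 1 / 2" using e(3) assms by (simp add: pos_divide_le_eq)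
    then have "(\<eta> / c1)\<^sup>2 \<le> (1 / 2)\<^sup>2" using e assms by (intro power_mono) auto
    then show ?thesis by (simp add: power2_eq_square)
  qed
  moreover have "(1 + c) * \<delta> \<le> 1" using d(3) assms by (simp add: pos_le_divide_eq mult.commute)
  ultimately show ?thesis using e d by (intro exI[of _ \<eta>] exI[of _ \<delta>]) auto
qed

text \<open>The proof yields more than the inequality: a surplus of \<open>E * k / 4\<close> times
  the Dirichlet energy, which dominates the integral of h^2. Equality therefore forces h = 0. The
  parameters \<open>\<rho>'\<close> and \<open>u\<close> enter only through the radius function
  \<open>r\<close>.\<close>

lemma main_estimate:
  assumes card: "CARD('n::finite) = j + 4" and \<rho>: "\<rho> > 0"
  shows "\<exists>\<delta>>0. \<forall>(r :: real^'n \<Rightarrow> real) p Dp u \<rho>'. radial_graph r p Dp \<longrightarrow>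
     (\<forall>x v w. norm x = 1 \<longrightarrow> v \<bullet> x = 0 \<longrightarrow> w \<bullet> x = 0 \<longrightarrow> Dp x v \<bullet> w = Dp x w \<bullet> v) \<longrightarrow>
     (\<forall>x. norm x = 1 \<longrightarrow> radf \<rho>' u x = r x) \<longrightarrow>
     (\<forall>x. norm x = 1 \<longrightarrow> \<bar>r x - \<rho>\<bar> < \<delta> \<and> norm (p x) < \<delta>) \<longrightarrow>
     (LINT x|sphere_measure. sinh (r x) ^ (j + 4)) = omega TYPE('n) * sinh \<rho> ^ (j + 4) \<longrightarrow>
     omega TYPE('n) * A \<rho> \<le> (LINT x|sphere_measure. G (r x) * max (mean_curv \<rho>' u x) 0 * area_elem \<rho>' u x) \<and>
     ((LINT x|sphere_measure. G (r x) * max (mean_curv \<rho>' u x) 0 * area_elem \<rho>' u x) = omega TYPE('n) * A \<rho> \<longrightarrow>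
        (\<forall>x. norm x = 1 \<longrightarrow> r x = \<rho>))"
proof -
  let ?I = "\<lambda>f. LINT x|(sphere_measure :: (real^'n) measure). f x"
  let ?S = "sphere (0::real^'n) 1"
  note ci = integrable_sphere_measure continuous_intros
  define n where "n = real j + 3"
  have n3: "n \<ge> 3" by (simp add: n_def)
  have nN: "real CARD('n) - 1 = n" by (simp add: card n_def)
  have N4: "CARD('n) \<ge> 4" "CARD('n) \<ge> 2" "CARD('n) - 2 = j + 2" by (simp_all add: card)
  have om: "omega TYPE('n) > 0" by (rule omega_pos)
  define s0 where "s0 = sinh \<rho>"
  define c0 where "c0 = cosh \<rho>"
  have s0: "s0 > 0" and c0: "c0 > 0" using \<rho> by (auto simp: s0_def c0_def)
  define E where "E = K \<rho> * c0"
  have E: "E > 0" using K_pos[OF \<rho>] c0 by (simp add: E_def)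
  have AE: "A \<rho> = n * E" by (simp add: A_def E_def n_def c0_def)
  \<comment> \<open>The share of \<open>L \<rho> / E\<close> that stems from the derivative of
    \<open>g\<close>; the remainder is n - 1. Positivity of \<open>g1\<close> makes it
    positive.\<close>
  define k where "k = g1 (cosh \<rho> - 1) * s0\<^sup>2 / (G \<rho> * c0)"
  have k: "k > 0" using g1_pos[OF \<rho>] G_pos[OF \<rho>] s0 c0 by (simp add: k_def)
  have LE: "L \<rho> = (n - 1 + k) * E"
  proof -
    have "k * E = g1 (cosh \<rho> - 1) * s0\<^sup>2 * s0 ^ (j + 2)"
      using G_pos[OF \<rho>] c0 by (simp add: k_def E_def K_def s0_def)
    then have "(n - 1 + k) * E = (real j + 2) * E + g1 (cosh \<rho> - 1) * s0\<^sup>2 * s0 ^ (j + 2)" by (simp add: n_def distrib_right)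
    then show ?thesis
      by (simp add: L_def Kr_def E_def K_def s0_def c0_def algebra_simps power2_eq_square)
  qed
  define c where "c = 1 / 2 + k / (2 * n)"
  have c: "c > 0" using k n3 by (simp add: c_def add_pos_pos)
  define M where "M = A \<rho> + L \<rho> + 1"
  have A0: "A \<rho> > 0" using AE E n3 by simp
  have L0: "L \<rho> \<ge> 0" by (rule L_nonneg[OF \<rho>])
  have M: "M > 0" using A0 L0 by (simp add: M_def)
  \<comment> \<open>The derivative at \<open>\<rho>\<close> of the volume density \<open>y\<close>
    with respect to h.\<close>
  define c1 where "c1 = s0 ^ (j + 4) * c0"
  have c1: "c1 > 0" using s0 c0 by (simp add: c1_def)
  have "\<exists>\<eta> \<delta>. \<eta> > 0 \<and> \<delta> > 0 \<and> \<eta> \<le> 1 \<and> \<delta> \<le> 1 \<and> (\<eta> / c1)\<^sup>2 \<le> 1 / 4 \<and> (1 + c) * \<delta> \<le> 1 \<and> \<delta> \<le> 2 * k / n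
    \<and> (E * n * (n - 1)) * (\<eta> / c1)\<^sup>2 + \<eta> + 2 * (\<eta> * (c + 3) + M * \<delta> * (4 * c + 6)) \<le> E * k / 4"
    using E k n3 c M c1 by (intro small_parameters) auto
  then obtain \<eta> d where eta: "\<eta> > 0" "\<eta> \<le> 1" "(\<eta> / c1)\<^sup>2 \<le> 1 / 4"
    and d: "d > 0" "d \<le> 1" "(1 + c) * d \<le> 1" "d \<le> 2 * k / n"
    and small: "(E * n * (n - 1)) * (\<eta> / c1)\<^sup>2 + \<eta> + 2 * (\<eta> * (c + 3) + M * d * (4 * c + 6)) \<le> E * k / 4"
    by blast
  obtain C where C: "C \<ge> 0" and proj: "\<And>(f :: real^'n \<Rightarrow> real) B. continuous_on ?S f \<Longrightarrow> (\<forall>x\<in>?S. \<bar>f x\<bar> \<le> B) \<Longrightarrow>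
     (\<exists>w P D l. pd 2 w \<and> green w P l \<and> pd 2 l \<and> svec P D \<and>
       (\<forall>h. pd 2 h \<longrightarrow> ?I (\<lambda>x. (f x - w x) * h x) = 0) \<and>
       (\<forall>x\<in>?S. norm (P x) \<le> C * B \<and> \<bar>div_at (D x)\<bar> \<le> C * B \<and> (\<forall>v. norm (D x v) \<le> C * B * norm v)))"
    using quadratic_projection[where 'n='n] by blast
  \<comment> \<open>Since the projection is bounded by \<open>C\<close> times sup |h|, keeping h
    below \<open>\<zeta>\<close> makes \<open>P\<close> and its derivatives at most
    \<open>d / 2\<close>.\<close>
  define \<zeta> where "\<zeta> = min \<eta> (d / (2 * (C + 1)))"
  have z: "\<zeta> > 0" "\<zeta> \<le> \<eta>" "C * \<zeta> \<le> d / 2"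
  proof -
    show "\<zeta> > 0" "\<zeta> \<le> \<eta>" using eta d C by (auto simp: \<zeta>_def)
    have "C * \<zeta> \<le> (C + 1) * (d / (2 * (C + 1)))" using C d eta by (intro mult_mono) (auto simp: \<zeta>_def)
    also have "\<dots> = d / 2" using C by (simp add: field_simps)
    finally show "C * \<zeta> \<le> d / 2" .
  qed
  obtain \<delta>0 where \<delta>0: "\<delta>0 > 0" "\<delta>0 < \<rho>" and loc: "\<And>t. \<bar>t - \<rho>\<bar> < \<delta>0 \<Longrightarrow>
     \<bar>A t - A \<rho>\<bar> \<le> \<zeta> \<and> \<bar>L t - L \<rho>\<bar> \<le> \<zeta> \<and> \<bar>logtanh t - logtanh \<rho>\<bar> \<le> \<zeta> \<and>
     \<bar>y t - y \<rho> - c1 * (logtanh t - logtanh \<rho>)\<bar> \<le> \<zeta> * \<bar>logtanh t - logtanh \<rho>\<bar> \<and>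
     A \<rho> + n * b \<rho> * (y t - y \<rho>) - ((n - 1) * A \<rho> + \<zeta>) * (logtanh t - logtanh \<rho>)\<^sup>2 \<le> A t"
    using local_estimates[OF \<rho> z(1)] unfolding n_def c1_def s0_def c0_def by (auto simp: add.commute)
  define \<delta> where "\<delta> = min \<delta>0 (d / 2)"
  have dpos: "\<delta> > 0" using \<delta>0 d by (simp add: \<delta>_def)
  have main: "omega TYPE('n) * A \<rho> + E * k / 4 * ?I (\<lambda>x. p x \<bullet> p x) \<le> ?I (\<lambda>x. G (r x) * max (mean_curv \<rho>' u x) 0 * area_elem \<rho>' u x)
     \<and> ?I (\<lambda>x. (logtanh (r x) - logtanh \<rho>)\<^sup>2) \<le> ?I (\<lambda>x. p x \<bullet> p x)"
    if rg: "radial_graph r p Dp"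
      and sym: "\<forall>x v w. norm x = 1 \<longrightarrow> v \<bullet> x = 0 \<longrightarrow> w \<bullet> x = 0 \<longrightarrow> Dp x v \<bullet> w = Dp x w \<bullet> v"
      and rr: "\<forall>x. norm x = 1 \<longrightarrow> radf \<rho>' u x = r x"
      and near: "\<forall>x. norm x = 1 \<longrightarrow> \<bar>r x - \<rho>\<bar> < \<delta> \<and> norm (p x) < \<delta>"
      and vol: "?I (\<lambda>x. sinh (r x) ^ (j + 4)) = omega TYPE('n) * sinh \<rho> ^ (j + 4)"
    for r :: "real^'n \<Rightarrow> real" and p Dp u \<rho>'
  proof -
    interpret radial_graph r p Dp by (rule rg)
    define h where "h x = logtanh (r x) - logtanh \<rho>" for x
    have sh: "sgrad h p"
      unfolding sgrad_def
    proof (intro conjI ballI p_continuous)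
      fix x :: "real^'n" assume "x \<in> ?S"
      then have x: "norm x = 1" by simp
      have "(logtanh has_derivative (\<lambda>v. 1 / sinh (r x) * v)) (at (hom_ext r x))"
        using logtanh_derivative[OF r_pos[OF x]] unfolding has_field_derivative_def by (simp only: hom_ext_sphere[OF x])
      from has_derivative_compose[OF r_has_derivative[OF x] this]
      have "((\<lambda>y. logtanh (hom_ext r y)) has_derivative (\<lambda>v. p x \<bullet> v)) (at x)" using r_pos[OF x] by simp
      from has_derivative_diff[OF this has_derivative_const[of "logtanh \<rho>"]]
      show "(hom_ext h has_derivative (\<lambda>v. p x \<bullet> v)) (at x)" by (simp add: hom_ext_def[abs_def] h_def)
    qed
    have ch: "continuous_on ?S h" by (rule sgrad_continuous[OF sh])
    have lx: "\<bar>A (r x) - A \<rho>\<bar> \<le> \<zeta>" "\<bar>L (r x) - L \<rho>\<bar> \<le> \<zeta>" "\<bar>h x\<bar> \<le> \<zeta>" "\<bar>y (r x) - y \<rho> - c1 * h x\<bar> \<le> \<zeta> * \<bar>h x\<bar>"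
      "A \<rho> + n * b \<rho> * (y (r x) - y \<rho>) - ((n - 1) * A \<rho> + \<zeta>) * (h x)\<^sup>2 \<le> A (r x)" if x: "norm x = 1" for x
      using loc[of "r x"] near x by (auto simp: h_def \<delta>_def)
    obtain w P DP l where w: "pd 2 w" "green w P l" "pd 2 l" "svec P DP"
      "\<And>f. pd 2 f \<Longrightarrow> ?I (\<lambda>x. (h x - w x) * f x) = 0"
      and Pb: "\<And>x. norm x = 1 \<Longrightarrow> norm (P x) \<le> C * \<zeta>" "\<And>x. norm x = 1 \<Longrightarrow> \<bar>div_at (DP x)\<bar> \<le> C * \<zeta>"
        "\<And>x v. norm x = 1 \<Longrightarrow> norm (DP x v) \<le> C * \<zeta> * norm v"
    proof -
      have "\<forall>x\<in>?S. \<bar>h x\<bar> \<le> \<zeta>" using lx(3) by auto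
      from proj[OF ch this] show ?thesis
        by (elim exE conjE) (rule that, assumption+, auto)
    qed
    have sw: "sgrad w P" using w(2) by (simp add: green_def)
    have Pt: "P x \<bullet> x = 0" if "norm x = 1" for x using sgrad_tangent[OF sw] that by simp
    have cP: "continuous_on ?S P" by (rule svec_continuous[OF w(4)])
    have cy: "continuous_on ?S (\<lambda>x. y (r x))" unfolding y_def by (intro continuous_intros r_continuous) auto
    have d2: "d / 2 * (d / 2) \<le> d / 2"
      using d mult_left_le_one_le[of "d / 2" "d / 2"] by simp
    have ptw: "p x \<bullet> p x \<le> d / 2" "P x \<bullet> P x \<le> d / 2" if x: "norm x = 1" for x
    proof -
      have "norm (p x) \<le> d / 2" using near x by (auto simp: \<delta>_def less_imp_le)
      then have "norm (p x) * norm (p x) \<le> d / 2 * (d / 2)" using d by (intro mult_mono) auto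
      then show "p x \<bullet> p x \<le> d / 2" using d2 by (simp add: dot_square_norm power2_eq_square)
      have "norm (P x) \<le> d / 2" using Pb(1)[OF x] z by linarith
      then have "norm (P x) * norm (P x) \<le> d / 2 * (d / 2)" using d by (intro mult_mono) auto
      then show "P x \<bullet> P x \<le> d / 2" using d2 by (simp add: dot_square_norm power2_eq_square)
    qed
    have wgt: "0 \<le> test_weight c P x \<and> test_weight c P x \<le> sqrt (1 + p x \<bullet> p x)" if x: "norm x = 1" for x
    proof -
      have kk: "k / (2 * n) \<ge> 0" "d \<le> 4 * (k / (2 * n))" using k n3 d by auto
      have "p x \<bullet> p x + P x \<bullet> P x \<le> d" using ptw[OF x] by linarith
      from test_weight_bounds[OF kk(1) c_def this kk(2) d(3)] show ?thesis by (simp add: test_weight_def)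
    qed
    let ?LHS = "?I (\<lambda>x. G (r x) * max (mean_curv \<rho>' u x) 0 * area_elem \<rho>' u x)"
    have lower: "?I (\<lambda>x. lower_integrand K Kr c P DP x) \<le> ?LHS"
    proof (rule positive_curvature_lower_bound[OF rr N4(2) K_deriv Kr_cont _ _ _ w(4) Pt wgt])
      show "G t \<ge> 0" if "t > 0" for t using G_pos[OF that] by simp
      show "K t = G t * sinh t ^ (CARD('n) - 2)" for t by (simp only: N4(3) K_def)
      show "Dp x v \<bullet> w = Dp x w \<bullet> v" if "norm x = 1" "v \<bullet> x = 0" "w \<bullet> x = 0" for x v w using sym that by blast
    qed
    define \<eta>1 where "\<eta>1 = \<eta> * (c + 3) + M * d * (4 * c + 6)"
    have ptwise: "A \<rho> + n * b \<rho> * (y (r x) - y \<rho>) - ((n - 1) * A \<rho> + \<eta>) * (h x)\<^sup>2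
       + A \<rho> * (p x \<bullet> P x - c * (P x \<bullet> P x) - (p x \<bullet> p x) / 2) + L \<rho> * (p x \<bullet> p x)
       - \<eta>1 * (p x \<bullet> p x + P x \<bullet> P x) \<le> lower_integrand K Kr c P DP x" if x: "norm x = 1" for x
    proof -
      have r0: "r x > 0" by (rule r_pos[OF x])
      have q: "0 \<le> p x \<bullet> p x" "0 \<le> P x \<bullet> P x" by auto
      have qt: "p x \<bullet> p x + P x \<bullet> P x \<le> d" using ptw[OF x] by linarith
      have s: "\<bar>p x \<bullet> P x\<bar> \<le> (p x \<bullet> p x + P x \<bullet> P x) / 2"
        by (rule abs_inner_le_half)
      have Dn: "norm (DP x (p x)) \<le> d * norm (p x)"
      proof -
        have "norm (DP x (p x)) \<le> C * \<zeta> * norm (p x)" by (rule Pb(3)[OF x])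
        also have "\<dots> \<le> d * norm (p x)" using z d by (intro mult_right_mono) auto
        finally show ?thesis .
      qed
      have d1: "\<bar>p x \<bullet> DP x (p x)\<bar> \<le> d * (p x \<bullet> p x)"
      proof -
        have "\<bar>p x \<bullet> DP x (p x)\<bar> \<le> norm (p x) * norm (DP x (p x))" by (rule Cauchy_Schwarz_ineq2)
        also have "\<dots> \<le> norm (p x) * (d * norm (p x))" by (rule mult_left_mono[OF Dn]) simp
        finally show ?thesis by (simp add: dot_square_norm power2_eq_square algebra_simps)
      qed
      have d2': "\<bar>P x \<bullet> DP x (p x)\<bar> \<le> d * ((p x \<bullet> p x + P x \<bullet> P x) / 2)"
      proof -
        have "\<bar>P x \<bullet> DP x (p x)\<bar> \<le> norm (P x) * norm (DP x (p x))" by (rule Cauchy_Schwarz_ineq2)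
        also have "\<dots> \<le> norm (P x) * (d * norm (p x))" by (rule mult_left_mono[OF Dn]) simp
        also have "\<dots> = d * (norm (P x) * norm (p x))" by simp
        also have "norm (P x) * norm (p x) \<le> (p x \<bullet> p x + P x \<bullet> P x) / 2"
          using sum_squares_bound[of "norm (P x)" "norm (p x)"] by (simp add: dot_square_norm)
        finally show ?thesis using d by (simp add: mult_left_mono)
      qed
      have d3: "\<bar>div_at (DP x)\<bar> \<le> d" using Pb(2)[OF x] z d by linarith
      have K0: "0 \<le> K (r x)" "K (r x) \<le> A (r x)"
      proof -
        show k0: "0 \<le> K (r x)" using K_pos[OF r0] by simp
        have "1 * (K (r x) * 1) \<le> (real j + 3) * (K (r x) * cosh (r x))"
          using k0 cosh_real_ge_1[of "r x"] by (intro mult_mono mult_left_mono) auto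
        then show "K (r x) \<le> A (r x)" by (simp add: A_def)
      qed
      have A1: "0 \<le> A (r x)" "A (r x) \<le> M" "\<bar>A (r x) - A \<rho>\<bar> \<le> \<eta>"
        using K0 lx(1)[OF x] z eta L0 by (auto simp: M_def abs_le_iff)
      have L1: "0 \<le> L (r x)" "L (r x) \<le> M" "\<bar>L (r x) - L \<rho>\<bar> \<le> \<eta>"
        using L_nonneg[OF r0] lx(2)[OF x] z eta A0 by (auto simp: M_def abs_le_iff)
      have "A (r x) + A \<rho> * (p x \<bullet> P x - c * (P x \<bullet> P x) - (p x \<bullet> p x) / 2) + L \<rho> * (p x \<bullet> p x)
         - (\<eta> * (c + 3) + M * d * (4 * c + 6)) * (p x \<bullet> p x + P x \<bullet> P x)
         \<le> A (r x) * ((1 + p x \<bullet> P x - c * (P x \<bullet> P x)) * W x)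
          + L (r x) * ((1 + p x \<bullet> P x - c * (P x \<bullet> P x)) * W x) * (p x \<bullet> p x)
          + K (r x) * W x * (p x \<bullet> DP x (p x) - 2 * c * (P x \<bullet> DP x (p x)))
          - (sqrt (1 + p x \<bullet> p x) - 1) * (L (r x) * (p x \<bullet> P x) + K (r x) * div_at (DP x))"
        by (rule lower_integrand_expansion[OF _ q qt d(2) s d1 d2' d3 refl W_def A1 L1 K0(1) order_trans[OF K0(2) A1(2)]])
          (use c in simp)
      also have "\<dots> = lower_integrand K Kr c P DP x"
        unfolding lower_integrand_def nN test_weight_def A_def L_def by (simp add: n_def)
      finally have "A (r x) + A \<rho> * (p x \<bullet> P x - c * (P x \<bullet> P x) - (p x \<bullet> p x) / 2) + L \<rho> * (p x \<bullet> p x)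
         - \<eta>1 * (p x \<bullet> p x + P x \<bullet> P x) \<le> lower_integrand K Kr c P DP x" by (simp only: \<eta>1_def)
      moreover have "((n - 1) * A \<rho> + \<zeta>) * (h x)\<^sup>2 \<le> ((n - 1) * A \<rho> + \<eta>) * (h x)\<^sup>2"
        using z by (intro mult_right_mono) auto
      ultimately show ?thesis using lx(5)[OF x] by linarith
    qed
    define Q where "Q = ?I (\<lambda>x. p x \<bullet> p x)"
    define T where "T = ?I (\<lambda>x. P x \<bullet> P x)"
    define R where "R = ?I (\<lambda>x. p x \<bullet> P x)"
    define H2 where "H2 = ?I (\<lambda>x. (h x)\<^sup>2)"
    define m where "m = (?I h)\<^sup>2 / omega TYPE('n)"
    have i: "integrable sphere_measure (\<lambda>x. p x \<bullet> p x)" "integrable sphere_measure (\<lambda>x. P x \<bullet> P x)"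
      "integrable sphere_measure (\<lambda>x. p x \<bullet> P x)" "integrable sphere_measure (\<lambda>x. (h x)\<^sup>2)"
      "integrable sphere_measure (\<lambda>x. y (r x) - y \<rho>)" "integrable (sphere_measure :: (real^'n) measure) (\<lambda>x. A \<rho>)"
      "integrable sphere_measure (\<lambda>x. y (r x))"
      using p_continuous cP ch cy by (auto intro!: ci)
    \<comment> \<open>The volume constraint: the linear term of the expansion of \<open>A\<close>
      integrates to zero.\<close>
    have Y0: "?I (\<lambda>x. y (r x) - y \<rho>) = 0"
    proof -
      have "?I (\<lambda>x. y (r x) - y \<rho>) = ?I (\<lambda>x. y (r x)) - y \<rho> * omega TYPE('n)"
        using i lint_const_sphere[where 'n='n, of "y \<rho>"] by (simp add: omega_def)
      also have "?I (\<lambda>x. y (r x)) = ?I (\<lambda>x. sinh (r x) ^ (j + 4)) / (real j + 4)" by (simp add: y_def)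
      finally show ?thesis unfolding vol by (simp add: y_def)
    qed
    have int_lower: "omega TYPE('n) * A \<rho> - ((n - 1) * A \<rho> + \<eta>) * H2 + A \<rho> * (R - c * T - Q / 2) + L \<rho> * Q - \<eta>1 * (Q + T) \<le> ?LHS"
    proof -
      have "?I (\<lambda>x. A \<rho> + n * b \<rho> * (y (r x) - y \<rho>) - ((n - 1) * A \<rho> + \<eta>) * (h x)\<^sup>2
       + A \<rho> * (p x \<bullet> P x - c * (P x \<bullet> P x) - (p x \<bullet> p x) / 2) + L \<rho> * (p x \<bullet> p x)
       - \<eta>1 * (p x \<bullet> p x + P x \<bullet> P x)) \<le> ?I (\<lambda>x. lower_integrand K Kr c P DP x)"
      proof (rule integral_mono)
        show "integrable sphere_measure (\<lambda>x. A \<rho> + n * b \<rho> * (y (r x) - y \<rho>) - ((n - 1) * A \<rho> + \<eta>) * (h x)\<^sup>2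
         + A \<rho> * (p x \<bullet> P x - c * (P x \<bullet> P x) - (p x \<bullet> p x) / 2) + L \<rho> * (p x \<bullet> p x)
         - \<eta>1 * (p x \<bullet> p x + P x \<bullet> P x))"
          by (intro ci p_continuous cP ch cy) auto
        show "integrable sphere_measure (\<lambda>x. lower_integrand K Kr c P DP x)"
          by (intro integrable_sphere_measure curvature_flux_divergence(2)[OF K_deriv Kr_cont _ w(4) Pt])
            (assumption | rule sym[rule_format])+
      qed (use ptwise in auto)
      moreover have "?I (\<lambda>x. A \<rho> + n * b \<rho> * (y (r x) - y \<rho>) - ((n - 1) * A \<rho> + \<eta>) * (h x)\<^sup>2
       + A \<rho> * (p x \<bullet> P x - c * (P x \<bullet> P x) - (p x \<bullet> p x) / 2) + L \<rho> * (p x \<bullet> p x)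
       - \<eta>1 * (p x \<bullet> p x + P x \<bullet> P x))
       = omega TYPE('n) * A \<rho> + n * b \<rho> * ?I (\<lambda>x. y (r x) - y \<rho>) - ((n - 1) * A \<rho> + \<eta>) * H2 + A \<rho> * (R - c * T - Q / 2) + L \<rho> * Q - \<eta>1 * (Q + T)"
        unfolding Q_def T_def R_def H2_def using i lint_const_sphere[where 'n='n, of "A \<rho>"]
        by (simp add: omega_def)
      ultimately show ?thesis using lower unfolding Y0 by simp
    qed
    have en: "k / 2 * Q - n * (n - 1) * m \<le> n * R - n * c * T + ((n - 2) / 2 + k) * Q - n * (n - 1) * H2"
      "T \<le> Q" "n * H2 \<le> Q + n * m"
      using sphere_energy_estimate[OF N4(1) sh k w(1,2,3) w(5), of c] unfolding nN Q_def T_def R_def H2_def m_def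
      by (auto simp: c_def)
    \<comment> \<open>The volume deviation has mean zero and is \<open>c1 * h\<close> up to a
      relative error, so the mean of h is of higher order.\<close>
    have mH: "m \<le> (\<eta> / c1)\<^sup>2 * H2"
    proof -
      have "(c1 * ?I h)\<^sup>2 \<le> \<eta>\<^sup>2 * (omega TYPE('n) * H2)"
        unfolding H2_def
      proof (rule integral_square_le[OF ch _ _ Y0])
        show "continuous_on ?S (\<lambda>x. y (r x) - y \<rho>)" by (intro continuous_intros cy)
        fix x :: "real^'n" assume x: "norm x = 1"
        have "\<zeta> * \<bar>h x\<bar> \<le> \<eta> * \<bar>h x\<bar>" using z by (intro mult_right_mono) auto
        then show "\<bar>y (r x) - y \<rho> - c1 * h x\<bar> \<le> \<eta> * \<bar>h x\<bar>" using lx(4)[OF x] by linarith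
      qed
      then have "c1\<^sup>2 * (omega TYPE('n) * m) \<le> \<eta>\<^sup>2 * (omega TYPE('n) * H2)"
        using om by (simp add: m_def power_mult_distrib)
      then have "omega TYPE('n) * (c1\<^sup>2 * m) \<le> omega TYPE('n) * (\<eta>\<^sup>2 * H2)" by (simp add: mult_ac)
      then have "c1\<^sup>2 * m \<le> \<eta>\<^sup>2 * H2" using om by simp
      then show ?thesis using c1 by (simp add: power_divide pos_le_divide_eq mult.commute)
    qed
    have H20: "H2 \<ge> 0" and Q0: "Q \<ge> 0" unfolding H2_def Q_def by (simp_all add: Bochner_Integration.integral_nonneg)
    \<comment> \<open>The Poincare inequality for h, whose mean term is absorbed since
      \<open>(\<eta> / c1)\<^sup>2 \<le> 1 / 4\<close>; the remaining factor 3 n / 4 exceeds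
      1.\<close>
    have HQ: "H2 \<le> Q"
    proof -
      have "m \<le> 1 / 4 * H2" using mH mult_right_mono[OF eta(3) H20] by linarith
      then have "n * m \<le> n * (1 / 4 * H2)" using n3 by (intro mult_left_mono) auto
      then have "3 / 4 * n * H2 \<le> Q" using en(3) by simp
      moreover have "1 * H2 \<le> 3 / 4 * n * H2" using n3 H20 by (intro mult_right_mono) auto
      ultimately show ?thesis by simp
    qed
    have mQ: "m \<le> (\<eta> / c1)\<^sup>2 * Q" using mH mult_left_mono[OF HQ, of "(\<eta> / c1)\<^sup>2"] by simp
    have eta1: "\<eta>1 \<ge> 0" using eta c M d by (simp add: \<eta>1_def)
    \<comment> \<open>With \<open>A \<rho> = n * E\<close> and
      \<open>L \<rho> = (n - 1 + k) * E\<close>, the terms with |p|^2 combine to the coefficient (n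
      - 2) / 2 + k of the energy estimate. Its surplus \<open>E * k / 2\<close> pays for all errors
      and leaves one half.\<close>
    have "omega TYPE('n) * A \<rho> + E * k / 4 * Q \<le> omega TYPE('n) * A \<rho> - ((n - 1) * A \<rho> + \<eta>) * H2 + A \<rho> * (R - c * T - Q / 2) + L \<rho> * Q - \<eta>1 * (Q + T)"
    proof -
      have "E * (k / 2 * Q - n * (n - 1) * m) \<le> E * (n * R - n * c * T + ((n - 2) / 2 + k) * Q - n * (n - 1) * H2)"
        using en(1) E by (intro mult_left_mono) auto
      also have "\<dots> = A \<rho> * (R - c * T - Q / 2) + L \<rho> * Q - (n - 1) * A \<rho> * H2"
        unfolding AE LE by (simp add: field_simps)
      finally have e1: "E * (k / 2 * Q - n * (n - 1) * m) \<le> A \<rho> * (R - c * T - Q / 2) + L \<rho> * Q - (n - 1) * A \<rho> * H2" .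
      have e2: "\<eta>1 * (Q + T) \<le> 2 * \<eta>1 * Q" using mult_left_mono[OF en(2) eta1] by (simp add: algebra_simps)
      have e3: "\<eta> * H2 \<le> \<eta> * Q" using HQ eta by (intro mult_left_mono) auto
      have "E * n * (n - 1) * m \<le> E * n * (n - 1) * ((\<eta> / c1)\<^sup>2 * Q)"
        using mQ E n3 by (intro mult_left_mono) auto
      moreover have "((E * n * (n - 1)) * (\<eta> / c1)\<^sup>2 + \<eta> + 2 * \<eta>1) * Q \<le> E * k / 4 * Q"
        using small Q0 unfolding \<eta>1_def by (intro mult_right_mono)
      ultimately have e4: "E * n * (n - 1) * m + \<eta> * Q + 2 * \<eta>1 * Q \<le> E * k / 4 * Q"
        by (simp add: distrib_right mult.assoc)
      have e5: "E * (k / 2 * Q - n * (n - 1) * m) = 2 * (E * k / 4 * Q) - E * n * (n - 1) * m"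
        by (simp add: algebra_simps)
      have lin: "o' + x1 \<le> o' - (z1 + z2) + x2 + x3 - x4"
        if "2 * x1 - x5 \<le> x2 + x3 - z1" "x4 \<le> x6" "z2 \<le> x7" "x5 + x7 + x6 \<le> x1" for o' x1 z1 z2 x2 x3 x4 x5 x6 x7 :: real
        using that by simp
      show ?thesis unfolding distrib_right[of "(n - 1) * A \<rho>"]
        by (rule lin[OF e1[unfolded e5] e2 e3 e4])
    qed
    then show ?thesis using int_lower HQ unfolding Q_def H2_def h_def by linarith
  qed
  show ?thesis
  proof (intro exI[of _ \<delta>] conjI dpos allI impI)
    fix r :: "real^'n \<Rightarrow> real" and p Dp u \<rho>'
    assume rg: "radial_graph r p Dp"
      and sym: "\<forall>x v w. norm x = 1 \<longrightarrow> v \<bullet> x = 0 \<longrightarrow> w \<bullet> x = 0 \<longrightarrow> Dp x v \<bullet> w = Dp x w \<bullet> v"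
      and rr: "\<forall>x. norm x = 1 \<longrightarrow> radf \<rho>' u x = r x"
      and near: "\<forall>x. norm x = 1 \<longrightarrow> \<bar>r x - \<rho>\<bar> < \<delta> \<and> norm (p x) < \<delta>"
      and vol: "?I (\<lambda>x. sinh (r x) ^ (j + 4)) = omega TYPE('n) * sinh \<rho> ^ (j + 4)"
    interpret radial_graph r p Dp by (rule rg)
    note mn = main[OF rg sym rr near vol]
    have Q0: "?I (\<lambda>x. p x \<bullet> p x) \<ge> 0" by (simp add: Bochner_Integration.integral_nonneg)
    have Ek: "E * k / 4 > 0" using E k by simp
    show "omega TYPE('n) * A \<rho> \<le> ?I (\<lambda>x. G (r x) * max (mean_curv \<rho>' u x) 0 * area_elem \<rho>' u x)"
      using mn mult_nonneg_nonneg[OF less_imp_le[OF Ek] Q0] by linarith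
    fix x :: "real^'n"
    assume eq: "?I (\<lambda>x. G (r x) * max (mean_curv \<rho>' u x) 0 * area_elem \<rho>' u x) = omega TYPE('n) * A \<rho>" and x: "norm x = 1"
    have "E * k / 4 * ?I (\<lambda>x. p x \<bullet> p x) \<le> 0" using mn eq by linarith
    then have "?I (\<lambda>x. p x \<bullet> p x) \<le> 0" by (meson Ek mult_pos_pos not_le)
    then have "?I (\<lambda>x. (logtanh (r x) - logtanh \<rho>)\<^sup>2) \<le> 0" using mn by linarith
    moreover have "?I (\<lambda>x. (logtanh (r x) - logtanh \<rho>)\<^sup>2) \<ge> 0" by (simp add: Bochner_Integration.integral_nonneg)
    ultimately have z0: "?I (\<lambda>x. (logtanh (r x) - logtanh \<rho>)\<^sup>2) = 0" by simp
    have "continuous_on {0<..} logtanh"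
      by (intro continuous_at_imp_continuous_on ballI DERIV_isCont[OF logtanh_derivative]) auto
    then have "continuous_on ?S (\<lambda>x. logtanh (r x))" by (rule compose_r_continuous)
    then have "(logtanh (r x) - logtanh \<rho>)\<^sup>2 = 0"
      using z0 x by (intro sphere_integral_zero_imp[of "\<lambda>x. (logtanh (r x) - logtanh \<rho>)\<^sup>2"]) (auto intro!: continuous_intros)
    then have e: "logtanh (r x) = logtanh \<rho>" by simp
    \<comment> \<open>Strict monotonicity of \<open>logtanh\<close> turns vanishing of h into
      constancy of the radius.\<close>
    have mono: "logtanh a < logtanh b'" if "0 < a" "a < b'" for a b'
    proof (rule DERIV_pos_imp_increasing[OF that(2)])
      fix t assume "a \<le> t" "t \<le> b'"
      then have "t > 0" using that by linarith
      then show "\<exists>y. (logtanh has_real_derivative y) (at t) \<and> y > 0"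
        using logtanh_derivative by (intro exI[of _ "1 / sinh t"]) auto
    qed
    show "r x = \<rho>"
      using mono[of "r x" \<rho>] mono[of \<rho> "r x"] e r_pos[OF x] \<rho> by (cases "r x" \<rho> rule: linorder_cases) auto
  qed
qed

end

subsection \<open>The theorem\<close>

lemma sgrad_cong:
  assumes "sgrad u \<Gamma>" "\<And>x. norm x = 1 \<Longrightarrow> \<Gamma> x = \<Delta> x"
  shows "sgrad u \<Delta>"
  using assms continuous_on_cong[of "sphere 0 1" "sphere 0 1" \<Gamma> \<Delta>] by (simp add: sgrad_def)

lemma radial_graph_of_gradient:
  fixes u :: "real^'n \<Rightarrow> real"
  assumes u: "sgrad u \<Gamma>" "svec \<Gamma> D" and \<rho>: "\<rho> > 0" and pos: "\<And>x. norm x = 1 \<Longrightarrow> u x > -1"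
  defines "p \<equiv> \<lambda>x. (\<rho> / sinh (radf \<rho> u x)) *\<^sub>R \<Gamma> x"
    and "Dp \<equiv> \<lambda>x v. (\<rho> / sinh (radf \<rho> u x)) *\<^sub>R D x v
       + (- (\<rho> * (cosh (radf \<rho> u x) * (\<rho> * (\<Gamma> x \<bullet> v)))) / (sinh (radf \<rho> u x))\<^sup>2) *\<^sub>R \<Gamma> x"
  shows "radial_graph (radf \<rho> u) p Dp"
proof
  show rpos: "radf \<rho> u x > 0" if "norm x = 1" for x using pos[OF that] \<rho> by (simp add: radf_def)
  have sr: "sgrad (radf \<rho> u) (\<lambda>x. \<rho> *\<^sub>R \<Gamma> x)"
  proof -
    have "sgrad (\<lambda>x::real^'n. \<rho>) (\<lambda>x. 0)" by (simp add: sgrad_def hom_ext_def[abs_def])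
    from sgrad_add[OF this sgrad_scale[OF u(1), of \<rho>]] show ?thesis
      by (simp add: radf_def[abs_def] distrib_left)
  qed
  show "sgrad (radf \<rho> u) (\<lambda>x. sinh (radf \<rho> u x) *\<^sub>R p x)"
    by (rule sgrad_cong[OF sr]) (frule rpos, simp add: p_def)
  have cr: "continuous_on (sphere 0 1) (radf \<rho> u)" by (rule sgrad_continuous[OF sr])
  have cG: "continuous_on (sphere 0 1) \<Gamma>" using u by (simp add: sgrad_def)
  have nz: "sinh (radf \<rho> u x) \<noteq> 0" if "x \<in> sphere 0 1" for x using rpos[of x] that by auto
  show "svec p Dp"
    unfolding svec_def
  proof (intro conjI ballI allI)
    show "continuous_on (sphere 0 1) (\<lambda>x. Dp x v)" for v
      unfolding Dp_def using u(2) nz by (intro continuous_intros cr cG) (auto simp: svec_def)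
    fix x :: "real^'n" assume xs: "x \<in> sphere 0 1"
    then have x: "norm x = 1" by simp
    have hr: "(hom_ext (radf \<rho> u) has_derivative (\<lambda>v. \<rho> * (\<Gamma> x \<bullet> v))) (at x)"
      using sr xs by (simp add: sgrad_def)
    have hG: "(hom_ext \<Gamma> has_derivative D x) (at x)" using u(2) xs by (simp add: svec_def)
    have "((\<lambda>t. \<rho> / sinh t) has_real_derivative - (\<rho> * cosh (radf \<rho> u x)) / (sinh (radf \<rho> u x))\<^sup>2) (at (radf \<rho> u x))"
      using nz[OF xs] by (auto intro!: derivative_eq_intros simp: power2_eq_square)
    then have d: "((\<lambda>t. \<rho> / sinh t) has_derivative (\<lambda>h. - (\<rho> * cosh (radf \<rho> u x)) / (sinh (radf \<rho> u x))\<^sup>2 * h)) (at (hom_ext (radf \<rho> u) x))"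
      unfolding has_field_derivative_def by (simp only: hom_ext_sphere[OF x])
    have "((\<lambda>y. (\<rho> / sinh (hom_ext (radf \<rho> u) y)) *\<^sub>R hom_ext \<Gamma> y) has_derivative
       (\<lambda>v. (\<rho> / sinh (hom_ext (radf \<rho> u) x)) *\<^sub>R D x v
         + (- (\<rho> * cosh (radf \<rho> u x)) / (sinh (radf \<rho> u x))\<^sup>2 * (\<rho> * (\<Gamma> x \<bullet> v))) *\<^sub>R hom_ext \<Gamma> x)) (at x)"
      by (rule has_derivative_scaleR[OF has_derivative_compose[OF hr d] hG])
    then show "(hom_ext p has_derivative Dp x) (at x)"
      using x by (simp add: p_def Dp_def[abs_def] hom_ext_def[abs_def] mult.assoc)
  qed
qed

lemma Omega_measurable:
  fixes u :: "real^'n \<Rightarrow> real"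
  assumes "continuous_on (sphere 0 1) (radf \<rho> u)"
  shows "Omega \<rho> u \<in> sets borel"
proof -
  have c: "continuous_on (UNIV - {0}) (\<lambda>y::real^'n. radf \<rho> u (y /\<^sub>R norm y) - norm y)"
  proof (intro continuous_intros continuous_on_compose2[OF assms])
    show "(\<lambda>y. y /\<^sub>R norm y) ` (UNIV - {0}) \<subseteq> sphere (0::real^'n) 1"
      by (auto simp: field_simps split: if_splits)
  qed auto
  have "open ((\<lambda>y::real^'n. radf \<rho> u (y /\<^sub>R norm y) - norm y) -` {0<..} \<inter> (UNIV - {0}))"
    using c by (intro continuous_open_preimage[of "UNIV - {0}" _ "{0<..}", simplified Int_commute]) auto
  moreover have "Omega \<rho> u = {0} \<union> ((\<lambda>y::real^'n. radf \<rho> u (y /\<^sub>R norm y) - norm y) -` {0<..} \<inter> (UNIV - {0}))"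
    by (auto simp: Omega_def)
  ultimately show ?thesis by auto
qed

lemma Omega_mem:
  assumes "norm (x::real^'n) = 1" "t > 0"
  shows "t *\<^sub>R x \<in> Omega \<rho> u \<longleftrightarrow> t < radf \<rho> u x"
proof -
  have "(t *\<^sub>R x) /\<^sub>R norm (t *\<^sub>R x) = x" "t *\<^sub>R x \<noteq> 0" "norm (t *\<^sub>R x) = t" using assms by auto
  then show ?thesis by (simp add: Omega_def)
qed

text \<open>A geodesic sphere about the origin is the graph with p = 0, so the curvature formula
  applies directly; this gives the converse direction of the equality case.\<close>

lemma round_sphere_integral:
  fixes u :: "real^'n \<Rightarrow> real"
  assumes R: "R > 0" and r: "\<forall>x. norm x = 1 \<longrightarrow> radf \<rho> u x = R" and N: "CARD('n) \<ge> 1"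
  shows "(LINT x|sphere_measure. F (radf \<rho> u x) * max (mean_curv \<rho> u x) 0 * area_elem \<rho> u x)
    = omega TYPE('n) * (F R * ((real CARD('n) - 1) * (cosh R / sinh R) * sinh R ^ (CARD('n) - 1)))"
proof -
  have sR: "sinh R > 0" using R by simp
  interpret radial_graph "\<lambda>x::real^'n. R" "\<lambda>x. 0" "\<lambda>x v. 0"
    by unfold_locales (auto simp: R sgrad_def svec_def hom_ext_def[abs_def])
  have W1: "W x = 1" for x by (simp add: W_def)
  have d0: "div_at (\<lambda>v::real^'n. 0) = 0" by (simp add: div_at_def)
  have "F (radf \<rho> u x) * max (mean_curv \<rho> u x) 0 * area_elem \<rho> u x
     = F R * ((real CARD('n) - 1) * (cosh R / sinh R) * sinh R ^ (CARD('n) - 1))" if x: "norm x = 1" for x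
  proof -
    have "mean_curv \<rho> u x = (real CARD('n) - 1) * (cosh R / sinh R)"
      using mean_curv_formula[OF x r] by (simp add: W1 d0)
    moreover have "(real CARD('n) - 1) * (cosh R / sinh R) \<ge> 0" using N sR by simp
    ultimately show ?thesis using area_elem_formula[OF x r] r x by simp
  qed
  then have "(LINT x|sphere_measure. F (radf \<rho> u x) * max (mean_curv \<rho> u x) 0 * area_elem \<rho> u x)
    = (LINT x|(sphere_measure :: (real^'n) measure). F R * ((real CARD('n) - 1) * (cosh R / sinh R) * sinh R ^ (CARD('n) - 1)))"
    by (intro Bochner_Integration.integral_cong refl) auto
  then show ?thesis by (simp add: omega_def mult.commute)
qed

theorem theorem1p2:
  fixes \<rho> :: real and g g1 g2 g3 :: "real \<Rightarrow> real"
  assumes dim: "CARD('n::finite) \<ge> 4"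
    and rho: "\<rho> > 0"
    and gpos: "\<forall>s\<ge>0. g s > 0"
    and gmono: "mono_on {0..} g"
    and gconv: "convex_on {0..} g"
    and d1: "\<forall>s\<ge>0. (g has_real_derivative g1 s) (at s within {0..})"
    and d2: "\<forall>s\<ge>0. (g1 has_real_derivative g2 s) (at s within {0..})"
    and d3: "\<forall>s\<ge>0. (g2 has_real_derivative g3 s) (at s within {0..})"
    and d3c: "continuous_on {0..} g3"
    and gcond: "\<forall>s\<ge>0. (1 + s) * g1 s - g s \<ge> 0"
  shows "\<exists>\<epsilon>>0. \<forall>u :: real^'n \<Rightarrow> real.
     (\<forall>x\<in>sphere 0 1. u x > -1) \<and> smooth_sphere u \<and> C1_norm_sphere u < \<epsilon>
     \<and> (LINT y:Omega \<rho> u|hvol. cosh (norm y)) = (LINT y:cball (0::real^'n) \<rho>|hvol. cosh (norm y))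
     \<and> (\<forall>p. (LINT y:Omega \<rho> u|hvol. (hdist y 0)\<^sup>2) \<le> (LINT y:Omega \<rho> u|hvol. (hdist y p)\<^sup>2))
     \<longrightarrow>
     (let n = real CARD('n) - 1;
          V = (n + 1) * (LINT y:Omega \<rho> u|hvol. cosh (norm y)) / omega TYPE('n);
          LHS = (LINT x|sphere_measure. g (cosh (radf \<rho> u x) - 1)
                    * max (mean_curv \<rho> u x) 0 * area_elem \<rho> u x);
          RHS = n * omega TYPE('n) * g (sqrt (1 + V powr (2 / (n + 1))) - 1)
                  * sqrt (V powr (2 * (n - 1) / (n + 1)) + V powr (2 * n / (n + 1)))
      in LHS \<ge> RHS \<and> (LHS = RHS \<longleftrightarrow> (\<exists>R>0. Omega \<rho> u = ball 0 R)))"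
proof -
  obtain j where card: "CARD('n) = j + 4" using dim by (metis add.commute le_Suc_ex)
  have deriv_at: "(f has_real_derivative f' s) (at s)" if "\<forall>s\<ge>0. (f has_real_derivative f' s) (at s within {0..})" "s > 0" for f f' s
  proof -
    have "(f has_real_derivative f' s) (at s within {0..})" using that by simp
    then have "(f has_real_derivative f' s) (at s within {0<..})"
      by (rule DERIV_subset) auto
    moreover have "at s within {0<..} = at s" using that(2) by (intro at_within_open) auto
    ultimately show ?thesis by simp
  qed
  interpret weight_profile g g1 g2 j
  proof
    show "g s > 0" if "s > 0" for s using gpos that by simp
    show "(g has_real_derivative g1 s) (at s)" if "s > 0" for s using deriv_at[OF d1 that] .
    show "(g1 has_real_derivative g2 s) (at s)" if "s > 0" for s using deriv_at[OF d2 that] .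
    show "g2 s \<ge> 0" if "s > 0" for s
      by (rule convex_second_derivative_nonneg[OF gconv deriv_at[OF d1] deriv_at[OF d2] that])
    show "g s \<le> (1 + s) * g1 s" if "s > 0" for s using gcond that by simp
  qed
  obtain \<delta> where \<delta>: "\<delta> > 0" and main: "\<And>(r :: real^'n \<Rightarrow> real) p Dp u \<rho>'. radial_graph r p Dp \<Longrightarrow>
     (\<forall>x v w. norm x = 1 \<longrightarrow> v \<bullet> x = 0 \<longrightarrow> w \<bullet> x = 0 \<longrightarrow> Dp x v \<bullet> w = Dp x w \<bullet> v) \<Longrightarrow>
     (\<forall>x. norm x = 1 \<longrightarrow> radf \<rho>' u x = r x) \<Longrightarrow>
     (\<forall>x. norm x = 1 \<longrightarrow> \<bar>r x - \<rho>\<bar> < \<delta> \<and> norm (p x) < \<delta>) \<Longrightarrow>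
     (LINT x|sphere_measure. sinh (r x) ^ (j + 4)) = omega TYPE('n) * sinh \<rho> ^ (j + 4) \<Longrightarrow>
     omega TYPE('n) * A \<rho> \<le> (LINT x|sphere_measure. G (r x) * max (mean_curv \<rho>' u x) 0 * area_elem \<rho>' u x) \<and>
     ((LINT x|sphere_measure. G (r x) * max (mean_curv \<rho>' u x) 0 * area_elem \<rho>' u x) = omega TYPE('n) * A \<rho> \<longrightarrow>
        (\<forall>x. norm x = 1 \<longrightarrow> r x = \<rho>))"
    using main_estimate[OF card rho] by blast
  have om: "omega TYPE('n) > 0" by (rule omega_pos)
  define S where "S = sinh \<rho>"
  have S: "S > 0" using rho by (simp add: S_def)
  have sh: "sinh (\<rho> / 2) > 0" using rho by simp
  \<comment> \<open>The bound 1/2 keeps the radius above \<open>\<rho> / 2\<close>, the second entry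
    controls the deviation of the radius, and the third controls \<open>p\<close> because its
    denominator is at least \<open>sinh (\<rho> / 2)\<close>.\<close>
  define \<epsilon> where "\<epsilon> = min (1 / 2) (min (\<delta> / \<rho>) (\<delta> * sinh (\<rho> / 2) / \<rho>))"
  have eps: "\<epsilon> > 0" "\<epsilon> \<le> 1 / 2" "\<epsilon> \<le> \<delta> / \<rho>" "\<epsilon> \<le> \<delta> * sinh (\<rho> / 2) / \<rho>"
  proof -
    show "\<epsilon> > 0" using rho \<delta> sh by (simp add: \<epsilon>_def)
    show "\<epsilon> \<le> 1 / 2" unfolding \<epsilon>_def by (rule min.cobounded1)
    show "\<epsilon> \<le> \<delta> / \<rho>" unfolding \<epsilon>_def by (rule order_trans[OF min.cobounded2 min.cobounded1])
    show "\<epsilon> \<le> \<delta> * sinh (\<rho> / 2) / \<rho>" unfolding \<epsilon>_def by (rule order_trans[OF min.cobounded2 min.cobounded2])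
  qed
  show ?thesis
  proof (intro exI[of _ \<epsilon>] conjI eps(1) allI impI)
    fix u :: "real^'n \<Rightarrow> real"
    assume H: "(\<forall>x\<in>sphere 0 1. u x > -1) \<and> smooth_sphere u \<and> C1_norm_sphere u < \<epsilon>
     \<and> (LINT y:Omega \<rho> u|hvol. cosh (norm y)) = (LINT y:cball (0::real^'n) \<rho>|hvol. cosh (norm y))
     \<and> (\<forall>p. (LINT y:Omega \<rho> u|hvol. (hdist y 0)\<^sup>2) \<le> (LINT y:Omega \<rho> u|hvol. (hdist y p)\<^sup>2))"
    have pos: "u x > -1" if "norm x = 1" for x using H that by simp
    obtain \<Gamma> D where u: "sgrad u \<Gamma>" "svec \<Gamma> D"
      and sym: "\<And>x v w. norm x = 1 \<Longrightarrow> v \<bullet> x = 0 \<Longrightarrow> w \<bullet> x = 0 \<Longrightarrow> D x v \<bullet> w = D x w \<bullet> v"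
      using smooth_sphere_gradient[of u] H by blast
    have small: "\<bar>u x\<bar> < \<epsilon>" "norm (\<Gamma> x) < \<epsilon>" if "norm x = 1" for x
      using C1_norm_sphere_bound[OF u(1), of \<epsilon> x] H that by auto
    define r where "r = radf \<rho> u"
    define p where "p x = (\<rho> / sinh (radf \<rho> u x)) *\<^sub>R \<Gamma> x" for x
    define Dp where "Dp x v = (\<rho> / sinh (radf \<rho> u x)) *\<^sub>R D x v
       + (- (\<rho> * (cosh (radf \<rho> u x) * (\<rho> * (\<Gamma> x \<bullet> v)))) / (sinh (radf \<rho> u x))\<^sup>2) *\<^sub>R \<Gamma> x" for x v
    have rg: "radial_graph r p Dp"
      using radial_graph_of_gradient[OF u rho pos] by (simp add: r_def p_def[abs_def] Dp_def[abs_def])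
    interpret radial_graph r p Dp by (rule rg)
    \<comment> \<open>The term in \<open>Dp\<close> from differentiating the scalar factor is a
      multiple of the gradient paired with itself, hence symmetric.\<close>
    have symp: "\<forall>x v w. norm x = 1 \<longrightarrow> v \<bullet> x = 0 \<longrightarrow> w \<bullet> x = 0 \<longrightarrow> Dp x v \<bullet> w = Dp x w \<bullet> v"
    proof (intro allI impI)
      fix x v w :: "real^'n" assume "norm x = 1" "v \<bullet> x = 0" "w \<bullet> x = 0"
      from sym[OF this] show "Dp x v \<bullet> w = Dp x w \<bullet> v" by (simp add: Dp_def inner_diff_left)
    qed
    have near: "\<forall>x. norm x = 1 \<longrightarrow> \<bar>r x - \<rho>\<bar> < \<delta> \<and> norm (p x) < \<delta>"
    proof (intro allI impI conjI)
      fix x :: "real^'n" assume x: "norm x = 1"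
      have "\<bar>r x - \<rho>\<bar> = \<rho> * \<bar>u x\<bar>" using rho by (simp add: r_def radf_def algebra_simps abs_mult)
      also have "\<dots> < \<rho> * \<epsilon>" using small(1)[OF x] rho by simp
      also have "\<dots> \<le> \<delta>" using eps(3) rho by (simp add: pos_le_divide_eq mult.commute)
      finally show "\<bar>r x - \<rho>\<bar> < \<delta>" .
      have "\<rho> * (1 / 2) \<le> \<rho> * (1 + u x)" using small(1)[OF x] eps(2) rho by (intro mult_left_mono) auto
      then have "\<rho> / 2 \<le> r x" by (simp add: r_def radf_def)
      then have s2: "sinh (\<rho> / 2) \<le> sinh (r x)" by simp
      have "norm (p x) = \<rho> / sinh (r x) * norm (\<Gamma> x)" using rho r_pos[OF x] by (simp add: p_def r_def)
      also have "\<dots> \<le> \<rho> / sinh (\<rho> / 2) * norm (\<Gamma> x)"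
        using s2 sh rho by (intro mult_right_mono divide_left_mono) auto
      also have "\<dots> < \<rho> / sinh (\<rho> / 2) * \<epsilon>" using small(2)[OF x] rho sh by (intro mult_strict_left_mono) auto
      also have "\<dots> \<le> \<delta>" using eps(4) rho sh by (simp add: field_simps)
      finally show "norm (p x) < \<delta>" .
    qed
    have rr: "\<forall>x. norm x = 1 \<longrightarrow> radf \<rho> u x = r x" by (simp add: r_def)
    have vO: "(LINT y:Omega \<rho> u|hvol. cosh (norm y)) = (LINT x|sphere_measure. sinh (r x) ^ CARD('n)) / real CARD('n)"
    proof (rule weighted_volume_star[OF r_continuous r_pos])
      show "Omega \<rho> u \<in> sets borel" using Omega_measurable r_continuous unfolding r_def by blast
      show "t *\<^sub>R x \<in> Omega \<rho> u" if "norm x = 1" "0 < t" "t < r x" for x t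
        using Omega_mem[OF that(1,2)] that(3) by (simp add: r_def)
      show "t *\<^sub>R x \<notin> Omega \<rho> u" if "norm x = 1" "r x < t" for x t
        using Omega_mem[OF that(1), of t] r_pos[OF that(1)] that(2) by (simp add: r_def)
    qed
    have vB: "(LINT y:cball (0::real^'n) \<rho>|hvol. cosh (norm y)) = omega TYPE('n) * S ^ CARD('n) / real CARD('n)"
    proof -
      have "(LINT y:cball (0::real^'n) \<rho>|hvol. cosh (norm y)) = (LINT x|(sphere_measure :: (real^'n) measure). sinh \<rho> ^ CARD('n)) / real CARD('n)"
        by (rule weighted_volume_star) (use rho in auto)
      then show ?thesis by (simp add: S_def omega_def mult.commute)
    qed
    have vol: "(LINT x|sphere_measure. sinh (r x) ^ (j + 4)) = omega TYPE('n) * sinh \<rho> ^ (j + 4)"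
      using H vO vB by (simp add: card S_def)
    note M = main[OF rg symp rr near vol]
    define n where "n = real CARD('n) - 1"
    define V where "V = (n + 1) * (LINT y:Omega \<rho> u|hvol. cosh (norm y)) / omega TYPE('n)"
    define LHS where "LHS = (LINT x|sphere_measure. g (cosh (radf \<rho> u x) - 1) * max (mean_curv \<rho> u x) 0 * area_elem \<rho> u x)"
    define RHS where "RHS = n * omega TYPE('n) * g (sqrt (1 + V powr (2 / (n + 1))) - 1)
                  * sqrt (V powr (2 * (n - 1) / (n + 1)) + V powr (2 * n / (n + 1)))"
    have n: "n = real j + 3" by (simp add: n_def card)
    \<comment> \<open>The volume constraint makes \<open>V\<close> the (n+1)-th power of
      \<open>sinh \<rho>\<close>. Consequently the two fractional powers in the bound reduce to
      \<open>cosh \<rho>\<close> and \<open>sinh \<rho> ^ (n - 1) * cosh \<rho>\<close>.\<close>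
    have V: "V = S powr (real j + 4)"
    proof -
      have "V = S ^ (j + 4)" using H om unfolding V_def n_def vB by (simp add: card add.commute[of 4])
      then show ?thesis using powr_realpow[OF S, of "j + 4"] by simp
    qed
    have e1: "sqrt (1 + V powr (2 / (n + 1))) = cosh \<rho>"
    proof -
      have "(real j + 4) * (2 / (n + 1)) = 2" unfolding n by (simp add: field_simps)
      then have "V powr (2 / (n + 1)) = S powr 2" unfolding V powr_powr by simp
      also have "\<dots> = S\<^sup>2" using S by simp
      finally have "1 + V powr (2 / (n + 1)) = (cosh \<rho>)\<^sup>2" by (simp add: cosh_square_eq S_def)
      then show ?thesis by simp
    qed
    have e2: "sqrt (V powr (2 * (n - 1) / (n + 1)) + V powr (2 * n / (n + 1))) = S ^ (j + 2) * cosh \<rho>"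
    proof -
      have x1: "V powr (2 * (n - 1) / (n + 1)) = S ^ (2 * (j + 2))"
      proof -
        have e: "(real j + 4) * (2 * (n - 1) / (n + 1)) = real (2 * (j + 2))" unfolding n by (simp add: field_simps)
        show ?thesis unfolding V powr_powr e by (rule powr_realpow[OF S])
      qed
      have x2: "V powr (2 * n / (n + 1)) = S ^ (2 * (j + 3))"
      proof -
        have e: "(real j + 4) * (2 * n / (n + 1)) = real (2 * (j + 3))" unfolding n by (simp add: field_simps)
        show ?thesis unfolding V powr_powr e by (rule powr_realpow[OF S])
      qed
      have "S ^ (2 * (j + 2)) + S ^ (2 * (j + 3)) = S ^ (2 * (j + 2)) * (1 + S\<^sup>2)"
      proof -
        have "2 * (j + 3) = 2 * (j + 2) + 2" by simp
        then show ?thesis by (simp only: power_add distrib_left mult_1_right)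
      qed
      also have "\<dots> = (S ^ (j + 2) * cosh \<rho>)\<^sup>2"
        by (simp only: power_mult_distrib cosh_square_eq S_def[symmetric] power_mult[symmetric] mult.commute[of 2] add.commute[of 1])
      finally show ?thesis unfolding x1 x2 using S by simp
    qed
    have R: "RHS = omega TYPE('n) * A \<rho>"
      unfolding RHS_def e1 e2 by (simp add: A_def K_def G_def S_def n)
    have Lr: "LHS = (LINT x|sphere_measure. G (r x) * max (mean_curv \<rho> u x) 0 * area_elem \<rho> u x)"
      by (simp add: LHS_def G_def r_def)
    have ge: "LHS \<ge> RHS" using M by (simp add: Lr R)
    have "LHS = RHS \<longleftrightarrow> (\<exists>R>0. Omega \<rho> u = ball 0 R)"
    proof
      assume "LHS = RHS"
      then have rc: "radf \<rho> u x = \<rho>" if "norm x = 1" for x using M that by (simp add: Lr R r_def)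
      have "Omega \<rho> u = ball 0 \<rho>"
      proof (intro set_eqI)
        fix z :: "real^'n"
        show "z \<in> Omega \<rho> u \<longleftrightarrow> z \<in> ball 0 \<rho>"
        proof (cases "z = 0")
          case True then show ?thesis using rho by (simp add: Omega_def)
        next
          case False
          then have "norm (z /\<^sub>R norm z) = 1" by simp
          then show ?thesis using False rc by (simp add: Omega_def)
        qed
      qed
      then show "\<exists>R>0. Omega \<rho> u = ball 0 R" using rho by blast
    next
      assume "\<exists>R>0. Omega \<rho> u = ball 0 R"
      then obtain R0 where R0: "R0 > 0" "Omega \<rho> u = ball 0 R0" by blast
      \<comment> \<open>Comparing membership of the points on one ray shows that the radius function
        equals \<open>R0\<close>; the volume constraint then identifies \<open>R0\<close> with
        \<open>\<rho>\<close>.\<close>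
      have rc: "r x = R0" if x: "norm x = 1" for x
      proof -
        have iff: "t < R0 \<longleftrightarrow> t < r x" if "t > 0" for t
          using Omega_mem[OF x that, of \<rho> u] R0(2) x that by (simp add: r_def)
        show ?thesis using iff[of "r x"] iff[OF R0(1)] r_pos[OF x] by simp
      qed
      have "(LINT x|sphere_measure. sinh (r x) ^ (j + 4)) = (LINT x|(sphere_measure :: (real^'n) measure). sinh R0 ^ (j + 4))"
        by (intro Bochner_Integration.integral_cong refl) (simp add: rc)
      then have "sinh R0 ^ (j + 4) = sinh \<rho> ^ (j + 4)" using vol om by (simp add: omega_def)
      then have "sinh R0 = sinh \<rho>" by (rule power_eq_imp_eq_base) (use R0 rho in auto)
      then have "R0 = \<rho>" by simp
      then have "\<forall>x. norm x = 1 \<longrightarrow> radf \<rho> u x = \<rho>" using rc by (simp add: r_def)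
      from round_sphere_integral[OF rho this, of "\<lambda>t. g (cosh t - 1)"]
      have "LHS = omega TYPE('n) * (g (cosh \<rho> - 1) * ((real CARD('n) - 1) * (cosh \<rho> / sinh \<rho>) * sinh \<rho> ^ (CARD('n) - 1)))"
        unfolding LHS_def by (simp add: card)
      also have "sinh \<rho> ^ (CARD('n) - 1) = sinh \<rho> ^ (j + 2) * sinh \<rho>" by (simp add: card eval_nat_numeral)
      also have "omega TYPE('n) * (g (cosh \<rho> - 1) * ((real CARD('n) - 1) * (cosh \<rho> / sinh \<rho>) * (sinh \<rho> ^ (j + 2) * sinh \<rho>))) = RHS"
        unfolding R A_def K_def G_def using S by (simp add: card S_def)
      finally show "LHS = RHS" .
    qed
    with ge show "let n = real CARD('n) - 1;
          V = (n + 1) * (LINT y:Omega \<rho> u|hvol. cosh (norm y)) / omega TYPE('n);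
          LHS = (LINT x|sphere_measure. g (cosh (radf \<rho> u x) - 1)
                    * max (mean_curv \<rho> u x) 0 * area_elem \<rho> u x);
          RHS = n * omega TYPE('n) * g (sqrt (1 + V powr (2 / (n + 1))) - 1)
                  * sqrt (V powr (2 * (n - 1) / (n + 1)) + V powr (2 * n / (n + 1)))
      in LHS \<ge> RHS \<and> (LHS = RHS \<longleftrightarrow> (\<exists>R>0. Omega \<rho> u = ball 0 R))"
      unfolding Let_def LHS_def RHS_def V_def n_def by blast
  qed
qed

end
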